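(* Let $$r_0 = 6^{492^{64}\cdot (37\cdot 16^3\cdot 1406^9)^{63}}.$$ For every integer $r \geq r_0$ there exists $n_0=n_0(r)$ such that for every integer $n \geq n_0$ and every $3$-uniform hypergraph $H$ on $n$ vertices, $$c_{r,F^R}(H) \leq r^{\mathrm{ex}(n,F)},$$ where $F$ denotes the Fano plane. Moreover, for $n \geq n_0$, equality holds if and only if $H$ is isomorphic to $B_n$.
   Context: The Fano plane $F$ is the unique linear $3$-uniform hypergraph (any two hyperedges share at most one vertex) with $7$ vertices and $7$ hyperedges. For a $3$-uniform hypergraph $H$, $\mathrm{ex}(n,F)$ is the maximum number of hyperedges in an $n$-vertex $3$-uniform hypergraph containing no copy of $F$. An $r$-coloring of $H$ is a function $E(H)\to\{1,\dots,r\}$. A copy of $F$ in $H$ is rainbow if its $7$ hyperedges receive $7$ pairwise distinct colors. $c_{r,F^R}(H)$ denotes the number of $r$-colorings of $H$ that contain no rainbow copy of the Fano plane. $B_n$ is the $n$-vertex $3$-uniform hypergraph whose vertex set is partitioned into two classes $V_1,V_2$ with $||V_1|-|V_2||\le 1$ and whose hyperedges are all triples meeting both $V_1$ and $V_2$. *)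

theory Defs
  imports "HOL-Library.FuncSet"
begin

text \<open>A hypergraph is a pair of a vertex set and a set of hyperedges.\<close>

type_synonym 'a hypergraph = "'a set \<times> 'a set set"

abbreviation verts :: "'a hypergraph \<Rightarrow> 'a set" where "verts \<equiv> fst"
abbreviation edges :: "'a hypergraph \<Rightarrow> 'a set set" where "edges \<equiv> snd"

definition uniform_hypergraph :: "nat \<Rightarrow> 'a hypergraph \<Rightarrow> bool" where
  "uniform_hypergraph k H \<longleftrightarrow> finite (verts H) \<and> (\<forall>e\<in>edges H. e \<subseteq> verts H \<and> card e = k)"

definition linear_hypergraph :: "'a hypergraph \<Rightarrow> bool" where
  "linear_hypergraph H \<longleftrightarrow> (\<forall>e\<in>edges H. \<forall>f\<in>edges H. e \<noteq> f \<longrightarrow> card (e \<inter> f) \<le> 1)"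

definition isomorphic :: "'a hypergraph \<Rightarrow> 'b hypergraph \<Rightarrow> bool" where
  "isomorphic G H \<longleftrightarrow> (\<exists>\<phi>. bij_betw \<phi> (verts G) (verts H) \<and> edges H = (\<lambda>e. \<phi> ` e) ` edges G)"

text \<open>The lines are the translates of the difference set \<open>{0, 1, 3}\<close> in the integers modulo 7.
  Lemmas \<open>fano_properties\<close> and \<open>fano_unique\<close> below show that this is the unique linear 3-uniform
  hypergraph with 7 vertices and 7 hyperedges.\<close>

definition fano :: "nat hypergraph" where
  "fano = ({..<7}, (\<lambda>i. {i, (i + 1) mod 7, (i + 3) mod 7}) ` {..<7})"

text \<open>Copies are subhypergraphs, not necessarily induced.\<close>

definition copy_of_in :: "'a hypergraph \<Rightarrow> 'b hypergraph \<Rightarrow> 'a hypergraph \<Rightarrow> bool" where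
  "copy_of_in C F H \<longleftrightarrow> verts C \<subseteq> verts H \<and> edges C \<subseteq> edges H \<and> isomorphic F C"

text \<open>The Turan number for 3-uniform hypergraphs. Since it is invariant under isomorphism,
  it is enough to consider the vertex set \<open>{..<n}\<close>.\<close>

definition turan_ex :: "nat \<Rightarrow> 'b hypergraph \<Rightarrow> nat" where
  "turan_ex n F = Max {card (edges H) | H :: nat hypergraph.
     uniform_hypergraph 3 H \<and> verts H = {..<n} \<and> \<not> (\<exists>C. copy_of_in C F H)}"

definition colorings :: "nat \<Rightarrow> 'a hypergraph \<Rightarrow> ('a set \<Rightarrow> nat) set" where
  "colorings r H = edges H \<rightarrow>\<^sub>E {1..r}"

definition has_rainbow_copy :: "('a set \<Rightarrow> nat) \<Rightarrow> 'b hypergraph \<Rightarrow> 'a hypergraph \<Rightarrow> bool" where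
  "has_rainbow_copy f F H \<longleftrightarrow> (\<exists>C. copy_of_in C F H \<and> inj_on f (edges C))"

definition num_rainbow_free_colorings :: "nat \<Rightarrow> 'b hypergraph \<Rightarrow> 'a hypergraph \<Rightarrow> nat" where
  "num_rainbow_free_colorings r F H = card {f \<in> colorings r H. \<not> has_rainbow_copy f F H}"

definition complete_bipartite3 :: "'a set \<Rightarrow> 'a set \<Rightarrow> 'a hypergraph" where
  "complete_bipartite3 V1 V2 =
     (V1 \<union> V2, {e. e \<subseteq> V1 \<union> V2 \<and> card e = 3 \<and> e \<inter> V1 \<noteq> {} \<and> e \<inter> V2 \<noteq> {}})"

definition balanced_bipartite3 :: "nat \<Rightarrow> nat hypergraph" where
  "balanced_bipartite3 n = complete_bipartite3 {..<n div 2} {n div 2..<n}"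

definition r0 :: nat where
  "r0 = 6 ^ (492 ^ 64 * (37 * 16 ^ 3 * 1406 ^ 9) ^ 63)"

lemma fano_edges:
  "edges fano = {{0,1,3},{1,2,4},{2,3,5},{3,4,6},{4,5,0},{5,6,1},{6,0,2}}"
proof -
  have "{..<7::nat} = {0,1,2,3,4,5,6}" by auto
  then show ?thesis by (simp add: fano_def del: One_nat_def) simp
qed

lemma fano_properties:
  "uniform_hypergraph 3 fano" "linear_hypergraph fano"
  "card (verts fano) = 7" "card (edges fano) = 7"
proof -
  have v: "verts fano = {..<7}" by (simp add: fano_def)
  show "card (verts fano) = 7" by (simp add: v)
  show "uniform_hypergraph 3 fano"
    unfolding uniform_hypergraph_def fano_edges v by simp
  show "linear_hypergraph fano"
    unfolding linear_hypergraph_def fano_edges ball_simps by (intro conjI; simp)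
  have "inj_on (\<lambda>i::nat. {i, (i + 1) mod 7, (i + 3) mod 7}) {..<7}"
  proof (rule inj_onI)
    fix i j :: nat
    assume "i \<in> {..<7}" "j \<in> {..<7}"
      and eq: "{i, (i + 1) mod 7, (i + 3) mod 7} = {j, (j + 1) mod 7, (j + 3) mod 7}"
    then have "j \<in> {0,1,2,3,4,5,6}" by auto
    moreover have "i = j \<or> i = (j + 1) mod 7 \<or> i = (j + 3) mod 7" using eq by blast
    moreover have "(i + 1) mod 7 = j \<or> (i + 1) mod 7 = (j + 1) mod 7 \<or> (i + 1) mod 7 = (j + 3) mod 7"
      using eq by blast
    ultimately show "i = j" by (elim insertE emptyE disjE; simp)
  qed
  then show "card (edges fano) = 7"
    by (simp add: fano_def card_image)
qed

lemma fano_unique: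
  fixes H :: "'a hypergraph"
  assumes u: "uniform_hypergraph 3 H" and l: "linear_hypergraph H"
    and cv: "card (verts H) = 7" and ce: "card (edges H) = 7"
  shows "isomorphic fano H"
proof -
  obtain V E where H: "H = (V, E)" by (cases H)
  have finV: "finite V" and E3: "\<And>e. e \<in> E \<Longrightarrow> e \<subseteq> V \<and> card e = 3"
    using u by (auto simp: H uniform_hypergraph_def)
  have cV: "card V = 7" and cE: "card E = 7" using cv ce by (auto simp: H)
  have finE: "finite E" using cE by (metis card.infinite zero_neq_numeral)
  have fine: "finite e" if "e \<in> E" for e using E3[OF that] finV finite_subset by blast
  have lin: "e = f" if "e \<in> E" "f \<in> E" "x \<in> e" "y \<in> e" "x \<in> f" "y \<in> f" "x \<noteq> y" for e f x y
  proof (rule ccontr)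
    assume "e \<noteq> f"
    then have "card (e \<inter> f) \<le> 1" using l that by (auto simp: H linear_hypergraph_def)
    moreover have "card {x, y} \<le> card (e \<inter> f)"
      using that fine by (intro card_mono) auto
    ultimately show False using \<open>x \<noteq> y\<close> by simp
  qed
  have inc: "z \<in> f" if "e \<in> E" "f \<in> E" "x \<in> e" "y \<in> e" "x \<in> f" "y \<in> f" "x \<noteq> y" "z \<in> e"
    for e f x y z using lin[of e f x y] that by simp
  define P where "P = (\<lambda>e :: 'a set. {p. p \<subseteq> e \<and> card p = 2})"
  have cP: "card (P e) = 3" if "e \<in> E" for e
    using n_subsets[OF fine[OF that], of 2] E3[OF that] by (simp add: P_def choose_two)
  have finP: "finite (P e)" if "e \<in> E" for e
    using fine[OF that] by (simp add: P_def)
  have disj: "P e \<inter> P f = {}" if "e \<in> E" "f \<in> E" "e \<noteq> f" for e f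
    using that lin by (fastforce simp: P_def card_2_iff)
  have "card (\<Union>e\<in>E. P e) = (\<Sum>e\<in>E. card (P e))"
    by (rule card_UN_disjoint) (use finE finP disj in auto)
  also have "\<dots> = 21" using cP cE by simp
  also have "\<dots> = card (P V)"
    using n_subsets[OF finV, of 2] cV by (simp add: P_def choose_two)
  finally have cc: "card (\<Union>e\<in>E. P e) = card (P V)" .
  have PV: "(\<Union>e\<in>E. P e) = P V"
    by (rule card_subset_eq[OF _ _ cc]) (use finV E3 in \<open>auto simp: P_def\<close>)
  have pair: "\<exists>z. {x, y, z} \<in> E \<and> z \<in> V \<and> z \<noteq> x \<and> z \<noteq> y"
    if "x \<in> V" "y \<in> V" "x \<noteq> y" for x y
  proof -
    have "{x, y} \<in> (\<Union>e\<in>E. P e)" unfolding PV using that by (simp add: P_def)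
    then obtain e where e: "e \<in> E" "x \<in> e" "y \<in> e" by (auto simp: P_def)
    have "card (e - {x, y}) = 1" using E3[OF e(1)] e that by (simp add: card_Diff_subset)
    then obtain z where z: "e - {x, y} = {z}" by (auto simp: card_1_singleton_iff)
    then have "e = {x, y, z}" using e by auto
    then show ?thesis using e z E3[OF e(1)] by auto
  qed
  obtain e0 where e0: "e0 \<in> E" using cE by fastforce
  obtain a b c where abc: "e0 = {a, b, c}" and d1: "a \<noteq> b" "b \<noteq> c" "a \<noteq> c"
    using E3[OF e0] by (auto simp: card_3_iff)
  have L1: "{a, b, c} \<in> E" and abcV: "a \<in> V" "b \<in> V" "c \<in> V" using e0 E3[OF e0] abc by auto
  have "card (V - {a, b, c}) = 4" using cV abcV d1 by (simp add: card_Diff_subset)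
  then have "V - {a, b, c} \<noteq> {}" by (metis card.empty zero_neq_numeral)
  then obtain d where d: "d \<in> V" "d \<noteq> a" "d \<noteq> b" "d \<noteq> c" by blast
  obtain e where L2: "{a, d, e} \<in> E" and e: "e \<in> V" "e \<noteq> a" "e \<noteq> d"
    using pair[of a d] abcV d by auto
  obtain f where L3: "{b, d, f} \<in> E" and f: "f \<in> V" "f \<noteq> b" "f \<noteq> d"
    using pair[of b d] abcV d by auto
  obtain g where L4: "{c, d, g} \<in> E" and g: "g \<in> V" "g \<noteq> c" "g \<noteq> d"
    using pair[of c d] abcV d by auto
  have e': "e \<noteq> b" "e \<noteq> c" using inc[OF L2 L1, of a e d] d1 d e by auto
  have f': "f \<noteq> a" "f \<noteq> c" using inc[OF L3 L1, of b f d] d1 d f by auto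
  have g': "g \<noteq> a" "g \<noteq> b" using inc[OF L4 L1, of c g d] d1 d g by auto
  have ef: "e \<noteq> f" using inc[OF L2 L3, of d e a] d1 d e by auto
  have eg: "e \<noteq> g" using inc[OF L2 L4, of d e a] d1 d e by auto
  have fg: "f \<noteq> g" using inc[OF L3 L4, of d f b] d1 d f by auto
  note dist = d1 d(2-) e(2-) f(2-) g(2-) e' f' g' ef eg fg
  have Veq: "V = {a, b, c, d, e, f, g}"
    by (rule card_subset_eq[symmetric, OF finV]) (use dist abcV d e f g cV in auto)
  have L5: "{a, f, g} \<in> E"
  proof -
    obtain z where z: "{a, f, z} \<in> E" "z \<in> V" "z \<noteq> a" "z \<noteq> f"
      using pair[of a f] abcV f dist by auto
    have "z \<notin> {b, c}" using inc[OF z(1) L1, of a z f] z dist by auto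
    moreover have "z \<notin> {d, e}" using inc[OF z(1) L2, of a z f] z dist by auto
    ultimately show ?thesis using z Veq by auto
  qed
  have L6: "{b, e, g} \<in> E"
  proof -
    obtain z where z: "{b, e, z} \<in> E" "z \<in> V" "z \<noteq> b" "z \<noteq> e"
      using pair[of b e] abcV e dist by auto
    have "z \<notin> {a, c}" using inc[OF z(1) L1, of b z e] z dist by auto
    moreover have "z \<notin> {d, f}" using inc[OF z(1) L3, of b z e] z dist by auto
    ultimately show ?thesis using z Veq by auto
  qed
  have L7: "{c, e, f} \<in> E"
  proof -
    obtain z where z: "{c, e, z} \<in> E" "z \<in> V" "z \<noteq> c" "z \<noteq> e"
      using pair[of c e] abcV e dist by auto
    have "z \<notin> {a, b}" using inc[OF z(1) L1, of c z e] z dist by auto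
    moreover have "z \<notin> {d, g}" using inc[OF z(1) L4, of c z e] z dist by auto
    ultimately show ?thesis using z Veq by auto
  qed
  define \<phi> where "\<phi> = (\<lambda>i :: nat. [a, b, d, c, f, g, e] ! i)"
  have bij: "bij_betw \<phi> {..<7} V"
    unfolding \<phi>_def by (rule bij_betw_nth) (use dist Veq in auto)
  have im: "(\<lambda>e. \<phi> ` e) ` edges fano \<subseteq> E"
    using L1 L2 L3 L4 L5 L6 L7
    by (simp add: fano_edges \<phi>_def numeral_eq_Suc insert_commute)
  have "inj_on (\<lambda>e. \<phi> ` e) (Pow {..<7})"
    using bij by (simp add: bij_betw_def inj_on_image_Pow)
  moreover have "edges fano \<subseteq> Pow {..<7}" by (auto simp: fano_def)
  ultimately have "card ((\<lambda>e. \<phi> ` e) ` edges fano) = card E"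
    using cE fano_properties(4) by (metis card_image inj_on_subset)
  then have "(\<lambda>e. \<phi> ` e) ` edges fano = E"
    using im finE by (intro card_subset_eq)
  then show ?thesis
    using bij by (auto simp: isomorphic_def H fano_def)
qed

end

theory Submission
  imports Defs Complex_Main
begin

text \<open>Choose a colouring uniformly among those without a rainbow Fano plane. If there are at least
  \<open>r ^ e\<close> of them, where \<open>e\<close> is the number of edges of \<open>B\<^sub>n\<close>, then its entropy is
  large. Pinning the colours of the edges that meet a suitable set of boundedly many vertices makes the lines of an average copy of the Fano plane
  almost independent. Call an edge rich if, conditionally on the pinned colours, no six colours
  carry almost all of its mass. An edge that is not rich has little entropy, so that on average
  the rich edges have density almost \<open>3/4\<close>; on the other hand, a Fano plane with six rich lines
  would be rainbow with positive probability, so there are few of them. Stability for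
  the Fano plane now shows that almost all edges cross a bipartition. If no vertex can be deleted
  at a cost below the minimum degree of \<open>B\<^sub>n\<close>, then the same argument at single
  vertices and single edges shows that the 3-graph is exactly bipartite, and counting edges
  finishes the proof. Otherwise each deletion gains a factor \<open>r\<close> over the bound, which can happen only
  boundedly often.\<close>

section \<open>The links of a complete 4-set\<close>

text \<open>Entropy controls only the rich edges, while the conclusion concerns every edge. This is
  why a forbidden plane has six rich lines and a seventh line that is any edge: its colour is fixed
  first, and each rich line still finds a fresh colour. So \<open>fano6\<close> and the stability
  lemmas carry two relations, all edges \<open>H\<close> and the rich edges \<open>R\<close> among
  them. A poor edge holds at most 12 nats, because \<eta> makes \<open>\<eta> * ln (2 * r)\<close>
  equal to 1; this is negligible against \<open>ln r\<close>, and \<open>ln r \<ge> 10^95\<close> is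
  all that is taken from \<open>r0\<close>. Stability under few Fano planes is reached by sampling
  instead of a removal lemma: \<open>10^90\<close> random vertices rarely span a forbidden plane,
  exact Fano-freeness gives a bipartition of the sample, and a test on six vertices carries it back.
  The test rests on the fact that two vertices of a non-edge of a complete bipartite 3-graph
  determine the opposite class. The Turan number is not presupposed either: the colouring bound,
  applied to Fano-free 3-graphs, yields it.\<close>

lemma sdr_greedy:
  assumes "finite P" "finite Q" "finite R" "1 \<le> card P" "2 \<le> card Q" "3 \<le> card R"
  shows "\<exists>i\<in>P. \<exists>j\<in>Q. \<exists>k\<in>R. i \<noteq> j \<and> j \<noteq> k \<and> i \<noteq> k"
proof -
  obtain i where i: "i \<in> P" using assms by (metis card.empty ex_in_conv not_one_le_zero)
  have "1 \<le> card (Q - {i})" using assms by (auto simp: card_Diff_singleton_if)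
  then obtain j where j: "j \<in> Q" "i \<noteq> j"
    by (metis DiffD1 DiffD2 card.empty ex_in_conv not_one_le_zero singletonI)
  have "card (R - {i,j}) \<ge> card R - card {i,j}" by (rule diff_card_le_card_Diff) auto
  moreover have "card {i,j} = 2" using j by simp
  ultimately have "1 \<le> card (R - {i,j})" using assms(6) by linarith
  then obtain k where k: "k \<in> R - {i,j}" by (metis card.empty ex_in_conv not_one_le_zero)
  show ?thesis by (rule bexI[OF _ i], rule bexI[OF _ j(1)], rule bexI[of _ k]) (use j k in auto)
qed

text \<open>The greedy criterion of \<open>sdr_greedy\<close> fails in all six orders: sorted
  increasingly, the sizes do not dominate 1, 2, 3. This is only necessary for the absence of
  distinct representatives, but it depends on the sizes alone and is open to linear
  arithmetic.\<close>

definition no_sdr_sizes :: "nat \<Rightarrow> nat \<Rightarrow> nat \<Rightarrow> bool" where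
  "no_sdr_sizes p q s \<longleftrightarrow> (p = 0 \<or> q < 2 \<or> s < 3) \<and> (p = 0 \<or> s < 2 \<or> q < 3) \<and>
     (q = 0 \<or> p < 2 \<or> s < 3) \<and> (q = 0 \<or> s < 2 \<or> p < 3) \<and>
     (s = 0 \<or> p < 2 \<or> q < 3) \<and> (s = 0 \<or> q < 2 \<or> p < 3)"

lemma no_sdr_card:
  assumes f: "finite P" "finite Q" "finite R"
    and no: "\<forall>i\<in>P. \<forall>j\<in>Q. \<forall>k\<in>R. i = j \<or> j = k \<or> i = k"
  shows "no_sdr_sizes (card P) (card Q) (card R)"
proof -
  have *: "card A = 0 \<or> card B < 2 \<or> card C < 3"
    if "finite A" "finite B" "finite C" "\<forall>i\<in>A. \<forall>j\<in>B. \<forall>k\<in>C. i = j \<or> j = k \<or> i = k" for A B C :: "'a set"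
    using sdr_greedy[OF that(1,2,3)] that(4) by (metis One_nat_def Suc_leI not_gr_zero not_less)
  show ?thesis unfolding no_sdr_sizes_def
    by (intro conjI *; (rule f | (intro ballI, metis no)))
qed

lemma no_sdr_sizes_8:
  assumes "no_sdr_sizes p q s" "p \<le> 4" "q \<le> 4" "s \<le> 4"
  shows "p + q + s \<le> 8"
proof (rule ccontr)
  assume "\<not> p + q + s \<le> 8"
  then have *: "9 \<le> p + q + s" by simp
  then have "p \<noteq> 0" "q \<noteq> 0" "s \<noteq> 0" using assms by linarith+
  then have "q < 2 \<or> s < 3" "s < 2 \<or> q < 3" "p < 2 \<or> s < 3"
    "s < 2 \<or> p < 3" "p < 2 \<or> q < 3" "q < 2 \<or> p < 3"
    using assms(1) unfolding no_sdr_sizes_def by blast+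
  then show False using * assms(2-) by linarith
qed

text \<open>Meant for a set of size \<open>s\<close> inside a 4-set that meets a fixed 3-subset in
  \<open>r\<close> elements, whence \<open>s \<le> r + 1\<close>. The extreme case is
  \<open>r = 0\<close>, \<open>s = 1\<close>, \<open>p = q = 4\<close>. What matters is that 28
  stays below three times \<open>3 + 4 + 3\<close>.\<close>

lemma no_sdr_sizes_28:
  assumes "no_sdr_sizes p r q" "p \<le> 4" "q \<le> 4" "r \<le> 3" "s \<le> r + 1"
  shows "3 * q + 4 * s + 3 * p \<le> 28"
proof (cases "p = 0 \<or> q = 0 \<or> r = 0")
  case True
  then show ?thesis using assms(2-) by linarith
next
  case False
  then have "q < 2 \<or> r < 3" "r < 2 \<or> q < 3" "p < 2 \<or> r < 3"
    "r < 2 \<or> p < 3" "p < 2 \<or> q < 3" "q < 2 \<or> p < 3"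
    using assms(1) unfolding no_sdr_sizes_def by blast+
  then show ?thesis using assms(2-) by linarith
qed

text \<open>A third element anywhere would permit the greedy choice. Among 2-sets, an element of one
  set missing from a second is represented by itself, after which the third and then the second set
  still have a free element; so all three coincide.\<close>

lemma no_sdr_twos:
  assumes f: "finite P" "finite Q" "finite R"
    and c: "2 \<le> card P" "2 \<le> card Q" "2 \<le> card R"
    and no: "\<forall>i\<in>P. \<forall>j\<in>Q. \<forall>k\<in>R. i = j \<or> j = k \<or> i = k"
  shows "P = Q \<and> Q = R \<and> card P = 2"
proof -
  have c2: "card P = 2" "card Q = 2" "card R = 2"
    using no_sdr_card[OF f no] c unfolding no_sdr_sizes_def by linarith+
  have sub: "A \<subseteq> B" if t: "card B = 2" "card C = 2" "\<forall>i\<in>A. \<forall>j\<in>B. \<forall>k\<in>C. i = j \<or> j = k \<or> i = k" for A B C :: "'a set"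
  proof
    fix x assume x: "x \<in> A"
    obtain q q' where B: "B = {q,q'}" "q \<noteq> q'" using t by (auto simp: card_2_iff)
    obtain r r' where C: "C = {r,r'}" "r \<noteq> r'" using t by (auto simp: card_2_iff)
    show "x \<in> B" using t(3) x B C by auto
  qed
  have "P \<subseteq> Q" using sub[OF c2(2,3) no] .
  then have "P = Q" using c2 f by (simp add: card_subset_eq)
  moreover have "R \<subseteq> Q"
  proof (rule sub[OF c2(2,1)], intro ballI)
    fix i j k assume "i \<in> R" "j \<in> Q" "k \<in> P"
    then have "k = j \<or> j = i \<or> k = i" using no by blast
    then show "i = j \<or> j = k \<or> i = k" by auto
  qed
  then have "R = Q" using c2 f by (simp add: card_subset_eq)
  ultimately show ?thesis using c2 by simp
qed

text \<open>The links of the four vertices of a complete 4-set \<open>X\<close>: \<open>S u v\<close> collects the vertices of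
  \<open>X\<close> whose link contains \<open>uv\<close>. By \<open>no_factor\<close> no three links split a 4-set into its three
  perfect matchings, which would complete an edge inside \<open>X\<close> to a Fano plane.\<close>

locale four_links =
  fixes S :: "'v \<Rightarrow> 'v \<Rightarrow> 'c set" and X :: "'c set"
  assumes card_X: "card X = 4"
    and S_sub: "S u v \<subseteq> X"
    and S_sym: "S u v = S v u"
    and S_irrefl: "S u u = {}"
    and no_factor: "\<lbrakk>i \<in> S a b; i \<in> S c d; j \<in> S a c; j \<in> S b d; k \<in> S a d; k \<in> S b c\<rbrakk>
        \<Longrightarrow> i = j \<or> j = k \<or> i = k"
begin

section \<open>Weights of pairs under four links: the average is at most three\<close>

abbreviation w :: "'v \<Rightarrow> 'v \<Rightarrow> nat" where "w u v \<equiv> card (S u v)"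

definition W :: "'v set \<Rightarrow> nat" where "W U = (\<Sum>u\<in>U. \<Sum>v\<in>U. w u v)"

lemma fin_X: "finite X" using card_X by (metis card.infinite zero_neq_numeral)
lemma fin_S [simp]: "finite (S u v)" using fin_X S_sub finite_subset by blast
lemma w_le: "w u v \<le> 4" using card_mono[OF fin_X S_sub] card_X by metis
lemma w_sym: "w u v = w v u" using S_sym by metis
lemma w_irrefl [simp]: "w u u = 0" using S_irrefl by simp
lemma S_full: "w u v = 4 \<Longrightarrow> S u v = X"
  using card_subset_eq[OF fin_X S_sub] card_X by metis

text \<open>A full pair accepts every label, so distinct representatives of \<open>S c d\<close>,
  \<open>S b d\<close>, \<open>S a d\<close> would already be a forbidden factor. The total 8 is
  less than the 9 that average weight 3 would give.\<close>

lemma triangle_444: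
  assumes "w a b = 4" "w b c = 4" "w a c = 4"
  shows "w a d + w b d + w c d \<le> 8"
proof -
  have "\<forall>i\<in>S c d. \<forall>j\<in>S b d. \<forall>k\<in>S a d. i = j \<or> j = k \<or> i = k"
  proof (intro ballI)
    fix i j k assume h: "i \<in> S c d" "j \<in> S b d" "k \<in> S a d"
    then have "i \<in> X" "j \<in> X" "k \<in> X" using S_sub by blast+
    then have "i \<in> S a b" "j \<in> S a c" "k \<in> S b c"
      using S_full[OF assms(1)] S_full[OF assms(2)] S_full[OF assms(3)] by simp_all
    then show "i = j \<or> j = k \<or> i = k" using no_factor h by simp
  qed
  from no_sdr_card[OF _ _ _ this] have "no_sdr_sizes (w c d) (w b d) (w a d)" by simp
  from no_sdr_sizes_8[OF this w_le w_le w_le] show ?thesis by linarith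
qed

text \<open>As in \<open>triangle_444\<close>, except that the label on \<open>b d\<close> must also
  lie in the 3-set \<open>S a c\<close>, which costs at most one element of \<open>S b d\<close>.
  The weighted mean is below 3 (28 against 30), and the plain sum is still at most 9.\<close>

lemma triangle_443:
  assumes "w a b = 4" "w b c = 4" "w a c = 3"
  shows "3 * w a d + 4 * w b d + 3 * w c d \<le> 28"
proof -
  have "\<forall>i\<in>S c d. \<forall>j\<in>S a c \<inter> S b d. \<forall>k\<in>S a d. i = j \<or> j = k \<or> i = k"
  proof (intro ballI)
    fix i j k assume h: "i \<in> S c d" "j \<in> S a c \<inter> S b d" "k \<in> S a d"
    then have "i \<in> X" "k \<in> X" using S_sub by blast+
    then have "i \<in> S a b" "k \<in> S b c"
      using S_full[OF assms(1)] S_full[OF assms(2)] by simp_all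
    then show "i = j \<or> j = k \<or> i = k" using no_factor h by simp
  qed
  from no_sdr_card[OF _ _ _ this] have n: "no_sdr_sizes (w c d) (card (S a c \<inter> S b d)) (w a d)" by simp
  have "S b d - S a c \<subseteq> X - S a c" using S_sub by blast
  moreover have "card (X - S a c) = 1" using S_sub card_X assms(3) by (simp add: card_Diff_subset)
  ultimately have "card (S b d - S a c) \<le> 1" using fin_X by (metis card_mono finite_Diff)
  moreover have "w b d = card (S a c \<inter> S b d) + card (S b d - S a c)"
    by (metis Int_commute card_Int_Diff fin_S)
  moreover have "card (S a c \<inter> S b d) \<le> 3" using assms(3) by (metis card_mono fin_S inf_le1)
  ultimately show ?thesis
    using no_sdr_sizes_28[OF n w_le w_le, of "w b d"] by linarith
qed

text \<open>The behaviour of the extremal example: in a complete bipartite 3-graph a complete 4-set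
  has two vertices in each class, cross pairs have weight 4 and inner pairs weight 2, so two full
  pairs at a vertex close up with weight 2.\<close>

definition light :: "'v set \<Rightarrow> bool" where
  "light U \<longleftrightarrow> (\<forall>a\<in>U. \<forall>b\<in>U. \<forall>c\<in>U. w a b = 4 \<longrightarrow> w b c = 4 \<longrightarrow> w a c \<le> 2)"

lemma heavy_triangle:
  assumes "\<not> light U"
  obtains a b c where "a \<in> U" "b \<in> U" "c \<in> U" "w a b = 4" "w b c = 4" "w a c = 3 \<or> w a c = 4"
proof -
  obtain a b c where h: "a \<in> U" "b \<in> U" "c \<in> U" "w a b = 4" "w b c = 4" "\<not> w a c \<le> 2"
    using assms by (auto simp: light_def)
  then show ?thesis using that[of a b c] w_le[of a c] by force
qed

lemma light_edge:
  assumes "light U" "a \<in> U" "b \<in> U" "c \<in> U" "w a b = 4"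
  shows "w a c + w b c \<le> 6"
proof (cases "w a c = 4 \<or> w b c = 4")
  case True
  then have "w a c = 4 \<and> w b c \<le> 2 \<or> w b c = 4 \<and> w a c \<le> 2"
    using assms w_sym unfolding light_def by metis
  then show ?thesis using w_le[of a c] w_le[of b c] by linarith
next
  case False
  then show ?thesis using w_le[of a c] w_le[of b c] by linarith
qed

lemma W_split:
  assumes "finite U" "Q \<subseteq> U"
  shows "W U = W (U - Q) + 2 * (\<Sum>u\<in>U-Q. \<Sum>q\<in>Q. w q u) + W Q"
proof -
  have s: "sum f U = sum f (U - Q) + sum f Q" for f :: "'v \<Rightarrow> nat"
    using assms by (simp add: sum.subset_diff)
  have "W U = (\<Sum>u\<in>U. (\<Sum>v\<in>U-Q. w u v) + (\<Sum>v\<in>Q. w u v))" by (simp add: W_def s)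
  also have "\<dots> = W (U - Q) + (\<Sum>u\<in>Q. \<Sum>v\<in>U-Q. w u v) + ((\<Sum>u\<in>U-Q. \<Sum>v\<in>Q. w u v) + W Q)"
    by (simp add: W_def sum.distrib s)
  also have "(\<Sum>u\<in>Q. \<Sum>v\<in>U-Q. w u v) = (\<Sum>u\<in>U-Q. \<Sum>q\<in>Q. w q u)" by (rule sum.swap)
  also have "(\<Sum>u\<in>U-Q. \<Sum>v\<in>Q. w u v) = (\<Sum>u\<in>U-Q. \<Sum>q\<in>Q. w q u)"
    by (intro sum.cong refl w_sym)
  finally show ?thesis by simp
qed

text \<open>Induction that deletes a block \<open>Q\<close> whose weights to each vertex average at
  most 3; \<open>red\<close> is this step. A heavy triangle is such a block, in a light set so is a
  full pair, and if neither exists all weights are at most 3. As \<open>W\<close> adds up four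
  links, the bound says that their mean density is at most 3/4.\<close>

lemma W_le:
  assumes "finite U"
  shows "W U \<le> 3 * (card U)\<^sup>2"
  using assms
proof (induction "card U" arbitrary: U rule: less_induct)
  case less
  note fin = less.prems
  have red: "W U \<le> 3 * (card U)\<^sup>2" if Q: "Q \<subseteq> U" "Q \<noteq> {}"
    and bnd: "\<And>u. u \<in> U \<Longrightarrow> (\<Sum>q\<in>Q. w q u) \<le> 3 * card Q" and WQ: "W Q \<le> 3 * (card Q)\<^sup>2" for Q
  proof -
    have fQ: "finite Q" using Q fin finite_subset by blast
    have cU: "card U = card (U - Q) + card Q"
      using Q fin fQ by (metis card_Diff_subset card_mono le_add_diff_inverse2)
    moreover have "card Q > 0" using Q fQ by (simp add: card_gt_0_iff)
    ultimately have "W (U - Q) \<le> 3 * (card (U - Q))\<^sup>2" using less.hyps[of "U - Q"] fin by simp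
    moreover have "(\<Sum>u\<in>U-Q. \<Sum>q\<in>Q. w q u) \<le> (\<Sum>u\<in>U-Q. 3 * card Q)"
      by (rule sum_mono) (use bnd in auto)
    ultimately have "W U \<le> 3 * (card (U - Q))\<^sup>2 + 2 * (card (U - Q) * (3 * card Q)) + 3 * (card Q)\<^sup>2"
      using W_split[OF fin Q(1)] WQ by simp
    also have "\<dots> = 3 * (card U)\<^sup>2" unfolding cU by (simp add: power2_eq_square algebra_simps)
    finally show ?thesis .
  qed
  show ?case
  proof (cases "light U")
    case False
    then obtain a b c where h: "a \<in> U" "b \<in> U" "c \<in> U" "w a b = 4" "w b c = 4" "w a c = 3 \<or> w a c = 4"
      by (rule heavy_triangle)
    then have d: "a \<noteq> b" "b \<noteq> c" "a \<noteq> c" by auto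
    show ?thesis
    proof (rule red[of "{a,b,c}"])
      show "(\<Sum>q\<in>{a,b,c}. w q u) \<le> 3 * card {a,b,c}" for u
        using d h(6) triangle_444[OF h(4,5), of u] triangle_443[OF h(4,5), of u] by auto
      have "W {a,b,c} = 2 * (w a b + w b c + w a c)" using d by (simp add: W_def w_sym)
      then show "W {a,b,c} \<le> 3 * (card {a,b,c})\<^sup>2" using d h by (auto simp: power2_eq_square)
    qed (use h in auto)
  next
    case light: True
    show ?thesis
    proof (cases "\<exists>a\<in>U. \<exists>b\<in>U. w a b = 4")
      case True
      then obtain a b where h: "a \<in> U" "b \<in> U" "w a b = 4" by blast
      then have d: "a \<noteq> b" by auto
      show ?thesis
      proof (rule red[of "{a,b}"])
        show "(\<Sum>q\<in>{a,b}. w q u) \<le> 3 * card {a,b}" if "u \<in> U" for u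
          using d light_edge[OF light h(1,2) that h(3)] by simp
        have "W {a,b} = 2 * w a b" using d by (simp add: W_def w_sym)
        then show "W {a,b} \<le> 3 * (card {a,b})\<^sup>2" using d h by (simp add: power2_eq_square)
      qed (use h in auto)
    next
      case False
      then have "w a b \<le> 3" if "a \<in> U" "b \<in> U" for a b using that w_le[of a b] by force
      then have "W U \<le> (\<Sum>u\<in>U. \<Sum>v\<in>U. 3)" unfolding W_def by (intro sum_mono) auto
      then show ?thesis by (simp add: power2_eq_square algebra_simps)
    qed
  qed
qed

end

section \<open>Minimum degree near three: the two classes and the link of a single label\<close>

lemma card_filter_sum:
  "finite A \<Longrightarrow> real (card {x\<in>A. P x}) = (\<Sum>x\<in>A. of_bool (P x))"
  by (simp add: of_bool_def sum.If_cases Int_def)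

context four_links
begin

lemma miss_ex1:
  assumes "w u v = 3"
  obtains x where "x \<in> X" "S u v = X - {x}"
proof -
  have "card (X - S u v) = 1" using S_sub card_X assms by (simp add: card_Diff_subset)
  then obtain x where x: "X - S u v = {x}" by (auto simp: card_1_singleton_iff)
  then have "S u v = X - {x}" using S_sub[of u v] by blast
  then show ?thesis using that x by blast
qed

definition miss :: "'v \<Rightarrow> 'v \<Rightarrow> 'c" where
  "miss u v = (SOME x. x \<in> X \<and> S u v = X - {x})"

lemma miss: "w u v = 3 \<Longrightarrow> miss u v \<in> X \<and> S u v = X - {miss u v}"
  unfolding miss_def by (rule someI_ex) (metis miss_ex1)

text \<open>Two opposite pairs share all labels but their missing ones, hence at least two. These
  three intersections have no distinct representatives, so \<open>no_sdr_twos\<close> makes them one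
  and the same 2-set: each perfect matching carries the same two distinct missing labels.\<close>

lemma K4_weight3:
  assumes w3: "w a b = 3" "w a c = 3" "w a d = 3" "w b c = 3" "w b d = 3" "w c d = 3"
  shows "miss a b \<noteq> miss c d \<and> {miss a b, miss c d} = {miss a c, miss b d} \<and>
    {miss a b, miss c d} = {miss a d, miss b c}"
proof -
  have I: "S u v \<inter> S x y = X - {miss u v, miss x y}" if "w u v = 3" "w x y = 3" for u v x y
    using miss[OF that(1)] miss[OF that(2)] by blast
  have c: "2 \<le> card (S u v \<inter> S x y)" if "w u v = 3" "w x y = 3" for u v x y
  proof -
    have "card (X - {miss u v, miss x y}) \<ge> card X - card {miss u v, miss x y}"
      by (rule diff_card_le_card_Diff) simp
    moreover have "card {miss u v, miss x y} \<le> 2" by (simp add: card_insert_if)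
    ultimately show ?thesis using I[OF that] card_X by simp
  qed
  have "S a b \<inter> S c d = S a c \<inter> S b d \<and> S a c \<inter> S b d = S a d \<inter> S b c \<and> card (S a b \<inter> S c d) = 2"
  proof (rule no_sdr_twos)
    show "\<forall>i\<in>S a b \<inter> S c d. \<forall>j\<in>S a c \<inter> S b d. \<forall>k\<in>S a d \<inter> S b c. i = j \<or> j = k \<or> i = k"
      using no_factor by blast
  qed (use c w3 in auto)
  then have e: "X - {miss a b, miss c d} = X - {miss a c, miss b d}"
     "X - {miss a b, miss c d} = X - {miss a d, miss b c}" "card (X - {miss a b, miss c d}) = 2"
    using I w3 by metis+
  have cc: "card (X - {x}) = 3" if "x \<in> X" for x using that card_X fin_X by simp
  have "miss a b \<noteq> miss c d" using e(3) cc miss[OF w3(1)] by force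
  moreover have "{miss a b, miss c d} = {miss a c, miss b d}" "{miss a b, miss c d} = {miss a d, miss b c}"
    using e(1,2) miss w3 by blast+
  ultimately show ?thesis by blast
qed

text \<open>\<open>K4_weight3\<close> on the five 4-subsets makes opposite pairs take different ones
  of the two labels \<open>miss a b\<close> and \<open>miss c d\<close>. Both ways of labelling the
  matching \<open>a d\<close>, \<open>b c\<close> propagate to a matching with two equal
  labels.\<close>

lemma no_K5_weight3:
  assumes "w a b = 3" "w a c = 3" "w a d = 3" "w a e = 3" "w b c = 3" "w b d = 3" "w b e = 3"
    "w c d = 3" "w c e = 3" "w d e = 3"
  shows False
proof -
  note k1 = K4_weight3[OF assms(1,2,3,5,6,8)]
  note k2 = K4_weight3[OF assms(1,2,4,5,7,9)]
  note k3 = K4_weight3[OF assms(1,3,4,6,7,10)]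
  note k4 = K4_weight3[OF assms(2,3,4,8,9,10)]
  note k5 = K4_weight3[OF assms(5,6,7,8,9,10)]
  have pq: "miss a b \<noteq> miss c d" using k1 by blast
  have "miss b c = miss c d \<and> miss a d = miss a b \<or> miss b c = miss a b \<and> miss a d = miss c d"
    using k1 unfolding doubleton_eq_iff by metis
  then show False
  proof
    assume h: "miss b c = miss c d \<and> miss a d = miss a b"
    have ce: "miss c e = miss c d" using k2 h pq unfolding doubleton_eq_iff by metis
    have "miss d e \<noteq> miss c d" using k5 h by metis
    then have "miss b d \<noteq> miss c d" using k3 pq unfolding doubleton_eq_iff by metis
    then have "miss b d = miss a b" using k1 unfolding doubleton_eq_iff by metis
    then have "miss d e = miss a b" using k5 h ce pq unfolding doubleton_eq_iff by metis
    then show False using k3 by metis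
  next
    assume h: "miss b c = miss a b \<and> miss a d = miss c d"
    have de: "miss d e = miss c d" using k3 h pq unfolding doubleton_eq_iff by metis
    have "miss a c \<noteq> miss c d" using k4 de by metis
    then have "miss a c = miss a b" using k1 unfolding doubleton_eq_iff by metis
    then have "miss c e = miss a b" using k4 h de pq unfolding doubleton_eq_iff by metis
    then show False using k2 by metis
  qed
qed

text \<open>Without full pairs the degrees leave at most \<open>\<beta> * card U\<close> partners of
  weight other than 3 at each vertex. As \<beta> is below 1/4, any four vertices have a common
  partner of weight 3, and a greedy choice builds the configuration refuted by
  \<open>no_K5_weight3\<close>.\<close>

lemma exists_weight4:
  fixes \<beta> :: real
  assumes fin: "finite U" and ne: "U \<noteq> {}" and \<beta>: "0 < \<beta>" "\<beta> < 1/4"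
    and deg: "\<And>a. a \<in> U \<Longrightarrow> (3 - \<beta>) * card U \<le> (\<Sum>u\<in>U. w a u)"
  shows "\<exists>a\<in>U. \<exists>b\<in>U. w a b = 4"
proof (rule ccontr)
  assume no: "\<not> ?thesis"
  then have le3: "w a b \<le> 3" if "a \<in> U" "b \<in> U" for a b using that w_le[of a b] by force
  define m where "m = real (card U)"
  have m: "m > 0" using fin ne by (simp add: m_def card_gt_0_iff)
  have few: "real (card {u\<in>U. w a u \<noteq> 3}) \<le> \<beta> * m" if "a \<in> U" for a
  proof -
    have "real (w a u) \<le> 3 - of_bool (w a u \<noteq> 3)" if "u \<in> U" for u
      using le3[OF \<open>a \<in> U\<close> that] by (auto simp: of_bool_def)
    then have "(\<Sum>u\<in>U. real (w a u)) \<le> (\<Sum>u\<in>U. 3 - of_bool (w a u \<noteq> 3))"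
      by (intro sum_mono)
    also have "\<dots> = 3 * m - card {u\<in>U. w a u \<noteq> 3}"
      by (simp add: sum_subtractf card_filter_sum[OF fin] m_def)
    finally have "real (\<Sum>u\<in>U. w a u) + real (card {u\<in>U. w a u \<noteq> 3}) \<le> 3 * m" by simp
    then show ?thesis using deg[OF that] by (simp add: m_def algebra_simps)
  qed
  have ext: "\<exists>v\<in>U. \<forall>q\<in>Q. w q v = 3" if Q: "Q \<subseteq> U" "card Q \<le> 4" for Q
  proof (rule ccontr)
    assume "\<not> ?thesis"
    then have "U \<subseteq> (\<Union>q\<in>Q. {u\<in>U. w q u \<noteq> 3})" by auto
    moreover have fQ: "finite Q" using Q fin finite_subset by blast
    ultimately have "card U \<le> card (\<Union>q\<in>Q. {u\<in>U. w q u \<noteq> 3})" using fin by (intro card_mono) auto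
    also have "\<dots> \<le> (\<Sum>q\<in>Q. card {u\<in>U. w q u \<noteq> 3})" by (rule card_UN_le[OF fQ])
    finally have "m \<le> (\<Sum>q\<in>Q. real (card {u\<in>U. w q u \<noteq> 3}))" unfolding m_def of_nat_sum[symmetric] by linarith
    also have "\<dots> \<le> (\<Sum>q\<in>Q. \<beta> * m)" using few Q by (intro sum_mono) auto
    also have "\<dots> = real (card Q) * (\<beta> * m)" by simp
    also have "\<dots> \<le> 4 * (\<beta> * m)" using Q \<beta> m by (intro mult_right_mono) auto
    also have "\<dots> < m" using \<beta> m by simp
    finally show False by simp
  qed
  have card_le: "card {a} \<le> 4" "card {a,b} \<le> 4" "card {a,b,c} \<le> 4" "card {a,b,c,d} \<le> 4" for a b c d :: 'v
    by (simp_all add: card_insert_if)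
  obtain a where a: "a \<in> U" using ne by blast
  obtain b where b: "b \<in> U" "w a b = 3" using ext[of "{a}"] a by auto
  obtain c where c: "c \<in> U" "w a c = 3" "w b c = 3" using ext[of "{a,b}"] a b card_le by auto
  obtain d where d: "d \<in> U" "w a d = 3" "w b d = 3" "w c d = 3" using ext[of "{a,b,c}"] a b c card_le by auto
  obtain e where e: "e \<in> U" "w a e = 3" "w b e = 3" "w c e = 3" "w d e = 3"
    using ext[of "{a,b,c,d}"] a b c d card_le by auto
  show False using no_K5_weight3[of a b c d e] b c d e by blast
qed

text \<open>Summed over \<open>U\<close>, the triangle inequalities bound a weighted mean of three
  degrees by 28/10 or 8/3 times \<open>card U\<close>, both below \<open>3 - 1/6\<close>.\<close>

lemma light_of_min_degree:
  fixes \<beta> :: real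
  assumes fin: "finite U" and ne: "U \<noteq> {}" and \<beta>: "0 < \<beta>" "\<beta> < 1/6"
    and deg: "\<And>a. a \<in> U \<Longrightarrow> (3 - \<beta>) * card U \<le> (\<Sum>u\<in>U. w a u)"
  shows "light U"
proof (rule ccontr)
  assume "\<not> light U"
  then obtain a b c where h: "a \<in> U" "b \<in> U" "c \<in> U" "w a b = 4" "w b c = 4" "w a c = 3 \<or> w a c = 4"
    by (rule heavy_triangle)
  have m: "real (card U) > 0" using fin ne by (simp add: card_gt_0_iff)
  from h(6) show False
  proof
    assume "w a c = 3"
    then have "(\<Sum>u\<in>U. 3 * w a u + 4 * w b u + 3 * w c u) \<le> (\<Sum>u\<in>U. 28)"
      using triangle_443[OF h(4,5)] by (intro sum_mono) auto
    then have "3 * (\<Sum>u\<in>U. w a u) + 4 * (\<Sum>u\<in>U. w b u) + 3 * (\<Sum>u\<in>U. w c u) \<le> 28 * card U"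
      by (simp add: sum.distrib sum_distrib_left)
    then have "3 * real (\<Sum>u\<in>U. w a u) + 4 * real (\<Sum>u\<in>U. w b u) + 3 * real (\<Sum>u\<in>U. w c u) \<le> 28 * real (card U)"
      by linarith
    then have "10 * ((3 - \<beta>) * card U) \<le> 28 * real (card U)" using deg[OF h(1)] deg[OF h(2)] deg[OF h(3)] by linarith
    moreover have "\<beta> * card U < 1/6 * card U" using \<beta> m by (intro mult_strict_right_mono) auto
    ultimately show False using m by (simp add: algebra_simps)
  next
    assume "w a c = 4"
    then have "(\<Sum>u\<in>U. w a u + w b u + w c u) \<le> (\<Sum>u\<in>U. 8)"
      using triangle_444[OF h(4,5)] by (intro sum_mono) auto
    then have "(\<Sum>u\<in>U. w a u) + (\<Sum>u\<in>U. w b u) + (\<Sum>u\<in>U. w c u) \<le> 8 * card U"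
      by (simp add: sum.distrib)
    then have "real (\<Sum>u\<in>U. w a u) + real (\<Sum>u\<in>U. w b u) + real (\<Sum>u\<in>U. w c u) \<le> 8 * real (card U)"
      by linarith
    then have "3 * ((3 - \<beta>) * card U) \<le> 8 * real (card U)" using deg[OF h(1)] deg[OF h(2)] deg[OF h(3)] by linarith
    moreover have "\<beta> * card U < 1/6 * card U" using \<beta> m by (intro mult_strict_right_mono) auto
    ultimately show False using m by (simp add: algebra_simps)
  qed
qed

text \<open>Sort the vertices by their weights to the ends of one full pair \<open>a b\<close>. The
  types (4,2) and (2,4) form the classes, and lightness at \<open>a\<close> or \<open>b\<close>
  gives weight at most 2 inside them. Type (3,3) and the vertices with sum at most 5 are
  exceptional: the degrees of \<open>a\<close> and \<open>b\<close> leave room for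
  \<open>2 * \<beta>\<close> of the latter, the degree of one vertex of type (3,3) for
  \<open>3 * \<beta>\<close> of the former.\<close>

lemma bipartition_of_min_degree:
  fixes \<beta> :: real
  assumes fin: "finite U" and ne: "U \<noteq> {}" and \<beta>: "0 < \<beta>" "\<beta> < 1/6"
    and deg: "\<And>a. a \<in> U \<Longrightarrow> (3 - \<beta>) * card U \<le> (\<Sum>u\<in>U. w a u)"
  shows "\<exists>A B. A \<subseteq> U \<and> B \<subseteq> U \<and> A \<inter> B = {} \<and> real (card (U - (A \<union> B))) \<le> 5 * \<beta> * card U \<and>
    (\<forall>u\<in>A. \<forall>v\<in>A. w u v \<le> 2) \<and> (\<forall>u\<in>B. \<forall>v\<in>B. w u v \<le> 2)"
proof -
  note light = light_of_min_degree[OF assms]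
  have "\<beta> < 1/4" using \<beta> by simp
  from exists_weight4[OF fin ne \<beta>(1) this deg] obtain a b where
    ab: "a \<in> U" "b \<in> U" "w a b = 4" by blast
  define A where "A = {c\<in>U. w a c = 4 \<and> w b c = 2}"
  define B where "B = {c\<in>U. w a c = 2 \<and> w b c = 4}"
  define D where "D = {c\<in>U. w a c = 3 \<and> w b c = 3}"
  define Z where "Z = {c\<in>U. w a c + w b c \<le> 5}"
  define m where "m = real (card U)"
  have part: "U = (A \<union> B) \<union> (D \<union> Z)"
  proof
    show "U \<subseteq> (A \<union> B) \<union> (D \<union> Z)"
    proof
      fix c assume c: "c \<in> U"
      have "w a c + w b c \<le> 6" using light_edge[OF light ab(1,2) c ab(3)] .
      then have "w a c + w b c \<le> 5 \<or> w a c = 4 \<and> w b c = 2 \<or> w a c = 2 \<and> w b c = 4 \<or> w a c = 3 \<and> w b c = 3"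
        using w_le[of a c] w_le[of b c] by linarith
      then show "c \<in> (A \<union> B) \<union> (D \<union> Z)" using c by (auto simp: A_def B_def D_def Z_def)
    qed
  qed (auto simp: A_def B_def D_def Z_def)
  have disj: "A \<inter> B = {}" "(A \<union> B) \<inter> (D \<union> Z) = {}" "D \<inter> Z = {}" by (auto simp: A_def B_def D_def Z_def)
  have fins: "finite A" "finite B" "finite D" "finite Z" using fin by (auto simp: A_def B_def D_def Z_def)
  have cU: "card U = card (A \<union> B) + (card D + card Z)"
    unfolding part using disj fins by (simp add: card_Un_disjoint)
  have O_small: "real (card Z) \<le> 2 * \<beta> * m"
  proof -
    have "real (w a u) + real (w b u) \<le> 6 - of_bool (w a u + w b u \<le> 5)" if "u \<in> U" for u
      using light_edge[OF light ab(1,2) that ab(3)] by (auto simp: of_bool_def)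
    then have "(\<Sum>u\<in>U. real (w a u) + real (w b u)) \<le> (\<Sum>u\<in>U. 6 - of_bool (w a u + w b u \<le> 5))"
      by (intro sum_mono)
    also have "\<dots> = 6 * m - card Z"
      unfolding Z_def by (simp add: sum_subtractf card_filter_sum[OF fin] m_def)
    finally have "real (\<Sum>u\<in>U. w a u) + real (\<Sum>u\<in>U. w b u) + real (card Z) \<le> 6 * m"
      by (simp add: sum.distrib)
    then show ?thesis using deg[OF ab(1)] deg[OF ab(2)] by (simp add: m_def algebra_simps)
  qed
  have D_small: "real (card D) \<le> 3 * \<beta> * m"
  proof (cases "D = {}")
    case True
    then show ?thesis using \<beta> by (simp add: m_def)
  next
    case False
    then obtain d where d: "d \<in> D" by blast
    \<comment> \<open>The matchings \<open>a d\<close>, \<open>b d'\<close> and \<open>a d'\<close>,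
      \<open>b d\<close> have two common labels each, and the full pair \<open>a b\<close> accepts
      anything. Three labels on \<open>d d'\<close> would therefore complete a forbidden factor, so
      a vertex of \<open>D\<close> loses degree towards all of \<open>D\<close>.\<close>
    have DD: "w d d' \<le> 2" if d': "d' \<in> D" for d'
    proof -
      have c2: "2 \<le> card (S u v \<inter> S x y)" if "w u v = 3" "w x y = 3" for u v x y
      proof -
        have "card (S u v \<union> S x y) \<le> 4" using card_mono[OF fin_X] S_sub card_X by (metis Un_least)
        moreover have "card (S u v \<union> S x y) + card (S u v \<inter> S x y) = 6"
          using card_Un_Int[of "S u v" "S x y"] that by simp
        ultimately show ?thesis by linarith
      qed
      have "\<forall>i\<in>S d d'. \<forall>j\<in>S a d \<inter> S b d'. \<forall>k\<in>S a d' \<inter> S b d. i = j \<or> j = k \<or> i = k"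
      proof (intro ballI)
        fix i j k assume h: "i \<in> S d d'" "j \<in> S a d \<inter> S b d'" "k \<in> S a d' \<inter> S b d"
        then have "i \<in> S a b" using S_full[OF ab(3)] S_sub[of d d'] by blast
        then show "i = j \<or> j = k \<or> i = k" using no_factor h by simp
      qed
      from no_sdr_card[OF _ _ _ this]
      have "no_sdr_sizes (w d d') (card (S a d \<inter> S b d')) (card (S a d' \<inter> S b d))" by simp
      moreover have "2 \<le> card (S a d \<inter> S b d')" "2 \<le> card (S a d' \<inter> S b d)"
        using c2 d d' by (auto simp: D_def)
      ultimately show ?thesis unfolding no_sdr_sizes_def by linarith
    qed
    have DC: "w d c \<le> 3" if c: "c \<in> A \<union> B" for c
    proof (rule ccontr)
      assume "\<not> w d c \<le> 3"
      then have "w d c = 4" using w_le[of d c] by linarith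
      moreover have "w c a = 4 \<or> w c b = 4" using c by (auto simp: A_def B_def w_sym)
      moreover have "d \<in> U" "c \<in> U" using c d by (auto simp: A_def B_def D_def)
      ultimately have "w d a \<le> 2 \<or> w d b \<le> 2" using light ab unfolding light_def by blast
      then show False using d by (auto simp: D_def w_sym)
    qed
    have sp: "sum f U = sum f (A \<union> B) + (sum f D + sum f Z)" for f :: "'v \<Rightarrow> nat"
      unfolding part using disj fins by (simp add: sum.union_disjoint)
    have "(\<Sum>u\<in>U. w d u) \<le> 3 * card (A \<union> B) + (2 * card D + 4 * card Z)"
      unfolding sp using DD DC w_le
      by (intro add_mono) (metis (no_types, lifting) mult.commute of_nat_id sum_bounded_above)+
    then have "real (\<Sum>u\<in>U. w d u) + real (card D) \<le> 3 * m + real (card Z)"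
      unfolding m_def using cU by linarith
    moreover have "d \<in> U" using d by (simp add: D_def)
    ultimately show ?thesis using deg[of d] O_small by (simp add: m_def algebra_simps)
  qed
  have "U - (A \<union> B) = D \<union> Z" using part disj by blast
  then have "real (card (U - (A \<union> B))) \<le> 5 * \<beta> * card U"
    using D_small O_small disj fins by (simp add: card_Un_disjoint m_def)
  moreover have "w u v \<le> 2" if "u \<in> A" "v \<in> A" for u v
  proof -
    have "u \<in> U" "v \<in> U" "w u a = 4" "w a v = 4" using that by (auto simp: A_def w_sym)
    then show ?thesis using light ab(1) unfolding light_def by blast
  qed
  moreover have "w u v \<le> 2" if "u \<in> B" "v \<in> B" for u v
  proof -
    have "u \<in> U" "v \<in> U" "w u b = 4" "w b v = 4" using that by (auto simp: B_def w_sym)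
    then show ?thesis using light ab(2) unfolding light_def by blast
  qed
  moreover have "A \<subseteq> U" "B \<subseteq> U" by (auto simp: A_def B_def)
  ultimately show ?thesis using disj(1)
    by (intro exI[of _ A] exI[of _ B]) simp
qed

end

lemma Max_exists_le:
  fixes f :: "'b \<Rightarrow> real"
  assumes "finite F" "F \<noteq> {}"
  shows "\<exists>x\<in>F. \<forall>y\<in>F. f y \<le> f x"
proof -
  have "Max (f ` F) \<in> f ` F" using assms by (intro Max_in) auto
  then obtain x where "x \<in> F" "Max (f ` F) = f x" by blast
  then show ?thesis using assms by (metis Max_ge finite_imageI imageI)
qed

context four_links
begin

text \<open>The identity \<open>2*a^2 + 8*a*b + 2*b^2 + (a - b)^2 = 3 * (a + b)^2\<close> shows that
  imbalance and deviation from the pattern 2, 2, 4 are both paid out of the degree deficit. Of the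
  41, one unit is that deficit and \<open>40 = 8 * 5\<close> comes from the vertices outside both
  classes.\<close>

lemma defect_bound:
  fixes \<beta> :: real
  assumes fin: "finite U" and \<beta>: "0 < \<beta>"
    and deg: "\<And>a. a \<in> U \<Longrightarrow> (3 - \<beta>) * card U \<le> (\<Sum>u\<in>U. w a u)"
    and AB: "A \<subseteq> U" "B \<subseteq> U" "A \<inter> B = {}" "real (card (U - (A \<union> B))) \<le> 5 * \<beta> * card U"
    and A2: "\<forall>u\<in>A. \<forall>v\<in>A. w u v \<le> 2" and B2: "\<forall>u\<in>B. \<forall>v\<in>B. w u v \<le> 2"
  shows "(real (card A) - real (card B))\<^sup>2 + card {p\<in>A\<times>A. w (fst p) (snd p) \<noteq> 2}
     + card {p\<in>B\<times>B. w (fst p) (snd p) \<noteq> 2} + 2 * card {p\<in>A\<times>B. w (fst p) (snd p) \<noteq> 4} \<le> 41 * \<beta> * (card U)\<^sup>2"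
proof -
  define m where "m = real (card U)"
  define P where "P = U - (A \<union> B)"
  define a where "a = real (card A)"
  define b where "b = real (card B)"
  have fA: "finite A" and fB: "finite B" and fP: "finite P"
    using AB fin finite_subset by (auto simp: P_def)
  have cU: "m = a + b + card P"
  proof -
    have "U = (A \<union> B) \<union> P" using AB by (auto simp: P_def)
    then have "card U = card ((A \<union> B) \<union> P)" by simp
    also have "\<dots> = card A + card B + card P"
      using AB(3) fA fB fP by (subst card_Un_disjoint; simp add: card_Un_disjoint P_def)
    finally show ?thesis by (simp add: m_def a_def b_def)
  qed
  have P5: "real (card P) \<le> 5 * \<beta> * m" using AB(4) by (simp add: P_def m_def)
  have m0: "m \<ge> 0" by (simp add: m_def)
  have bnd: "real (\<Sum>u\<in>C. \<Sum>v\<in>D. w u v) \<le> real k * card C * card D - real (card {p\<in>C\<times>D. w (fst p) (snd p) \<noteq> k})"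
    if "\<forall>u\<in>C. \<forall>v\<in>D. w u v \<le> k" "finite C" "finite D" for C D and k :: nat
  proof -
    have "(\<Sum>u\<in>C. \<Sum>v\<in>D. real (w u v)) = (\<Sum>p\<in>C\<times>D. real (w (fst p) (snd p)))"
      by (simp add: sum.cartesian_product split_def)
    also have "\<dots> \<le> (\<Sum>p\<in>C\<times>D. real k - of_bool (w (fst p) (snd p) \<noteq> k))"
    proof (rule sum_mono)
      fix p assume "p \<in> C \<times> D"
      then have "w (fst p) (snd p) \<le> k" using that(1) by auto
      then show "real (w (fst p) (snd p)) \<le> real k - of_bool (w (fst p) (snd p) \<noteq> k)"
        by (auto simp: of_bool_def)
    qed
    also have "\<dots> = real k * card C * card D - real (card {p\<in>C\<times>D. w (fst p) (snd p) \<noteq> k})"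
      using that by (simp add: sum_subtractf card_filter_sum[of "C \<times> D"] card_cartesian_product del: sum_of_bool_eq)
    finally show ?thesis by simp
  qed
  have WU: "real (W U) \<le> real (W (A \<union> B)) + 8 * card P * m"
  proof -
    have "U - P = A \<union> B" using AB by (auto simp: P_def)
    then have W: "W U = W (A \<union> B) + 2 * (\<Sum>u\<in>A\<union>B. \<Sum>q\<in>P. w q u) + W P"
      using W_split[OF fin, of P] by (auto simp: P_def)
    have "(\<Sum>u\<in>A\<union>B. \<Sum>q\<in>P. w q u) \<le> (\<Sum>u\<in>A\<union>B. \<Sum>q\<in>P. 4)" by (intro sum_mono w_le)
    also have "\<dots> = 4 * card P * (card A + card B)" using fA fB AB(3) by (simp add: card_Un_disjoint)
    finally have 1: "(\<Sum>u\<in>A\<union>B. \<Sum>q\<in>P. w q u) \<le> 4 * card P * (card A + card B)" .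
    have "W P \<le> (\<Sum>u\<in>P. \<Sum>q\<in>P. 4)" unfolding W_def by (intro sum_mono w_le)
    then have 2: "W P \<le> 4 * card P * card P" by simp
    have "W U \<le> W (A \<union> B) + 8 * card P * (card A + card B) + 4 * card P * card P" using W 1 2 by linarith
    then have "real (W U) \<le> real (W (A \<union> B) + 8 * card P * (card A + card B) + 4 * card P * card P)"
      by (rule of_nat_mono)
    also have "\<dots> \<le> real (W (A \<union> B)) + 8 * card P * m"
      unfolding cU by (simp add: a_def b_def algebra_simps)
    finally show ?thesis .
  qed
  have "A \<union> B - B = A" using AB(3) by blast
  then have "W (A \<union> B) = W A + 2 * (\<Sum>u\<in>A. \<Sum>q\<in>B. w u q) + W B"
    using W_split[of "A \<union> B" B] fA fB by (simp add: w_sym)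
  then have "real (W (A \<union> B)) = real (\<Sum>u\<in>A. \<Sum>v\<in>A. w u v) + 2 * real (\<Sum>u\<in>A. \<Sum>v\<in>B. w u v) + real (\<Sum>u\<in>B. \<Sum>v\<in>B. w u v)"
    by (simp add: W_def)
  also have "\<dots> \<le> (2 * a * a - card {p\<in>A\<times>A. w (fst p) (snd p) \<noteq> 2}) + 2 * (4 * a * b - card {p\<in>A\<times>B. w (fst p) (snd p) \<noteq> 4})
     + (2 * b * b - card {p\<in>B\<times>B. w (fst p) (snd p) \<noteq> 2})"
    using bnd[of A A 2] bnd[of A B 4] bnd[of B B 2] A2 B2 fA fB w_le by (simp add: a_def b_def)
  finally have WAB: "real (W (A \<union> B)) \<le> \<dots>" .
  have "(\<Sum>a\<in>U. (3 - \<beta>) * m) \<le> (\<Sum>a\<in>U. real (\<Sum>u\<in>U. w a u))" using deg by (intro sum_mono) (simp add: m_def)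
  then have "(3 - \<beta>) * m * m \<le> real (W U)" by (simp add: W_def m_def algebra_simps)
  moreover have "8 * card P * m \<le> 8 * (5 * \<beta> * m) * m" using P5 m0 by (intro mult_right_mono) auto
  ultimately have "(3 - \<beta>) * m * m - 40 * \<beta> * m * m \<le> real (W (A \<union> B))" using WU by (simp add: algebra_simps)
  moreover have "2 * a * a + 8 * a * b + 2 * b * b + (a - b)\<^sup>2 \<le> 3 * m * m"
  proof -
    have "2 * a * a + 8 * a * b + 2 * b * b + (a - b)\<^sup>2 = 3 * ((a + b) * (a + b))"
      by (simp add: power2_eq_square algebra_simps)
    also have "(a + b) * (a + b) \<le> m * m" using cU by (intro mult_mono) (auto simp: a_def b_def)
    finally show ?thesis by simp
  qed
  ultimately show ?thesis using WAB unfolding a_def[symmetric] b_def[symmetric] of_nat_power m_def[symmetric]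
    by (simp add: power2_eq_square algebra_simps)
qed

text \<open>When all cross pairs are full, an inner pair of \<open>A\<close> and one of
  \<open>B\<close> carry complementary 2-subsets of \<open>X\<close>. Hence a label \<open>i\<close>
  lies on nearly all inner pairs of one class and on almost none of the other; \<open>T\<close> is
  the class that it avoids. In a bipartite 3-graph this is the class containing
  \<open>i\<close>.\<close>

lemma link_of_min_degree:
  fixes \<beta> :: real
  assumes fin: "finite U" and ne: "U \<noteq> {}" and \<beta>: "0 < \<beta>" "\<beta> \<le> 1/10000"
    and deg: "\<And>a. a \<in> U \<Longrightarrow> (3 - \<beta>) * card U \<le> (\<Sum>u\<in>U. w a u)"
    and i: "i \<in> X"
  shows "\<exists>T\<subseteq>U. real (card {p\<in>U\<times>U. (i \<in> S (fst p) (snd p)) = (fst p \<in> T \<and> snd p \<in> T)}) \<le> 2000 * \<beta> * (card U)\<^sup>2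
     \<and> (real (card T) - card U / 2)\<^sup>2 \<le> 25 * \<beta> * (card U)\<^sup>2"
proof -
  have "\<beta> < 1/6" using \<beta> by simp
  from bipartition_of_min_degree[OF fin ne \<beta>(1) this deg] obtain A B where
    AB: "A \<subseteq> U" "B \<subseteq> U" "A \<inter> B = {}" "real (card (U - (A \<union> B))) \<le> 5 * \<beta> * card U"
    and A2: "\<forall>u\<in>A. \<forall>v\<in>A. w u v \<le> 2" and B2: "\<forall>u\<in>B. \<forall>v\<in>B. w u v \<le> 2" by blast
  define m where "m = real (card U)"
  have m0: "m > 0" using fin ne by (simp add: m_def card_gt_0_iff)
  define P where "P = U - (A \<union> B)"
  have fA: "finite A" and fB: "finite B" and fP: "finite P"
    using AB fin finite_subset by (auto simp: P_def)
  define NA where "NA = {p\<in>A\<times>A. w (fst p) (snd p) \<noteq> 2}"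
  define NB where "NB = {p\<in>B\<times>B. w (fst p) (snd p) \<noteq> 2}"
  define NAB where "NAB = {p\<in>A\<times>B. w (fst p) (snd p) \<noteq> 4}"
  have fN: "finite NA" "finite NB" "finite NAB" using fA fB by (auto simp: NA_def NB_def NAB_def)
  define a where "a = real (card A)"
  define b where "b = real (card B)"
  have def: "(a - b)\<^sup>2 + card NA + card NB + 2 * card NAB \<le> 41 * \<beta> * m\<^sup>2"
    using defect_bound[OF fin \<beta>(1) deg AB A2 B2] by (simp add: m_def a_def b_def NA_def NB_def NAB_def)
  have P5: "real (card P) \<le> 5 * \<beta> * m" using AB(4) by (simp add: P_def m_def)
  have cU: "m = a + b + card P"
  proof -
    have "U = (A \<union> B) \<union> P" using AB by (auto simp: P_def)
    then have "card U = card ((A \<union> B) \<union> P)" by simp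
    also have "\<dots> = card A + card B + card P"
      using AB(3) fA fB fP by (subst card_Un_disjoint; simp add: card_Un_disjoint P_def)
    finally show ?thesis by (simp add: m_def a_def b_def)
  qed
  have a0: "a \<ge> 0" "b \<ge> 0" by (simp_all add: a_def b_def)
  have ab: "a \<le> m" "b \<le> m" using cU a0 by auto
  have diff: "\<bar>a - b\<bar> \<le> m / 15"
  proof (rule power2_le_imp_le)
    have "\<bar>a - b\<bar>\<^sup>2 \<le> 41 * \<beta> * m\<^sup>2" using def by (simp add: power2_abs)
    also have "\<dots> \<le> 41 * (1/10000) * m\<^sup>2" using \<beta> by (intro mult_right_mono) auto
    also have "\<dots> \<le> (m/15)\<^sup>2" by (simp add: power2_eq_square)
    finally show "\<bar>a - b\<bar>\<^sup>2 \<le> (m/15)\<^sup>2" .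
  qed (use m0 in simp)
  have "5 * \<beta> * m \<le> m / 2000" using \<beta> m0 by simp
  then have ge: "a \<ge> 9/20 * m" "b \<ge> 9/20 * m" using diff cU P5 m0 by linarith+
  have a2: "a * a \<ge> m\<^sup>2 / 5" and b2: "b * b \<ge> m\<^sup>2 / 5"
  proof -
    have "(9/20 * m) * (9/20 * m) \<le> a * a" "(9/20 * m) * (9/20 * m) \<le> b * b"
      using ge m0 by (intro mult_mono; simp)+
    moreover have "m\<^sup>2 / 5 \<le> (9/20 * m) * (9/20 * m)" by (simp add: power2_eq_square)
    ultimately show "a * a \<ge> m\<^sup>2 / 5" "b * b \<ge> m\<^sup>2 / 5" by linarith+
  qed
  have sz: "(a - m / 2)\<^sup>2 \<le> 25 * \<beta> * m\<^sup>2 \<and> (b - m / 2)\<^sup>2 \<le> 25 * \<beta> * m\<^sup>2"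
  proof -
    have c: "real (card P) \<ge> 0" by simp
    have c2: "(real (card P))\<^sup>2 \<le> 25 * \<beta> * \<beta> * m\<^sup>2"
      using power_mono[OF P5 c, of 2] by (simp add: power2_eq_square algebra_simps)
    moreover have "25 * \<beta> * \<beta> * m\<^sup>2 \<le> 25 * \<beta> * (1/10000) * m\<^sup>2" using \<beta> by (intro mult_right_mono mult_left_mono) auto
    moreover have "25 * \<beta> * (1/10000) * m\<^sup>2 \<le> \<beta> * m\<^sup>2" using \<beta> by simp
    ultimately have c3: "(real (card P))\<^sup>2 \<le> \<beta> * m\<^sup>2" by linarith
    have d: "(a - b)\<^sup>2 \<le> 41 * \<beta> * m\<^sup>2" using def by simp
    have q: "(x / 2 - y / 2)\<^sup>2 \<le> x\<^sup>2 / 2 + y\<^sup>2 / 2" for x y :: real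
    proof -
      have "0 \<le> (x + y)\<^sup>2" by simp
      then show ?thesis by (simp add: power2_eq_square field_simps)
    qed
    have "a - m / 2 = (a - b) / 2 - card P / 2" "b - m / 2 = (b - a) / 2 - card P / 2" using cU by (simp_all add: field_simps)
    then have "(a - m/2)\<^sup>2 \<le> (a - b)\<^sup>2 / 2 + (real (card P))\<^sup>2 / 2" "(b - m/2)\<^sup>2 \<le> (b - a)\<^sup>2 / 2 + (real (card P))\<^sup>2 / 2"
      using q by metis+
    moreover have "(b - a)\<^sup>2 = (a - b)\<^sup>2" by (simp add: power2_commute)
    moreover have "0 \<le> \<beta> * m\<^sup>2" using \<beta> by simp
    ultimately show ?thesis using c3 d by (intro conjI) linarith+
  qed
  define Q where "Q = (\<lambda>C t. {p\<in>C\<times>C. (i \<in> S (fst p) (snd p)) = t})"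
  have fQ: "finite (Q C t)" if "finite C" for C t using that by (simp add: Q_def)
  have Qsum: "real (card (Q C True)) + real (card (Q C False)) = card C * card C" if "finite C" for C
  proof -
    have "card (Q C True \<union> Q C False) = card (Q C True) + card (Q C False)"
    proof (rule card_Un_disjoint)
      show "Q C True \<inter> Q C False = {}" by (auto simp: Q_def)
    qed (rule fQ[OF that])+
    moreover have "Q C True \<union> Q C False = C \<times> C" by (auto simp: Q_def)
    ultimately show ?thesis by (simp add: card_cartesian_product flip: of_nat_add of_nat_mult)
  qed
  \<comment> \<open>Couples of inner pairs, one per class, on which \<open>i\<close> behaves alike.
    Each contains a deviating inner pair or a deviating one among its four cross pairs;
    \<open>f\<close> and \<open>g\<close> rebuild the couple from two disjoint cross pairs, taken
    straight or crossed.\<close>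
  have prod: "real (card (Q A True)) * card (Q B True) + real (card (Q A False)) * card (Q B False) \<le> 82 * \<beta> * m^4"
  proof -
    define f where "f = (\<lambda>(p :: 'v \<times> 'v, q :: 'v \<times> 'v). ((fst p, fst q), (snd p, snd q)))"
    define g where "g = (\<lambda>(p :: 'v \<times> 'v, q :: 'v \<times> 'v). ((fst p, fst q), (snd q, snd p)))"
    define Bad where "Bad = NA \<times> (B \<times> B) \<union> (A \<times> A) \<times> NB \<union> (f ` (NAB \<times> (A \<times> B)) \<union> f ` ((A\<times>B) \<times> NAB) \<union>
       (g ` (NAB \<times> (A \<times> B)) \<union> g ` ((A\<times>B)\<times> NAB)))"
    let ?E = "Q A True \<times> Q B True \<union> Q A False \<times> Q B False"
    have key: "w u v \<noteq> 2 \<or> w x y \<noteq> 2"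
      if w4: "w u x = 4" "w u y = 4" "w v x = 4" "w v y = 4" and t: "(i \<in> S u v) = (i \<in> S x y)" for u v x y
    proof (rule ccontr)
      assume "\<not> ?thesis"
      then have w2: "w u v = 2" "w x y = 2" by simp_all
      \<comment> \<open>A label common to both inner pairs, together with any two further labels on
        the full cross pairs, is a forbidden factor.\<close>
      have disj: "S u v \<inter> S x y = {}"
      proof (rule ccontr)
        assume "S u v \<inter> S x y \<noteq> {}"
        then obtain l where l: "l \<in> S u v" "l \<in> S x y" by blast
        then have lX: "l \<in> X" using S_sub by blast
        have "card (X - {l}) = 3" using lX card_X fin_X by simp
        then obtain j k n where jkn: "X - {l} = {j,k,n}" "j \<noteq> k" unfolding card_3_iff by blast
        then have "j \<in> X - {l}" "k \<in> X - {l}" by simp_all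
        then have "j \<in> X" "k \<in> X" "j \<noteq> l" "k \<noteq> l" by simp_all
        then show False using no_factor[of l u v x y j k] l S_full[OF w4(1)] S_full[OF w4(2)]
            S_full[OF w4(3)] S_full[OF w4(4)] jkn(2) by simp
      qed
      have "card (S u v \<union> S x y) = 4" using card_Un_disjoint[OF fin_S fin_S disj] w2 by simp
      moreover have "S u v \<union> S x y \<subseteq> X" using S_sub by (simp add: Un_least)
      ultimately have "S u v \<union> S x y = X" using card_X fin_X by (simp add: card_subset_eq)
      then show False using t disj i by blast
    qed
    have fg: "((u,v),(x,y)) = f ((u,x),(v,y))" "((u,v),(x,y)) = g ((u,y),(v,x))" for u v x y by (auto simp: f_def g_def)
    have im: "((u,v),(x,y)) \<in> Bad" if m: "u \<in> A" "v \<in> A" "x \<in> B" "y \<in> B"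
      and "(u,x) \<in> NAB \<or> (u,y) \<in> NAB \<or> (v,x) \<in> NAB \<or> (v,y) \<in> NAB" for u v x y
    proof -
      from that(5) consider "(u,x) \<in> NAB" | "(u,y) \<in> NAB" | "(v,x) \<in> NAB" | "(v,y) \<in> NAB" by blast
      then show ?thesis
      proof cases
        case 1
        then have "((u,v),(x,y)) \<in> f ` (NAB \<times> (A \<times> B))" using m by (intro image_eqI[of _ _ "((u,x),(v,y))"] fg(1)) auto
        then show ?thesis by (simp add: Bad_def)
      next
        case 2
        then have "((u,v),(x,y)) \<in> g ` (NAB \<times> (A \<times> B))" using m by (intro image_eqI[of _ _ "((u,y),(v,x))"] fg(2)) auto
        then show ?thesis by (simp add: Bad_def)
      next
        case 3
        then have "((u,v),(x,y)) \<in> g ` ((A \<times> B) \<times> NAB)" using m by (intro image_eqI[of _ _ "((u,y),(v,x))"] fg(2)) auto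
        then show ?thesis by (simp add: Bad_def)
      next
        case 4
        then have "((u,v),(x,y)) \<in> f ` ((A \<times> B) \<times> NAB)" using m by (intro image_eqI[of _ _ "((u,x),(v,y))"] fg(1)) auto
        then show ?thesis by (simp add: Bad_def)
      qed
    qed
    have E: "?E \<subseteq> Bad"
    proof
      fix e assume e: "e \<in> ?E"
      obtain u v x y where euv: "e = ((u,v),(x,y))" by (metis surj_pair)
      have m: "u \<in> A" "v \<in> A" "x \<in> B" "y \<in> B" and t: "(i \<in> S u v) = (i \<in> S x y)"
        using e euv by (auto simp: Q_def)
      show "e \<in> Bad"
      proof (cases "(u,x) \<in> NAB \<or> (u,y) \<in> NAB \<or> (v,x) \<in> NAB \<or> (v,y) \<in> NAB")
        case True
        then show ?thesis using im m euv by simp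
      next
        case False
        then have "w u x = 4" "w u y = 4" "w v x = 4" "w v y = 4" using m by (simp_all add: NAB_def)
        from key[OF this t] show ?thesis using m euv by (auto simp: Bad_def NA_def NB_def)
      qed
    qed
    have finBad: "finite Bad" using fN fA fB by (simp add: Bad_def)
    have ci: "card (h ` (C \<times> D)) \<le> card C * card D" if "finite C" "finite D" for h :: "('v \<times> 'v) \<times> ('v \<times> 'v) \<Rightarrow> ('v \<times> 'v) \<times> ('v \<times> 'v)" and C D
      using card_image_le[of "C \<times> D" h] that by (simp add: card_cartesian_product)
    have un: "card (C \<union> D) \<le> c + d" if "card C \<le> c" "card D \<le> d" for C D :: "(('v \<times> 'v) \<times> ('v \<times> 'v)) set" and c d
      using card_Un_le[of C D] that by linarith
    have "card Bad \<le> (card NA * (card B * card B) + card A * card A * card NB) + ((card NAB * (card A * card B) + card A * card B * card NAB)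
       + (card NAB * (card A * card B) + card A * card B * card NAB))"
      unfolding Bad_def
      by (intro un ci[THEN order_trans]) (use fN fA fB in \<open>simp_all add: card_cartesian_product\<close>)
    then have "card ?E \<le> card NA * (card B * card B) + card A * card A * card NB + 4 * (card NAB * (card A * card B))"
      using card_mono[OF finBad E] by (simp add: mult_ac)
    moreover have "card ?E = card (Q A True) * card (Q B True) + card (Q A False) * card (Q B False)"
      by (subst card_Un_disjoint) (use fQ fA fB in \<open>auto simp: card_cartesian_product Q_def\<close>)
    ultimately have "real (card (Q A True) * card (Q B True) + card (Q A False) * card (Q B False))
      \<le> real (card NA * (card B * card B) + card A * card A * card NB + 4 * (card NAB * (card A * card B)))"
      by (simp only: of_nat_mono)
    then have "real (card (Q A True)) * card (Q B True) + real (card (Q A False)) * card (Q B False)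
      \<le> card NA * (b * b) + card NB * (a * a) + 4 * (card NAB * (a * b))"
      by (simp add: a_def b_def mult_ac)
    also have "\<dots> \<le> card NA * (m * m) + card NB * (m * m) + 4 * (card NAB * (m * m))"
      using ab a0 m0 by (intro add_mono mult_left_mono mult_mono) auto
    also have "\<dots> = (card NA + card NB + 4 * card NAB) * m\<^sup>2" by (simp add: power2_eq_square algebra_simps)
    also have "\<dots> \<le> (2 * (41 * \<beta> * m\<^sup>2)) * m\<^sup>2"
    proof (rule mult_right_mono)
      have "0 \<le> (a - b)\<^sup>2" by simp
      then show "real (card NA + card NB + 4 * card NAB) \<le> 2 * (41 * \<beta> * m\<^sup>2)" using def by linarith
    qed simp
    also have "\<dots> = 82 * \<beta> * m^4" by (simp add: power2_eq_square power4_eq_xxxx)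
    finally show ?thesis .
  qed
  have final: "\<exists>T\<subseteq>U. real (card {p\<in>U\<times>U. (i \<in> S (fst p) (snd p)) = (fst p \<in> T \<and> snd p \<in> T)}) \<le> 2000 * \<beta> * (card U)\<^sup>2
     \<and> (real (card T) - card U / 2)\<^sup>2 \<le> 25 * \<beta> * (card U)\<^sup>2"
    if C: "C = A \<and> D = B \<or> C = B \<and> D = A" and half: "real (card (Q C True)) \<le> card C * card C / 2" for C D
  proof -
    have fC: "finite C" "finite D" and sz2: "real (card C * card C) \<ge> m\<^sup>2 / 5" "real (card D * card D) \<ge> m\<^sup>2 / 5"
      using C fA fB a2 b2 by (auto simp: a_def b_def)
    have prod': "real (card (Q C True)) * card (Q D True) + real (card (Q C False)) * card (Q D False) \<le> 82 * \<beta> * m^4"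
      using C prod by (auto simp: mult.commute)
    have n0: "real (card (Q C False)) \<ge> m\<^sup>2 / 10" using Qsum[OF fC(1)] half sz2 by linarith
    \<comment> \<open>\<open>prod\<close> bounds products, so one factor of order \<open>m^2\<close>
      bounds the other: first the pairs of \<open>D\<close> lacking \<open>i\<close> are few, then
      \<open>D\<close> has many pairs with \<open>i\<close>, and this bounds the pairs of
      \<open>C\<close> carrying \<open>i\<close>.\<close>
    have div: "x \<le> 820 * \<beta> * m\<^sup>2" if "y \<ge> m\<^sup>2 / 10" "x * y \<le> 82 * \<beta> * m^4" "x \<ge> 0" for x y
    proof -
      have "x * (m\<^sup>2 / 10) \<le> x * y" using that by (intro mult_left_mono) auto
      then have "x * m\<^sup>2 \<le> (820 * \<beta> * m\<^sup>2) * m\<^sup>2" using that by (simp add: power2_eq_square power4_eq_xxxx)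
      then show ?thesis using m0 by simp
    qed
    have qD: "real (card (Q D False)) \<le> 820 * \<beta> * m\<^sup>2"
    proof (rule div[OF n0])
      have "0 \<le> real (card (Q C True)) * card (Q D True)" by simp
      then show "real (card (Q D False)) * real (card (Q C False)) \<le> 82 * \<beta> * m ^ 4"
        using prod' by (subst mult.commute) linarith
    qed simp
    have "820 * \<beta> * m\<^sup>2 \<le> m\<^sup>2 / 10" using \<beta> mult_right_mono[of "820 * \<beta>" "1/10" "m\<^sup>2"] by simp
    then have "real (card (Q D True)) \<ge> m\<^sup>2 / 10" using Qsum[OF fC(2)] qD sz2 by linarith
    then have pC: "real (card (Q C True)) \<le> 820 * \<beta> * m\<^sup>2"
    proof (rule div)
      have "0 \<le> real (card (Q C False)) * card (Q D False)" by simp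
      then show "real (card (Q C True)) * real (card (Q D True)) \<le> 82 * \<beta> * m ^ 4"
        using prod' by linarith
    qed simp
    let ?E = "{p\<in>U\<times>U. (i \<in> S (fst p) (snd p)) = (fst p \<in> C \<and> snd p \<in> C)}"
    have "?E \<subseteq> (Q C True \<union> Q D False) \<union> (NAB \<union> prod.swap ` NAB) \<union> (P \<times> U \<union> U \<times> P)"
    proof
      fix p assume p: "p \<in> ?E"
      obtain u v where uv: "p = (u,v)" by (cases p)
      have U: "u \<in> A \<or> u \<in> B \<or> u \<in> P" "v \<in> A \<or> v \<in> B \<or> v \<in> P" using p uv by (auto simp: P_def)
      have full: "i \<in> S x y" if "x \<in> A" "y \<in> B" "(x,y) \<notin> NAB" for x y
      proof -
        have "w x y = 4" using that by (auto simp: NAB_def)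
        then show ?thesis using i S_full by simp
      qed
      show "p \<in> (Q C True \<union> Q D False) \<union> (NAB \<union> prod.swap ` NAB) \<union> (P \<times> U \<union> U \<times> P)"
      proof (cases "u \<in> P \<or> v \<in> P")
        case True then show ?thesis using p uv by auto
      next
        case False
        show ?thesis
        proof (cases "u \<in> A \<and> v \<in> B \<or> u \<in> B \<and> v \<in> A")
          case True
          then have "\<not> (u \<in> C \<and> v \<in> C)" using C AB(3) by blast
          then have "i \<notin> S u v" using p uv by simp
          then have "(u,v) \<in> NAB \<or> (v,u) \<in> NAB" using True full S_sym by blast
          moreover have "(u,v) = prod.swap (v,u)" by simp
          ultimately have "(u,v) \<in> NAB \<union> prod.swap ` NAB" by blast
          then show ?thesis using uv by blast
        next
          case F2: False
          then have "u \<in> C \<and> v \<in> C \<or> u \<in> D \<and> v \<in> D \<and> u \<notin> C" using False U C AB(3) by blast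
          then show ?thesis using p uv by (auto simp: Q_def)
        qed
      qed
    qed
    then have "card ?E \<le> card ((Q C True \<union> Q D False) \<union> (NAB \<union> prod.swap ` NAB) \<union> (P \<times> U \<union> U \<times> P))"
      by (rule card_mono[rotated]) (use fQ fC fN fP fin in simp)
    also have "\<dots> \<le> (card (Q C True) + card (Q D False)) + (card NAB + card NAB) + (card P * card U + card U * card P)"
      by (intro order_trans[OF card_Un_le] add_mono) (use card_image_le[OF fN(3)] in \<open>auto simp: card_cartesian_product\<close>)
    finally have "real (card ?E) \<le> real ((card (Q C True) + card (Q D False)) + (card NAB + card NAB) + (card P * card U + card U * card P))"
      by (rule of_nat_mono)
    also have "\<dots> = card (Q C True) + card (Q D False) + 2 * card NAB + 2 * (card P * m)" by (simp add: m_def)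
    also have "\<dots> \<le> 820 * \<beta> * m\<^sup>2 + 820 * \<beta> * m\<^sup>2 + 41 * \<beta> * m\<^sup>2 + 2 * ((5 * \<beta> * m) * m)"
    proof -
      have "0 \<le> (a - b)\<^sup>2" by simp
      then have "2 * real (card NAB) \<le> 41 * \<beta> * m\<^sup>2" using def by linarith
      moreover have "card P * m \<le> (5 * \<beta> * m) * m" using P5 m0 by (intro mult_right_mono) auto
      ultimately show ?thesis using pC qD by linarith
    qed
    also have "\<dots> \<le> 2000 * \<beta> * m\<^sup>2" using \<beta> m0 by (simp add: power2_eq_square)
    finally have 1: "real (card ?E) \<le> 2000 * \<beta> * m\<^sup>2" .
    have "(real (card C) - m / 2)\<^sup>2 \<le> 25 * \<beta> * m\<^sup>2" using sz C by (auto simp: a_def b_def)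
    moreover have "C \<subseteq> U" using C AB by blast
    ultimately show ?thesis using 1 by (intro exI[of _ C]) (simp add: m_def)
  qed
  show ?thesis
  proof (cases "real (card (Q A True)) \<le> card A * card A / 2")
    case True
    then show ?thesis using final[of A B] by blast
  next
    case False
    have "real (card (Q B True)) \<le> card B * card B / 2"
    proof (rule ccontr)
      assume n: "\<not> ?thesis"
      have "m\<^sup>2 / 10 \<le> card (Q A True)" "m\<^sup>2 / 10 \<le> card (Q B True)"
        using False n a2 b2 by (auto simp: a_def b_def)
      then have "(m\<^sup>2 / 10) * (m\<^sup>2 / 10) \<le> real (card (Q A True)) * card (Q B True)"
        by (intro mult_mono) auto
      also have "\<dots> \<le> 82 * \<beta> * m^4"
      proof -
        have "0 \<le> real (card (Q A False)) * card (Q B False)" by simp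
        then show ?thesis using prod by linarith
      qed
      also have "\<dots> \<le> 82 * (1/10000) * m^4" using \<beta> by (intro mult_right_mono) auto
      finally show False using m0 by (simp add: power2_eq_square power4_eq_xxxx)
    qed
    then show ?thesis using final[of B A] by blast
  qed
qed

end

section \<open>Stability of dense Fano-free 3-graphs\<close>

lemma sum_of_bool_filter:
  "finite A \<Longrightarrow> (\<Sum>x\<in>A. of_bool (P x)) = card {x\<in>A. P x}"
proof -
  assume "finite A"
  moreover have "{x\<in>A. P x} = A \<inter> Collect P" by blast
  ultimately show ?thesis by simp
qed

text \<open>The plane is presented as an edge \<open>xyz\<close> whose vertices have in their links
  the three perfect matchings of \<open>a, b, c, d\<close>. Any two points of the plane share a
  line, so distinctness within edges makes all seven points distinct. Counts run over ordered
  triples.\<close>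

locale fano_free =
  fixes R :: "'v \<Rightarrow> 'v \<Rightarrow> 'v \<Rightarrow> bool"
  assumes swap1: "R x y z \<Longrightarrow> R y x z"
    and swap2: "R x y z \<Longrightarrow> R x z y"
    and distinct12: "R x y z \<Longrightarrow> x \<noteq> y"
    and no_fano: "\<not> (R x y z \<and> R x a b \<and> R x c d \<and> R y a c \<and> R y b d \<and> R z a d \<and> R z b c)"
begin

lemma distinct3: assumes "R x y z" shows "x \<noteq> y" "y \<noteq> z" "x \<noteq> z"
  using assms distinct12 swap1 swap2 by blast+

lemma perms:
  "R x y z = R y x z" "R x y z = R x z y" "R x y z = R z y x" "R x y z = R y z x" "R x y z = R z x y"
proof -
  have 1: "R x y z = R y x z" for x y z using swap1 by blast
  have 2: "R x y z = R x z y" for x y z using swap2 by blast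
  show "R x y z = R y x z" "R x y z = R x z y" "R x y z = R z y x" "R x y z = R y z x" "R x y z = R z x y"
    using 1[of x y z] 2[of x y z] 1[of x z y] 2[of z x y] 2[of y x z] by simp_all
qed

definition E :: "'v set \<Rightarrow> nat" where
  "E U = (\<Sum>u\<in>U. \<Sum>v\<in>U. \<Sum>w\<in>U. of_bool (R u v w))"

definition D :: "'v set \<Rightarrow> 'v \<Rightarrow> nat" where
  "D U x = (\<Sum>v\<in>U. \<Sum>w\<in>U. of_bool (R x v w))"

lemma E_eq_sum_D: "E U = (\<Sum>x\<in>U. D U x)"
  by (simp add: E_def D_def)

definition K4 :: "'v \<Rightarrow> 'v \<Rightarrow> 'v \<Rightarrow> 'v \<Rightarrow> bool" where
  "K4 a b c d \<longleftrightarrow> R a b c \<and> R a b d \<and> R a c d \<and> R b c d"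

lemma card_K4: "K4 a b c d \<Longrightarrow> card {a,b,c,d} = 4"
proof -
  assume "K4 a b c d"
  then have "R a b c" "R a b d" "R a c d" by (auto simp: K4_def)
  from distinct3[OF this(1)] distinct3[OF this(2)] distinct3[OF this(3)] show ?thesis by simp
qed

text \<open>For distinct labels \<open>i, j, k\<close> the complete 4-set itself contains the edge
  \<open>ijk\<close> that closes the Fano plane; hence \<open>no_factor\<close>.\<close>

lemma four_links_K4:
  assumes "K4 x1 x2 x3 x4"
  shows "four_links (\<lambda>u v. {x\<in>{x1,x2,x3,x4}. R x u v}) {x1,x2,x3,x4}"
proof
  show "card {x1,x2,x3,x4} = 4" using card_K4[OF assms] .
  show "{x \<in> {x1, x2, x3, x4}. R x u v} \<subseteq> {x1, x2, x3, x4}" for u v by blast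
  show "{x \<in> {x1, x2, x3, x4}. R x u v} = {x \<in> {x1, x2, x3, x4}. R x v u}" for u v using perms(2) by blast
  show "{x \<in> {x1, x2, x3, x4}. R x u u} = {}" for u using distinct3 by blast
  fix i j k a b c d
  assume h: "i \<in> {x \<in> {x1, x2, x3, x4}. R x a b}" "i \<in> {x \<in> {x1, x2, x3, x4}. R x c d}"
       "j \<in> {x \<in> {x1, x2, x3, x4}. R x a c}" "j \<in> {x \<in> {x1, x2, x3, x4}. R x b d}"
       "k \<in> {x \<in> {x1, x2, x3, x4}. R x a d}" "k \<in> {x \<in> {x1, x2, x3, x4}. R x b c}"
  show "i = j \<or> j = k \<or> i = k"
  proof (rule ccontr)
    assume d: "\<not> ?thesis"
    have m: "i \<in> {x1,x2,x3,x4}" "j \<in> {x1,x2,x3,x4}" "k \<in> {x1,x2,x3,x4}" using h by blast+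
    have r: "R x1 x2 x3" "R x1 x2 x4" "R x1 x3 x4" "R x2 x3 x4" using assms by (auto simp: K4_def)
    have ap: "R q p s \<and> R p s q \<and> R s q p \<and> R q s p \<and> R s p q" if "R p q s" for p q s
      using that perms[of p q s] by simp
    note a = r ap[OF r(1)] ap[OF r(2)] ap[OF r(3)] ap[OF r(4)]
    have "R i j k" using m d by (elim insertE emptyE) (simp_all add: a)
    moreover have "R i a b" "R i c d" "R j a c" "R j b d" "R k a d" "R k b c" using h by simp_all
    ultimately show False using no_fano by metis
  qed
qed

lemma sum_D_K4:
  assumes "K4 x1 x2 x3 x4" "finite U"
  shows "(\<Sum>u\<in>U. \<Sum>v\<in>U. card {x\<in>{x1,x2,x3,x4}. R x u v}) = (\<Sum>x\<in>{x1,x2,x3,x4}. D U x)"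
proof -
  let ?X = "{x1,x2,x3,x4}"
  have "card {x\<in>?X. R x u v} = (\<Sum>x\<in>?X. of_bool (R x u v))" for u v
    by (rule sum_of_bool_filter[symmetric]) simp
  then have "(\<Sum>u\<in>U. \<Sum>v\<in>U. card {x\<in>?X. R x u v}) = (\<Sum>u\<in>U. \<Sum>v\<in>U. \<Sum>x\<in>?X. of_bool (R x u v))" by simp
  also have "\<dots> = (\<Sum>u\<in>U. \<Sum>x\<in>?X. \<Sum>v\<in>U. of_bool (R x u v))" by (intro sum.cong refl sum.swap)
  also have "\<dots> = (\<Sum>x\<in>?X. \<Sum>u\<in>U. \<Sum>v\<in>U. of_bool (R x u v))" by (rule sum.swap)
  finally show ?thesis by (simp add: D_def)
qed

lemma E_split:
  assumes "finite U" "X \<subseteq> U"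
  shows "E U = E (U - X) + 3 * (\<Sum>x\<in>X. D (U - X) x) + 3 * (\<Sum>u\<in>U-X. \<Sum>x\<in>X. \<Sum>y\<in>X. of_bool (R u x y)) + E X"
proof -
  define K where "K = U - X"
  have s: "sum f U = sum f K + sum f X" for f :: "'v \<Rightarrow> nat"
    using assms by (simp add: sum.subset_diff K_def)
  let ?T = "\<lambda>P Q S. \<Sum>u\<in>P. \<Sum>v\<in>Q. \<Sum>w\<in>S. (of_bool (R u v w) :: nat)"
  have 0: "E U = ?T K K K + ?T K K X + ?T K X K + ?T K X X + (?T X K K + ?T X K X + ?T X X K + ?T X X X)"
    unfolding E_def s by (simp only: sum.distrib add.assoc)
  have KX: "?T P Q S = ?T P S Q" for P Q S
  proof (rule sum.cong[OF refl])
    fix u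
    have "(\<Sum>v\<in>Q. \<Sum>w\<in>S. (of_bool (R u v w) :: nat)) = (\<Sum>w\<in>S. \<Sum>v\<in>Q. of_bool (R u v w))" by (rule sum.swap)
    also have "\<dots> = (\<Sum>w\<in>S. \<Sum>v\<in>Q. of_bool (R u w v))" by (simp only: perms(2))
    finally show "(\<Sum>v\<in>Q. \<Sum>w\<in>S. (of_bool (R u v w) :: nat)) = (\<Sum>w\<in>S. \<Sum>v\<in>Q. of_bool (R u w v))" .
  qed
  have sw: "?T P Q S = ?T Q P S" for P Q S
  proof -
    have "?T P Q S = (\<Sum>v\<in>Q. \<Sum>u\<in>P. \<Sum>w\<in>S. (of_bool (R u v w) :: nat))" by (rule sum.swap)
    also have "\<dots> = ?T Q P S" by (intro sum.cong refl) (simp only: perms(1))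
    finally show ?thesis .
  qed
  have D: "(\<Sum>x\<in>X. D K x) = ?T X K K" by (simp only: D_def)
  show ?thesis unfolding K_def[symmetric] D
    using 0 sw[where P=K and Q=X and S=K] KX[where P=K and Q=K and S=X]
      sw[where P=X and Q=K and S=X] KX[where P=X and Q=X and S=K] unfolding E_def by linarith
qed

text \<open>Induction by deleting a complete 4-set: the triples with one vertex in it are counted by
  its four links, which \<open>W_le\<close> bounds, and the resulting cubic is exactly
  \<open>3 * (k + 4)^3\<close>. Without a complete 4-set, every 4-tuple has at most three of its
  four triples, and averaging gives 3/4.\<close>

lemma E_le:
  assumes "finite U"
  shows "4 * E U \<le> 3 * (card U)^3"
  using assms
proof (induction "card U" arbitrary: U rule: less_induct)
  case less
  note fin = less.prems
  show ?case
  proof (cases "\<exists>a\<in>U. \<exists>b\<in>U. \<exists>c\<in>U. \<exists>d\<in>U. K4 a b c d")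
    case True
    then obtain a b c d where K: "a \<in> U" "b \<in> U" "c \<in> U" "d \<in> U" "K4 a b c d" by blast
    define X where "X = {a,b,c,d}"
    have X: "X \<subseteq> U" "card X = 4" "finite X" using K card_K4 by (auto simp: X_def)
    define k where "k = card (U - X)"
    have cU: "card U = k + 4"
      using X fin card_mono[OF fin X(1)] by (simp add: k_def card_Diff_subset)
    have IH: "4 * E (U - X) \<le> 3 * k^3" using less.hyps[of "U - X"] fin cU by (simp add: k_def)
    interpret F: four_links "\<lambda>u v. {x\<in>X. R x u v}" X
      unfolding X_def by (rule four_links_K4[OF K(5)])
    have "(\<Sum>x\<in>X. D (U - X) x) = F.W (U - X)"
      unfolding F.W_def using sum_D_K4[OF K(5), of "U - X", folded X_def] fin by simp
    then have 1: "(\<Sum>x\<in>X. D (U - X) x) \<le> 3 * k\<^sup>2" using F.W_le[of "U - X"] fin by (simp add: k_def)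
    have 2: "(\<Sum>x\<in>X. \<Sum>y\<in>X. of_bool (R u x y)) \<le> (12::nat)" for u
    proof -
      have "(\<Sum>x\<in>X. \<Sum>y\<in>X. of_bool (R u x y)) \<le> (\<Sum>x\<in>X. \<Sum>y\<in>X. (of_bool (x \<noteq> y) :: nat))"
        using distinct3 by (intro sum_mono) (auto simp: of_bool_def)
      also have "\<dots> = (\<Sum>x\<in>X. card (X - {x}))"
      proof (rule sum.cong[OF refl])
        fix x assume "x \<in> X"
        have "{y\<in>X. x \<noteq> y} = X - {x}" by blast
        then show "(\<Sum>y\<in>X. (of_bool (x \<noteq> y) :: nat)) = card (X - {x})"
          using sum_of_bool_filter[OF X(3)] by metis
      qed
      also have "\<dots> = (\<Sum>x\<in>X. 3)" using X by (intro sum.cong) auto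
      also have "\<dots> = 12" using X by simp
      finally show ?thesis .
    qed
    then have 3: "(\<Sum>u\<in>U-X. \<Sum>x\<in>X. \<Sum>y\<in>X. of_bool (R u x y)) \<le> 12 * k"
      using sum_mono[of "U - X" "\<lambda>u. \<Sum>x\<in>X. \<Sum>y\<in>X. of_bool (R u x y)" "\<lambda>_. 12::nat"] by (simp add: k_def)
    have 4: "E X \<le> 48"
      using sum_mono[of X "\<lambda>u. \<Sum>x\<in>X. \<Sum>y\<in>X. of_bool (R u x y)" "\<lambda>_. 12::nat"] 2 X by (simp add: E_def)
    have "4 * E U \<le> 3 * k^3 + 36 * k\<^sup>2 + 144 * k + 192"
      using E_split[OF fin X(1)] IH 1 3 4 by linarith
    also have "\<dots> = 3 * (card U)^3" unfolding cU by (simp add: power3_eq_cube power2_eq_square algebra_simps)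
    finally show ?thesis .
  next
    case False
    define m where "m = card U"
    let ?f = "\<lambda>x y z. (of_bool (R x y z) :: nat)"
    have "(\<Sum>a\<in>U. \<Sum>b\<in>U. \<Sum>c\<in>U. \<Sum>d\<in>U. ?f a b c + ?f a b d + ?f a c d + ?f b c d) \<le> (\<Sum>a\<in>U. \<Sum>b\<in>U. \<Sum>c\<in>U. \<Sum>d\<in>U. 3)"
    proof (intro sum_mono)
      fix a b c d assume "a \<in> U" "b \<in> U" "c \<in> U" "d \<in> U"
      then have "\<not> (R a b c \<and> R a b d \<and> R a c d \<and> R b c d)" using False unfolding K4_def by blast
      then show "?f a b c + ?f a b d + ?f a c d + ?f b c d \<le> 3"
        by (cases "R a b c"; cases "R a b d"; cases "R a c d"; cases "R b c d"; simp)
    qed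
    also have "\<dots> = 3 * m^4" by (simp add: m_def power4_eq_xxxx)
    also have "(\<Sum>a\<in>U. \<Sum>b\<in>U. \<Sum>c\<in>U. \<Sum>d\<in>U. ?f a b c + ?f a b d + ?f a c d + ?f b c d) = 4 * (m * E U)"
    proof -
      have 1: "(\<Sum>a\<in>U. \<Sum>b\<in>U. \<Sum>c\<in>U. \<Sum>d\<in>U. ?f a b c) = m * E U"
        by (simp add: E_def m_def sum_distrib_left)
      have 2: "(\<Sum>a\<in>U. \<Sum>b\<in>U. \<Sum>c\<in>U. \<Sum>d\<in>U. ?f a b d) = m * E U"
        by (simp add: E_def m_def sum_distrib_left)
      have 3: "(\<Sum>a\<in>U. \<Sum>b\<in>U. \<Sum>c\<in>U. \<Sum>d\<in>U. ?f a c d) = m * E U"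
        by (simp add: E_def m_def sum_distrib_left)
      have 4: "(\<Sum>a\<in>U. \<Sum>b\<in>U. \<Sum>c\<in>U. \<Sum>d\<in>U. ?f b c d) = m * E U"
        by (simp add: E_def m_def)
      show ?thesis by (simp only: sum.distrib 1 2 3 4)
    qed
    finally have "m * (4 * E U) \<le> m * (3 * m^3)" by (simp add: power4_eq_xxxx power3_eq_cube mult.assoc)
    then show ?thesis
    proof (cases "U = {}")
      case False
      then have "m > 0" using fin by (simp add: m_def card_gt_0_iff)
      then show ?thesis using \<open>m * (4 * E U) \<le> m * (3 * m^3)\<close> by (simp add: m_def)
    qed (simp add: E_def)
  qed
qed

text \<open>Without a complete 4-set at \<open>x\<close>, convexity of the degrees in its link
  yields \<open>2 * m * D V x + E V \<le> 17/8 * m^3\<close>, whereas the minimum degree gives three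
  times \<open>3/4 - \<beta>\<close>, that is \<open>9/4 - 3 * \<beta>\<close>.\<close>

lemma K4_of_min_degree:
  fixes \<beta> :: real
  assumes fin: "finite V" and x: "x \<in> V" and \<beta>: "\<beta> < 1/24"
    and deg: "\<And>x. x \<in> V \<Longrightarrow> (3/4 - \<beta>) * (card V)\<^sup>2 \<le> D V x"
  shows "\<exists>y\<in>V. \<exists>z\<in>V. \<exists>t\<in>V. K4 x y z t"
proof (rule ccontr)
  assume n: "\<not> ?thesis"
  define m where "m = real (card V)"
  have m0: "m > 0" using fin x by (auto simp: m_def card_gt_0_iff)
  let ?L = "\<lambda>u v. (of_bool (R x u v) :: real)"
  \<comment> \<open>A linearised form of the exclusion: for an edge \<open>x u v\<close> it says
    that the other three triples of \<open>x, u, v, w\<close> are not all edges, and otherwise it is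
    trivial. Its sum involves only \<open>E V\<close>, \<open>D V x\<close> and the squared degrees
    in the link.\<close>
  have "?L u v * (?L u w + ?L v w - 1) + of_bool (R u v w) - 1 \<le> (0::real)" if "u \<in> V" "v \<in> V" "w \<in> V" for u v w
  proof -
    have "\<not> (R x u v \<and> R x u w \<and> R x v w \<and> R u v w)" using n that unfolding K4_def by blast
    then show ?thesis by (cases "R x u v"; cases "R x u w"; cases "R x v w"; cases "R u v w"; simp)
  qed
  then have "(\<Sum>u\<in>V. \<Sum>v\<in>V. \<Sum>w\<in>V. ?L u v * (?L u w + ?L v w - 1) + of_bool (R u v w) - 1) \<le> 0"
    by (intro sum_nonpos) auto
  moreover define d where "d = (\<lambda>u. \<Sum>v\<in>V. ?L u v)"
  have a: "(\<Sum>u\<in>V. \<Sum>v\<in>V. \<Sum>w\<in>V. ?L u v * ?L u w) = (\<Sum>u\<in>V. d u * d u)"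
    by (simp add: d_def sum_product)
  have b: "(\<Sum>u\<in>V. \<Sum>v\<in>V. \<Sum>w\<in>V. ?L u v * ?L v w) = (\<Sum>u\<in>V. d u * d u)"
    by (subst sum.swap) (simp add: d_def sum_product perms(2)[of x])
  have c: "(\<Sum>u\<in>V. \<Sum>v\<in>V. \<Sum>w\<in>V. ?L u v) = m * D V x"
    by (simp add: D_def m_def sum_distrib_left)
  have dsum: "(\<Sum>u\<in>V. d u) = D V x" by (simp add: d_def D_def)
  have e: "(\<Sum>u\<in>V. \<Sum>v\<in>V. \<Sum>w\<in>V. (of_bool (R u v w) :: real)) = E V" by (simp add: E_def)
  have f: "(\<Sum>u\<in>V. \<Sum>v\<in>V. \<Sum>w\<in>V. (1::real)) = m^3" by (simp add: m_def power3_eq_cube)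
  have "(\<Sum>u\<in>V. \<Sum>v\<in>V. \<Sum>w\<in>V. ?L u v * (?L u w + ?L v w - 1) + of_bool (R u v w) - 1)
     = (\<Sum>u\<in>V. \<Sum>v\<in>V. \<Sum>w\<in>V. ?L u v * ?L u w) + (\<Sum>u\<in>V. \<Sum>v\<in>V. \<Sum>w\<in>V. ?L u v * ?L v w)
       - (\<Sum>u\<in>V. \<Sum>v\<in>V. \<Sum>w\<in>V. ?L u v) + (\<Sum>u\<in>V. \<Sum>v\<in>V. \<Sum>w\<in>V. of_bool (R u v w)) - (\<Sum>u\<in>V. \<Sum>v\<in>V. \<Sum>w\<in>V. 1)"
    by (simp only: sum.distrib[symmetric] sum_subtractf[symmetric]) (simp add: algebra_simps)
  ultimately have main: "2 * (\<Sum>u\<in>V. d u * d u) - m * D V x + E V - m^3 \<le> 0"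
    using a b c e f by linarith
  \<comment> \<open>The tangent of the square at the ideal degree \<open>3/4 * m\<close> replaces
    Cauchy-Schwarz and keeps the bound linear in \<open>D V x\<close>.\<close>
  have "(\<Sum>u\<in>V. 2 * (3/4 * m) * d u - (3/4 * m) * (3/4 * m)) \<le> (\<Sum>u\<in>V. d u * d u)"
  proof (rule sum_mono)
    fix u
    have "0 \<le> (d u - 3/4 * m)\<^sup>2" by simp
    then show "2 * (3/4 * m) * d u - (3/4 * m) * (3/4 * m) \<le> d u * d u"
      by (simp add: power2_eq_square algebra_simps)
  qed
  moreover have "(\<Sum>u\<in>V. 2 * (3/4 * m) * d u - (3/4 * m) * (3/4 * m)) = 2 * (3/4 * m) * D V x - m * ((3/4 * m) * (3/4 * m))"
    by (simp only: sum_subtractf sum_distrib_left[symmetric] dsum sum_constant m_def)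
  ultimately have "3/2 * m * D V x - 9/16 * m^3 \<le> (\<Sum>u\<in>V. d u * d u)"
    by (simp add: power3_eq_cube)
  then have 1: "2 * (m * D V x) + E V \<le> 17/8 * m^3" using main by (simp add: algebra_simps)
  have "m * ((3/4 - \<beta>) * m\<^sup>2) \<le> m * D V x" using deg[OF x] m0 by (simp add: m_def)
  moreover have "(\<Sum>x\<in>V. (3/4 - \<beta>) * m\<^sup>2) \<le> (\<Sum>x\<in>V. real (D V x))"
    using deg by (intro sum_mono) (simp add: m_def)
  then have "m * ((3/4 - \<beta>) * m\<^sup>2) \<le> E V" by (simp add: E_eq_sum_D m_def)
  ultimately have "3 * (m * ((3/4 - \<beta>) * m\<^sup>2)) \<le> 17/8 * m^3" using 1 by linarith
  then have "m^3 * (1/8) \<le> m^3 * (3 * \<beta>)" by (simp add: power3_eq_cube power2_eq_square algebra_simps)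
  then have "1/8 \<le> 3 * \<beta>" using m0 by (simp only: mult_le_cancel_left_pos zero_less_power)
  then show False using \<beta> by simp
qed

text \<open>A complete 4-set through \<open>x\<close> turns the degrees of its four vertices into
  total weight \<open>(3 - \<beta>^2) * m^2\<close>; \<open>link_of_min_degree\<close> then reads
  off the link of the label \<open>x\<close>, once a subset of large minimum weight has been
  found.\<close>

lemma link_structure:
  fixes \<beta> :: real
  assumes fin: "finite V" and x: "x \<in> V" and \<beta>: "0 < \<beta>" "\<beta> \<le> 1/20000" and big: "4 / \<beta> \<le> card V"
    and deg: "\<And>x. x \<in> V \<Longrightarrow> (3/4 - \<beta>\<^sup>2/4) * (card V)\<^sup>2 \<le> D V x"
  shows "\<exists>T\<subseteq>V. real (card {p\<in>V\<times>V. R x (fst p) (snd p) = (fst p \<in> T \<and> snd p \<in> T)}) \<le> 5000 * \<beta> * (card V)\<^sup>2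
     \<and> (real (card T) - card V / 2)\<^sup>2 \<le> 101 * \<beta> * (card V)\<^sup>2"
proof -
  define m where "m = real (card V)"
  have m0: "m > 0" using fin x by (auto simp: m_def card_gt_0_iff)
  have \<beta>2: "\<beta>\<^sup>2 \<le> \<beta> * (1/20000)" using \<beta> by (simp add: power2_eq_square)
  then have "\<beta>\<^sup>2 / 4 < 1/24" using \<beta> by simp
  from K4_of_min_degree[OF fin x this deg] obtain y z t where
    K: "y \<in> V" "z \<in> V" "t \<in> V" "K4 x y z t" by blast
  define X where "X = {x,y,z,t}"
  interpret F: four_links "\<lambda>u v. {i\<in>X. R i u v}" X
    unfolding X_def by (rule four_links_K4[OF K(4)])
  have "F.W V = (\<Sum>i\<in>X. D V i)" unfolding F.W_def using sum_D_K4[OF K(4) fin, folded X_def] .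
  moreover have "(\<Sum>i\<in>X. (3/4 - \<beta>\<^sup>2/4) * m\<^sup>2) \<le> (\<Sum>i\<in>X. real (D V i))"
    using deg x K by (intro sum_mono) (auto simp: m_def X_def)
  ultimately have WV: "(3 - \<beta>\<^sup>2) * m\<^sup>2 \<le> F.W V" using F.card_X by (simp add: algebra_simps)
  \<comment> \<open>A maximiser of this functional cannot gain by losing a vertex, which is a
    minimum degree condition. Comparison with \<open>V\<close>, whose deficit is \<beta>^2 against
    the allowed \<beta>, shows that only a \<beta>-fraction is lost.\<close>
  have "finite (Pow V)" "Pow V \<noteq> {}" using fin by auto
  from Max_exists_le[OF this, of "\<lambda>U. real (F.W U) - (3 - \<beta>) * (real (card U))\<^sup>2"]
  obtain U where U: "U \<subseteq> V" and max: "\<And>U'. U' \<subseteq> V \<Longrightarrow> real (F.W U') - (3 - \<beta>) * (real (card U'))\<^sup>2 \<le> real (F.W U) - (3 - \<beta>) * (real (card U))\<^sup>2"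
    by blast
  have finU: "finite U" using U fin finite_subset by blast
  define k where "k = real (card U)"
  have km: "k \<le> m" using card_mono[OF fin U] by (simp add: k_def m_def)
  have "real (F.W U) \<le> 3 * k\<^sup>2" using F.W_le[OF finU] by (simp add: k_def flip: of_nat_power of_nat_mult)
  then have "\<beta> * k\<^sup>2 \<ge> (\<beta> - \<beta>\<^sup>2) * m\<^sup>2" using max[of V] WV by (simp add: k_def m_def algebra_simps)
  then have "\<beta> * ((1 - \<beta>) * m\<^sup>2) \<le> \<beta> * k\<^sup>2" by (simp add: power2_eq_square algebra_simps)
  then have k2: "(1 - \<beta>) * m\<^sup>2 \<le> k\<^sup>2" using \<beta> by simp
  have kge: "(1 - \<beta>) * m \<le> k"
  proof (rule power2_le_imp_le)
    have "((1 - \<beta>) * m)\<^sup>2 = (1 - \<beta>) * ((1 - \<beta>) * m\<^sup>2)" by (simp add: power2_eq_square)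
    also have "\<dots> \<le> 1 * ((1 - \<beta>) * m\<^sup>2)" using \<beta> by (intro mult_right_mono) auto
    finally show "((1 - \<beta>) * m)\<^sup>2 \<le> k\<^sup>2" using k2 by simp
  qed (simp add: k_def)
  have "(1/2) * m \<le> (1 - \<beta>) * m" using \<beta> m0 by (intro mult_right_mono) auto
  then have khalf: "m / 2 \<le> k" using kge by simp
  then have k0: "k > 0" using m0 by simp
  then have ne: "U \<noteq> {}" by (auto simp: k_def)
  have "4 \<le> \<beta> * m" using big \<beta> by (simp add: m_def field_simps)
  moreover have "\<beta> * (m / 2) \<le> \<beta> * k" using khalf \<beta> by (intro mult_left_mono) auto
  ultimately have bk: "\<beta> * k \<ge> 2" by simp
  have degU: "(3 - 2 * \<beta>) * card U \<le> real (\<Sum>u\<in>U. F.w a u)" if a: "a \<in> U" for a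
  proof -
    have "F.W U = F.W (U - {a}) + 2 * (\<Sum>u\<in>U - {a}. F.w a u) + F.W {a}"
      using F.W_split[OF finU, of "{a}"] a by simp
    moreover have "F.W {a} = 0" using F.w_irrefl[of a] unfolding F.W_def by simp
    moreover have "(\<Sum>u\<in>U. F.w a u) = (\<Sum>u\<in>U - {a}. F.w a u)"
      using sum.remove[OF finU a, of "\<lambda>u. F.w a u"] F.w_irrefl[of a] by simp
    ultimately have "real (F.W U) = real (F.W (U - {a})) + 2 * real (\<Sum>u\<in>U. F.w a u)" by simp
    moreover have "real (card (U - {a})) = k - 1" using a finU ne
      by (simp add: k_def of_nat_diff card_gt_0_iff Suc_leI)
    moreover have "U - {a} \<subseteq> V" using U by blast
    from max[OF this] have "real (F.W (U - {a})) - (3 - \<beta>) * (real (card (U - {a})))\<^sup>2 \<le> real (F.W U) - (3 - \<beta>) * k\<^sup>2"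
      by (simp add: k_def)
    ultimately have "(3 - \<beta>) * (k\<^sup>2 - (k - 1)\<^sup>2) \<le> 2 * real (\<Sum>u\<in>U. F.w a u)"
      by (simp add: right_diff_distrib)
    moreover have "k\<^sup>2 - (k - 1)\<^sup>2 = 2 * k - 1" by (simp add: power2_eq_square algebra_simps)
    ultimately have "(3 - \<beta>) * k - (3/2 - \<beta>/2) \<le> real (\<Sum>u\<in>U. F.w a u)" by (simp add: field_simps)
    moreover have "(3 - 2 * \<beta>) * k + \<beta> * k = (3 - \<beta>) * k" by (simp add: algebra_simps)
    ultimately show ?thesis using bk \<beta> unfolding k_def by linarith
  qed
  have b2: "0 < 2 * \<beta>" "2 * \<beta> \<le> 1/10000" using \<beta> by auto
  have "x \<in> X" by (simp add: X_def)
  from F.link_of_min_degree[OF finU ne b2 degU this] obtain T where T: "T \<subseteq> U"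
    and err: "real (card {p\<in>U\<times>U. (x \<in> {i\<in>X. R i (fst p) (snd p)}) = (fst p \<in> T \<and> snd p \<in> T)}) \<le> 2000 * (2 * \<beta>) * k\<^sup>2"
    and sz: "(real (card T) - k / 2)\<^sup>2 \<le> 25 * (2 * \<beta>) * k\<^sup>2" by (auto simp: k_def)
  have kk: "k\<^sup>2 \<le> m\<^sup>2" using km k0 by (intro power_mono) auto
  have mk: "m - k \<le> \<beta> * m" using kge by (simp add: algebra_simps)
  let ?E = "{p\<in>V\<times>V. R x (fst p) (snd p) = (fst p \<in> T \<and> snd p \<in> T)}"
  let ?F = "{p\<in>U\<times>U. (x \<in> {i\<in>X. R i (fst p) (snd p)}) = (fst p \<in> T \<and> snd p \<in> T)}"
  have "?E \<subseteq> ?F \<union> ((V - U) \<times> V \<union> V \<times> (V - U))" by (auto simp: X_def)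
  then have "card ?E \<le> card (?F \<union> ((V - U) \<times> V \<union> V \<times> (V - U)))"
    by (rule card_mono[rotated]) (use fin finU in auto)
  also have "\<dots> \<le> card ?F + (card (V - U) * card V + card V * card (V - U))"
    by (intro order_trans[OF card_Un_le] add_mono) (auto simp: card_cartesian_product)
  finally have "real (card ?E) \<le> real (card ?F + (card (V - U) * card V + card V * card (V - U)))" by (rule of_nat_mono)
  also have "\<dots> = card ?F + 2 * ((m - k) * m)"
    using card_Diff_subset[OF finU U] card_mono[OF fin U] by (simp add: m_def k_def of_nat_diff)
  also have "\<dots> \<le> 4000 * \<beta> * m\<^sup>2 + 2 * ((\<beta> * m) * m)"
  proof -
    have "2000 * (2 * \<beta>) * k\<^sup>2 \<le> 2000 * (2 * \<beta>) * m\<^sup>2" using kk \<beta> by (intro mult_left_mono) auto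
    moreover have "(m - k) * m \<le> (\<beta> * m) * m" using mk m0 by (intro mult_right_mono) auto
    ultimately show ?thesis using err by linarith
  qed
  also have "\<dots> \<le> 5000 * \<beta> * m\<^sup>2" using \<beta> by (simp add: power2_eq_square)
  finally have 1: "real (card ?E) \<le> 5000 * \<beta> * m\<^sup>2" .
  have "(real (card T) - m / 2)\<^sup>2 \<le> 2 * (real (card T) - k / 2)\<^sup>2 + 2 * ((m - k)/2)\<^sup>2"
  proof -
    have "0 \<le> ((real (card T) - k / 2) + (m - k)/2)\<^sup>2" by simp
    then show ?thesis by (simp add: power2_eq_square field_simps)
  qed
  moreover have "2 * (real (card T) - k / 2)\<^sup>2 \<le> 100 * \<beta> * m\<^sup>2"
  proof -
    have "25 * (2 * \<beta>) * k\<^sup>2 \<le> 25 * (2 * \<beta>) * m\<^sup>2" using kk \<beta> by (intro mult_left_mono) auto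
    then show ?thesis using sz by simp
  qed
  moreover have "2 * ((m - k)/2)\<^sup>2 \<le> \<beta> * m\<^sup>2"
  proof -
    have "((m - k)/2)\<^sup>2 \<le> (\<beta> * m / 2)\<^sup>2" using mk km by (intro power_mono) auto
    also have "\<dots> = \<beta>\<^sup>2 * m\<^sup>2 / 4" by (simp add: power2_eq_square)
    also have "\<dots> \<le> \<beta> * (1/20000) * m\<^sup>2 / 4" using \<beta>2 by (intro divide_right_mono mult_right_mono) auto
    finally have "80000 * ((m - k)/2)\<^sup>2 \<le> \<beta> * m\<^sup>2" by simp
    moreover have "0 \<le> ((m - k)/2)\<^sup>2" by simp
    ultimately show ?thesis by linarith
  qed
  ultimately have "(real (card T) - m / 2)\<^sup>2 \<le> 101 * \<beta> * m\<^sup>2" by simp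
  then show ?thesis using 1 T U by (intro exI[of _ T]) (auto simp: m_def)
qed

end

text \<open>Repeated entries are allowed, so that counts run over the whole cube of
  \<open>V\<close>. The notion is unchanged when \<open>A\<close> is replaced by its complement,
  which lets any set inducing the right split on the sampled vertices serve as
  \<open>A\<close>.\<close>

definition cross :: "'v set \<Rightarrow> 'v \<Rightarrow> 'v \<Rightarrow> 'v \<Rightarrow> bool" where
  "cross A u v w \<longleftrightarrow> \<not> (u \<in> A \<and> v \<in> A \<and> w \<in> A) \<and> \<not> (u \<notin> A \<and> v \<notin> A \<and> w \<notin> A)"

section \<open>Counting ordered triples; one bipartition out of all links\<close>

abbreviation count2 :: "'v set \<Rightarrow> ('v \<Rightarrow> 'v \<Rightarrow> bool) \<Rightarrow> nat" where
  "count2 V P \<equiv> \<Sum>u\<in>V. \<Sum>v\<in>V. of_bool (P u v)"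

abbreviation count3 :: "'v set \<Rightarrow> ('v \<Rightarrow> 'v \<Rightarrow> 'v \<Rightarrow> bool) \<Rightarrow> nat" where
  "count3 V P \<equiv> \<Sum>u\<in>V. \<Sum>v\<in>V. \<Sum>w\<in>V. of_bool (P u v w)"

lemma count2_mono: "(\<And>u v. u \<in> V \<Longrightarrow> v \<in> V \<Longrightarrow> P u v \<Longrightarrow> Q u v) \<Longrightarrow> count2 V P \<le> count2 V Q"
  by (intro sum_mono) (auto simp: of_bool_def)

lemma count3_mono:
  "(\<And>u v w. u \<in> V \<Longrightarrow> v \<in> V \<Longrightarrow> w \<in> V \<Longrightarrow> P u v w \<Longrightarrow> Q u v w) \<Longrightarrow> count3 V P \<le> count3 V Q"
  by (intro sum_mono) (auto simp: of_bool_def)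

lemma count2_disj: "count2 V (\<lambda>u v. P u v \<or> Q u v) \<le> count2 V P + count2 V Q"
  unfolding sum.distrib[symmetric] by (intro sum_mono) (auto simp: of_bool_def)

lemma count3_disj: "count3 V (\<lambda>u v w. P u v w \<or> Q u v w) \<le> count3 V P + count3 V Q"
  unfolding sum.distrib[symmetric] by (intro sum_mono) (auto simp: of_bool_def)

lemma count2_card: "finite V \<Longrightarrow> count2 V P = card {p\<in>V\<times>V. P (fst p) (snd p)}"
  unfolding sum.cartesian_product by (subst sum_of_bool_filter[symmetric]) (auto simp: split_def)

lemma count3_rotate: "count3 V P = count3 V (\<lambda>u v w. P v u w)" "count3 V P = count3 V (\<lambda>u v w. P u w v)"
    "count3 V P = count3 V (\<lambda>u v w. P w v u)"
proof -
  have 1: "count3 V P = count3 V (\<lambda>u v w. P v u w)" for P by (rule sum.swap)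
  have 2: "count3 V P = count3 V (\<lambda>u v w. P u w v)" for P by (intro sum.cong refl sum.swap)
  show "count3 V P = count3 V (\<lambda>u v w. P v u w)" "count3 V P = count3 V (\<lambda>u v w. P u w v)" by (rule 1 2)+
  show "count3 V P = count3 V (\<lambda>u v w. P w v u)"
    by (subst 1, subst 2, subst 1) (rule refl)
qed

lemma count3_fst: "finite V \<Longrightarrow> B \<subseteq> V \<Longrightarrow> count3 V (\<lambda>u v w. u \<in> B) = card B * (card V)\<^sup>2"
proof -
  assume "finite V" "B \<subseteq> V"
  have "count3 V (\<lambda>u v w. u \<in> B) = (\<Sum>u\<in>V. of_bool (u \<in> B)) * (card V)\<^sup>2"
    unfolding sum_distrib_right by (intro sum.cong) (auto simp: power2_eq_square)
  also have "(\<Sum>u\<in>V. of_bool (u \<in> B)) = card {u\<in>V. u \<in> B}" by (rule sum_of_bool_filter) fact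
  also have "{u\<in>V. u \<in> B} = B" using \<open>B \<subseteq> V\<close> by blast
  finally show ?thesis .
qed

lemma count3_inside: "finite V \<Longrightarrow> A \<subseteq> V \<Longrightarrow> count3 V (\<lambda>u v w. u \<in> A \<and> v \<in> A \<and> w \<in> A) = (card A)^3"
proof -
  assume V: "finite V" "A \<subseteq> V"
  have s: "(\<Sum>u\<in>V. f u * of_bool (u \<in> A)) = sum f A" for f :: "'a \<Rightarrow> nat"
    using V by (simp add: sum.If_cases of_bool_def if_distrib Int_absorb1 cong: if_cong)
  have "count3 V (\<lambda>u v w. u \<in> A \<and> v \<in> A \<and> w \<in> A) =
     (\<Sum>u\<in>V. (\<Sum>v\<in>V. (\<Sum>w\<in>V. 1 * of_bool (w \<in> A)) * of_bool (v \<in> A)) * of_bool (u \<in> A))"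
    by (simp add: sum_distrib_left of_bool_conj mult_ac)
  also have "\<dots> = (card A)^3" unfolding s by (simp add: power3_eq_cube)
  finally show ?thesis .
qed

context fano_free
begin

text \<open>Symmetry couples the links: with no error at \<open>v x w\<close> and
  \<open>x v w\<close>, the sets \<open>T v\<close> and \<open>T x\<close> must tell the same story
  about \<open>w\<close>. Averaging finds an \<open>x\<close> for which such errors are rare, and
  \<open>A = T x\<close> then describes the links of nearly all \<open>v \<in> A\<close>. Triples
  inside the complement of \<open>A\<close> are invisible this way and are bounded through
  \<open>E_le\<close>.\<close>

lemma bipartite_of_links:
  fixes \<gamma> :: real
  assumes fin: "finite V" and ne: "V \<noteq> {}" and \<gamma>: "0 < \<gamma>" "\<gamma> \<le> 1/1000"
    and links: "\<And>x. x \<in> V \<Longrightarrow> \<exists>T\<subseteq>V. real (count2 V (\<lambda>u v. R x u v = (u \<in> T \<and> v \<in> T))) \<le> \<gamma> * (card V)\<^sup>2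
        \<and> (real (card T) - card V / 2)\<^sup>2 \<le> \<gamma> * (card V)\<^sup>2"
  shows "\<exists>A\<subseteq>V. real (count3 V (\<lambda>u v w. R u v w \<noteq> cross A u v w)) \<le> 90 * \<gamma> * (card V)^3"
proof -
  define m where "m = real (card V)"
  have m0: "m > 0" using fin ne by (simp add: m_def card_gt_0_iff)
  define T where "T = (\<lambda>x. SOME T. T \<subseteq> V \<and> real (count2 V (\<lambda>u v. R x u v = (u \<in> T \<and> v \<in> T))) \<le> \<gamma> * m\<^sup>2
        \<and> (real (card T) - m / 2)\<^sup>2 \<le> \<gamma> * m\<^sup>2)"
  have T: "T x \<subseteq> V" "real (count2 V (\<lambda>u v. R x u v = (u \<in> T x \<and> v \<in> T x))) \<le> \<gamma> * m\<^sup>2"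
    "(real (card (T x)) - m / 2)\<^sup>2 \<le> \<gamma> * m\<^sup>2" if "x \<in> V" for x
  proof -
    have "\<exists>T. T \<subseteq> V \<and> real (count2 V (\<lambda>u v. R x u v = (u \<in> T \<and> v \<in> T))) \<le> \<gamma> * m\<^sup>2
        \<and> (real (card T) - m / 2)\<^sup>2 \<le> \<gamma> * m\<^sup>2" using links[OF that] by (simp add: m_def)
    from someI_ex[OF this]
    show "T x \<subseteq> V" "real (count2 V (\<lambda>u v. R x u v = (u \<in> T x \<and> v \<in> T x))) \<le> \<gamma> * m\<^sup>2"
      "(real (card (T x)) - m / 2)\<^sup>2 \<le> \<gamma> * m\<^sup>2" unfolding T_def by auto
  qed
  define err where "err = (\<lambda>x u v. R x u v = (u \<in> T x \<and> v \<in> T x))"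
  have Tsize: "2/5 * m < card (T x)" if "x \<in> V" for x
  proof -
    have "(real (card (T x)) - m / 2)\<^sup>2 \<le> (1/1000) * m\<^sup>2"
      using T(3)[OF that] \<gamma> mult_right_mono[of \<gamma> "1/1000" "m\<^sup>2"] by simp
    also have "\<dots> < (m/10)\<^sup>2" using m0 by (simp add: power2_eq_square)
    finally have "\<bar>real (card (T x)) - m / 2\<bar> < m / 10"
      using m0 by (metis abs_le_square_iff abs_of_pos divide_pos_pos not_less zero_less_numeral)
    then show ?thesis by linarith
  qed
  have "\<exists>x\<in>V. real (count2 V (\<lambda>v w. err v x w)) \<le> \<gamma> * m\<^sup>2"
  proof (rule ccontr)
    assume "\<not> ?thesis"
    then have "(\<Sum>x\<in>V. \<gamma> * m\<^sup>2) < (\<Sum>x\<in>V. real (count2 V (\<lambda>v w. err v x w)))"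
      using fin ne by (intro sum_strict_mono) auto
    also have "\<dots> = real (count3 V (\<lambda>x v w. err v x w))" by simp
    also have "count3 V (\<lambda>x v w. err v x w) = (\<Sum>v\<in>V. count2 V (\<lambda>x w. err v x w))" by (rule sum.swap)
    also have "real \<dots> \<le> (\<Sum>v\<in>V. \<gamma> * m\<^sup>2)"
      unfolding of_nat_sum[of _ V] by (intro sum_mono) (use T(2) in \<open>simp add: err_def\<close>)
    finally show False by simp
  qed
  then obtain x where x: "x \<in> V" and ex: "real (count2 V (\<lambda>v w. err v x w)) \<le> \<gamma> * m\<^sup>2" by blast
  define A where "A = T x"
  have AV: "A \<subseteq> V" using T(1)[OF x] by (simp add: A_def)
  define r where "r = (\<lambda>v. \<Sum>w\<in>V. (of_bool (err v x w \<or> err x v w) :: nat))"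
  have rsum: "real (\<Sum>v\<in>V. r v) \<le> 2 * \<gamma> * m\<^sup>2"
  proof -
    have "(\<Sum>v\<in>V. r v) \<le> count2 V (\<lambda>v w. err v x w) + count2 V (\<lambda>v w. err x v w)"
      unfolding r_def by (rule count2_disj)
    then have "real (\<Sum>v\<in>V. r v) \<le> real (count2 V (\<lambda>v w. err v x w)) + real (count2 V (\<lambda>v w. err x v w))"
      by (metis of_nat_add of_nat_mono)
    then show ?thesis using ex T(2)[OF x] unfolding err_def by linarith
  qed
  have row: "real (count2 V (\<lambda>w t. R v w t = (w \<in> A \<and> t \<in> A))) \<le> count2 V (\<lambda>w t. err v w t) + 4 * (r v * m)"
    if v: "v \<in> A" for v
  proof (cases "real (r v) < m / 4")
    case False
    have "count2 V (\<lambda>w t. R v w t = (w \<in> A \<and> t \<in> A)) \<le> (\<Sum>w\<in>V. \<Sum>t\<in>V. 1)" by (intro sum_mono) auto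
    then have "real (count2 V (\<lambda>w t. R v w t = (w \<in> A \<and> t \<in> A))) \<le> real (\<Sum>w\<in>V. \<Sum>t\<in>V. 1)" by (rule of_nat_mono)
    also have "\<dots> = m * m" by (simp add: m_def)
    also have "\<dots> \<le> (4 * r v) * m" using False m0 by (intro mult_right_mono) auto
    finally have "real (count2 V (\<lambda>w t. R v w t = (w \<in> A \<and> t \<in> A))) \<le> 4 * (r v * m)" by (simp only: mult.assoc)
    then show ?thesis using of_nat_0_le_iff[of "count2 V (\<lambda>w t. err v w t)"] by linarith
  next
    case True
    let ?B = "{w\<in>V. err v x w \<or> err x v w}"
    have rB: "r v = card ?B" unfolding r_def by (rule sum_of_bool_filter[OF fin])
    have "\<not> A \<subseteq> ?B"
    proof
      assume "A \<subseteq> ?B"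
      then have "card A \<le> r v" unfolding rB using fin by (intro card_mono) auto
      then show False using Tsize[OF x] True m0 unfolding A_def by linarith
    qed
    \<comment> \<open>One error-free \<open>w0\<close> in \<open>A\<close> certifies
      \<open>x \<in> T v\<close>; after that, every error-free \<open>w\<close> satisfies
      \<open>w \<in> T v \<longleftrightarrow> w \<in> A\<close>.\<close>
    then obtain w0 where w0: "w0 \<in> A" "\<not> err v x w0" "\<not> err x v w0" using AV by blast
    then have "\<not> R x v w0" using v by (auto simp: err_def A_def)
    then have xv: "x \<in> T v" using w0(2) perms(1)[of x v w0] by (auto simp: err_def)
    have same: "w \<in> T v \<longleftrightarrow> w \<in> A" if "\<not> err v x w" "\<not> err x v w" for w
      using that xv v perms(1)[of x v w] by (auto simp: err_def A_def)
    have "count2 V (\<lambda>w t. R v w t = (w \<in> A \<and> t \<in> A)) \<le> count2 V (\<lambda>w t. err v w t \<or> (w \<in> ?B \<or> t \<in> ?B))"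
    proof (rule count2_mono)
      fix w t assume "w \<in> V" "t \<in> V" "R v w t = (w \<in> A \<and> t \<in> A)"
      then show "err v w t \<or> (w \<in> ?B \<or> t \<in> ?B)" using same[of w] same[of t] by (auto simp: err_def)
    qed
    also have "\<dots> \<le> count2 V (\<lambda>w t. err v w t) + count2 V (\<lambda>w t. w \<in> ?B \<or> t \<in> ?B)" by (rule count2_disj)
    also have "\<dots> \<le> count2 V (\<lambda>w t. err v w t) + (card V * r v + card V * r v)"
    proof (rule add_left_mono)
      have B: "(\<Sum>t\<in>V. of_bool (t \<in> ?B)) = r v" unfolding r_def by (intro sum.cong) auto
      have "count2 V (\<lambda>w t. w \<in> ?B \<or> t \<in> ?B) \<le> count2 V (\<lambda>w t. w \<in> ?B) + count2 V (\<lambda>w t. t \<in> ?B)" by (rule count2_disj)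
      also have "count2 V (\<lambda>w t. t \<in> ?B) = card V * r v" using B by simp
      also have "count2 V (\<lambda>w t. w \<in> ?B) = card V * r v" using B by (subst sum.swap) simp
      finally show "count2 V (\<lambda>w t. w \<in> ?B \<or> t \<in> ?B) \<le> card V * r v + card V * r v" .
    qed
    finally have "real (count2 V (\<lambda>w t. R v w t = (w \<in> A \<and> t \<in> A))) \<le> real (count2 V (\<lambda>w t. err v w t) + (card V * r v + card V * r v))"
      by (rule of_nat_mono)
    also have "\<dots> = count2 V (\<lambda>w t. err v w t) + 2 * (r v * m)" by (simp add: m_def)
    also have "\<dots> \<le> count2 V (\<lambda>w t. err v w t) + 4 * (r v * m)" using m0 by simp
    finally show ?thesis .
  qed
  define F where "F = count3 V (\<lambda>v w t. v \<in> A \<and> R v w t = (w \<in> A \<and> t \<in> A))"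
  have F: "real F \<le> 9 * \<gamma> * m^3"
  proof -
    have "F = (\<Sum>v\<in>A. count2 V (\<lambda>w t. R v w t = (w \<in> A \<and> t \<in> A)))"
      unfolding F_def using AV fin by (intro sum.mono_neutral_cong_right) auto
    then have "real F = (\<Sum>v\<in>A. real (count2 V (\<lambda>w t. R v w t = (w \<in> A \<and> t \<in> A))))" by simp
    also have "\<dots> \<le> (\<Sum>v\<in>A. count2 V (\<lambda>w t. err v w t) + 4 * (r v * m))" using row by (intro sum_mono)
    also have "\<dots> \<le> (\<Sum>v\<in>V. count2 V (\<lambda>w t. err v w t) + 4 * (r v * m))"
      using AV fin m0 by (intro sum_mono2 add_nonneg_nonneg of_nat_0_le_iff mult_nonneg_nonneg) auto
    also have "\<dots> \<le> (\<Sum>v\<in>V. \<gamma> * m\<^sup>2 + 4 * (r v * m))"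
      using T(2) by (intro sum_mono add_mono) (auto simp: err_def)
    also have "\<dots> = m * (\<gamma> * m\<^sup>2) + 4 * (real (\<Sum>v\<in>V. r v) * m)"
      by (simp add: sum.distrib m_def sum_distrib_left sum_distrib_right)
    also have "\<dots> \<le> m * (\<gamma> * m\<^sup>2) + 4 * ((2 * \<gamma> * m\<^sup>2) * m)"
      using rsum m0 by (intro add_mono mult_left_mono mult_right_mono) auto
    finally show ?thesis by (simp add: power2_eq_square power3_eq_cube)
  qed
  define B where "B = V - A"
  have BV: "B \<subseteq> V" by (simp add: B_def)
  let ?Mis = "\<lambda>u v w. R u v w \<noteq> cross A u v w"
  let ?F1 = "\<lambda>v w t. v \<in> A \<and> R v w t = (w \<in> A \<and> t \<in> A)"
  let ?BR = "\<lambda>u v w. u \<in> B \<and> v \<in> B \<and> w \<in> B \<and> R u v w"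
  let ?BB = "\<lambda>u v w. u \<in> B \<and> v \<in> B \<and> w \<in> B"
  let ?AA = "\<lambda>u v w. u \<in> A \<and> v \<in> A \<and> w \<in> A"
  have F2: "count3 V (\<lambda>u v w. ?F1 v u w) = F" "count3 V (\<lambda>u v w. ?F1 w v u) = F"
    unfolding F_def by (rule count3_rotate(1)[symmetric], rule count3_rotate(3)[symmetric])
  have "count3 V ?Mis \<le> count3 V (\<lambda>u v w. ?BR u v w \<or> (?F1 u v w \<or> (?F1 v u w \<or> ?F1 w v u)))"
  proof (rule count3_mono)
    fix u v w assume "u \<in> V" "v \<in> V" "w \<in> V" "?Mis u v w"
    then show "?BR u v w \<or> (?F1 u v w \<or> (?F1 v u w \<or> ?F1 w v u))"
      using perms[of u v w] unfolding cross_def B_def by blast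
  qed
  also have "\<dots> \<le> count3 V ?BR + (F + (F + F))"
    by (rule order_trans[OF count3_disj], rule add_left_mono, rule order_trans[OF count3_disj],
        unfold F_def[symmetric], rule add_left_mono, rule order_trans[OF count3_disj], unfold F2) simp
  finally have Mis: "count3 V ?Mis \<le> count3 V ?BR + 3 * F" by simp
  \<comment> \<open>A covering of all ordered triples: edges not inside \<open>B\<close>, triples
    inside a class, and misfits with a vertex in \<open>A\<close>. It makes the edges outside
    \<open>B\<close> so numerous that the bound 3/4 of \<open>E_le\<close> leaves little room inside
    \<open>B\<close>.\<close>
  have "(\<Sum>u\<in>V. \<Sum>v\<in>V. \<Sum>w\<in>V. 1) \<le> count3 V (\<lambda>u v w. (R u v w \<and> \<not> ?BR u v w \<or> (?BB u v w \<or> ?AA u v w)) \<or> (?F1 u v w \<or> (?F1 v u w \<or> ?F1 w v u)))"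
  proof (intro sum_mono)
    fix u v w assume "u \<in> V" "v \<in> V" "w \<in> V"
    then have "(R u v w \<and> \<not> ?BR u v w \<or> (?BB u v w \<or> ?AA u v w)) \<or> (?F1 u v w \<or> (?F1 v u w \<or> ?F1 w v u))"
      using perms[of u v w] unfolding B_def by blast
    then show "1 \<le> (of_bool ((R u v w \<and> \<not> ?BR u v w \<or> (?BB u v w \<or> ?AA u v w)) \<or> (?F1 u v w \<or> (?F1 v u w \<or> ?F1 w v u))) :: nat)"
      by (simp only: of_bool_eq)
  qed
  also have "\<dots> \<le> (count3 V (\<lambda>u v w. R u v w \<and> \<not> ?BR u v w) + ((card B)^3 + (card A)^3)) + (F + (F + F))"
    apply (rule order_trans[OF count3_disj], rule add_mono)
     apply (rule order_trans[OF count3_disj], rule add_left_mono, rule order_trans[OF count3_disj])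
     apply (unfold count3_inside[OF fin AV] count3_inside[OF fin BV], simp)
    by (rule order_trans[OF count3_disj],
        unfold F_def[symmetric], rule add_left_mono, rule order_trans[OF count3_disj], unfold F2) simp
  finally have tot: "(card V)^3 \<le> count3 V (\<lambda>u v w. R u v w \<and> \<not> ?BR u v w) + (card B)^3 + (card A)^3 + 3 * F"
    by (simp add: power3_eq_cube)
  have "count3 V (\<lambda>u v w. R u v w \<and> \<not> ?BR u v w) + count3 V ?BR = E V"
    unfolding E_def sum.distrib[symmetric] by (intro sum.cong refl) (auto simp: of_bool_def)
  then have "4 * (count3 V (\<lambda>u v w. R u v w \<and> \<not> ?BR u v w) + count3 V ?BR) \<le> 3 * (card V)^3"
    using E_le[OF fin] by simp
  then have "4 * (count3 V ?BR) + (card V)^3 \<le> 4 * ((card B)^3 + (card A)^3 + 3 * F)"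
    using tot unfolding add_mult_distrib2 by linarith
  then have "real (4 * (count3 V ?BR) + (card V)^3) \<le> real (4 * ((card B)^3 + (card A)^3 + 3 * F))" by (rule of_nat_mono)
  then have BR: "4 * real (count3 V ?BR) + m^3 \<le> 4 * (real (card B)^3 + real (card A)^3 + 3 * F)"
    unfolding m_def by simp
  define a where "a = real (card A)"
  have b: "real (card B) = m - a" unfolding B_def m_def a_def using AV fin
    by (simp add: card_Diff_subset finite_subset card_mono of_nat_diff)
  have "(m - a)^3 + a^3 = m^3 / 4 + 3 * m * (a - m/2)\<^sup>2" by (simp add: power2_eq_square power3_eq_cube field_simps)
  moreover have "3 * m * (a - m/2)\<^sup>2 \<le> 3 * m * (\<gamma> * m\<^sup>2)"
    using T(3)[OF x] m0 by (intro mult_left_mono) (auto simp: a_def A_def)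
  moreover have "3 * m * (\<gamma> * m\<^sup>2) = 3 * \<gamma> * m^3" by (simp add: power2_eq_square power3_eq_cube)
  ultimately have "real (count3 V ?BR) \<le> 3 * \<gamma> * m^3 + 3 * F" using BR b by (simp add: a_def[symmetric])
  moreover have "real (count3 V ?Mis) \<le> real (count3 V ?BR + 3 * F)" using Mis by (rule of_nat_mono)
  ultimately have "real (count3 V ?Mis) \<le> 3 * \<gamma> * m^3 + 6 * (9 * \<gamma> * m^3)" using F by simp
  also have "\<dots> \<le> 90 * \<gamma> * m^3" using \<gamma> m0 by simp
  finally show ?thesis using AV unfolding m_def by (intro exI[of _ A]) simp
qed

end

lemma count2_subset:
  assumes "finite V" "U \<subseteq> V"
  shows "count2 U P \<le> count2 V P"
proof -
  have "count2 U P \<le> (\<Sum>u\<in>U. \<Sum>v\<in>V. of_bool (P u v))"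
    by (rule sum_mono, rule sum_mono2) (use assms in auto)
  also have "\<dots> \<le> count2 V P" by (rule sum_mono2) (use assms in auto)
  finally show ?thesis .
qed

context fano_free
begin

text \<open>The maximiser of \<open>link_structure\<close> one level up: a density deficit of order
  \<beta>^3 becomes a degree deficit of order \<beta>^2 on a subset missing at most a
  \<beta>-fraction of the vertices, and then a link error of order \<beta>. The 500000 covers
  \<open>90 * 5000\<close> and the triples that leave the subset.\<close>

lemma near_bipartite:
  fixes \<beta> :: real
  assumes fin: "finite V" and \<beta>: "0 < \<beta>" "\<beta> \<le> 1/10^7" and big: "16 / \<beta>\<^sup>2 \<le> card V"
    and dense: "(3/4 - \<beta>^3/8) * (card V)^3 \<le> E V"
  shows "\<exists>A\<subseteq>V. real (count3 V (\<lambda>u v w. R u v w \<noteq> cross A u v w)) \<le> 500000 * \<beta> * (card V)^3"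
proof -
  define M where "M = real (card V)"
  have b2: "\<beta>\<^sup>2 > 0" "\<beta>\<^sup>2 \<le> \<beta>" using \<beta> by (auto simp: power2_eq_square mult_le_cancel_left1)
  have b1: "\<beta> \<le> 1/1000" using \<beta> by simp
  have "0 < 16 / \<beta>\<^sup>2" using b2(1) by simp
  then have M0: "M > 0" using big unfolding M_def by linarith
  define h where "h = \<beta>\<^sup>2 / 8"
  have h: "0 < h" "h \<le> 3/4" using b2 b1 unfolding h_def by linarith+
  have "finite (Pow V)" "Pow V \<noteq> {}" using fin by auto
  from Max_exists_le[OF this, of "\<lambda>U. real (E U) - (3/4 - h) * (real (card U))^3"]
  obtain U where U: "U \<subseteq> V" and max: "\<And>U'. U' \<subseteq> V \<Longrightarrow>
      real (E U') - (3/4 - h) * (real (card U'))^3 \<le> real (E U) - (3/4 - h) * (real (card U))^3"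
    by blast
  have finU: "finite U" using U fin finite_subset by blast
  define m where "m = real (card U)"
  have mM: "m \<le> M" using card_mono[OF fin U] by (simp add: m_def M_def)
  have "real (4 * E U) \<le> real (3 * (card U)^3)" using E_le[OF finU] by (rule of_nat_mono)
  then have "real (E U) \<le> 3/4 * m^3" by (simp add: m_def)
  moreover have "real (E V) - (3/4 - h) * M^3 \<ge> (h - \<beta>^3/8) * M^3"
    using dense by (simp add: M_def algebra_simps)
  ultimately have "(h - \<beta>^3/8) * M^3 \<le> h * m^3" using max[of V] by (simp add: M_def m_def algebra_simps)
  moreover have "(h - \<beta>^3/8) * M^3 = h * ((1 - \<beta>) * M^3)" by (simp add: h_def power2_eq_square power3_eq_cube field_simps)
  ultimately have m3: "(1 - \<beta>) * M^3 \<le> m^3" using h by simp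
  have "((1 - \<beta>) * M)^3 = (1 - \<beta>) * M^3 * ((1 - \<beta>) * (1 - \<beta>))" by (simp add: power3_eq_cube)
  also have "\<dots> \<le> (1 - \<beta>) * M^3 * 1" using \<beta> M0 by (intro mult_left_mono mult_le_one) auto
  also have "\<dots> \<le> m^3" using m3 by simp
  finally have mge: "(1 - \<beta>) * M \<le> m"
    by (metis m_def of_nat_0_le_iff power_mono_iff not_less power_strict_mono zero_less_numeral linorder_le_cases order_trans)
  have "(1/2) * M \<le> (1 - \<beta>) * M" using \<beta> M0 by (intro mult_right_mono) auto
  then have mhalf: "M / 2 \<le> m" using mge by simp
  then have m0: "m > 0" using M0 by simp
  have ne: "U \<noteq> {}" using m0 by (auto simp: m_def)
  have big2: "8 / \<beta>\<^sup>2 \<le> m" using big mhalf by (simp add: M_def)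
  then have bm: "8 \<le> \<beta>\<^sup>2 * m" using b2 by (simp add: field_simps)
  have big1: "4 / \<beta> \<le> card U"
  proof -
    have "\<beta>\<^sup>2 * m \<le> \<beta> * m" using b2 m0 by (intro mult_right_mono) auto
    then have "4 \<le> \<beta> * m" using bm by linarith
    then show ?thesis using \<beta> by (simp add: m_def field_simps)
  qed
  have deg: "(3/4 - \<beta>\<^sup>2/4) * (card U)\<^sup>2 \<le> D U x" if x: "x \<in> U" for x
  proof -
    have irr: "\<not> R u y y" for u y using distinct3 by blast
    have "E U = E (U - {x}) + 3 * D (U - {x}) x"
      using E_split[OF finU, of "{x}"] x irr by (simp add: E_def[of "{x}"])
    moreover have "D (U - {x}) x \<le> D U x" unfolding D_def
      by (rule count2_subset[OF finU]) blast
    ultimately have "real (E U) \<le> real (E (U - {x})) + 3 * real (D U x)" by linarith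
    moreover have "real (card (U - {x})) = m - 1" using x finU ne
      by (simp add: m_def of_nat_diff card_gt_0_iff Suc_leI)
    moreover have "U - {x} \<subseteq> V" using U by blast
    from max[OF this] have "real (E (U - {x})) - (3/4 - h) * (real (card (U - {x})))^3 \<le> real (E U) - (3/4 - h) * m^3"
      by (simp add: m_def)
    ultimately have "(3/4 - h) * m^3 - (3/4 - h) * (m - 1)^3 \<le> 3 * real (D U x)" by simp
    moreover have "(3/4 - h) * m^3 - (3/4 - h) * (m - 1)^3 = (3/4 - h) * (3 * m\<^sup>2 - 3 * m) + (3/4 - h)"
      by (simp add: power2_eq_square power3_eq_cube algebra_simps)
    ultimately have "(3/4 - h) * (3 * m\<^sup>2 - 3 * m) \<le> 3 * real (D U x)" using h by linarith
    then have "(3/4 - h) * m\<^sup>2 - (3/4 - h) * m \<le> real (D U x)" by (simp add: algebra_simps)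
    moreover have "(3/4 - h) * m \<le> 1 * m" using h m0 by (intro mult_right_mono) auto
    moreover have "m * 8 \<le> m * (\<beta>\<^sup>2 * m)" using bm m0 by (intro mult_left_mono) auto
    then have "m \<le> (\<beta>\<^sup>2/8) * m\<^sup>2" by (simp add: power2_eq_square mult_ac)
    moreover have "(3/4 - h) * m\<^sup>2 - (\<beta>\<^sup>2/8) * m\<^sup>2 = (3/4 - \<beta>\<^sup>2/4) * m\<^sup>2" by (simp add: h_def algebra_simps)
    ultimately have "(3/4 - \<beta>\<^sup>2/4) * m\<^sup>2 \<le> D U x" by linarith
    then show ?thesis by (simp add: m_def)
  qed
  have links: "\<exists>T\<subseteq>U. real (count2 U (\<lambda>u v. R x u v = (u \<in> T \<and> v \<in> T))) \<le> (5000 * \<beta>) * (card U)\<^sup>2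
        \<and> (real (card T) - card U / 2)\<^sup>2 \<le> (5000 * \<beta>) * (card U)\<^sup>2" if x: "x \<in> U" for x
  proof -
    have b: "\<beta> \<le> 1/20000" using \<beta> by simp
    have le: "101 * \<beta> * real ((card U)\<^sup>2) \<le> (5000 * \<beta>) * real ((card U)\<^sup>2)" using \<beta> by (intro mult_right_mono) auto
    from link_structure[OF finU x \<beta>(1) b big1 deg] obtain T where T: "T \<subseteq> U"
      "real (card {p\<in>U\<times>U. R x (fst p) (snd p) = (fst p \<in> T \<and> snd p \<in> T)}) \<le> 5000 * \<beta> * (card U)\<^sup>2"
      "(real (card T) - card U / 2)\<^sup>2 \<le> 101 * \<beta> * (card U)\<^sup>2" by blast
    show ?thesis unfolding count2_card[OF finU] using T(1,2) order_trans[OF T(3) le] by blast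
  qed
  have "0 < 5000 * \<beta>" "5000 * \<beta> \<le> 1/1000" using \<beta> by auto
  from bipartite_of_links[OF finU ne this links] obtain A where A: "A \<subseteq> U"
    and mis: "real (count3 U (\<lambda>u v w. R u v w \<noteq> cross A u v w)) \<le> 90 * (5000 * \<beta>) * (card U)^3" by blast
  let ?P = "\<lambda>u v w. R u v w \<noteq> cross A u v w"
  let ?Q = "\<lambda>u v w. u \<in> U \<and> v \<in> U \<and> w \<in> U \<and> ?P u v w"
  have "count3 V ?P \<le> count3 V (\<lambda>u v w. ?Q u v w \<or> (u \<in> V - U \<or> (v \<in> V - U \<or> w \<in> V - U)))"
    by (rule count3_mono) blast
  also have "\<dots> \<le> count3 V ?Q + (count3 V (\<lambda>u v w. u \<in> V - U) + (count3 V (\<lambda>u v w. v \<in> V - U) + count3 V (\<lambda>u v w. w \<in> V - U)))"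
    by (rule order_trans[OF count3_disj], rule add_left_mono, rule order_trans[OF count3_disj],
        rule add_left_mono, rule count3_disj)
  also have "count3 V (\<lambda>u v w. v \<in> V - U) = count3 V (\<lambda>u v w. u \<in> V - U)" by (rule count3_rotate(1))
  also have "count3 V (\<lambda>u v w. w \<in> V - U) = count3 V (\<lambda>u v w. u \<in> V - U)" by (rule count3_rotate(3))
  also have "count3 V (\<lambda>u v w. u \<in> V - U) = card (V - U) * (card V)\<^sup>2" by (rule count3_fst[OF fin]) blast
  also have "count3 V ?Q = count3 U ?P"
    using U fin by (intro sum.mono_neutral_cong_right) (auto intro!: sum.mono_neutral_cong_right sum.neutral)
  finally have "real (count3 V ?P) \<le> real (count3 U ?P + (card (V - U) * (card V)\<^sup>2 + (card (V - U) * (card V)\<^sup>2 + card (V - U) * (card V)\<^sup>2)))"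
    by (rule of_nat_mono)
  also have "\<dots> = real (count3 U ?P) + 3 * ((M - m) * M\<^sup>2)"
    using card_Diff_subset[OF finU U] card_mono[OF fin U] by (simp add: m_def M_def of_nat_diff)
  also have "\<dots> \<le> 450000 * \<beta> * M^3 + 3 * ((\<beta> * M) * M\<^sup>2)"
  proof -
    have "M - m \<le> \<beta> * M" using mge by (simp add: algebra_simps)
    then have 1: "(M - m) * M\<^sup>2 \<le> (\<beta> * M) * M\<^sup>2" by (intro mult_right_mono) auto
    have "m^3 \<le> M^3" using mM m0 by (intro power_mono) auto
    then have "450000 * \<beta> * m^3 \<le> 450000 * \<beta> * M^3" using \<beta> by (intro mult_left_mono) auto
    then show ?thesis using mis 1 by (simp add: m_def)
  qed
  also have "\<dots> \<le> 500000 * \<beta> * M^3" using \<beta> M0 by (simp add: power2_eq_square power3_eq_cube)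
  finally show ?thesis using A U by (intro exI[of _ A]) (auto simp: M_def)
qed

end

section \<open>Passing from the relation \<open>R\<close> to a larger relation
  \<open>H\<close>\<close>

lemma sum4_product:
  fixes f :: "'v \<Rightarrow> 'v \<Rightarrow> nat"
  assumes "finite D"
  shows "(\<Sum>a\<in>D. \<Sum>b\<in>D. \<Sum>c\<in>D. \<Sum>d\<in>D. f a b) = (card D)\<^sup>2 * (\<Sum>a\<in>D. \<Sum>b\<in>D. f a b)"
    "(\<Sum>a\<in>D. \<Sum>b\<in>D. \<Sum>c\<in>D. \<Sum>d\<in>D. f c d) = (card D)\<^sup>2 * (\<Sum>a\<in>D. \<Sum>b\<in>D. f a b)"
    "(\<Sum>a\<in>D. \<Sum>b\<in>D. \<Sum>c\<in>D. \<Sum>d\<in>D. f a c) = (card D)\<^sup>2 * (\<Sum>a\<in>D. \<Sum>b\<in>D. f a b)"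
    "(\<Sum>a\<in>D. \<Sum>b\<in>D. \<Sum>c\<in>D. \<Sum>d\<in>D. f b d) = (card D)\<^sup>2 * (\<Sum>a\<in>D. \<Sum>b\<in>D. f a b)"
    "(\<Sum>a\<in>D. \<Sum>b\<in>D. \<Sum>c\<in>D. \<Sum>d\<in>D. f a d) = (card D)\<^sup>2 * (\<Sum>a\<in>D. \<Sum>b\<in>D. f a b)"
    "(\<Sum>a\<in>D. \<Sum>b\<in>D. \<Sum>c\<in>D. \<Sum>d\<in>D. f b c) = (card D)\<^sup>2 * (\<Sum>a\<in>D. \<Sum>b\<in>D. f a b)"
  by (simp_all add: power2_eq_square mult.assoc flip: sum_distrib_left)

text \<open>A union bound over four independent points: each of the three relations is tested on two
  disjoint pairs, hence the factor 2.\<close>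

lemma exists_factor:
  fixes P Q S :: "'v \<Rightarrow> 'v \<Rightarrow> bool"
  assumes fin: "finite D"
    and few: "2 * (count2 D P + count2 D Q + count2 D S) < (card D)\<^sup>2"
  shows "\<exists>a\<in>D. \<exists>b\<in>D. \<exists>c\<in>D. \<exists>d\<in>D. \<not> P a b \<and> \<not> P c d \<and> \<not> Q a c \<and> \<not> Q b d \<and> \<not> S a d \<and> \<not> S b c"
proof (rule ccontr)
  assume n: "\<not> ?thesis"
  let ?o = "\<lambda>x. (of_bool x :: nat)"
  have "(\<Sum>a\<in>D. \<Sum>b\<in>D. \<Sum>c\<in>D. \<Sum>d\<in>D. 1) \<le> (\<Sum>a\<in>D. \<Sum>b\<in>D. \<Sum>c\<in>D. \<Sum>d\<in>D.
      ?o (P a b) + ?o (P c d) + ?o (Q a c) + ?o (Q b d) + ?o (S a d) + ?o (S b c))"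
  proof (intro sum_mono)
    fix a b c d assume "a \<in> D" "b \<in> D" "c \<in> D" "d \<in> D"
    then have "P a b \<or> P c d \<or> Q a c \<or> Q b d \<or> S a d \<or> S b c" using n by blast
    then show "1 \<le> ?o (P a b) + ?o (P c d) + ?o (Q a c) + ?o (Q b d) + ?o (S a d) + ?o (S b c)"
      by (elim disjE) simp_all
  qed
  also have "\<dots> = (card D)\<^sup>2 * (2 * (count2 D P + count2 D Q + count2 D S))"
    unfolding sum.distrib sum4_product[OF fin] by (simp add: algebra_simps)
  finally have "(card D)\<^sup>2 * (card D)\<^sup>2 \<le> (card D)\<^sup>2 * (2 * (count2 D P + count2 D Q + count2 D S))"
    by (simp add: power2_eq_square mult.assoc)
  moreover have "(card D)\<^sup>2 > 0" using few by linarith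
  ultimately have "(card D)\<^sup>2 \<le> 2 * (count2 D P + count2 D Q + count2 D S)" by (simp only: mult_le_cancel1)
  then show False using few by linarith
qed

text \<open>The bipartition comes from \<open>R\<close>. An \<open>H\<close>-edge inside a class,
  all of whose vertices see almost every pair of the opposite class in \<open>R\<close>, would close
  a forbidden plane by \<open>exists_factor\<close>; so each inner \<open>H\<close>-edge meets the
  small set \<open>Hv\<close> of vertices with many missing pairs.\<close>

lemma near_bipartite_super:
  fixes \<beta> :: real and H R :: "'v \<Rightarrow> 'v \<Rightarrow> 'v \<Rightarrow> bool"
  assumes symR: "\<And>x y z. R x y z \<Longrightarrow> R y x z" "\<And>x y z. R x y z \<Longrightarrow> R x z y"
    and symH: "\<And>x y z. H x y z \<Longrightarrow> H y x z" "\<And>x y z. H x y z \<Longrightarrow> H x z y"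
    and sub: "\<And>x y z. R x y z \<Longrightarrow> H x y z" and dist: "\<And>x y z. H x y z \<Longrightarrow> x \<noteq> y"
    and nof: "\<And>x y z a b c d. \<not> (H x y z \<and> R x a b \<and> R x c d \<and> R y a c \<and> R y b d \<and> R z a d \<and> R z b c)"
    and fin: "finite V" and \<beta>: "0 < \<beta>" "\<beta> \<le> 1/10^10" and big: "16 / \<beta>\<^sup>2 \<le> card V"
    and dense: "(3/4 - \<beta>^3/8) * (card V)^3 \<le> count3 V R"
  shows "\<exists>A\<subseteq>V. real (count3 V (\<lambda>u v w. H u v w \<noteq> cross A u v w)) \<le> 200000000 * \<beta> * (card V)^3"
proof -
  interpret fano_free R
  proof
    show "\<not> (R x y z \<and> R x a b \<and> R x c d \<and> R y a c \<and> R y b d \<and> R z a d \<and> R z b c)" for x y z a b c d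
      using nof[of x y z a b c d] sub[of x y z] by blast
    show "R x y z \<Longrightarrow> x \<noteq> y" for x y z using dist[of x y z] sub[of x y z] by blast
    show "R x y z \<Longrightarrow> R y x z" "R x y z \<Longrightarrow> R x z y" for x y z by (fact symR)+
  qed
  define M where "M = real (card V)"
  have b2: "\<beta>\<^sup>2 > 0" "\<beta>\<^sup>2 \<le> \<beta>" using \<beta> by (auto simp: power2_eq_square mult_le_cancel_left1)
  have b1: "\<beta> \<le> 1/1000" using \<beta> by simp
  have "0 < 16 / \<beta>\<^sup>2" using b2(1) by simp
  then have M0: "M > 0" using big unfolding M_def by linarith
  have "\<beta> \<le> 1/10^7" using \<beta> by simp
  moreover have "(3/4 - \<beta>^3/8) * (card V)^3 \<le> E V" using dense unfolding E_def .
  ultimately obtain A where A: "A \<subseteq> V" and mis: "real (count3 V (\<lambda>u v w. R u v w \<noteq> cross A u v w)) \<le> 500000 * \<beta> * M^3"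
    using near_bipartite[OF fin \<beta>(1) _ big] unfolding M_def by auto
  define B where "B = V - A"
  have BV: "B \<subseteq> V" by (simp add: B_def)
  have fA: "finite A" "finite B" using A fin finite_subset by (auto simp: B_def)
  define a where "a = real (card A)"
  have cB: "real (card B) = M - a" unfolding B_def M_def a_def using A fin
    by (simp add: card_Diff_subset finite_subset card_mono of_nat_diff)
  let ?AA = "\<lambda>u v w. u \<in> A \<and> v \<in> A \<and> w \<in> A"
  let ?BB = "\<lambda>u v w. u \<in> B \<and> v \<in> B \<and> w \<in> B"
  let ?Mis = "\<lambda>u v w. R u v w \<noteq> cross A u v w"
  have sz: "a * (M - a) \<ge> 246/1000 * M\<^sup>2"
  proof -
    have "count3 V R + ((card A)^3 + (card B)^3) \<le> count3 V ?Mis + (card V)^3"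
    proof -
      have "count3 V R + (count3 V ?AA + count3 V ?BB) \<le> count3 V ?Mis + count3 V (\<lambda>_ _ _. True)"
        unfolding sum.distrib[symmetric]
        by (intro sum_mono) (auto simp: of_bool_def cross_def B_def)
      then show ?thesis unfolding count3_inside[OF fin A] count3_inside[OF fin BV] by (simp add: power3_eq_cube)
    qed
    then have "real (count3 V R + ((card A)^3 + (card B)^3)) \<le> real (count3 V ?Mis + (card V)^3)" by (rule of_nat_mono)
    then have "(3/4 - \<beta>^3/8) * M^3 + a^3 + (M - a)^3 \<le> 500000 * \<beta> * M^3 + M^3"
      using dense mis cB by (simp add: M_def a_def)
    moreover have "a^3 + (M - a)^3 = M^3 - 3 * (a * (M - a)) * M" by (simp add: power3_eq_cube algebra_simps)
    ultimately have 1: "(3/4 - \<beta>^3/8 - 500000 * \<beta>) * M^3 \<le> 3 * (a * (M - a)) * M" by (simp add: algebra_simps)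
    have "\<beta>^3 \<le> \<beta>" using \<beta> b2 by (simp add: power3_eq_cube power2_eq_square mult_le_one)
    then have "738/1000 \<le> 3/4 - \<beta>^3/8 - 500000 * \<beta>" using \<beta> by simp
    moreover have "0 \<le> M^3" using M0 by simp
    ultimately have "738/1000 * M^3 \<le> (3/4 - \<beta>^3/8 - 500000 * \<beta>) * M^3" by (rule mult_right_mono)
    then have "738/1000 * M^3 \<le> 3 * (a * (M - a)) * M" using 1 by (rule order_trans)
    moreover have "738/1000 * M^3 = 3 * ((246/1000 * M\<^sup>2) * M)" by (simp add: power2_eq_square power3_eq_cube)
    moreover have "3 * (a * (M - a)) * M = 3 * ((a * (M - a)) * M)" by (simp only: mult.assoc)
    ultimately have "(246/1000 * M\<^sup>2) * M \<le> (a * (M - a)) * M" by linarith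
    then have "246/1000 * M\<^sup>2 \<le> a * (M - a)" using M0 by (simp only: mult_le_cancel_right_pos)
    then show ?thesis by (simp only:)
  qed
  have big_part: "2/5 * M < x" if "x = a \<or> x = M - a" for x
  proof (rule ccontr)
    assume n: "\<not> 2/5 * M < x"
    have "0 \<le> (2/5 * M - x) * (3/5 * M - x)" using n M0 by (intro mult_nonneg_nonneg) auto
    moreover have "x * (M - x) = a * (M - a)" using that by auto
    ultimately have "a * (M - a) \<le> 6/25 * M\<^sup>2" by (simp add: power2_eq_square algebra_simps)
    moreover have "0 < M\<^sup>2" using M0 by simp
    ultimately show False using sz by linarith
  qed
  have inner: "real (count3 V (\<lambda>u v w. u \<in> C \<and> v \<in> C \<and> w \<in> C \<and> H u v w)) \<le> 60000000 * \<beta> * M^3"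
    if CD: "C = A \<and> D = B \<or> C = B \<and> D = A" for C D
  proof -
    have CV: "C \<subseteq> V" "D \<subseteq> V" "finite C" "finite D" "C \<inter> D = {}" using CD A BV fA by (auto simp: B_def)
    have Dsz: "2/5 * M < real (card D)" using CD big_part cB a_def by auto
    define de where "de = (\<lambda>x. count2 D (\<lambda>u v. \<not> R x u v))"
    \<comment> \<open>Below one sixth of the pairs missing at each of three vertices, their sum
      meets the hypothesis of \<open>exists_factor\<close>.\<close>
    define Hv where "Hv = {x\<in>C. (card D)\<^sup>2 \<le> 6 * de x}"
    have HvV: "Hv \<subseteq> V" using CV by (auto simp: Hv_def)
    have "(\<Sum>x\<in>C. de x) \<le> count3 V ?Mis"
    proof -
      have "(\<Sum>x\<in>C. de x) \<le> (\<Sum>x\<in>C. count2 V (\<lambda>u v. ?Mis x u v))"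
      proof (rule sum_mono)
        fix x assume x: "x \<in> C"
        have "de x \<le> count2 D (\<lambda>u v. ?Mis x u v)" unfolding de_def
          by (rule count2_mono) (use x CD in \<open>auto simp: cross_def B_def\<close>)
        also have "\<dots> \<le> count2 V (\<lambda>u v. ?Mis x u v)"
          by (rule count2_subset[OF fin CV(2)])
        finally show "de x \<le> count2 V (\<lambda>u v. ?Mis x u v)" .
      qed
      also have "\<dots> \<le> count3 V ?Mis" using CV fin by (intro sum_mono2) auto
      finally show ?thesis .
    qed
    moreover have "card Hv * (card D)\<^sup>2 \<le> 6 * (\<Sum>x\<in>C. de x)"
    proof -
      have "card Hv * (card D)\<^sup>2 \<le> (\<Sum>x\<in>Hv. 6 * de x)"
        using sum_mono[of Hv "\<lambda>_. (card D)\<^sup>2" "\<lambda>x. 6 * de x"] by (simp add: Hv_def)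
      also have "\<dots> \<le> (\<Sum>x\<in>C. 6 * de x)" using CV by (intro sum_mono2) (auto simp: Hv_def)
      finally show ?thesis by (simp add: sum_distrib_left)
    qed
    ultimately have "card Hv * (card D)\<^sup>2 \<le> 6 * count3 V ?Mis" by linarith
    then have "real (card Hv * (card D)\<^sup>2) \<le> real (6 * count3 V ?Mis)" by (rule of_nat_mono)
    then have 1: "real (card Hv) * (real (card D))\<^sup>2 \<le> 3000000 * \<beta> * M^3" using mis by simp
    have "real (card Hv) * (2/5 * M)\<^sup>2 \<le> real (card Hv) * (real (card D))\<^sup>2"
      using Dsz M0 by (intro mult_left_mono power_mono) auto
    then have "real (card Hv) * (2/5 * M)\<^sup>2 \<le> 3000000 * \<beta> * M^3" using 1 by linarith
    then have Hv: "real (card Hv) * M\<^sup>2 \<le> 18750000 * \<beta> * M^3" by (simp add: power2_eq_square mult_ac)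
    have "count3 V (\<lambda>u v w. u \<in> C \<and> v \<in> C \<and> w \<in> C \<and> H u v w) \<le> count3 V (\<lambda>u v w. u \<in> Hv \<or> (v \<in> Hv \<or> w \<in> Hv))"
    proof (rule count3_mono)
      fix x y z assume "x \<in> V" "y \<in> V" "z \<in> V" and h: "x \<in> C \<and> y \<in> C \<and> z \<in> C \<and> H x y z"
      show "x \<in> Hv \<or> (y \<in> Hv \<or> z \<in> Hv)"
      proof (rule ccontr)
        assume "\<not> ?thesis"
        then have "6 * de x < (card D)\<^sup>2" "6 * de y < (card D)\<^sup>2" "6 * de z < (card D)\<^sup>2" using h by (auto simp: Hv_def)
        then have "2 * (de x + de y + de z) < (card D)\<^sup>2" unfolding add_mult_distrib2 by linarith
        then have "2 * (count2 D (\<lambda>u v. \<not> R x u v) + count2 D (\<lambda>u v. \<not> R y u v) + count2 D (\<lambda>u v. \<not> R z u v)) < (card D)\<^sup>2"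
          unfolding de_def .
        from exists_factor[OF CV(4) this] show False using nof h by blast
      qed
    qed
    also have "\<dots> \<le> count3 V (\<lambda>u v w. u \<in> Hv) + (count3 V (\<lambda>u v w. v \<in> Hv) + count3 V (\<lambda>u v w. w \<in> Hv))"
      by (rule order_trans[OF count3_disj], rule add_left_mono, rule count3_disj)
    also have "count3 V (\<lambda>u v w. v \<in> Hv) = count3 V (\<lambda>u v w. u \<in> Hv)" by (rule count3_rotate(1))
    also have "count3 V (\<lambda>u v w. w \<in> Hv) = count3 V (\<lambda>u v w. u \<in> Hv)" by (rule count3_rotate(3))
    also have "count3 V (\<lambda>u v w. u \<in> Hv) = card Hv * (card V)\<^sup>2" by (rule count3_fst[OF fin HvV])
    finally have "real (count3 V (\<lambda>u v w. u \<in> C \<and> v \<in> C \<and> w \<in> C \<and> H u v w)) \<le> real (card Hv * (card V)\<^sup>2 + (card Hv * (card V)\<^sup>2 + card Hv * (card V)\<^sup>2))"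
      by (rule of_nat_mono)
    also have "\<dots> = 3 * (real (card Hv) * M\<^sup>2)" by (simp add: M_def)
    also have "\<dots> \<le> 60000000 * \<beta> * M^3"
    proof -
      have "0 \<le> \<beta> * M^3" using \<beta> M0 by simp
      then show ?thesis using Hv by linarith
    qed
    finally show ?thesis .
  qed
  let ?IA = "\<lambda>u v w. u \<in> A \<and> v \<in> A \<and> w \<in> A \<and> H u v w"
  let ?IB = "\<lambda>u v w. u \<in> B \<and> v \<in> B \<and> w \<in> B \<and> H u v w"
  have "count3 V (\<lambda>u v w. H u v w \<noteq> cross A u v w) \<le> count3 V (\<lambda>u v w. ?Mis u v w \<or> (?IA u v w \<or> ?IB u v w))"
    by (rule count3_mono) (use sub in \<open>unfold cross_def B_def, blast\<close>)
  also have "\<dots> \<le> count3 V ?Mis + (count3 V ?IA + count3 V ?IB)"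
    by (rule order_trans[OF count3_disj], rule add_left_mono, rule count3_disj)
  finally have "real (count3 V (\<lambda>u v w. H u v w \<noteq> cross A u v w)) \<le> real (count3 V ?Mis + (count3 V ?IA + count3 V ?IB))"
    by (rule of_nat_mono)
  then have "real (count3 V (\<lambda>u v w. H u v w \<noteq> cross A u v w)) \<le> 500000 * \<beta> * M^3 + 60000000 * \<beta> * M^3 + 60000000 * \<beta> * M^3"
    using mis inner[of A B] inner[of B A] by simp
  also have "\<dots> \<le> 200000000 * \<beta> * M^3"
  proof -
    have "0 \<le> \<beta> * M^3" using \<beta> M0 by simp
    then show ?thesis by linarith
  qed
  finally show ?thesis using A by (intro exI[of _ A]) (auto simp: M_def)
qed

section \<open>Sampling\<close>

text \<open>Swapping the \<open>D\<close>-coordinates of \<open>u\<close> with their \<sigma>-images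
  in \<open>w\<close> is an involution on pairs of tuples. Sampling distinct coordinates and gluing
  two tuples are both instances.\<close>

lemma sum_PiE_exchange:
  fixes h :: "('i \<Rightarrow> 'a) \<Rightarrow> ('k \<Rightarrow> 'a) \<Rightarrow> 'c::comm_monoid_add"
  assumes inj: "inj_on \<sigma> D" and sub: "D \<subseteq> K" "\<sigma> ` D \<subseteq> I"
  shows "(\<Sum>w\<in>PiE I (\<lambda>_. V). \<Sum>u\<in>PiE K (\<lambda>_. V).
      h (\<lambda>i. if i \<in> \<sigma> ` D then u (the_inv_into D \<sigma> i) else w i) (\<lambda>k. if k \<in> D then w (\<sigma> k) else u k))
    = (\<Sum>w\<in>PiE I (\<lambda>_. V). \<Sum>u\<in>PiE K (\<lambda>_. V). h w u)"
proof -
  define T where "T = (\<lambda>(w::'i \<Rightarrow> 'a, u::'k \<Rightarrow> 'a).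
      (\<lambda>i. if i \<in> \<sigma> ` D then u (the_inv_into D \<sigma> i) else w i, \<lambda>k. if k \<in> D then w (\<sigma> k) else u k))"
  let ?X = "PiE I (\<lambda>_. V) \<times> PiE K (\<lambda>_. V)"
  have inv: "the_inv_into D \<sigma> (\<sigma> k) = k" if "k \<in> D" for k using the_inv_into_f_f[OF inj that] .
  have mem: "T p \<in> ?X" if "p \<in> ?X" for p
  proof -
    obtain w u where p: "p = (w,u)" by (cases p)
    have w: "w \<in> PiE I (\<lambda>_. V)" and u: "u \<in> PiE K (\<lambda>_. V)" using that p by auto
    have "(\<lambda>i. if i \<in> \<sigma> ` D then u (the_inv_into D \<sigma> i) else w i) \<in> PiE I (\<lambda>_. V)"
      by (rule PiE_I) (use w u sub inv in \<open>auto simp: PiE_iff extensional_def\<close>)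
    moreover have "(\<lambda>k. if k \<in> D then w (\<sigma> k) else u k) \<in> PiE K (\<lambda>_. V)"
      by (rule PiE_I) (use w u sub in \<open>auto simp: PiE_iff extensional_def\<close>)
    ultimately show ?thesis by (simp add: T_def p)
  qed
  have invol: "T (T p) = p" for p
  proof -
    obtain w u where p: "p = (w,u)" by (cases p)
    show ?thesis unfolding p T_def by (auto simp: fun_eq_iff inv)
  qed
  have "(\<Sum>p\<in>?X. case T p of (w,u) \<Rightarrow> h w u) = (\<Sum>p\<in>?X. case p of (w,u) \<Rightarrow> h w u)"
    by (rule sum.reindex_bij_witness[of _ T T]) (use mem invol in auto)
  then show ?thesis by (simp add: sum.cartesian_product T_def split_def)
qed

lemma sum_PiE_sample:
  fixes g :: "('k \<Rightarrow> 'a) \<Rightarrow> real"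
  assumes fin: "finite I" "finite K" and inj: "inj_on \<sigma> K" "\<sigma> ` K \<subseteq> I"
  shows "real (card V) ^ card K * (\<Sum>w\<in>PiE I (\<lambda>_. V). g (restrict (\<lambda>k. w (\<sigma> k)) K))
    = real (card V) ^ card I * (\<Sum>u\<in>PiE K (\<lambda>_. V). g u)"
proof -
  have "(\<Sum>w\<in>PiE I (\<lambda>_. V). \<Sum>u\<in>PiE K (\<lambda>_. V). g (\<lambda>k. if k \<in> K then w (\<sigma> k) else u k))
    = (\<Sum>w\<in>PiE I (\<lambda>_. V). \<Sum>u\<in>PiE K (\<lambda>_. V). g u)"
    by (rule sum_PiE_exchange[OF inj(1) order_refl inj(2), where V = V and h = "\<lambda>w u. g u"])
  moreover have "(\<lambda>k. if k \<in> K then w (\<sigma> k) else u k) = restrict (\<lambda>k. w (\<sigma> k)) K"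
    if "u \<in> PiE K (\<lambda>_. V)" for w u
    using that by (auto simp: fun_eq_iff PiE_iff extensional_def)
  ultimately have "(\<Sum>w\<in>PiE I (\<lambda>_. V). \<Sum>u\<in>PiE K (\<lambda>_. V). g (restrict (\<lambda>k. w (\<sigma> k)) K))
    = (\<Sum>w\<in>PiE I (\<lambda>_. V). \<Sum>u\<in>PiE K (\<lambda>_. V). g u)" by simp
  then show ?thesis using fin by (simp add: card_PiE flip: sum_distrib_left)
qed

text \<open>The exchange with \<sigma> the identity: two independent uniform tuples glued along
  \<open>D\<close> form a uniform tuple. The pinning argument averages over such glued
  copies.\<close>

lemma sum_PiE_merge:
  fixes g :: "('i \<Rightarrow> 'a) \<Rightarrow> real"
  assumes "D \<subseteq> J" "finite J"
  shows "(\<Sum>w\<in>PiE J (\<lambda>_. V). \<Sum>u\<in>PiE J (\<lambda>_. V). g (\<lambda>i. if i \<in> D then w i else u i))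
    = real (card V) ^ card J * (\<Sum>w\<in>PiE J (\<lambda>_. V). g w)"
proof -
  have "(\<Sum>w\<in>PiE J (\<lambda>_. V). \<Sum>u\<in>PiE J (\<lambda>_. V). g (\<lambda>i. if i \<in> id ` (J - D) then u (the_inv_into (J - D) id i) else w i))
    = (\<Sum>w\<in>PiE J (\<lambda>_. V). \<Sum>u\<in>PiE J (\<lambda>_. V). g w)"
    by (rule sum_PiE_exchange[where \<sigma> = id and D = "J - D" and K = J and I = J and V = V and h = "\<lambda>w u. g w"]) auto
  moreover have "(\<lambda>i. if i \<in> id ` (J - D) then u (the_inv_into (J - D) id i) else w i) = (\<lambda>i. if i \<in> D then w i else u i)"
    if "w \<in> PiE J (\<lambda>_. V)" "u \<in> PiE J (\<lambda>_. V)" for w u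
  proof
    fix i
    have "the_inv_into (J - D) id i = i" if "i \<in> J - D" using the_inv_into_f_f[of id "J - D" i] that by simp
    then show "(if i \<in> id ` (J - D) then u (the_inv_into (J - D) id i) else w i) = (if i \<in> D then w i else u i)"
      using that assms(1) by (auto simp: PiE_iff extensional_def)
  qed
  ultimately have "(\<Sum>w\<in>PiE J (\<lambda>_. V). \<Sum>u\<in>PiE J (\<lambda>_. V). g (\<lambda>i. if i \<in> D then w i else u i))
    = (\<Sum>w\<in>PiE J (\<lambda>_. V). \<Sum>u\<in>PiE J (\<lambda>_. V). g w)" by simp
  then show ?thesis using assms by (simp add: card_PiE sum_distrib_left)
qed

lemma sum_PiE_insert:
  fixes g :: "('i \<Rightarrow> 'a) \<Rightarrow> 'c::comm_monoid_add"
  assumes "k \<notin> K"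
  shows "(\<Sum>u\<in>PiE (insert k K) V. g u) = (\<Sum>v\<in>V k. \<Sum>u\<in>PiE K V. g (u(k := v)))"
proof -
  have "(\<Sum>u\<in>PiE (insert k K) V. g u) = (\<Sum>p\<in>V k \<times> PiE K V. g ((\<lambda>(y,h). h(k := y)) p))"
    unfolding PiE_insert_eq by (rule sum.reindex[OF inj_combinator[OF assms], unfolded o_def])
  then show ?thesis by (simp add: sum.cartesian_product split_def)
qed

section \<open>Sums over random tuples\<close>

abbreviation tuples :: "nat \<Rightarrow> 'a set \<Rightarrow> (nat \<Rightarrow> 'a) set" where
  "tuples k V \<equiv> PiE {..<k} (\<lambda>_. V)"

lemma sum_tuples_0: "(\<Sum>u\<in>tuples 0 V. g u) = g (\<lambda>_. undefined)"
  by simp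

lemma sum_tuples_Suc: "(\<Sum>u\<in>tuples (Suc k) V. g u) = (\<Sum>v\<in>V. \<Sum>u\<in>tuples k V. g (u(k := v)))"
  unfolding lessThan_Suc by (rule sum_PiE_insert) simp

text \<open>The indices run downwards because \<open>sum_tuples_Suc\<close> peels off the highest
  coordinate as the outermost sum.\<close>

lemma sum_tuples_3: "(\<Sum>u\<in>tuples 3 V. g (u 2) (u 1) (u 0)) = (\<Sum>x\<in>V. \<Sum>y\<in>V. \<Sum>z\<in>V. g x y z)"
  by (simp add: numeral_3_eq_3 numeral_2_eq_2 sum_tuples_Suc sum_tuples_0)

lemma sum_tuples_6:
  "(\<Sum>u\<in>tuples 6 V. g (u 5) (u 4) (u 3) (u 2) (u 1) (u 0)) =
    (\<Sum>a\<in>V. \<Sum>b\<in>V. \<Sum>c\<in>V. \<Sum>x\<in>V. \<Sum>y\<in>V. \<Sum>z\<in>V. g a b c x y z)"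
  by (simp add: eval_nat_numeral sum_tuples_Suc sum_tuples_0)

lemma finite_tuples: "finite V \<Longrightarrow> finite (tuples k V)"
  by (simp add: finite_PiE)

lemma card_tuples: "card (tuples k V) = card V ^ k"
  by (simp add: card_PiE)

lemma sum_tuples_sample:
  fixes g :: "(nat \<Rightarrow> 'a) \<Rightarrow> real"
  assumes fin: "finite V" and ne: "V \<noteq> {}" and s: "inj_on \<sigma> {..<k}" "\<sigma> ` {..<k} \<subseteq> {..<M}"
  shows "(\<Sum>w\<in>tuples M V. g (restrict (\<lambda>j. w (\<sigma> j)) {..<k})) = real (card V) ^ M / real (card V) ^ k * (\<Sum>u\<in>tuples k V. g u)"
proof -
  have "real (card V) > 0" using fin ne by (simp add: card_gt_0_iff)
  then show ?thesis using sum_PiE_sample[OF _ _ s, of V g] by (simp add: field_simps)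
qed

lemma count3_sample:
  assumes fin: "finite V" and ne: "V \<noteq> {}" and d: "i < M" "j < M" "k < M" "i \<noteq> j" "j \<noteq> k" "i \<noteq> k"
  shows "(\<Sum>w\<in>tuples M V. of_bool (P (w i) (w j) (w k))) = real (card V) ^ M / real (card V) ^ 3 * real (count3 V P)"
proof -
  define \<sigma> where "\<sigma> = (\<lambda>x::nat. if x = 2 then i else if x = 1 then j else k)"
  have l3: "{..<3} = {0,1,2::nat}" by auto
  have "inj_on \<sigma> {..<3}" "\<sigma> ` {..<3} \<subseteq> {..<M}" unfolding l3 using d by (auto simp: \<sigma>_def inj_on_def)
  from sum_tuples_sample[OF fin ne this, of "\<lambda>u. of_bool (P (u 2) (u 1) (u 0))"]
  have "(\<Sum>w\<in>tuples M V. of_bool (P (w i) (w j) (w k))) = real (card V) ^ M / real (card V) ^ 3 * (\<Sum>u\<in>tuples 3 V. of_bool (P (u 2) (u 1) (u 0)))"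
    by (simp add: \<sigma>_def del: One_nat_def)
  then show ?thesis using sum_tuples_3[where V = V and g = "\<lambda>x y z. of_bool (P x y z) :: real"]
    by (simp only: of_nat_sum of_nat_of_bool)
qed

lemma count3_distinct:
  "card V ^ 3 \<le> count3 V (\<lambda>i j k. i \<noteq> j \<and> j \<noteq> k \<and> i \<noteq> k) + 3 * (card V)\<^sup>2" if "finite V"
proof -
  have one: "(\<Sum>j\<in>V. (of_bool (i = j) :: nat)) \<le> 1" for i
    using that by (simp add: card_le_Suc0_iff_eq)
  have one': "(\<Sum>j\<in>V. (of_bool (j = i) :: nat)) \<le> 1" for i using one[of i] by (simp only: eq_commute)
  have c: "count3 V (\<lambda>i j k. j = k) \<le> (card V)\<^sup>2"
  proof -
    have "count3 V (\<lambda>i j k. j = k) \<le> (\<Sum>i\<in>V. \<Sum>j\<in>V. 1)" by (intro sum_mono one)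
    then show ?thesis by (simp add: power2_eq_square)
  qed
  have c2: "count3 V (\<lambda>i j k. i = k) \<le> (card V)\<^sup>2" using c count3_rotate(1)[of "\<lambda>i j k. j = k" V] by simp
  have c3: "count3 V (\<lambda>i j k. i = j) \<le> (card V)\<^sup>2" using c2 count3_rotate(2)[of "\<lambda>i j k. i = k" V] by simp
  have "card V ^ 3 = count3 V (\<lambda>_ _ _. True)" by (simp add: power3_eq_cube)
  also have "\<dots> \<le> count3 V (\<lambda>i j k. (i \<noteq> j \<and> j \<noteq> k \<and> i \<noteq> k) \<or> (i = j \<or> (j = k \<or> i = k)))"
    by (rule count3_mono) blast
  also have "\<dots> \<le> count3 V (\<lambda>i j k. i \<noteq> j \<and> j \<noteq> k \<and> i \<noteq> k) + ((card V)\<^sup>2 + ((card V)\<^sup>2 + (card V)\<^sup>2))"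
    by (rule order_trans[OF count3_disj add_left_mono], rule order_trans[OF count3_disj add_mono[OF c3]],
        rule order_trans[OF count3_disj add_mono[OF c c2]])
  finally show ?thesis by simp
qed

text \<open>Positions 0, 1, 2 carry the one line taken from \<open>H\<close>; the matchings of
  positions 3, 4, 5, 6 lie in their \<open>R\<close>-links. The labelling agrees with
  \<open>line\<close>, whose last line is \<open>{0,1,2}\<close>.\<close>

definition fano6 :: "('a \<Rightarrow> 'a \<Rightarrow> 'a \<Rightarrow> bool) \<Rightarrow> ('a \<Rightarrow> 'a \<Rightarrow> 'a \<Rightarrow> bool) \<Rightarrow> (nat \<Rightarrow> 'a) \<Rightarrow> bool" where
  "fano6 H R u \<longleftrightarrow> H (u 0) (u 1) (u 2) \<and> R (u 0) (u 3) (u 4) \<and> R (u 0) (u 5) (u 6) \<and> R (u 1) (u 3) (u 5)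
     \<and> R (u 1) (u 4) (u 6) \<and> R (u 2) (u 3) (u 6) \<and> R (u 2) (u 4) (u 5)"

text \<open>A random \<open>M\<close>-tuple of vertices induces relations on its indices. Most
  samples contain no forbidden plane and have \<open>R\<close>-density near 3/4, so
  \<open>near_bipartite_super\<close> bipartitions them exactly where it is provable. These
  bipartitions vary with the sample; they are made global by a condition on six vertices that speaks
  of \<open>H\<close> only.\<close>

lemma near_bipartite_of_few_fano:
  fixes \<beta> \<delta>' \<epsilon> :: real and H R :: "'v \<Rightarrow> 'v \<Rightarrow> 'v \<Rightarrow> bool"
  assumes symR: "\<And>x y z. R x y z \<Longrightarrow> R y x z" "\<And>x y z. R x y z \<Longrightarrow> R x z y"
    and symH: "\<And>x y z. H x y z \<Longrightarrow> H y x z" "\<And>x y z. H x y z \<Longrightarrow> H x z y"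
    and sub: "\<And>x y z. R x y z \<Longrightarrow> H x y z" and dist: "\<And>x y z. H x y z \<Longrightarrow> x \<noteq> y"
    and fin: "finite V" and ne: "V \<noteq> {}" and \<beta>: "\<beta> = 1/10^24"
    and M: "16 / \<beta>\<^sup>2 \<le> real M" "3 / real M \<le> \<beta>^3 / 8 / 10^16"
    and \<delta>: "\<delta>' \<le> \<beta>^3 / 8 / 10^16" and \<epsilon>: "real M^7 * \<epsilon> \<le> \<beta>^3 / 8 / 10^16"
    and dense: "(3/4 - \<delta>') * (card V)^3 \<le> count3 V R"
    and few: "(\<Sum>u\<in>tuples 7 V. of_bool (fano6 H R u)) \<le> \<epsilon> * (card V)^7"
  shows "\<exists>A\<subseteq>V. real (count3 V (\<lambda>u v w. H u v w \<noteq> cross A u v w)) \<le> (card V)^3 / 10^8"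
proof -
  define n where "n = real (card V)"
  have n0: "n > 0" using fin ne by (simp add: n_def card_gt_0_iff)
  define d where "d = \<beta>^3 / 8"
  have d0: "d > 0" by (simp add: d_def \<beta>)
  define W where "W = tuples M V"
  define I where "I = {..<M}"
  define m where "m = real M"
  have finI: "finite I" and cI: "card I = M" by (simp_all add: I_def)
  have finW: "finite W" unfolding W_def by (rule finite_tuples[OF fin])
  have cW: "real (card W) = n ^ M" by (simp add: W_def card_tuples n_def)
  have big: "16 * 10^48 \<le> m" using M(1) by (simp add: m_def \<beta> power2_eq_square)
  have m0: "m > 0" using big by simp
  have "(7::real) \<le> 16 * 10^48" by simp
  then have M7: "7 \<le> M" using big unfolding m_def by linarith
  define Rw where "Rw = (\<lambda>w i j k. i < M \<and> j < M \<and> k < M \<and> R (w i :: 'v) (w j) (w k))"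
  define Hw where "Hw = (\<lambda>w i j k. i < M \<and> j < M \<and> k < M \<and> H (w i :: 'v) (w j) (w k))"
  define fan where "fan = (\<lambda>w. \<exists>\<sigma>\<in>tuples 7 I. fano6 H R (restrict (\<lambda>k. w (\<sigma> k)) {..<7}))"
  have l7: "{..<7} = {0,1,2,3,4,5,6::nat}" by auto
  have Hdist: "x \<noteq> y \<and> y \<noteq> z \<and> x \<noteq> z" if "H x y z" for x y z
    using dist[OF that] dist[OF symH(1)[OF symH(2)[OF that]]] dist[OF symH(2)[OF that]]
      dist[OF symH(2)[OF symH(1)[OF that]]] by blast
  have Finj: "inj_on u {..<7}" if "fano6 H R u" for u
  proof -
    have h: "H (u 0) (u 1) (u 2)" "H (u 0) (u 3) (u 4)" "H (u 0) (u 5) (u 6)" "H (u 1) (u 3) (u 5)"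
      "H (u 1) (u 4) (u 6)" "H (u 2) (u 3) (u 6)" "H (u 2) (u 4) (u 5)" using that sub unfolding fano6_def by blast+
    note D = Hdist[OF h(1)] Hdist[OF h(2)] Hdist[OF h(3)] Hdist[OF h(4)] Hdist[OF h(5)] Hdist[OF h(6)] Hdist[OF h(7)]
    show ?thesis unfolding l7 using D by (simp add: inj_on_insert)
  qed
  \<comment> \<open>Union bound over the \<open>M^7\<close> placements; a placement repeating an
    index is never a plane, since the seven points are distinct.\<close>
  have b1: "real (card {w\<in>W. fan w}) \<le> m^7 * \<epsilon> * n^M"
  proof -
    have "real (card {w\<in>W. fan w}) = (\<Sum>w\<in>W. of_bool (fan w))" by (rule card_filter_sum[OF finW])
    also have "\<dots> \<le> (\<Sum>w\<in>W. \<Sum>\<sigma>\<in>tuples 7 I. of_bool (fano6 H R (restrict (\<lambda>k. w (\<sigma> k)) {..<7})))"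
    proof (rule sum_mono)
      fix w
      show "(of_bool (fan w) :: real) \<le> (\<Sum>\<sigma>\<in>tuples 7 I. of_bool (fano6 H R (restrict (\<lambda>k. w (\<sigma> k)) {..<7})))"
      proof (cases "fan w")
        case True
        then obtain \<sigma> where s: "\<sigma> \<in> tuples 7 I" "fano6 H R (restrict (\<lambda>k. w (\<sigma> k)) {..<7})" unfolding fan_def by blast
        then have "(1::real) = of_bool (fano6 H R (restrict (\<lambda>k. w (\<sigma> k)) {..<7}))" by simp
        also have "\<dots> \<le> (\<Sum>\<sigma>\<in>tuples 7 I. of_bool (fano6 H R (restrict (\<lambda>k. w (\<sigma> k)) {..<7})))"
          by (rule member_le_sum[OF s(1)]) (use finite_tuples[OF finI] in auto)
        finally show ?thesis using True by simp
      qed (simp add: sum_nonneg)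
    qed
    also have "\<dots> = (\<Sum>\<sigma>\<in>tuples 7 I. \<Sum>w\<in>W. of_bool (fano6 H R (restrict (\<lambda>k. w (\<sigma> k)) {..<7})))" by (rule sum.swap)
    also have "\<dots> \<le> (\<Sum>\<sigma>\<in>tuples 7 I. \<epsilon> * n^M)"
    proof (rule sum_mono)
      fix \<sigma> assume s: "\<sigma> \<in> tuples 7 I"
      have e0: "0 \<le> \<epsilon>"
      proof -
        have "0 \<le> (\<Sum>u\<in>tuples 7 V. (of_bool (fano6 H R u) :: real))" by (intro sum_nonneg) auto
        then have "0 \<le> \<epsilon> * n^7" using few by (simp add: n_def)
        then show ?thesis using n0 by (simp add: zero_le_mult_iff)
      qed
      show "(\<Sum>w\<in>W. of_bool (fano6 H R (restrict (\<lambda>k. w (\<sigma> k)) {..<7}))) \<le> \<epsilon> * n^M"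
      proof (cases "inj_on \<sigma> {..<7}")
        case True
        have "\<sigma> ` {..<7} \<subseteq> {..<M}" using s by (auto simp: I_def)
        from sum_tuples_sample[OF fin ne True this, of "\<lambda>u. of_bool (fano6 H R u)"]
        have "(\<Sum>w\<in>W. of_bool (fano6 H R (restrict (\<lambda>k. w (\<sigma> k)) {..<7}))) = n^M / n^7 * (\<Sum>u\<in>tuples 7 V. of_bool (fano6 H R u))"
          unfolding W_def n_def .
        also have "\<dots> \<le> n^M / n^7 * (\<epsilon> * n^7)" using few n0 by (intro mult_left_mono) (auto simp: n_def)
        finally show ?thesis using n0 by (simp add: mult.commute)
      next
        case False
        have "\<not> fano6 H R (restrict (\<lambda>k. w (\<sigma> k)) {..<7})" for w
        proof
          assume "fano6 H R (restrict (\<lambda>k. w (\<sigma> k)) {..<7})"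
          then have "inj_on (restrict (\<lambda>k. w (\<sigma> k)) {..<7}) {..<7}" by (rule Finj)
          then have "inj_on \<sigma> {..<7}" by (auto simp: inj_on_def)
          then show False using False by simp
        qed
        then show ?thesis using e0 n0 by simp
      qed
    qed
    also have "\<dots> = m^7 * \<epsilon> * n^M" by (simp add: card_tuples cI m_def)
    finally show ?thesis .
  qed
  have nof: "\<not> (Hw w x y z \<and> Rw w x a b \<and> Rw w x c e \<and> Rw w y a c \<and> Rw w y b e \<and> Rw w z a e \<and> Rw w z b c)"
    if nf: "\<not> fan w" for w x y z a b c e
  proof
    assume h: "Hw w x y z \<and> Rw w x a b \<and> Rw w x c e \<and> Rw w y a c \<and> Rw w y b e \<and> Rw w z a e \<and> Rw w z b c"
    define \<sigma> where "\<sigma> = (\<lambda>k::nat. if k = 0 then x else if k = 1 then y else if k = 2 then z else if k = 3 then a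
        else if k = 4 then b else if k = 5 then c else if k = 6 then e else undefined)"
    have "\<sigma> \<in> tuples 7 I"
      by (rule PiE_I) (use h in \<open>auto simp: \<sigma>_def I_def Hw_def Rw_def\<close>)
    moreover have "fano6 H R (restrict (\<lambda>k. w (\<sigma> k)) {..<7})"
      using h by (simp add: fano6_def \<sigma>_def Hw_def Rw_def)
    ultimately show False using nf unfolding fan_def by blast
  qed
  have ff: "fano_free (Rw w)" if nf: "\<not> fan w" for w
  proof
    show "Rw w x y z \<Longrightarrow> Rw w y x z" for x y z unfolding Rw_def using symR(1) by blast
    show "Rw w x y z \<Longrightarrow> Rw w x z y" for x y z unfolding Rw_def using symR(2) by blast
    show "Rw w x y z \<Longrightarrow> x \<noteq> y" for x y z unfolding Rw_def using dist sub by blast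
    show "\<not> (Rw w x y z \<and> Rw w x a b \<and> Rw w x c d \<and> Rw w y a c \<and> Rw w y b d \<and> Rw w z a d \<and> Rw w z b c)" for x y z a b c d
    proof -
      have "Rw w x y z \<Longrightarrow> Hw w x y z" unfolding Rw_def Hw_def using sub by blast
      then show ?thesis using nof[OF nf, of x y z a b c d] by blast
    qed
  qed
  define good where "good = (\<lambda>w. \<not> fan w \<and> (3/4 - d) * m^3 \<le> real (count3 I (Rw w)))"
  have swapsum: "(\<Sum>w\<in>W. real (count3 I (\<lambda>i j k. P (w i) (w j) (w k)))) = (\<Sum>i\<in>I. \<Sum>j\<in>I. \<Sum>k\<in>I. \<Sum>w\<in>W. of_bool (P (w i) (w j) (w k)))" for P :: "'v \<Rightarrow> 'v \<Rightarrow> 'v \<Rightarrow> bool"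
  proof -
    have "(\<Sum>w\<in>W. real (count3 I (\<lambda>i j k. P (w i) (w j) (w k)))) = (\<Sum>w\<in>W. \<Sum>i\<in>I. \<Sum>j\<in>I. \<Sum>k\<in>I. of_bool (P (w i) (w j) (w k)))" by simp
    also have "\<dots> = (\<Sum>i\<in>I. \<Sum>w\<in>W. \<Sum>j\<in>I. \<Sum>k\<in>I. of_bool (P (w i) (w j) (w k)))" by (rule sum.swap)
    also have "\<dots> = (\<Sum>i\<in>I. \<Sum>j\<in>I. \<Sum>w\<in>W. \<Sum>k\<in>I. of_bool (P (w i) (w j) (w k)))" by (intro sum.cong refl sum.swap)
    also have "\<dots> = (\<Sum>i\<in>I. \<Sum>j\<in>I. \<Sum>k\<in>I. \<Sum>w\<in>W. of_bool (P (w i) (w j) (w k)))" by (intro sum.cong refl sum.swap)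
    finally show ?thesis .
  qed
  have dist3: "m^3 - 3 * m\<^sup>2 \<le> real (count3 I (\<lambda>i j k. i \<noteq> j \<and> j \<noteq> k \<and> i \<noteq> k))"
  proof -
    have "real (card I ^ 3) \<le> real (count3 I (\<lambda>i j k. i \<noteq> j \<and> j \<noteq> k \<and> i \<noteq> k) + 3 * (card I)\<^sup>2)"
      by (rule of_nat_mono[OF count3_distinct[OF finI]])
    then show ?thesis by (simp add: cI m_def)
  qed
  have RwI: "count3 I (Rw w) = count3 I (\<lambda>i j k. R (w i) (w j) (w k))" for w
    by (intro sum.cong refl) (auto simp: Rw_def I_def)
  have HwI: "count3 I (\<lambda>i j k. \<not> Hw w i j k) = count3 I (\<lambda>i j k. \<not> H (w i) (w j) (w k))" for w
    by (intro sum.cong refl) (auto simp: Hw_def I_def)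
  have lowerT: "n^M * ((m^3 - 3 * m\<^sup>2) * (3/4 - \<delta>')) \<le> (\<Sum>w\<in>W. real (count3 I (Rw w)))"
  proof -
    let ?D = "\<lambda>i j k. i \<noteq> j \<and> j \<noteq> k \<and> i \<noteq> (k::nat)"
    have r: "(3/4 - \<delta>') \<le> real (count3 V R) / n^3" using dense n0 by (simp add: n_def pos_le_divide_eq)
    have r0: "0 \<le> 3/4 - \<delta>'" using \<delta> by (simp add: \<beta> power3_eq_cube)
    have "n^M * ((m^3 - 3 * m\<^sup>2) * (3/4 - \<delta>')) \<le> n^M * (real (count3 I ?D) * (real (count3 V R) / n^3))"
      using n0 by (intro mult_left_mono mult_mono dist3 r r0 of_nat_0_le_iff) simp
    also have "\<dots> = (\<Sum>i\<in>I. \<Sum>j\<in>I. \<Sum>k\<in>I. of_bool (?D i j k) * (n^M / n^3 * real (count3 V R)))"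
      by (simp only: sum_distrib_right[symmetric] of_nat_sum of_nat_of_bool) simp
    also have "\<dots> \<le> (\<Sum>i\<in>I. \<Sum>j\<in>I. \<Sum>k\<in>I. \<Sum>w\<in>W. of_bool (R (w i) (w j) (w k)))"
    proof (intro sum_mono)
      fix i j k assume "i \<in> I" "j \<in> I" "k \<in> I"
      then have "?D i j k \<Longrightarrow> (\<Sum>w\<in>W. of_bool (R (w i) (w j) (w k))) = n^M / n^3 * real (count3 V R)"
        unfolding W_def n_def by (intro count3_sample[OF fin ne]) (auto simp: I_def)
      moreover have "0 \<le> (\<Sum>w\<in>W. (of_bool (R (w i) (w j) (w k)) :: real))" by (intro sum_nonneg) simp
      ultimately show "of_bool (?D i j k) * (n^M / n^3 * real (count3 V R)) \<le> (\<Sum>w\<in>W. of_bool (R (w i) (w j) (w k)))"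
        by (cases "?D i j k") auto
    qed
    also have "\<dots> = (\<Sum>w\<in>W. real (count3 I (\<lambda>i j k. R (w i) (w j) (w k))))" by (rule swapsum[symmetric])
    finally show ?thesis by (simp only: RwI)
  qed
  have c3le: "real (count3 I P) \<le> m^3" for P
  proof -
    have "count3 I P \<le> count3 I (\<lambda>_ _ _. True)" by (rule count3_mono) simp
    also have "\<dots> = M^3" by (simp add: cI power3_eq_cube)
    finally have "real (count3 I P) \<le> real (M^3)" by (rule of_nat_mono)
    then show ?thesis by (simp add: m_def)
  qed
  define low where "low = (\<lambda>w. \<not> fan w \<and> \<not> good w)"
  \<comment> \<open>Fano-free samples never exceed density 3/4, so an average close to 3/4 leaves
    little mass for those below \<open>3/4 - d\<close>. This one-sided bound does the work of a
    variance estimate.\<close>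
  have point: "real (count3 I (Rw w)) \<le> 3/4 * m^3 + of_bool (fan w) * (m^3/4) - of_bool (low w) * (d * m^3)" for w
  proof (cases "fan w")
    case True
    then show ?thesis using c3le[of "Rw w"] by (simp add: low_def)
  next
    case False
    have "4 * count3 I (Rw w) \<le> 3 * (card I)^3"
      using fano_free.E_le[OF ff[OF False] finI] by (simp add: fano_free.E_def[OF ff[OF False]])
    then have "real (4 * count3 I (Rw w)) \<le> real (3 * (card I)^3)" by (rule of_nat_mono)
    then have "real (count3 I (Rw w)) \<le> 3/4 * m^3" by (simp add: cI m_def)
    then show ?thesis using False by (auto simp: low_def good_def algebra_simps)
  qed
  have "(\<Sum>w\<in>W. real (count3 I (Rw w))) \<le> (\<Sum>w\<in>W. 3/4 * m^3 + of_bool (fan w) * (m^3/4) - of_bool (low w) * (d * m^3))"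
    by (intro sum_mono point)
  also have "\<dots> = n^M * (3/4 * m^3) + real (card {w\<in>W. fan w}) * (m^3/4) - real (card {w\<in>W. low w}) * (d * m^3)"
    using cW by (simp only: sum.distrib sum_subtractf card_filter_sum[OF finW] sum_distrib_right[symmetric] sum_constant)
  finally have "n^M * ((m^3 - 3 * m\<^sup>2) * (3/4 - \<delta>')) \<le> n^M * (3/4 * m^3) + real (card {w\<in>W. fan w}) * (m^3/4) - real (card {w\<in>W. low w}) * (d * m^3)"
    using lowerT by linarith
  then have low1: "real (card {w\<in>W. low w}) * (d * m^3) \<le> n^M * (3/4 * m^3) - n^M * ((m^3 - 3 * m\<^sup>2) * (3/4 - \<delta>')) + real (card {w\<in>W. fan w}) * (m^3/4)"
    by linarith
  have e7: "m^7 * \<epsilon> \<le> d / 10^16" using \<epsilon> by (simp add: m_def d_def)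
  have nM: "n^M > 0" using n0 by simp
  have m3: "m^3 > 0" using m0 by simp
  have b1': "real (card {w\<in>W. fan w}) \<le> d / 10^16 * n^M"
    using b1 mult_right_mono[OF e7, of "n^M"] nM by linarith
  have low2: "real (card {w\<in>W. low w}) \<le> 3 / 10^16 * n^M"
  proof -
    have "3 \<le> (d / 10^16) * m" using M(2) m0 by (simp add: m_def d_def field_simps)
    then have "3 * m\<^sup>2 \<le> (d / 10^16) * m * m\<^sup>2" by (rule mult_right_mono) simp
    then have x1: "3 * m\<^sup>2 \<le> (d / 10^16) * m^3" by (simp add: power2_eq_square power3_eq_cube mult_ac)
    have x2: "\<delta>' * m^3 \<le> (d / 10^16) * m^3" using \<delta> m3 by (intro mult_right_mono) (auto simp: d_def)
    have x3: "(m^3 - 3 * m\<^sup>2) * (3/4 - \<delta>') = 3/4 * m^3 - \<delta>' * m^3 - 9/4 * m\<^sup>2 + \<delta>' * (3 * m\<^sup>2)" by (simp add: algebra_simps)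
    have "(-1/4) \<le> \<delta>'"
    proof (rule ccontr)
      assume "\<not> ?thesis"
      then have "1 * (real (card V))^3 < (3/4 - \<delta>') * (real (card V))^3" using n0 by (intro mult_strict_right_mono) (auto simp: n_def)
      then have "real (card V ^ 3) < real (count3 V R)" using dense by simp
      moreover have "count3 V R \<le> count3 V (\<lambda>_ _ _. True)" by (rule count3_mono) simp
      then have "count3 V R \<le> card V ^ 3" by (simp add: power3_eq_cube)
      ultimately show False by linarith
    qed
    then have "(-1/4) * (3 * m\<^sup>2) \<le> \<delta>' * (3 * m\<^sup>2)" by (intro mult_right_mono) auto
    then have "3/4 * m^3 - (m^3 - 3 * m\<^sup>2) * (3/4 - \<delta>') \<le> 2 * ((d / 10^16) * m^3)"
    proof -
      have "p - q \<le> 2 * D" if "(-1/4) * s \<le> e" "s \<le> D" "t \<le> D" "q = p - t - 9/4 * s' + e" "s = 3 * s'" for p q s s' e t D :: real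
        using that by linarith
      from this[OF _ x1 x2 x3 refl] show ?thesis using \<open>(-1/4) * (3 * m\<^sup>2) \<le> \<delta>' * (3 * m\<^sup>2)\<close> by blast
    qed
    then have y: "n^M * (3/4 * m^3 - (m^3 - 3 * m\<^sup>2) * (3/4 - \<delta>')) \<le> n^M * (2 * ((d / 10^16) * m^3))"
      using nM by (intro mult_left_mono) auto
    have z: "real (card {w\<in>W. fan w}) * (m^3/4) \<le> d / 10^16 * n^M * (m^3/4)" using b1' m3 by (intro mult_right_mono) auto
    have p: "0 \<le> d / 10^16 * n^M * m^3" using d0 nM m3 by simp
    have "n^M * (2 * ((d / 10^16) * m^3)) = 2 * (d / 10^16 * n^M * m^3)" "d / 10^16 * n^M * (m^3/4) = (d / 10^16 * n^M * m^3) / 4"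
      "(3 / 10^16 * n^M) * (d * m^3) = 3 * (d / 10^16 * n^M * m^3)" by (simp_all add: field_simps)
    note eqs = this
    have y': "n^M * (3/4 * m^3) - n^M * ((m^3 - 3 * m\<^sup>2) * (3/4 - \<delta>')) \<le> n^M * (2 * ((d / 10^16) * m^3))"
      unfolding right_diff_distrib[of "n^M", symmetric] by (rule y)
    have lin: "L \<le> r" if "L \<le> a - b + f" "a - b \<le> y" "f \<le> z" "y = 2 * p" "z = p / 4" "r = 3 * p" "0 \<le> p" for L r a b f y z p :: real
      using that by linarith
    have "real (card {w\<in>W. low w}) * (d * m^3) \<le> (3 / 10^16 * n^M) * (d * m^3)"
      by (rule lin[OF low1 y' z eqs p])
    then show ?thesis using d0 m3 by (simp only: mult_le_cancel_right_pos mult_pos_pos)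
  qed
  have bad: "real (card {w\<in>W. \<not> good w}) \<le> 4 / 10^16 * n^M"
  proof -
    have "card {w\<in>W. \<not> good w} \<le> card ({w\<in>W. fan w} \<union> {w\<in>W. low w})"
      by (rule card_mono) (use finW in \<open>auto simp: low_def\<close>)
    also have "\<dots> \<le> card {w\<in>W. fan w} + card {w\<in>W. low w}" by (rule card_Un_le)
    finally have "real (card {w\<in>W. \<not> good w}) \<le> real (card {w\<in>W. fan w}) + real (card {w\<in>W. low w})" by linarith
    moreover have "d / 10^16 * n^M \<le> 1 / 10^16 * n^M" using nM by (intro mult_right_mono) (auto simp: d_def \<beta> power3_eq_cube)
    ultimately show ?thesis using b1' low2 by linarith
  qed
  have ex_A: "\<exists>A\<subseteq>I. real (count3 I (\<lambda>u v t. Hw w u v t \<noteq> cross A u v t)) \<le> 2 / 10^16 * m^3" if g: "good w" for w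
  proof -
    have nf: "\<not> fan w" using g by (simp add: good_def)
    have "\<exists>A\<subseteq>I. real (count3 I (\<lambda>u v t. Hw w u v t \<noteq> cross A u v t)) \<le> 200000000 * \<beta> * (card I)^3"
    proof (rule near_bipartite_super[where R = "Rw w"])
      show "Rw w x y z \<Longrightarrow> Rw w y x z" "Rw w x y z \<Longrightarrow> Rw w x z y" "Rw w x y z \<Longrightarrow> Hw w x y z" for x y z
        unfolding Rw_def Hw_def using symR sub by blast+
      show "Hw w x y z \<Longrightarrow> Hw w y x z" "Hw w x y z \<Longrightarrow> Hw w x z y" "Hw w x y z \<Longrightarrow> x \<noteq> y" for x y z
        unfolding Hw_def using symH dist by blast+
      show "\<not> (Hw w x y z \<and> Rw w x a b \<and> Rw w x c d \<and> Rw w y a c \<and> Rw w y b d \<and> Rw w z a d \<and> Rw w z b c)" for x y z a b c d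
        by (rule nof[OF nf])
      show "(3 / 4 - \<beta> ^ 3 / 8) * real (card I ^ 3) \<le> real (count3 I (Rw w))"
        using g by (simp add: good_def d_def cI m_def)
      show "16 / \<beta>\<^sup>2 \<le> real (card I)" using M(1) by (simp add: cI)
    qed (use finI in \<open>simp_all add: \<beta>\<close>)
    then show ?thesis by (simp add: \<beta> cI m_def)
  qed
  define N3 where "N3 = real (count3 V (\<lambda>x y z. \<not> H x y z))"
  \<comment> \<open>Two classes contain at least a quarter of all ordered triples, whatever their
    sizes. Good samples hand this on to the non-edges of \<open>H\<close>, with 1/5 left after the
    errors.\<close>
  have N3: "n^3 / 5 \<le> N3"
  proof -
    have lowH: "m^3 / 4 - 2 / 10^16 * m^3 \<le> real (count3 I (\<lambda>i j k. \<not> Hw w i j k))" if g: "good w" for w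
    proof -
      obtain A where A: "A \<subseteq> I" "real (count3 I (\<lambda>u v t. Hw w u v t \<noteq> cross A u v t)) \<le> 2 / 10^16 * m^3" using ex_A[OF g] by blast
      define a where "a = real (card A)"
      have BI: "I - A \<subseteq> I" by blast
      have cb: "real (card (I - A)) = m - a" using A finI card_mono[OF finI A(1)]
        by (simp add: card_Diff_subset finite_subset a_def m_def cI of_nat_diff)
      have "count3 I (\<lambda>u v t. u \<in> A \<and> v \<in> A \<and> t \<in> A) + count3 I (\<lambda>u v t. u \<in> I - A \<and> v \<in> I - A \<and> t \<in> I - A)
          \<le> count3 I (\<lambda>i j k. \<not> Hw w i j k) + count3 I (\<lambda>u v t. Hw w u v t \<noteq> cross A u v t)"
        unfolding sum.distrib[symmetric] by (intro sum_mono) (auto simp: of_bool_def cross_def)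
      then have "card A ^ 3 + card (I - A) ^ 3 \<le> count3 I (\<lambda>i j k. \<not> Hw w i j k) + count3 I (\<lambda>u v t. Hw w u v t \<noteq> cross A u v t)"
        unfolding count3_inside[OF finI A(1)] count3_inside[OF finI BI] .
      then have "real (card A ^ 3 + card (I - A) ^ 3) \<le> real (count3 I (\<lambda>i j k. \<not> Hw w i j k) + count3 I (\<lambda>u v t. Hw w u v t \<noteq> cross A u v t))"
        by (rule of_nat_mono)
      then have "a^3 + (m - a)^3 \<le> real (count3 I (\<lambda>i j k. \<not> Hw w i j k)) + 2 / 10^16 * m^3"
        using A(2) cb by (simp add: a_def)
      moreover have "a^3 + (m - a)^3 = m^3 / 4 + 3 * m * (a - m/2)\<^sup>2" by (simp add: power2_eq_square power3_eq_cube field_simps)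
      moreover have "0 \<le> 3 * m * (a - m/2)\<^sup>2" using m0 by simp
      ultimately show ?thesis by linarith
    qed
    let ?D = "\<lambda>i j k. i \<noteq> j \<and> j \<noteq> k \<and> i \<noteq> (k::nat)"
    have "(\<Sum>w\<in>W. (1 - of_bool (\<not> good w)) * (m^3 / 4 - 2 / 10^16 * m^3)) \<le> (\<Sum>w\<in>W. real (count3 I (\<lambda>i j k. \<not> H (w i) (w j) (w k))))"
    proof (rule sum_mono)
      fix w
      show "(1 - of_bool (\<not> good w)) * (m^3 / 4 - 2 / 10^16 * m^3) \<le> real (count3 I (\<lambda>i j k. \<not> H (w i) (w j) (w k)))"
      proof (cases "good w")
        case True
        then show ?thesis using lowH[OF True] unfolding HwI by (simp del: of_nat_sum)
      next
        case False
        have "0 \<le> real (count3 I (\<lambda>i j k. \<not> H (w i) (w j) (w k)))" by (rule of_nat_0_le_iff)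
        then show ?thesis using False by (simp del: of_nat_sum)
      qed
    qed
    also have "\<dots> = (\<Sum>i\<in>I. \<Sum>j\<in>I. \<Sum>k\<in>I. \<Sum>w\<in>W. of_bool (\<not> H (w i) (w j) (w k)))" by (rule swapsum)
    also have "\<dots> \<le> (\<Sum>i\<in>I. \<Sum>j\<in>I. \<Sum>k\<in>I. n^M / n^3 * N3 + (1 - of_bool (?D i j k)) * n^M)"
    proof (intro sum_mono)
      fix i j k assume ijk: "i \<in> I" "j \<in> I" "k \<in> I"
      show "(\<Sum>w\<in>W. of_bool (\<not> H (w i) (w j) (w k))) \<le> n^M / n^3 * N3 + (1 - of_bool (?D i j k)) * n^M"
      proof (cases "?D i j k")
        case True
        then have "(\<Sum>w\<in>W. of_bool (\<not> H (w i) (w j) (w k))) = n^M / n^3 * N3"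
          unfolding W_def n_def N3_def using ijk by (intro count3_sample[OF fin ne]) (auto simp: I_def)
        then show ?thesis using True by simp
      next
        case False
        have "(\<Sum>w\<in>W. of_bool (\<not> H (w i) (w j) (w k))) \<le> (\<Sum>w\<in>W. (1::real))" by (intro sum_mono) simp
        also have "\<dots> = n^M" by (simp add: cW)
        also have "\<dots> \<le> n^M / n^3 * N3 + n^M" using n0 by (simp add: N3_def del: of_nat_sum)
        also have "\<dots> = n^M / n^3 * N3 + (1 - of_bool (?D i j k)) * n^M"
          by (simp only: False of_bool_eq diff_zero mult_1)
        finally show ?thesis .
      qed
    qed
    also have "\<dots> = m^3 * (n^M / n^3 * N3) + (m^3 - real (count3 I ?D)) * n^M"
    proof -
      have "(\<Sum>i\<in>I. \<Sum>j\<in>I. \<Sum>k\<in>I. n^M / n^3 * N3 + (1 - of_bool (?D i j k)) * n^M)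
        = (\<Sum>i\<in>I. \<Sum>j\<in>I. \<Sum>k\<in>I. n^M / n^3 * N3) + ((\<Sum>i\<in>I. \<Sum>j\<in>I. \<Sum>k\<in>I. (1::real)) - (\<Sum>i\<in>I. \<Sum>j\<in>I. \<Sum>k\<in>I. of_bool (?D i j k))) * n^M"
        by (simp only: sum.distrib sum_subtractf sum_distrib_right[symmetric])
      moreover have "(\<Sum>i\<in>I. \<Sum>j\<in>I. \<Sum>k\<in>I. n^M / n^3 * N3) = m^3 * (n^M / n^3 * N3)" "(\<Sum>i\<in>I. \<Sum>j\<in>I. \<Sum>k\<in>I. (1::real)) = m^3"
        by (simp_all add: cI m_def power3_eq_cube)
      moreover have "(\<Sum>i\<in>I. \<Sum>j\<in>I. \<Sum>k\<in>I. of_bool (?D i j k)) = real (count3 I ?D)" by (simp only: of_nat_sum of_nat_of_bool)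
      ultimately show ?thesis by (simp only:)
    qed
    also have "\<dots> \<le> m^3 * (n^M / n^3 * N3) + 3 * m\<^sup>2 * n^M"
    proof (intro add_left_mono mult_right_mono)
      show "m^3 - real (count3 I ?D) \<le> 3 * m\<^sup>2" using dist3 by linarith
    qed (use nM in simp)
    finally have 1: "(\<Sum>w\<in>W. (1 - of_bool (\<not> good w)) * (m^3 / 4 - 2 / 10^16 * m^3)) \<le> m^3 * (n^M / n^3 * N3) + 3 * m\<^sup>2 * n^M" .
    have "(\<Sum>w\<in>W. (1 - of_bool (\<not> good w)) * (m^3 / 4 - 2 / 10^16 * m^3)) = (n^M - real (card {w\<in>W. \<not> good w})) * (m^3 / 4 - 2 / 10^16 * m^3)"
      unfolding sum_distrib_right[symmetric] sum_subtractf card_filter_sum[OF finW] using cW by simp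
    also have "\<dots> \<ge> (n^M - 4 / 10^16 * n^M) * (m^3 / 4 - 2 / 10^16 * m^3)"
      by (intro mult_right_mono diff_left_mono bad) (use m3 in simp)
    finally have 2: "(n^M - 4 / 10^16 * n^M) * (m^3 / 4 - 2 / 10^16 * m^3) \<le> m^3 * (n^M / n^3 * N3) + 3 * m\<^sup>2 * n^M" using 1 by linarith
    have "(n^M - 4 / 10^16 * n^M) * (m^3 / 4 - 2 / 10^16 * m^3) = ((1 - 4 / 10^16) * (1/4 - 2/10^16)) * (n^M * m^3)" by (simp add: algebra_simps)
    also have "\<dots> \<ge> (24/100) * (n^M * m^3)" by (rule mult_right_mono) (use nM m3 in simp_all)
    finally have 3: "(24/100) * (n^M * m^3) \<le> m^3 * (n^M / n^3 * N3) + 3 * m\<^sup>2 * n^M" using 2 by linarith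
    have "300 * m\<^sup>2 \<le> m * m\<^sup>2" using big by (intro mult_right_mono) auto
    then have "300 * m\<^sup>2 * n^M \<le> m^3 * n^M" using nM by (intro mult_right_mono) (auto simp: power2_eq_square power3_eq_cube)
    then have 4: "3 * m\<^sup>2 * n^M \<le> (1/100) * (n^M * m^3)" by (simp add: mult_ac)
    have "(20/100) * x \<le> y" if "(24/100) * x \<le> y + z" "z \<le> (1/100) * x" "0 \<le> x" for x y z :: real
      using that by linarith
    from this[OF 3 4] have "(20/100) * (n^M * m^3) \<le> m^3 * (n^M / n^3 * N3)" using nM m3 by simp
    also have "m^3 * (n^M / n^3 * N3) = (N3 / n^3) * (n^M * m^3)" by simp
    finally have "20/100 \<le> N3 / n^3" using mult_pos_pos[OF nM m3] by (simp only: mult_le_cancel_right_pos)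
    then show ?thesis using n0 by (simp add: field_simps)
  qed
  \<comment> \<open>In a complete bipartite 3-graph, a non-edge \<open>abc\<close> of distinct
    vertices lies in one class and \<open>{v. H a b v}\<close> is the other class. \<open>Q\<close>
    says that the split read off in this way is wrong on \<open>xyz\<close>. Only five triples of
    the six vertices are involved, so a good sample sees \<open>Q\<close> rarely.\<close>
  define Q where "Q = (\<lambda>a b c x y z. \<not> H a b c \<and> H x y z \<noteq> cross {v. H a b v} x y z)"
  define c6 where "c6 = (\<Sum>u\<in>tuples 6 V. (of_bool (Q (u 5) (u 4) (u 3) (u 2) (u 1) (u 0)) :: real))"
  define q6 where "q6 = (\<lambda>w (t::nat\<Rightarrow>nat). (of_bool (Q (w (t 5)) (w (t 4)) (w (t 3)) (w (t 2)) (w (t 1)) (w (t 0))) :: real))"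
  have "0 \<in> I" using M7 by (simp add: I_def)
  then have Ine: "I \<noteq> {}" by blast
  have goodQ: "(\<Sum>t\<in>tuples 6 I. q6 w t) \<le> 10 / 10^16 * m^6" if g: "good w" for w
  proof -
    obtain A where A: "A \<subseteq> I" "real (count3 I (\<lambda>u v t. Hw w u v t \<noteq> cross A u v t)) \<le> 2 / 10^16 * m^3" using ex_A[OF g] by blast
    let ?Mi = "\<lambda>u v t. Hw w u v t \<noteq> cross A u v t"
    let ?o = "\<lambda>b. (of_bool b :: real)"
    have "(\<Sum>t\<in>tuples 6 I. q6 w t) \<le> (\<Sum>t\<in>tuples 6 I. ?o (?Mi (t 5) (t 4) (t 3)) + ?o (?Mi (t 5) (t 4) (t 2)) + ?o (?Mi (t 5) (t 4) (t 1))
        + ?o (?Mi (t 5) (t 4) (t 0)) + ?o (?Mi (t 2) (t 1) (t 0)))"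
    proof (rule sum_mono)
      fix t assume t: "t \<in> tuples 6 I"
      have tM: "t k < M" if "k < 6" for k using t that by (auto simp: I_def)
      have "?Mi (t 5) (t 4) (t 3) \<or> ?Mi (t 5) (t 4) (t 2) \<or> ?Mi (t 5) (t 4) (t 1) \<or> ?Mi (t 5) (t 4) (t 0) \<or> ?Mi (t 2) (t 1) (t 0)"
        if "Q (w (t 5)) (w (t 4)) (w (t 3)) (w (t 2)) (w (t 1)) (w (t 0))"
        using that tM[of 0] tM[of 1] tM[of 2] tM[of 3] tM[of 4] tM[of 5] by (auto simp: Q_def Hw_def cross_def)
      then show "q6 w t \<le> ?o (?Mi (t 5) (t 4) (t 3)) + ?o (?Mi (t 5) (t 4) (t 2)) + ?o (?Mi (t 5) (t 4) (t 1))
        + ?o (?Mi (t 5) (t 4) (t 0)) + ?o (?Mi (t 2) (t 1) (t 0))"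
        unfolding q6_def by (auto simp: of_bool_def)
    qed
    also have "\<dots> = 5 * (real (card I) ^ 6 / real (card I) ^ 3 * real (count3 I ?Mi))"
    proof -
      have cs: "(\<Sum>t\<in>tuples 6 I. ?o (?Mi (t i) (t j) (t k))) = real (card I) ^ 6 / real (card I) ^ 3 * real (count3 I ?Mi)"
        if "i < 6" "j < 6" "k < 6" "i \<noteq> j" "j \<noteq> k" "i \<noteq> k" for i j k
        by (rule count3_sample[OF finI Ine that, where P = ?Mi])
      show ?thesis unfolding sum.distrib
        by (subst cs, simp, simp, simp, simp, simp, simp)+ (simp only: mult_2 mult_numeral_1 ring_distribs)
    qed
    also have "\<dots> = 5 * (m^3 * real (count3 I ?Mi))"
      using m0 by (simp add: cI m_def power_eq_if)
    also have "\<dots> \<le> 5 * (m^3 * (2 / 10^16 * m^3))" using A(2) m3 by (intro mult_left_mono) auto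
    also have "\<dots> = 10 / 10^16 * m^6" by (simp add: power_eq_if)
    finally show ?thesis .
  qed
  have allQ: "(\<Sum>t\<in>tuples 6 I. q6 w t) \<le> m^6" for w
  proof -
    have "(\<Sum>t\<in>tuples 6 I. q6 w t) \<le> (\<Sum>t\<in>tuples 6 I. 1)" by (intro sum_mono) (simp add: q6_def)
    then show ?thesis by (simp add: card_tuples cI m_def)
  qed
  have upQ: "(\<Sum>w\<in>W. \<Sum>t\<in>tuples 6 I. q6 w t) \<le> 14 / 10^16 * m^6 * n^M"
  proof -
    have "(\<Sum>w\<in>W. \<Sum>t\<in>tuples 6 I. q6 w t) \<le> (\<Sum>w\<in>W. 10 / 10^16 * m^6 + of_bool (\<not> good w) * m^6)"
    proof (rule sum_mono)
      fix w
      have "0 \<le> 10 / 10^16 * m^6" by simp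
      then show "(\<Sum>t\<in>tuples 6 I. q6 w t) \<le> 10 / 10^16 * m^6 + of_bool (\<not> good w) * m^6"
      proof (cases "good w")
        case True
        then show ?thesis using goodQ[of w] by simp
      next
        case False
        then have "of_bool (\<not> good w) = (1::real)" by simp
        then show ?thesis using allQ[of w] \<open>0 \<le> 10 / 10^16 * m^6\<close> by (simp only: mult_1)
      qed
    qed
    also have "\<dots> = n^M * (10 / 10^16 * m^6) + real (card {w\<in>W. \<not> good w}) * m^6"
      by (simp only: sum.distrib sum_distrib_right[symmetric] card_filter_sum[OF finW] sum_constant cW)
    also have "\<dots> \<le> n^M * (10 / 10^16 * m^6) + (4 / 10^16 * n^M) * m^6"
      using bad by (intro add_left_mono mult_right_mono) auto
    finally show ?thesis by (simp add: mult_ac)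
  qed
  define q where "q = M div 6"
  have qm: "m \<le> 7 * real q"
  proof -
    have "(42::real) \<le> 16 * 10^48" by simp
    then have "42 \<le> M" using big unfolding m_def by linarith
    then have "M \<le> 7 * q" unfolding q_def by linarith
    then show ?thesis unfolding m_def by linarith
  qed
  define Bk where "Bk = PiE {..<6} (\<lambda>a. {a * q..<(a + 1) * q})"
  have BkI: "Bk \<subseteq> tuples 6 I"
  proof -
    have "{a * q..<(a + 1) * q} \<subseteq> I" if "a < 6" for a
    proof -
      have "(a + 1) * q \<le> 6 * q" using that by (intro mult_right_mono) auto
      also have "\<dots> \<le> M" by (simp add: q_def)
      finally show ?thesis by (auto simp: I_def)
    qed
    then show ?thesis unfolding Bk_def by (intro PiE_mono) auto
  qed
  have cBk: "card Bk = q^6" unfolding Bk_def by (simp add: card_PiE)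
  have loQ: "real q ^ 6 * (n^M / n^6 * c6) \<le> (\<Sum>w\<in>W. \<Sum>t\<in>tuples 6 I. q6 w t)"
  proof -
    have "real q ^ 6 * (n^M / n^6 * c6) = (\<Sum>t\<in>Bk. n^M / n^6 * c6)" using cBk by simp
    also have "\<dots> = (\<Sum>t\<in>Bk. \<Sum>w\<in>W. q6 w t)"
    proof (rule sum.cong[OF refl])
      fix t assume t: "t \<in> Bk"
      have blk: "t a div q = a" if "a < 6" for a
      proof -
        have "t a \<in> {a * q..<(a + 1) * q}" using PiE_mem[OF t[unfolded Bk_def], of a] that by simp
        then show ?thesis by (intro div_nat_eqI) (simp_all add: algebra_simps)
      qed
      have inj: "inj_on t {..<6}"
      proof (rule inj_onI)
        fix a b assume "a \<in> {..<6::nat}" "b \<in> {..<6::nat}" "t a = t b"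
        then show "a = b" using blk[of a] blk[of b] by (metis lessThan_iff)
      qed
      have tI: "t \<in> tuples 6 I" using t BkI by blast
      have "t ` {..<6} \<subseteq> {..<M}" using PiE_mem[OF tI] by (auto simp: I_def)
      from sum_tuples_sample[OF fin ne inj this, of "\<lambda>u. of_bool (Q (u 5) (u 4) (u 3) (u 2) (u 1) (u 0))"]
      have smp: "(\<Sum>w\<in>W. of_bool (Q (restrict (\<lambda>j. w (t j)) {..<6} 5) (restrict (\<lambda>j. w (t j)) {..<6} 4)
          (restrict (\<lambda>j. w (t j)) {..<6} 3) (restrict (\<lambda>j. w (t j)) {..<6} 2) (restrict (\<lambda>j. w (t j)) {..<6} 1)
          (restrict (\<lambda>j. w (t j)) {..<6} 0))) = n^M / n^6 * c6"
        unfolding W_def n_def c6_def .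
      have e: "of_bool (Q (restrict (\<lambda>j. w (t j)) {..<6} 5) (restrict (\<lambda>j. w (t j)) {..<6} 4)
          (restrict (\<lambda>j. w (t j)) {..<6} 3) (restrict (\<lambda>j. w (t j)) {..<6} 2) (restrict (\<lambda>j. w (t j)) {..<6} 1)
          (restrict (\<lambda>j. w (t j)) {..<6} 0)) = q6 w t" for w
        by (simp add: q6_def)
      show "n^M / n^6 * c6 = (\<Sum>w\<in>W. q6 w t)" using smp unfolding e by simp
    qed
    also have "\<dots> \<le> (\<Sum>t\<in>tuples 6 I. \<Sum>w\<in>W. q6 w t)"
    proof (rule sum_mono2[OF finite_tuples[OF finI] BkI])
      show "0 \<le> (\<Sum>w\<in>W. q6 w t)" for t by (rule sum_nonneg) (simp add: q6_def)
    qed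
    also have "\<dots> = (\<Sum>w\<in>W. \<Sum>t\<in>tuples 6 I. q6 w t)" by (rule sum.swap)
    finally show ?thesis .
  qed
  have c6: "c6 \<le> 1 / 10^9 * n^6"
  proof -
    have q0: "real q > 0" using qm m0 by simp
    have "m^6 \<le> (7 * real q)^6" using qm m0 by (intro power_mono) auto
    then have "m^6 \<le> 117649 * real q ^ 6" by (simp add: power_mult_distrib)
    then have "14 / 10^16 * m^6 * n^M \<le> 14 / 10^16 * (117649 * real q ^ 6) * n^M" using nM by (intro mult_right_mono mult_left_mono) auto
    then have "real q ^ 6 * (n^M / n^6 * c6) \<le> 14 / 10^16 * (117649 * real q ^ 6) * n^M" using loQ upQ by linarith
    moreover have "real q ^ 6 * (n^M / n^6 * c6) = (c6 / n^6) * (real q ^ 6 * n^M)" by simp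
    moreover have "14 / 10^16 * (117649 * real q ^ 6) * n^M = (14 / 10^16 * 117649) * (real q ^ 6 * n^M)" by simp
    ultimately have "(c6 / n^6) * (real q ^ 6 * n^M) \<le> (14 / 10^16 * 117649) * (real q ^ 6 * n^M)" by linarith
    then have "c6 / n^6 \<le> 14 / 10^16 * 117649" using q0 nM by (simp only: mult_le_cancel_right_pos zero_less_power mult_pos_pos)
    also have "\<dots> \<le> 1 / 10^9" by simp
    finally show ?thesis using n0 by (simp add: field_simps)
  qed
  define g where "g = (\<lambda>a b. real (count3 V (\<lambda>x y z. H x y z \<noteq> cross {v. H a b v} x y z)))"
  have c6g: "c6 = (\<Sum>a\<in>V. \<Sum>b\<in>V. \<Sum>c\<in>V. of_bool (\<not> H a b c) * g a b)"
  proof -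
    have "c6 = (\<Sum>a\<in>V. \<Sum>b\<in>V. \<Sum>c\<in>V. \<Sum>x\<in>V. \<Sum>y\<in>V. \<Sum>z\<in>V. of_bool (Q a b c x y z))"
      unfolding c6_def by (rule sum_tuples_6)
    also have "\<dots> = (\<Sum>a\<in>V. \<Sum>b\<in>V. \<Sum>c\<in>V. of_bool (\<not> H a b c) * g a b)"
      unfolding Q_def of_bool_conj g_def of_nat_sum of_nat_of_bool sum_distrib_left by (rule refl)
    finally show ?thesis .
  qed
  \<comment> \<open>Otherwise each of the at least \<open>n^3 / 5\<close> non-edges
    \<open>abc\<close> would contribute more than \<open>n^3 / 10^8\<close> to \<open>c6\<close>,
    twice what the bound on \<open>c6\<close> allows.\<close>
  have "\<exists>a\<in>V. \<exists>b\<in>V. g a b \<le> n^3 / 10^8"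
  proof (rule ccontr)
    assume "\<not> ?thesis"
    then have gg: "n^3 / 10^8 < g a b" if "a \<in> V" "b \<in> V" for a b using that by force
    have "N3 * (n^3 / 10^8) = (\<Sum>a\<in>V. \<Sum>b\<in>V. \<Sum>c\<in>V. of_bool (\<not> H a b c) * (n^3 / 10^8))"
      unfolding N3_def of_nat_sum of_nat_of_bool sum_distrib_right by (rule refl)
    also have "\<dots> \<le> c6" unfolding c6g using gg by (intro sum_mono mult_left_mono) (auto intro: less_imp_le)
    also have "\<dots> \<le> 1 / 10^9 * n^6" by (rule c6)
    finally have f1: "N3 * (n^3 / 10^8) \<le> 1 / 10^9 * n^6" .
    have f2: "(n^3 / 5) * (n^3 / 10^8) \<le> N3 * (n^3 / 10^8)" using N3 n0 by (intro mult_right_mono) auto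
    have f3: "(n^3 / 5) * (n^3 / 10^8) = 2 / 10^9 * n^6" by (simp add: power_eq_if)
    have "2 / 10^9 * n^6 \<le> 1 / 10^9 * n^6" using order_trans[OF f2 f1] unfolding f3 .
    then show False using n0 by simp
  qed
  then obtain a b where ab: "a \<in> V" "b \<in> V" "g a b \<le> n^3 / 10^8" by blast
  have "count3 V (\<lambda>u v w. H u v w \<noteq> cross {v\<in>V. H a b v} u v w) = count3 V (\<lambda>x y z. H x y z \<noteq> cross {v. H a b v} x y z)"
    by (intro sum.cong refl) (auto simp: cross_def)
  then show ?thesis using ab(3) by (intro exI[of _ "{v\<in>V. H a b v}"]) (auto simp: g_def n_def)
qed

section \<open>Entropy on a finite uniform space\<close>

definition cn :: "'w set \<Rightarrow> ('w \<Rightarrow> 'b) \<Rightarrow> 'w \<Rightarrow> real" where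
  "cn \<Omega> X \<omega> = real (card {\<omega>'\<in>\<Omega>. X \<omega>' = X \<omega>})"

text \<open>Shannon entropy of \<open>X\<close> given \<open>Z\<close> in nats, for the uniform
  measure on \<Omega>. Summing over sample points instead of values makes the chain rule a termwise
  identity and shows that only the induced partitions matter.\<close>

definition cond_entropy :: "'w set \<Rightarrow> ('w \<Rightarrow> 'b) \<Rightarrow> ('w \<Rightarrow> 'c) \<Rightarrow> real" where
  "cond_entropy \<Omega> X Z = (\<Sum>\<omega>\<in>\<Omega>. ln (cn \<Omega> Z \<omega> / cn \<Omega> (\<lambda>\<omega>. (X \<omega>, Z \<omega>)) \<omega>)) / card \<Omega>"

definition cprob :: "'w set \<Rightarrow> ('w \<Rightarrow> 'b) \<Rightarrow> ('w \<Rightarrow> 'c) \<Rightarrow> 'w \<Rightarrow> 'b \<Rightarrow> real" where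
  "cprob \<Omega> X Z \<omega> x = real (card {\<omega>'\<in>\<Omega>. Z \<omega>' = Z \<omega> \<and> X \<omega>' = x}) / cn \<Omega> Z \<omega>"

locale uniform_space =
  fixes \<Omega> :: "'w set"
  assumes fin: "finite \<Omega>" and ne: "\<Omega> \<noteq> {}"
begin

abbreviation "N X \<omega> \<equiv> cn \<Omega> X \<omega>"
abbreviation "En X Z \<equiv> cond_entropy \<Omega> X Z"
abbreviation "Cl Z \<omega> \<equiv> {\<omega>'\<in>\<Omega>. Z \<omega>' = Z \<omega>}"

lemma card_pos: "real (card \<Omega>) > 0" using fin ne by (simp add: card_gt_0_iff)

lemma cn_pos [simp]: "\<omega> \<in> \<Omega> \<Longrightarrow> N X \<omega> > 0"
  unfolding cn_def using fin by (auto simp: card_gt_0_iff)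

lemma cn_nonzero [simp]: "\<omega> \<in> \<Omega> \<Longrightarrow> N X \<omega> \<noteq> 0"
  using cn_pos by (metis less_irrefl)

lemma class_average: "(\<Sum>\<omega>\<in>\<Omega>. F \<omega>) = (\<Sum>\<omega>\<in>\<Omega>. (\<Sum>\<omega>'\<in>Cl Z \<omega>. F \<omega>') / N Z \<omega>)"
proof -
  have "(\<Sum>\<omega>\<in>\<Omega>. (\<Sum>\<omega>'\<in>Cl Z \<omega>. F \<omega>') / N Z \<omega>) = (\<Sum>\<omega>\<in>\<Omega>. \<Sum>\<omega>'\<in>\<Omega>. if Z \<omega>' = Z \<omega> then F \<omega>' / N Z \<omega>' else 0)"
  proof (rule sum.cong[OF refl])
    fix \<omega> assume "\<omega> \<in> \<Omega>"
    have "(\<Sum>\<omega>'\<in>Cl Z \<omega>. F \<omega>') / N Z \<omega> = (\<Sum>\<omega>'\<in>Cl Z \<omega>. F \<omega>' / N Z \<omega>')"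
      by (simp add: sum_divide_distrib cn_def)
    also have "\<dots> = (\<Sum>\<omega>'\<in>\<Omega>. if Z \<omega>' = Z \<omega> then F \<omega>' / N Z \<omega>' else 0)"
      using fin by (simp add: sum.inter_filter)
    finally show "(\<Sum>\<omega>'\<in>Cl Z \<omega>. F \<omega>') / N Z \<omega> = (\<Sum>\<omega>'\<in>\<Omega>. if Z \<omega>' = Z \<omega> then F \<omega>' / N Z \<omega>' else 0)" .
  qed
  also have "\<dots> = (\<Sum>\<omega>'\<in>\<Omega>. \<Sum>\<omega>\<in>\<Omega>. if Z \<omega>' = Z \<omega> then F \<omega>' / N Z \<omega>' else 0)" by (rule sum.swap)
  also have "\<dots> = (\<Sum>\<omega>'\<in>\<Omega>. F \<omega>')"
  proof (rule sum.cong[OF refl])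
    fix \<omega>' assume w: "\<omega>' \<in> \<Omega>"
    have "(\<Sum>\<omega>\<in>\<Omega>. if Z \<omega>' = Z \<omega> then F \<omega>' / N Z \<omega>' else 0) = (\<Sum>\<omega>\<in>Cl Z \<omega>'. F \<omega>' / N Z \<omega>')"
      using fin by (subst sum.inter_filter) (auto intro!: sum.cong)
    also have "\<dots> = F \<omega>'" using cn_pos[OF w, of Z] by (simp add: cn_def)
    finally show "(\<Sum>\<omega>\<in>\<Omega>. if Z \<omega>' = Z \<omega> then F \<omega>' / N Z \<omega>' else 0) = F \<omega>'" .
  qed
  finally show ?thesis by simp
qed

text \<open>The weight is the reciprocal of the conditional probability of the observed value, so
  the expectation collapses to a sum over the values attained on each class. Both
  \<open>gibbs\<close> and the divergence bound reduce to this.\<close>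

lemma sum_density:
  assumes g: "\<And>\<omega> \<omega>'. \<omega> \<in> \<Omega> \<Longrightarrow> \<omega>' \<in> \<Omega> \<Longrightarrow> Z \<omega>' = Z \<omega> \<Longrightarrow> g \<omega>' = g \<omega>"
  shows "(\<Sum>\<omega>\<in>\<Omega>. g \<omega> (X \<omega>) * N Z \<omega> / N (\<lambda>\<omega>. (X \<omega>, Z \<omega>)) \<omega>) = (\<Sum>\<omega>\<in>\<Omega>. \<Sum>x\<in>X ` Cl Z \<omega>. g \<omega> x)"
proof -
  let ?N = "N (\<lambda>\<omega>. (X \<omega>, Z \<omega>))"
  have "(\<Sum>\<omega>\<in>\<Omega>. g \<omega> (X \<omega>) * N Z \<omega> / ?N \<omega>) = (\<Sum>\<omega>\<in>\<Omega>. (\<Sum>\<omega>'\<in>Cl Z \<omega>. g \<omega>' (X \<omega>') * N Z \<omega>' / ?N \<omega>') / N Z \<omega>)"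
    by (rule class_average)
  also have "\<dots> = (\<Sum>\<omega>\<in>\<Omega>. \<Sum>x\<in>X ` Cl Z \<omega>. g \<omega> x)"
  proof (rule sum.cong[OF refl])
    fix \<omega> assume w: "\<omega> \<in> \<Omega>"
    have nz: "N Z \<omega> \<noteq> 0" using cn_pos[OF w, of Z] by simp
    have "(\<Sum>\<omega>'\<in>Cl Z \<omega>. g \<omega>' (X \<omega>') * N Z \<omega>' / ?N \<omega>') / N Z \<omega> = (\<Sum>\<omega>'\<in>Cl Z \<omega>. g \<omega> (X \<omega>') / ?N \<omega>')"
      unfolding sum_divide_distrib
    proof (rule sum.cong[OF refl])
      fix \<omega>' assume "\<omega>' \<in> Cl Z \<omega>"
      then have w': "\<omega>' \<in> \<Omega>" "Z \<omega>' = Z \<omega>" by auto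
      have "g \<omega>' = g \<omega>" "N Z \<omega>' = N Z \<omega>" using g[OF w w'] w'(2) by (simp_all add: cn_def)
      then show "g \<omega>' (X \<omega>') * N Z \<omega>' / ?N \<omega>' / N Z \<omega> = g \<omega> (X \<omega>') / ?N \<omega>'" using nz by simp
    qed
    also have "\<dots> = (\<Sum>x\<in>X ` Cl Z \<omega>. \<Sum>\<omega>'\<in>{\<omega>'\<in>Cl Z \<omega>. X \<omega>' = x}. g \<omega> (X \<omega>') / ?N \<omega>')"
      by (rule sum.image_gen) (use fin in simp)
    also have "\<dots> = (\<Sum>x\<in>X ` Cl Z \<omega>. g \<omega> x)"
    proof (rule sum.cong[OF refl])
      fix x assume "x \<in> X ` Cl Z \<omega>"
      then obtain \<omega>0 where w0: "\<omega>0 \<in> \<Omega>" "Z \<omega>0 = Z \<omega>" "X \<omega>0 = x" by auto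
      let ?S = "{\<omega>'\<in>Cl Z \<omega>. X \<omega>' = x}"
      have eq: "?N \<omega>' = real (card ?S)" if "\<omega>' \<in> ?S" for \<omega>'
      proof -
        have "{\<omega>''\<in>\<Omega>. (X \<omega>'', Z \<omega>'') = (X \<omega>', Z \<omega>')} = ?S" using that by auto
        then show ?thesis by (simp only: cn_def)
      qed
      have "?S \<noteq> {}" using w0 by auto
      then have c: "real (card ?S) \<noteq> 0" using fin by simp
      have "(\<Sum>\<omega>'\<in>?S. g \<omega> (X \<omega>') / ?N \<omega>') = (\<Sum>\<omega>'\<in>?S. g \<omega> x / real (card ?S))"
        by (intro sum.cong refl) (use eq in auto)
      also have "\<dots> = g \<omega> x" using c by simp
      finally show "(\<Sum>\<omega>'\<in>?S. g \<omega> (X \<omega>') / ?N \<omega>') = g \<omega> x" .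
    qed
    finally show "(\<Sum>\<omega>'\<in>Cl Z \<omega>. g \<omega>' (X \<omega>') * N Z \<omega>' / ?N \<omega>') / N Z \<omega> = (\<Sum>x\<in>X ` Cl Z \<omega>. g \<omega> x)" .
  qed
  finally show ?thesis .
qed

text \<open>\<open>ln t \<le> t - 1\<close> for the ratio of \<open>q\<close> to the true
  conditional probability. The upper bounds on entropy are choices of \<open>q\<close>: a coarser
  conditional law, a uniform law, or a two-part law for poor edges.\<close>

lemma gibbs:
  assumes g: "\<And>\<omega> \<omega>'. \<omega> \<in> \<Omega> \<Longrightarrow> \<omega>' \<in> \<Omega> \<Longrightarrow> Z \<omega>' = Z \<omega> \<Longrightarrow> q \<omega>' = q \<omega>"
    and pos: "\<And>\<omega>. \<omega> \<in> \<Omega> \<Longrightarrow> q \<omega> (X \<omega>) > 0"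
    and le1: "\<And>\<omega>. \<omega> \<in> \<Omega> \<Longrightarrow> (\<Sum>x\<in>X ` Cl Z \<omega>. q \<omega> x) \<le> 1"
  shows "En X Z \<le> (\<Sum>\<omega>\<in>\<Omega>. ln (1 / q \<omega> (X \<omega>))) / card \<Omega>"
proof -
  let ?N = "N (\<lambda>\<omega>. (X \<omega>, Z \<omega>))"
  have "(\<Sum>\<omega>\<in>\<Omega>. ln (N Z \<omega> / ?N \<omega>)) - (\<Sum>\<omega>\<in>\<Omega>. ln (1 / q \<omega> (X \<omega>))) = (\<Sum>\<omega>\<in>\<Omega>. ln (q \<omega> (X \<omega>) * N Z \<omega> / ?N \<omega>))"
    unfolding sum_subtractf[symmetric]
  proof (intro sum.cong refl)
    fix \<omega> assume w: "\<omega> \<in> \<Omega>"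
    have "q \<omega> (X \<omega>) > 0" by (rule pos[OF w])
    then show "ln (N Z \<omega> / ?N \<omega>) - ln (1 / q \<omega> (X \<omega>)) = ln (q \<omega> (X \<omega>) * N Z \<omega> / ?N \<omega>)"
      using w by (simp add: ln_div ln_mult)
  qed
  also have "\<dots> \<le> (\<Sum>\<omega>\<in>\<Omega>. q \<omega> (X \<omega>) * N Z \<omega> / ?N \<omega> - 1)"
    by (intro sum_mono ln_le_minus_one) (use pos cn_pos in auto)
  also have "\<dots> = (\<Sum>\<omega>\<in>\<Omega>. \<Sum>x\<in>X ` Cl Z \<omega>. q \<omega> x) - card \<Omega>"
    by (simp add: sum_subtractf sum_density[OF g])
  also have "\<dots> \<le> (\<Sum>\<omega>\<in>\<Omega>. (1::real)) - card \<Omega>" by (intro diff_right_mono sum_mono le1)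
  finally show ?thesis unfolding cond_entropy_def using card_pos by (simp add: divide_right_mono)
qed

section \<open>Conditional laws and the calculus of entropy\<close>

lemma cprob_nonneg: "cprob \<Omega> X Z \<omega> x \<ge> 0" by (simp add: cprob_def cn_def)

lemma cprob_self: "cprob \<Omega> X Z \<omega> (X \<omega>) = N (\<lambda>\<omega>. (X \<omega>, Z \<omega>)) \<omega> / N Z \<omega>"
proof -
  have "{\<omega>'\<in>\<Omega>. Z \<omega>' = Z \<omega> \<and> X \<omega>' = X \<omega>} = {\<omega>'\<in>\<Omega>. (X \<omega>', Z \<omega>') = (X \<omega>, Z \<omega>)}" by auto
  then show ?thesis by (simp only: cprob_def cn_def)
qed

lemma cprob_cong: "Z \<omega>' = Z \<omega> \<Longrightarrow> cprob \<Omega> X Z \<omega>' = cprob \<Omega> X Z \<omega>"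
  by (rule ext) (simp add: cprob_def cn_def)

lemma cprob_sum:
  assumes w: "\<omega> \<in> \<Omega>" and C: "finite C"
  shows "(\<Sum>x\<in>C. cprob \<Omega> X Z \<omega> x) = real (card {\<omega>'\<in>Cl Z \<omega>. X \<omega>' \<in> C}) / N Z \<omega>"
proof -
  have "card (\<Union>x\<in>C. {\<omega>'\<in>\<Omega>. Z \<omega>' = Z \<omega> \<and> X \<omega>' = x}) = (\<Sum>x\<in>C. card {\<omega>'\<in>\<Omega>. Z \<omega>' = Z \<omega> \<and> X \<omega>' = x})"
    by (rule card_UN_disjoint) (use C fin in auto)
  moreover have "(\<Union>x\<in>C. {\<omega>'\<in>\<Omega>. Z \<omega>' = Z \<omega> \<and> X \<omega>' = x}) = {\<omega>'\<in>Cl Z \<omega>. X \<omega>' \<in> C}" by auto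
  ultimately show ?thesis by (simp add: cprob_def flip: sum_divide_distrib of_nat_sum)
qed

lemma cprob_sum_le1:
  assumes "\<omega> \<in> \<Omega>" "finite C" shows "(\<Sum>x\<in>C. cprob \<Omega> X Z \<omega> x) \<le> 1"
proof -
  have "card {\<omega>'\<in>Cl Z \<omega>. X \<omega>' \<in> C} \<le> card (Cl Z \<omega>)" by (rule card_mono) (use fin in auto)
  then show ?thesis using cn_pos[OF assms(1), of Z] by (simp add: cprob_sum[OF assms] cn_def)
qed

lemma cprob_sum_eq1:
  assumes "\<omega> \<in> \<Omega>" "finite C" "X ` \<Omega> \<subseteq> C" shows "(\<Sum>x\<in>C. cprob \<Omega> X Z \<omega> x) = 1"
proof -
  have "{\<omega>'\<in>Cl Z \<omega>. X \<omega>' \<in> C} = Cl Z \<omega>" using assms(3) by auto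
  then show ?thesis using cn_pos[OF assms(1), of Z] by (simp add: cprob_sum[OF assms(1,2)] cn_def)
qed

lemma entropy_mono:
  assumes "\<And>\<omega> \<omega>'. \<omega> \<in> \<Omega> \<Longrightarrow> \<omega>' \<in> \<Omega> \<Longrightarrow> Z' \<omega>' = Z' \<omega> \<Longrightarrow> Z \<omega>' = Z \<omega>"
  shows "En X Z' \<le> En X Z"
proof -
  have "En X Z' \<le> (\<Sum>\<omega>\<in>\<Omega>. ln (1 / cprob \<Omega> X Z \<omega> (X \<omega>))) / card \<Omega>"
  proof (rule gibbs)
    show "cprob \<Omega> X Z \<omega>' = cprob \<Omega> X Z \<omega>" if "\<omega> \<in> \<Omega>" "\<omega>' \<in> \<Omega>" "Z' \<omega>' = Z' \<omega>" for \<omega> \<omega>'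
      using cprob_cong assms[OF that] by blast
    show "cprob \<Omega> X Z \<omega> (X \<omega>) > 0" if "\<omega> \<in> \<Omega>" for \<omega> using that by (simp add: cprob_self)
    show "(\<Sum>x\<in>X ` Cl Z' \<omega>. cprob \<Omega> X Z \<omega> x) \<le> 1" if "\<omega> \<in> \<Omega>" for \<omega>
      by (rule cprob_sum_le1[OF that]) (use fin in simp)
  qed
  then show ?thesis by (simp add: cprob_self cond_entropy_def)
qed

lemma entropy_cong:
  assumes "\<And>\<omega> \<omega>'. \<omega> \<in> \<Omega> \<Longrightarrow> \<omega>' \<in> \<Omega> \<Longrightarrow> (Z' \<omega>' = Z' \<omega>) = (Z \<omega>' = Z \<omega>)"
    and "\<And>\<omega> \<omega>'. \<omega> \<in> \<Omega> \<Longrightarrow> \<omega>' \<in> \<Omega> \<Longrightarrow> Z \<omega>' = Z \<omega> \<Longrightarrow> (X' \<omega>' = X' \<omega>) = (X \<omega>' = X \<omega>)"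
  shows "En X' Z' = En X Z"
proof -
  have "N Z' \<omega> = N Z \<omega>" "N (\<lambda>\<omega>. (X' \<omega>, Z' \<omega>)) \<omega> = N (\<lambda>\<omega>. (X \<omega>, Z \<omega>)) \<omega>" if "\<omega> \<in> \<Omega>" for \<omega>
  proof -
    have "{\<omega>'\<in>\<Omega>. Z' \<omega>' = Z' \<omega>} = {\<omega>'\<in>\<Omega>. Z \<omega>' = Z \<omega>}"
      "{\<omega>'\<in>\<Omega>. (X' \<omega>', Z' \<omega>') = (X' \<omega>, Z' \<omega>)} = {\<omega>'\<in>\<Omega>. (X \<omega>', Z \<omega>') = (X \<omega>, Z \<omega>)}"
      using assms[OF that] by blast+
    then show "N Z' \<omega> = N Z \<omega>" "N (\<lambda>\<omega>. (X' \<omega>, Z' \<omega>)) \<omega> = N (\<lambda>\<omega>. (X \<omega>, Z \<omega>)) \<omega>" by (simp_all only: cn_def)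
  qed
  then show ?thesis unfolding cond_entropy_def by (intro arg_cong2[where f = "(/)"] sum.cong refl) simp
qed

lemma entropy_chain: "En (\<lambda>\<omega>. (X \<omega>, Y \<omega>)) Z = En Y Z + En X (\<lambda>\<omega>. (Y \<omega>, Z \<omega>))"
proof -
  have e: "N (\<lambda>\<omega>. ((X \<omega>, Y \<omega>), Z \<omega>)) \<omega> = N (\<lambda>\<omega>. (X \<omega>, (Y \<omega>, Z \<omega>))) \<omega>" for \<omega>
    by (simp add: cn_def conj_assoc)
  show ?thesis unfolding cond_entropy_def e add_divide_distrib[symmetric] sum.distrib[symmetric]
    by (intro arg_cong2[where f = "(/)"] sum.cong refl) (simp add: ln_div)
qed

lemma entropy_nonneg: "En X Z \<ge> 0"
proof -
  have "ln (N Z \<omega> / N (\<lambda>\<omega>. (X \<omega>, Z \<omega>)) \<omega>) \<ge> 0" if w: "\<omega> \<in> \<Omega>" for \<omega>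
  proof -
    have "card {\<omega>'\<in>\<Omega>. (X \<omega>', Z \<omega>') = (X \<omega>, Z \<omega>)} \<le> card (Cl Z \<omega>)" by (rule card_mono) (use fin in auto)
    then have "N (\<lambda>\<omega>. (X \<omega>, Z \<omega>)) \<omega> \<le> N Z \<omega>" by (simp add: cn_def)
    then have "1 \<le> N Z \<omega> / N (\<lambda>\<omega>. (X \<omega>, Z \<omega>)) \<omega>" using w by (simp add: le_divide_eq_1_pos)
    then show ?thesis by (rule ln_ge_zero)
  qed
  then show ?thesis unfolding cond_entropy_def by (intro divide_nonneg_nonneg sum_nonneg) auto
qed

lemma entropy_determined:
  assumes "\<And>\<omega> \<omega>'. \<omega> \<in> \<Omega> \<Longrightarrow> \<omega>' \<in> \<Omega> \<Longrightarrow> Z \<omega>' = Z \<omega> \<Longrightarrow> X \<omega>' = X \<omega>"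
  shows "En X Z = 0"
proof -
  have "N (\<lambda>\<omega>. (X \<omega>, Z \<omega>)) \<omega> = N Z \<omega>" if "\<omega> \<in> \<Omega>" for \<omega>
  proof -
    have "{\<omega>'\<in>\<Omega>. (X \<omega>', Z \<omega>') = (X \<omega>, Z \<omega>)} = {\<omega>'\<in>\<Omega>. Z \<omega>' = Z \<omega>}" using assms[OF that] by blast
    then show ?thesis by (simp only: cn_def)
  qed
  then show ?thesis unfolding cond_entropy_def by simp
qed

lemma entropy_le_card:
  assumes "finite C" "X ` \<Omega> \<subseteq> C"
  shows "En X Z \<le> ln (card C)"
proof -
  have C: "card C > 0" using assms ne by (auto simp: card_gt_0_iff)
  have "En X Z \<le> (\<Sum>\<omega>\<in>\<Omega>. ln (1 / (1 / real (card C)))) / card \<Omega>"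
  proof (rule gibbs[where q = "\<lambda>_ _. 1 / real (card C)"])
    show "(\<Sum>x\<in>X ` Cl Z \<omega>. 1 / real (card C)) \<le> 1" for \<omega>
    proof -
      have "card (X ` Cl Z \<omega>) \<le> card C" by (rule card_mono) (use assms in auto)
      then show ?thesis using C by simp
    qed
  qed (use C in auto)
  then show ?thesis using card_pos by simp
qed

lemma entropy_total:
  assumes "inj_on X \<Omega>"
  shows "En X (\<lambda>_. ()) = ln (card \<Omega>)"
proof -
  have "N (\<lambda>_. ()) \<omega> / N (\<lambda>\<omega>. (X \<omega>, ())) \<omega> = card \<Omega>" if "\<omega> \<in> \<Omega>" for \<omega>
  proof -
    have "{\<omega>'\<in>\<Omega>. (X \<omega>', ()) = (X \<omega>, ())} = {\<omega>}" using assms that by (auto dest: inj_onD)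
    then show ?thesis by (simp add: cn_def)
  qed
  then show ?thesis unfolding cond_entropy_def using card_pos by simp
qed

lemma entropy_restrict_le:
  assumes "finite F"
  shows "En (\<lambda>\<omega>. restrict (X \<omega>) F) Z \<le> (\<Sum>e\<in>F. En (\<lambda>\<omega>. X \<omega> e) Z)"
  using assms
proof (induction F rule: finite_induct)
  case empty
  show ?case by (simp add: entropy_determined)
next
  case (insert e F)
  have "En (\<lambda>\<omega>. restrict (X \<omega>) (insert e F)) Z = En (\<lambda>\<omega>. (X \<omega> e, restrict (X \<omega>) F)) Z"
    by (rule entropy_cong) (use insert in \<open>auto simp: restrict_def fun_eq_iff\<close>)
  moreover have "En (\<lambda>\<omega>. (X \<omega> e, restrict (X \<omega>) F)) Z = En (\<lambda>\<omega>. restrict (X \<omega>) F) Z + En (\<lambda>\<omega>. X \<omega> e) (\<lambda>\<omega>. (restrict (X \<omega>) F, Z \<omega>))"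
    by (rule entropy_chain)
  moreover have "En (\<lambda>\<omega>. X \<omega> e) (\<lambda>\<omega>. (restrict (X \<omega>) F, Z \<omega>)) \<le> En (\<lambda>\<omega>. X \<omega> e) Z"
    by (rule entropy_mono) simp
  ultimately show ?case unfolding sum.insert[OF insert.hyps] using insert.IH by linarith
qed

lemma entropy_tuple_chain:
  fixes k :: nat
  shows "En (\<lambda>\<omega>. restrict (\<lambda>i. X i \<omega>) {..<k}) Z = (\<Sum>i<k. En (X i) (\<lambda>\<omega>. (restrict (\<lambda>j. X j \<omega>) {..<i}, Z \<omega>)))"
proof (induction k)
  case 0
  show ?case by (simp add: entropy_determined)
next
  case (Suc k)
  have "En (\<lambda>\<omega>. restrict (\<lambda>i. X i \<omega>) {..<Suc k}) Z = En (\<lambda>\<omega>. (X k \<omega>, restrict (\<lambda>i. X i \<omega>) {..<k})) Z"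
    by (rule entropy_cong) (auto simp: restrict_def fun_eq_iff less_Suc_eq)
  also have "\<dots> = En (\<lambda>\<omega>. restrict (\<lambda>i. X i \<omega>) {..<k}) Z + En (X k) (\<lambda>\<omega>. (restrict (\<lambda>j. X j \<omega>) {..<k}, Z \<omega>))"
    by (rule entropy_chain)
  finally show ?case unfolding sum.lessThan_Suc using Suc.IH by linarith
qed

text \<open>The total correlation is the divergence of the joint law from the product of the marginals,
  and a divergence dominates the mass that the second measure puts outside the support of the first.\<close>

lemma total_correlation_ge:
  fixes k :: nat
  assumes C: "finite C" "\<And>i. i < k \<Longrightarrow> X i ` \<Omega> \<subseteq> C"
    and avoid: "\<And>\<omega>. \<omega> \<in> \<Omega> \<Longrightarrow> restrict (\<lambda>i. X i \<omega>) {..<k} \<notin> A"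
    and A: "A \<subseteq> PiE {..<k} (\<lambda>_. C)"
  shows "(\<Sum>\<omega>\<in>\<Omega>. \<Sum>x\<in>A. \<Prod>i<k. cprob \<Omega> (X i) Z \<omega> (x i)) / card \<Omega>
     \<le> (\<Sum>i<k. En (X i) Z - En (X i) (\<lambda>\<omega>. (restrict (\<lambda>j. X j \<omega>) {..<i}, Z \<omega>)))"
proof -
  define T where "T = (\<lambda>\<omega>. restrict (\<lambda>i. X i \<omega>) {..<k})"
  define q where "q = (\<lambda>\<omega> x. \<Prod>i<k. cprob \<Omega> (X i) Z \<omega> (x i))"
  let ?P = "PiE {..<k} (\<lambda>_. C)"
  let ?N = "N (\<lambda>\<omega>. (T \<omega>, Z \<omega>))"
  have finP: "finite ?P" using C by (simp add: finite_PiE)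
  have q0: "q \<omega> x \<ge> 0" for \<omega> x unfolding q_def by (intro prod_nonneg) (simp add: cprob_nonneg)
  have qcong: "q \<omega>' = q \<omega>" if "Z \<omega>' = Z \<omega>" for \<omega> \<omega>'
  proof -
    have "cprob \<Omega> (X i) Z \<omega>' = cprob \<Omega> (X i) Z \<omega>" for i by (rule cprob_cong[of Z, OF that])
    then show ?thesis by (simp add: q_def)
  qed
  have TP: "T \<omega> \<in> ?P" if "\<omega> \<in> \<Omega>" for \<omega> using C that by (auto simp: T_def)
  have qT: "q \<omega> (T \<omega>) = (\<Prod>i<k. N (\<lambda>\<omega>. (X i \<omega>, Z \<omega>)) \<omega> / N Z \<omega>)" for \<omega>
    unfolding q_def T_def by (intro prod.cong refl) (simp add: cprob_self)
  have tot: "(\<Sum>x\<in>?P. q \<omega> x) = 1" if "\<omega> \<in> \<Omega>" for \<omega>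
  proof -
    have "(\<Sum>x\<in>?P. q \<omega> x) = (\<Prod>i<k. \<Sum>c\<in>C. cprob \<Omega> (X i) Z \<omega> c)"
      unfolding q_def by (rule prod_sum_PiE[symmetric]) (use C in auto)
    also have "\<dots> = 1" by (intro prod.neutral ballI cprob_sum_eq1[OF that C(1)]) (use C(2) in auto)
    finally show ?thesis .
  qed
  \<comment> \<open>\<open>A\<close> is disjoint from the tuples observed on the class of \<omega>,
    so the product law gives \<open>A\<close> at most what those tuples leave over.\<close>
  have "(\<Sum>\<omega>\<in>\<Omega>. \<Sum>x\<in>A. q \<omega> x) \<le> (\<Sum>\<omega>\<in>\<Omega>. 1 - (\<Sum>x\<in>T ` Cl Z \<omega>. q \<omega> x))"
  proof (rule sum_mono)
    fix \<omega> assume w: "\<omega> \<in> \<Omega>"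
    have "(\<Sum>x\<in>A. q \<omega> x) + (\<Sum>x\<in>T ` Cl Z \<omega>. q \<omega> x) = (\<Sum>x\<in>A \<union> T ` Cl Z \<omega>. q \<omega> x)"
      by (rule sum.union_disjoint[symmetric]) (use finP A fin avoid finite_subset in \<open>auto simp: T_def\<close>)
    also have "\<dots> \<le> (\<Sum>x\<in>?P. q \<omega> x)" by (rule sum_mono2) (use finP A TP q0 in auto)
    finally show "(\<Sum>x\<in>A. q \<omega> x) \<le> 1 - (\<Sum>x\<in>T ` Cl Z \<omega>. q \<omega> x)" using tot[OF w] by simp
  qed
  also have "\<dots> = (\<Sum>\<omega>\<in>\<Omega>. 1 - q \<omega> (T \<omega>) * N Z \<omega> / ?N \<omega>)"
    by (simp add: sum_subtractf sum_density[where g = q, OF qcong])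
  also have "\<dots> \<le> (\<Sum>\<omega>\<in>\<Omega>. - ln (q \<omega> (T \<omega>) * N Z \<omega> / ?N \<omega>))"
  proof (rule sum_mono)
    fix \<omega> assume w: "\<omega> \<in> \<Omega>"
    have "q \<omega> (T \<omega>) > 0" unfolding qT using w by (intro prod_pos) auto
    then have "ln (q \<omega> (T \<omega>) * N Z \<omega> / ?N \<omega>) \<le> q \<omega> (T \<omega>) * N Z \<omega> / ?N \<omega> - 1"
      using w by (intro ln_le_minus_one) auto
    then show "1 - q \<omega> (T \<omega>) * N Z \<omega> / ?N \<omega> \<le> - ln (q \<omega> (T \<omega>) * N Z \<omega> / ?N \<omega>)" by simp
  qed
  also have "\<dots> = (\<Sum>\<omega>\<in>\<Omega>. (\<Sum>i<k. ln (N Z \<omega> / N (\<lambda>\<omega>. (X i \<omega>, Z \<omega>)) \<omega>)) - ln (N Z \<omega> / ?N \<omega>))"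
  proof (rule sum.cong[OF refl])
    fix \<omega> assume w: "\<omega> \<in> \<Omega>"
    have pos: "q \<omega> (T \<omega>) > 0" unfolding qT using w by (intro prod_pos) auto
    have "ln (q \<omega> (T \<omega>)) = (\<Sum>i<k. ln (N (\<lambda>\<omega>. (X i \<omega>, Z \<omega>)) \<omega> / N Z \<omega>))"
      unfolding qT by (rule ln_prod) (use w in auto)
    also have "\<dots> = - (\<Sum>i<k. ln (N Z \<omega> / N (\<lambda>\<omega>. (X i \<omega>, Z \<omega>)) \<omega>))"
      unfolding sum_negf[symmetric] by (intro sum.cong refl) (use w in \<open>simp add: ln_div\<close>)
    finally show "- ln (q \<omega> (T \<omega>) * N Z \<omega> / ?N \<omega>) = (\<Sum>i<k. ln (N Z \<omega> / N (\<lambda>\<omega>. (X i \<omega>, Z \<omega>)) \<omega>)) - ln (N Z \<omega> / ?N \<omega>)"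
      using pos w by (simp add: ln_div ln_mult)
  qed
  also have "\<dots> = card \<Omega> * ((\<Sum>i<k. En (X i) Z) - En T Z)"
  proof -
    have "(\<Sum>\<omega>\<in>\<Omega>. \<Sum>i<k. ln (N Z \<omega> / N (\<lambda>\<omega>. (X i \<omega>, Z \<omega>)) \<omega>)) = (\<Sum>i<k. card \<Omega> * En (X i) Z)"
      by (subst sum.swap) (use card_pos in \<open>simp add: cond_entropy_def\<close>)
    moreover have "(\<Sum>\<omega>\<in>\<Omega>. ln (N Z \<omega> / ?N \<omega>)) = card \<Omega> * En T Z"
      using card_pos by (simp add: cond_entropy_def)
    ultimately show ?thesis by (simp add: sum_subtractf right_diff_distrib sum_distrib_left)
  qed
  finally have "(\<Sum>\<omega>\<in>\<Omega>. \<Sum>x\<in>A. q \<omega> x) / card \<Omega> \<le> (\<Sum>i<k. En (X i) Z) - En T Z"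
    using card_pos by (simp add: field_simps)
  then show ?thesis unfolding q_def T_def entropy_tuple_chain sum_subtractf .
qed

end

text \<open>Reveal \<open>i0\<close> first and the others one by one: at most \<open>m\<close>
  values are in use at any time, and a rich index keeps mass \<eta> outside them. Only the total
  mass 1 is asked of \<open>i0\<close>; this index will be the line that is just an edge.\<close>

lemma prob_injective_ge:
  fixes p :: "'i \<Rightarrow> 'c \<Rightarrow> real"
  assumes fin: "finite I" "finite C" and i0: "i0 \<notin> I" and p0: "\<And>i c. p i c \<ge> 0" and one: "(\<Sum>c\<in>C. p i0 c) = 1"
    and rich: "\<And>i K. i \<in> I \<Longrightarrow> finite K \<Longrightarrow> card K \<le> m \<Longrightarrow> (\<Sum>c\<in>C - K. p i c) \<ge> \<eta>"
    and m: "card I \<le> m" and \<eta>: "\<eta> \<ge> 0"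
  shows "(\<Sum>x\<in>{x\<in>PiE (insert i0 I) (\<lambda>_. C). inj_on x (insert i0 I)}. \<Prod>i\<in>insert i0 I. p i (x i)) \<ge> \<eta> ^ card I"
  using fin(1) i0 rich m
proof (induction I rule: finite_induct)
  case empty
  have "{x\<in>PiE {i0} (\<lambda>_. C). inj_on x {i0}} = PiE {i0} (\<lambda>_. C)" by auto
  moreover have "(\<Sum>x\<in>PiE {i0} (\<lambda>_. C). p i0 (x i0)) = 1"
    using sum_PiE_insert[of i0 "{}" "\<lambda>x. p i0 (x i0)" "\<lambda>_. C"] one by simp
  ultimately show ?case by simp
next
  case (insert j I)
  let ?J = "insert i0 I"
  let ?G = "{x\<in>PiE ?J (\<lambda>_. C). inj_on x ?J}"
  have j: "j \<notin> ?J" using insert by auto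
  have finJ: "finite ?J" using insert by simp
  have finP: "finite (PiE ?J (\<lambda>_. C))" using finJ fin by (simp add: finite_PiE)
  have IH: "\<eta> ^ card I \<le> (\<Sum>x\<in>?G. \<Prod>i\<in>?J. p i (x i))" using insert by auto
  have "(\<Sum>x\<in>{x\<in>PiE (insert i0 (insert j I)) (\<lambda>_. C). inj_on x (insert i0 (insert j I))}. \<Prod>i\<in>insert i0 (insert j I). p i (x i))
     = (\<Sum>x\<in>PiE (insert j ?J) (\<lambda>_. C). if inj_on x (insert j ?J) then \<Prod>i\<in>insert j ?J. p i (x i) else 0)"
    using finJ fin by (subst sum.inter_filter[symmetric]) (simp_all add: finite_PiE insert_commute)
  also have "\<dots> = (\<Sum>c\<in>C. \<Sum>x\<in>PiE ?J (\<lambda>_. C). if inj_on (x(j := c)) (insert j ?J) then \<Prod>i\<in>insert j ?J. p i ((x(j := c)) i) else 0)"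
    by (rule sum_PiE_insert[OF j])
  also have "\<dots> = (\<Sum>c\<in>C. \<Sum>x\<in>PiE ?J (\<lambda>_. C). if inj_on x ?J \<and> c \<notin> x ` ?J then p j c * (\<Prod>i\<in>?J. p i (x i)) else 0)"
  proof (intro sum.cong refl)
    fix c x
    have 1: "(\<Prod>i\<in>insert j ?J. p i ((x(j := c)) i)) = p j c * (\<Prod>i\<in>?J. p i (x i))"
    proof -
      have "(\<Prod>i\<in>?J. p i ((x(j := c)) i)) = (\<Prod>i\<in>?J. p i (x i))" using j by (intro prod.cong) auto
      then show ?thesis using j finJ by (subst prod.insert) auto
    qed
    have "inj_on (x(j := c)) ?J = inj_on x ?J" by (rule inj_on_cong) (use j in auto)
    moreover have "(x(j := c)) ` ?J = x ` ?J" using j by (intro image_cong) auto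
    ultimately have 2: "inj_on (x(j := c)) (insert j ?J) = (inj_on x ?J \<and> c \<notin> x ` ?J)"
      using j by (simp only: inj_on_insert) (simp add: Diff_insert_absorb)
    show "(if inj_on (x(j := c)) (insert j ?J) then \<Prod>i\<in>insert j ?J. p i ((x(j := c)) i) else 0)
      = (if inj_on x ?J \<and> c \<notin> x ` ?J then p j c * (\<Prod>i\<in>?J. p i (x i)) else 0)" unfolding 1 2 ..
  qed
  also have "\<dots> = (\<Sum>x\<in>PiE ?J (\<lambda>_. C). \<Sum>c\<in>C. if inj_on x ?J \<and> c \<notin> x ` ?J then p j c * (\<Prod>i\<in>?J. p i (x i)) else 0)"
    by (rule sum.swap)
  also have "\<dots> = (\<Sum>x\<in>?G. (\<Sum>c\<in>C - x ` ?J. p j c) * (\<Prod>i\<in>?J. p i (x i)))"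
  proof -
    have "(\<Sum>c\<in>C. if b \<and> c \<notin> S then p j c * t else 0) = (if b then (\<Sum>c\<in>C - S. p j c) * t else 0)" for b S t
    proof (cases b)
      case True
      have "C - S = {c\<in>C. c \<notin> S}" by blast
      then have "(\<Sum>c\<in>C - S. p j c * t) = (\<Sum>c\<in>C. if c \<notin> S then p j c * t else 0)"
        by (simp only: sum.inter_filter[OF fin(2)])
      then show ?thesis using True by (simp only: sum_distrib_right if_True simp_thms)
    qed simp
    then show ?thesis using finP by (simp only: sum.inter_filter)
  qed
  also have "\<dots> \<ge> (\<Sum>x\<in>?G. \<eta> * (\<Prod>i\<in>?J. p i (x i)))"
  proof (intro sum_mono mult_right_mono)
    fix x :: "'i \<Rightarrow> 'c"
    have "card (x ` ?J) \<le> card ?J" by (rule card_image_le[OF finJ])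
    also have "\<dots> \<le> m" using insert by simp
    finally show "\<eta> \<le> (\<Sum>c\<in>C - x ` ?J. p j c)" using insert.prems(2)[of j "x ` ?J"] finJ by simp
    show "0 \<le> (\<Prod>i\<in>?J. p i (x i))" using p0 by (intro prod_nonneg) auto
  qed
  finally have "\<eta> * (\<Sum>x\<in>?G. \<Prod>i\<in>?J. p i (x i)) \<le> (\<Sum>x\<in>{x\<in>PiE (insert i0 (insert j I)) (\<lambda>_. C). inj_on x (insert i0 (insert j I))}. \<Prod>i\<in>insert i0 (insert j I). p i (x i))"
    by (simp only: sum_distrib_left)
  moreover have "\<eta> ^ card (insert j I) \<le> \<eta> * (\<Sum>x\<in>?G. \<Prod>i\<in>?J. p i (x i))"
    using IH insert \<eta> by (simp add: mult_left_mono)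
  ultimately show ?case by linarith
qed

section \<open>Rich edges and pinning\<close>

context uniform_space
begin

text \<open>Six colours may be excluded because a line of a rainbow Fano plane has to avoid the colours of
  the other six lines.\<close>

definition rich :: "real \<Rightarrow> nat \<Rightarrow> ('w \<Rightarrow> nat) \<Rightarrow> ('w \<Rightarrow> 'c) \<Rightarrow> 'w \<Rightarrow> bool" where
  "rich \<eta> r X Z \<omega> \<longleftrightarrow> (\<forall>K. finite K \<longrightarrow> card K \<le> 6 \<longrightarrow> \<eta> \<le> (\<Sum>c\<in>{1..r} - K. cprob \<Omega> X Z \<omega> c))"

text \<open>\<open>gibbs\<close> with the uniform law on rich classes. On a poor class half of the
  mass goes to the at most six exceptional colours, costing \<open>ln 12\<close> each, and half is
  spread uniformly, so that a colour outside costs \<open>ln (2 * r)\<close>; this happens with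
  probability at most \<eta>.\<close>

lemma entropy_le_rich:
  assumes r: "r \<ge> 1" and X: "X ` \<Omega> \<subseteq> {1..r}" and \<eta>: "\<eta> > 0"
  shows "En X Z \<le> ln r * (real (card {\<omega>\<in>\<Omega>. rich \<eta> r X Z \<omega>}) / card \<Omega>) + (ln 12 + \<eta> * ln (2 * real r))"
proof -
  define K where "K = (\<lambda>\<omega>. SOME K. finite K \<and> card K \<le> 6 \<and> (\<Sum>c\<in>{1..r} - K. cprob \<Omega> X Z \<omega> c) < \<eta>)"
  have K: "finite (K \<omega>) \<and> card (K \<omega>) \<le> 6 \<and> (\<Sum>c\<in>{1..r} - K \<omega>. cprob \<Omega> X Z \<omega> c) < \<eta>"
    if "\<not> rich \<eta> r X Z \<omega>" for \<omega>
  proof -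
    have "\<exists>K. finite K \<and> card K \<le> 6 \<and> (\<Sum>c\<in>{1..r} - K. cprob \<Omega> X Z \<omega> c) < \<eta>"
      using that unfolding rich_def by (auto simp: not_le)
    then show ?thesis unfolding K_def by (rule someI_ex)
  qed
  define poor where "poor = (\<lambda>\<omega>. \<not> rich \<eta> r X Z \<omega>)"
  define q where "q = (\<lambda>\<omega> c. if poor \<omega> then (if c \<in> K \<omega> then 1/12 else 1 / (2 * real r)) else 1 / real r)"
  have cc: "poor \<omega>' = poor \<omega>" "K \<omega>' = K \<omega>" if "Z \<omega>' = Z \<omega>" for \<omega> \<omega>'
    unfolding poor_def rich_def K_def using cprob_cong[of Z, OF that, of X] by simp_all
  have r0: "real r > 0" using r by simp
  have "En X Z \<le> (\<Sum>\<omega>\<in>\<Omega>. ln (1 / q \<omega> (X \<omega>))) / card \<Omega>"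
  proof (rule gibbs)
    show "q \<omega>' = q \<omega>" if "\<omega> \<in> \<Omega>" "\<omega>' \<in> \<Omega>" "Z \<omega>' = Z \<omega>" for \<omega> \<omega>'
      unfolding q_def cc[OF that(3)] by (rule refl)
    show "q \<omega> (X \<omega>) > 0" for \<omega> using r0 by (simp add: q_def)
    show "(\<Sum>x\<in>X ` Cl Z \<omega>. q \<omega> x) \<le> 1" if w: "\<omega> \<in> \<Omega>" for \<omega>
    proof -
      have "(\<Sum>x\<in>X ` Cl Z \<omega>. q \<omega> x) \<le> (\<Sum>x\<in>{1..r}. q \<omega> x)"
        by (rule sum_mono2) (use X r0 in \<open>auto simp: q_def\<close>)
      also have "\<dots> \<le> 1"
      proof (cases "poor \<omega>")
        case True
        have Kw: "finite (K \<omega>)" "card (K \<omega>) \<le> 6" using K[of \<omega>] True by (auto simp: poor_def)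
        have "(\<Sum>x\<in>{1..r}. q \<omega> x) \<le> (\<Sum>x\<in>{1..r}. of_bool (x \<in> K \<omega>) * (1/12) + 1 / (2 * real r))"
          using True r0 by (intro sum_mono) (auto simp: q_def)
        also have "\<dots> = real (card {x\<in>{1..r}. x \<in> K \<omega>}) * (1/12) + r * (1 / (2 * real r))"
          by (simp only: sum.distrib sum_distrib_right[symmetric] card_filter_sum[of "{1..r}"] finite_atLeastAtMost sum_constant card_atLeastAtMost) simp
        also have "\<dots> \<le> 6 * (1/12) + r * (1 / (2 * real r))"
        proof -
          have "card {x\<in>{1..r}. x \<in> K \<omega>} \<le> card (K \<omega>)" using Kw by (intro card_mono) auto
          then have "real (card {x\<in>{1..r}. x \<in> K \<omega>}) \<le> 6" using Kw by linarith
          then show ?thesis by simp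
        qed
        also have "\<dots> = 1" using r0 by simp
        finally show ?thesis .
      next
        case False
        then show ?thesis using r0 by (simp add: q_def)
      qed
      finally show ?thesis .
    qed
  qed
  also have "(\<Sum>\<omega>\<in>\<Omega>. ln (1 / q \<omega> (X \<omega>))) \<le> (\<Sum>\<omega>\<in>\<Omega>. of_bool (rich \<eta> r X Z \<omega>) * ln r + (ln 12 + of_bool (poor \<omega> \<and> X \<omega> \<notin> K \<omega>) * ln (2 * real r)))"
  proof (rule sum_mono)
    fix \<omega>
    have "0 \<le> ln (12::real)" "0 \<le> ln (2 * real r)" using r by simp_all
    then show "ln (1 / q \<omega> (X \<omega>)) \<le> of_bool (rich \<eta> r X Z \<omega>) * ln r + (ln 12 + of_bool (poor \<omega> \<and> X \<omega> \<notin> K \<omega>) * ln (2 * real r))"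
      by (auto simp: q_def poor_def)
  qed
  also have "\<dots> = real (card {\<omega>\<in>\<Omega>. rich \<eta> r X Z \<omega>}) * ln r + (card \<Omega> * ln 12 + (\<Sum>\<omega>\<in>\<Omega>. of_bool (poor \<omega> \<and> X \<omega> \<notin> K \<omega>)) * ln (2 * real r))"
    by (simp only: sum.distrib sum_distrib_right[symmetric] card_filter_sum[OF fin] sum_constant)
  also have "(\<Sum>\<omega>\<in>\<Omega>. (of_bool (poor \<omega> \<and> X \<omega> \<notin> K \<omega>) :: real)) \<le> card \<Omega> * \<eta>"
  proof -
    have "(\<Sum>\<omega>\<in>\<Omega>. (of_bool (poor \<omega> \<and> X \<omega> \<notin> K \<omega>) :: real)) = (\<Sum>\<omega>\<in>\<Omega>. (\<Sum>\<omega>'\<in>Cl Z \<omega>. of_bool (poor \<omega>' \<and> X \<omega>' \<notin> K \<omega>')) / N Z \<omega>)"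
      by (rule class_average)
    also have "\<dots> \<le> (\<Sum>\<omega>\<in>\<Omega>. \<eta>)"
    proof (rule sum_mono)
      fix \<omega> assume w: "\<omega> \<in> \<Omega>"
      have "(\<Sum>\<omega>'\<in>Cl Z \<omega>. (of_bool (poor \<omega>' \<and> X \<omega>' \<notin> K \<omega>') :: real)) = (\<Sum>\<omega>'\<in>Cl Z \<omega>. of_bool (poor \<omega> \<and> X \<omega>' \<notin> K \<omega>))"
      proof (rule sum.cong[OF refl])
        fix \<omega>' assume "\<omega>' \<in> Cl Z \<omega>"
        then have "Z \<omega>' = Z \<omega>" by simp
        from cc[OF this] show "(of_bool (poor \<omega>' \<and> X \<omega>' \<notin> K \<omega>') :: real) = of_bool (poor \<omega> \<and> X \<omega>' \<notin> K \<omega>)"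
          by simp
      qed
      also have "\<dots> / N Z \<omega> \<le> \<eta>"
      proof (cases "poor \<omega>")
        case True
        have "(\<Sum>\<omega>'\<in>Cl Z \<omega>. (of_bool (poor \<omega> \<and> X \<omega>' \<notin> K \<omega>) :: real)) = real (card {\<omega>'\<in>Cl Z \<omega>. X \<omega>' \<notin> K \<omega>})"
          using True fin by (subst card_filter_sum) auto
        also have "{\<omega>'\<in>Cl Z \<omega>. X \<omega>' \<notin> K \<omega>} = {\<omega>'\<in>Cl Z \<omega>. X \<omega>' \<in> {1..r} - K \<omega>}" using X by auto
        also have "real (card \<dots>) / N Z \<omega> = (\<Sum>c\<in>{1..r} - K \<omega>. cprob \<Omega> X Z \<omega> c)"
          by (rule cprob_sum[OF w, symmetric]) simp
        also have "\<dots> \<le> \<eta>" using K[of \<omega>] True by (simp add: poor_def)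
        finally show ?thesis .
      qed (use \<eta> in simp)
      finally show "(\<Sum>\<omega>'\<in>Cl Z \<omega>. of_bool (poor \<omega>' \<and> X \<omega>' \<notin> K \<omega>')) / N Z \<omega> \<le> \<eta>" .
    qed
    finally show ?thesis by simp
  qed
  finally have "En X Z \<le> (real (card {\<omega>\<in>\<Omega>. rich \<eta> r X Z \<omega>}) * ln r + (card \<Omega> * ln 12 + (card \<Omega> * \<eta>) * ln (2 * real r))) / card \<Omega>"
    using r by (simp add: divide_right_mono mult_right_mono)
  also have "\<dots> = ln r * (real (card {\<omega>\<in>\<Omega>. rich \<eta> r X Z \<omega>}) / card \<Omega>) + (ln 12 + \<eta> * ln (2 * real r))"
    using card_pos by (simp add: field_simps)
  finally show ?thesis .
qed

end

locale coloring_space = uniform_space \<Omega> for \<Omega> :: "('a set \<Rightarrow> nat) set" +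
  fixes E :: "'a set set" and r :: nat
  assumes r1: "r \<ge> 1"
    and color: "\<And>\<omega> e. \<omega> \<in> \<Omega> \<Longrightarrow> e \<in> E \<Longrightarrow> \<omega> e \<in> {1..r}"
    and undef: "\<And>\<omega> e. \<omega> \<in> \<Omega> \<Longrightarrow> e \<notin> E \<Longrightarrow> \<omega> e = undefined"
begin

text \<open>All sets meeting \<open>T\<close> are recorded, not only edges; outside \<open>E\<close>
  the colourings are constantly \<open>undefined\<close>, so nothing is added to the
  information.\<close>

abbreviation pin :: "'a set \<Rightarrow> ('a set \<Rightarrow> nat) \<Rightarrow> 'a set \<Rightarrow> nat" where
  "pin T \<omega> \<equiv> restrict \<omega> {e. e \<inter> T \<noteq> {}}"

section \<open>Pinning a bounded set of vertices\<close>

lemma ln_r_nonneg: "0 \<le> ln (real r)" using r1 by simp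

lemma entropy_edge_le: "En (\<lambda>\<omega>. \<omega> e) Z \<le> ln r"
proof (cases "e \<in> E")
  case True
  then have "(\<lambda>\<omega>. \<omega> e) ` \<Omega> \<subseteq> {1..r}" using color by blast
  from entropy_le_card[OF finite_atLeastAtMost this, of Z] show ?thesis by simp
next
  case False
  then have "En (\<lambda>\<omega>. \<omega> e) Z = 0" by (intro entropy_determined) (simp add: undef)
  then show ?thesis using ln_r_nonneg by simp
qed

text \<open>The mutual informations between each line and the earlier ones, given the pinned
  colours; together they are the total correlation of the \<open>k\<close> colours.\<close>

definition drop :: "'a set \<Rightarrow> nat \<Rightarrow> (nat \<Rightarrow> 'a set) \<Rightarrow> real" where
  "drop T k e = (\<Sum>i<k. En (\<lambda>\<omega>. \<omega> (e i)) (pin T) - En (\<lambda>\<omega>. \<omega> (e i)) (\<lambda>\<omega>. (restrict (\<lambda>j. \<omega> (e j)) {..<i}, pin T \<omega>)))"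

lemma drop_nonneg: "drop T k e \<ge> 0"
  unfolding drop_def
proof (rule sum_nonneg)
  fix i
  have "En (\<lambda>\<omega>. \<omega> (e i)) (\<lambda>\<omega>. (restrict (\<lambda>j. \<omega> (e j)) {..<i}, pin T \<omega>)) \<le> En (\<lambda>\<omega>. \<omega> (e i)) (pin T)"
    by (rule entropy_mono) simp
  then show "0 \<le> En (\<lambda>\<omega>. \<omega> (e i)) (pin T) - En (\<lambda>\<omega>. \<omega> (e i)) (\<lambda>\<omega>. (restrict (\<lambda>j. \<omega> (e j)) {..<i}, pin T \<omega>))"
    by simp
qed

text \<open>Pinning the edges that meet a random copy of the pattern costs every line its mutual information
  with the earlier lines, while the total entropy of the lines stays nonnegative.\<close>

lemma exists_pin:
  fixes e :: "nat \<Rightarrow> (nat \<Rightarrow> 'a) \<Rightarrow> 'a set" and P :: "'a set"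
  assumes P: "finite P" "P \<noteq> {}" and J: "finite J" and dep: "\<And>i. i < k \<Longrightarrow> dep i \<subseteq> J"
    and loc: "\<And>i \<phi> \<psi>. i < k \<Longrightarrow> (\<And>p. p \<in> dep i \<Longrightarrow> \<phi> p = \<psi> p) \<Longrightarrow> e i \<phi> = e i \<psi>"
    and meet: "\<And>i j. j < i \<Longrightarrow> i < k \<Longrightarrow> \<exists>p\<in>dep j - dep i. \<forall>\<phi>. \<phi> p \<in> e j \<phi>"
    and L: "L > 0"
  shows "\<exists>T\<subseteq>P. card T \<le> card J * L \<and>
    (\<Sum>\<phi>\<in>PiE J (\<lambda>_. P). drop T k (\<lambda>i. e i \<phi>)) \<le> real (card P) ^ card J * k * ln r / L"
proof (rule ccontr)
  assume no: "\<not> ?thesis"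
  define F where "F = PiE J (\<lambda>_. P)"
  define B where "B = real (card P) ^ card J"
  have finF: "finite F" unfolding F_def using P J by (simp add: finite_PiE)
  have cF: "real (card F) = B" by (simp add: F_def B_def card_PiE J)
  have B0: "B > 0" using P by (simp add: B_def card_gt_0_iff)
  define D where "D = B * k * ln r / L"
  define \<Psi> where "\<Psi> = (\<lambda>T. \<Sum>\<phi>\<in>F. \<Sum>i<k. En (\<lambda>\<omega>. \<omega> (e i \<phi>)) (pin T))"
  define g where "g = (\<lambda>T i \<phi>. En (\<lambda>\<omega>. \<omega> (e i \<phi>)) (\<lambda>\<omega>. (restrict (\<lambda>j. \<omega> (e j \<phi>)) {..<i}, pin T \<omega>)))"
  define G where "G = (\<lambda>T. \<Sum>\<phi>\<in>F. drop T k (\<lambda>i. e i \<phi>))"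
  have GD: "D < G T" if "T \<subseteq> P" "card T \<le> card J * L" for T
    using no that unfolding G_def D_def F_def B_def by (auto simp: not_le)
  have GPsi: "G T = \<Psi> T - (\<Sum>\<phi>\<in>F. \<Sum>i<k. g T i \<phi>)" for T
    by (simp add: G_def \<Psi>_def drop_def g_def sum_subtractf)
  \<comment> \<open>The potential \<Psi> is the total conditional entropy of the lines over all
    copies. The set to be pinned next is a second, independent random copy \<psi>, and the expected
    new potential is compared with \<Psi> after subtracting all mutual informations.\<close>
  have step: "\<exists>\<psi>\<in>F. \<Psi> (T \<union> \<psi> ` J) \<le> \<Psi> T - G T" for T
  proof (rule ccontr)
    assume n: "\<not> ?thesis"
    have Fne: "F \<noteq> {}" using cF B0 by auto
    have "(\<Sum>\<psi>\<in>F. \<Psi> T - G T) < (\<Sum>\<psi>\<in>F. \<Psi> (T \<union> \<psi> ` J))"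
      using n finF Fne by (intro sum_strict_mono) auto
    also have "\<dots> = (\<Sum>\<psi>\<in>F. \<Sum>i<k. \<Sum>\<phi>\<in>F. En (\<lambda>\<omega>. \<omega> (e i \<phi>)) (pin (T \<union> \<psi> ` J)))"
      unfolding \<Psi>_def by (intro sum.cong refl sum.swap)
    also have "\<dots> = (\<Sum>i<k. \<Sum>\<psi>\<in>F. \<Sum>\<phi>\<in>F. En (\<lambda>\<omega>. \<omega> (e i \<phi>)) (pin (T \<union> \<psi> ` J)))"
      by (rule sum.swap)
    also have "\<dots> = (\<Sum>i<k. \<Sum>\<phi>\<in>F. \<Sum>\<psi>\<in>F. En (\<lambda>\<omega>. \<omega> (e i \<phi>)) (pin (T \<union> \<psi> ` J)))"
      by (intro sum.cong refl sum.swap)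
    also have "\<dots> \<le> (\<Sum>i<k. \<Sum>\<phi>\<in>F. \<Sum>\<psi>\<in>F. g T i (\<lambda>p. if p \<in> dep i then \<phi> p else \<psi> p))"
    proof (intro sum_mono)
      fix i :: nat and \<phi> \<psi> :: "nat \<Rightarrow> 'a" assume i: "i \<in> {..<k}"
      \<comment> \<open>The copy \<chi> has the line \<open>i\<close> of \<phi>, while every earlier
        line of \<chi> contains a vertex coming from \<psi>. So pinning \<psi> reveals those lines,
        and \<open>sum_PiE_merge\<close> makes \<chi> uniform.\<close>
      define \<chi> where "\<chi> = (\<lambda>p. if p \<in> dep i then \<phi> p else \<psi> p)"
      have ei: "e i \<phi> = e i \<chi>" using i by (intro loc) (auto simp: \<chi>_def)
      show "En (\<lambda>\<omega>. \<omega> (e i \<phi>)) (pin (T \<union> \<psi> ` J)) \<le> g T i (\<lambda>p. if p \<in> dep i then \<phi> p else \<psi> p)"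
        unfolding g_def \<chi>_def[symmetric] ei
      proof (rule entropy_mono)
        fix \<omega> \<omega>' assume "\<omega> \<in> \<Omega>" "\<omega>' \<in> \<Omega>" and eq: "pin (T \<union> \<psi> ` J) \<omega>' = pin (T \<union> \<psi> ` J) \<omega>"
        have val: "\<omega>' d = \<omega> d" if "d \<inter> (T \<union> \<psi> ` J) \<noteq> {}" for d
          using fun_cong[OF eq, of d] that by simp
        have 1: "pin T \<omega>' = pin T \<omega>"
        proof
          fix d
          have "\<omega>' d = \<omega> d" if "d \<inter> T \<noteq> {}" by (rule val) (use that in blast)
          then show "pin T \<omega>' d = pin T \<omega> d" by simp
        qed
        have 2: "\<omega>' (e j \<chi>) = \<omega> (e j \<chi>)" if j: "j < i" for j
        proof -
          obtain p where p: "p \<in> dep j - dep i" "\<forall>\<phi>. \<phi> p \<in> e j \<phi>" using meet[OF j] i by auto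
          have "p \<in> J" using p(1) dep[of j] j i by auto
          moreover have "\<psi> p \<in> e j \<chi>" using p(2)[rule_format, of \<chi>] p(1) by (simp add: \<chi>_def)
          ultimately show ?thesis by (intro val) blast
        qed
        have "restrict (\<lambda>j. \<omega>' (e j \<chi>)) {..<i} = restrict (\<lambda>j. \<omega> (e j \<chi>)) {..<i}"
          by (rule restrict_ext) (use 2 in simp)
        then show "(restrict (\<lambda>j. \<omega>' (e j \<chi>)) {..<i}, pin T \<omega>') = (restrict (\<lambda>j. \<omega> (e j \<chi>)) {..<i}, pin T \<omega>)"
          using 1 by simp
      qed
    qed
    also have "\<dots> = (\<Sum>i<k. B * (\<Sum>\<phi>\<in>F. g T i \<phi>))"
      unfolding F_def B_def by (intro sum.cong refl sum_PiE_merge J) (use dep in auto)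
    also have "\<dots> = B * (\<Sum>\<phi>\<in>F. \<Sum>i<k. g T i \<phi>)" unfolding sum_distrib_left by (rule sum.swap)
    also have "\<dots> = (\<Sum>\<psi>\<in>F. \<Psi> T - G T)" using cF by (simp add: GPsi)
    finally show False by simp
  qed
  \<comment> \<open>If \<open>G\<close> exceeded \<open>D\<close> for every small \<open>T\<close>,
    then \<open>L\<close> rounds would lower \<Psi> by \<open>L * D\<close>, which is the largest
    value \<Psi> can start from, while \<Psi> must stay above \<open>G > D\<close>.\<close>
  have iter: "l \<le> L \<Longrightarrow> \<exists>T\<subseteq>P. card T \<le> card J * l \<and> \<Psi> T \<le> \<Psi> {} - l * D" for l
  proof (induction l)
    case 0
    show ?case by (intro exI[of _ "{}"]) simp
  next
    case (Suc l)
    then obtain T where T: "T \<subseteq> P" "card T \<le> card J * l" "\<Psi> T \<le> \<Psi> {} - l * D" by auto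
    have "card J * l \<le> card J * L" using Suc.prems by simp
    then have GT: "D < G T" using GD[OF T(1)] T(2) by linarith
    obtain \<psi> where \<psi>: "\<psi> \<in> F" "\<Psi> (T \<union> \<psi> ` J) \<le> \<Psi> T - G T" using step by blast
    have "\<psi> ` J \<subseteq> P" using \<psi>(1) by (auto simp: F_def)
    moreover have "card (T \<union> \<psi> ` J) \<le> card J * Suc l"
      using card_Un_le[of T "\<psi> ` J"] card_image_le[OF J, of \<psi>] T(2) by simp
    moreover have "\<Psi> (T \<union> \<psi> ` J) \<le> \<Psi> {} - Suc l * D" using \<psi>(2) GT T(3) by (simp add: algebra_simps)
    ultimately show ?case using T(1) by (intro exI[of _ "T \<union> \<psi> ` J"]) auto
  qed
  obtain T where T: "T \<subseteq> P" "card T \<le> card J * L" "\<Psi> T \<le> \<Psi> {} - L * D" using iter[of L] by auto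
  have "\<Psi> {} \<le> (\<Sum>\<phi>\<in>F. \<Sum>i<k. ln r)" unfolding \<Psi>_def by (intro sum_mono entropy_edge_le)
  also have "\<dots> = L * D" using cF L by (simp add: D_def)
  finally have "\<Psi> T \<le> 0" using T(3) by simp
  moreover have "0 \<le> (\<Sum>\<phi>\<in>F. \<Sum>i<k. g T i \<phi>)" unfolding g_def by (intro sum_nonneg entropy_nonneg)
  moreover have "0 \<le> D" unfolding D_def using B0 ln_r_nonneg by simp
  ultimately show False using GD[OF T(1,2)] GPsi[of T] by linarith
qed

abbreviation rich_edge :: "real \<Rightarrow> 'a set \<Rightarrow> ('a set \<Rightarrow> nat) \<Rightarrow> 'a set \<Rightarrow> bool" where
  "rich_edge \<eta> T \<omega> e \<equiv> rich \<eta> r (\<lambda>\<omega>. \<omega> e) (pin T) \<omega>"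

text \<open>Outside \<open>E\<close> all mass sits on \<open>undefined\<close>, whether or not this
  number is a colour; excluding that single value leaves nothing.\<close>

lemma rich_edge_in:
  assumes "\<eta> > 0" "\<omega> \<in> \<Omega>" "rich_edge \<eta> T \<omega> e"
  shows "e \<in> E"
proof (rule ccontr)
  assume "e \<notin> E"
  then have "cprob \<Omega> (\<lambda>\<omega>. \<omega> e) (pin T) \<omega> c = 0" if "c \<noteq> undefined" for c
    unfolding cprob_def using undef that by (auto simp: card_eq_0_iff)
  then have "(\<Sum>c\<in>{1..r} - {undefined}. cprob \<Omega> (\<lambda>\<omega>. \<omega> e) (pin T) \<omega> c) = 0" by (intro sum.neutral) auto
  moreover have "\<eta> \<le> (\<Sum>c\<in>{1..r} - {undefined}. cprob \<Omega> (\<lambda>\<omega>. \<omega> e) (pin T) \<omega> c)"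
    using assms(3) unfolding rich_def by simp
  ultimately show False using assms(1) by simp
qed

text \<open>Under the product of the conditional laws the seven lines get distinct colours with
  probability at least \<eta>^6, by \<open>prob_injective_ge\<close>; the true colourings never do
  this. \<open>total_correlation_ge\<close> charges the discrepancy to \<open>drop\<close>.\<close>

lemma few_rich_copies:
  assumes \<eta>: "\<eta> > 0"
    and nr: "(\<And>i. i < 7 \<Longrightarrow> e i \<in> E) \<Longrightarrow> (\<And>\<omega>. \<omega> \<in> \<Omega> \<Longrightarrow> \<not> inj_on (\<lambda>i. \<omega> (e i)) {..<7})"
  shows "(\<Sum>\<omega>\<in>\<Omega>. of_bool (e 6 \<in> E \<and> (\<forall>i<6. rich_edge \<eta> T \<omega> (e i)))) * \<eta>^6 / card \<Omega> \<le> drop T 7 e"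
proof (cases "\<exists>\<omega>\<in>\<Omega>. e 6 \<in> E \<and> (\<forall>i<6. rich_edge \<eta> T \<omega> (e i))")
  case False
  then have "(\<Sum>\<omega>\<in>\<Omega>. (of_bool (e 6 \<in> E \<and> (\<forall>i<6. rich_edge \<eta> T \<omega> (e i))) :: real)) = 0" by (intro sum.neutral) auto
  then show ?thesis using drop_nonneg by simp
next
  case True
  have eE: "e i \<in> E" if "i < 7" for i
  proof (cases "i = 6")
    case True then show ?thesis using \<open>\<exists>\<omega>\<in>\<Omega>. e 6 \<in> E \<and> (\<forall>i<6. rich_edge \<eta> T \<omega> (e i))\<close> by blast
  next
    case False
    then have "i < 6" using that by simp
    then show ?thesis using True rich_edge_in[OF \<eta>] by blast
  qed
  define A where "A = {x \<in> PiE {..<7::nat} (\<lambda>_. {1..r}). inj_on x {..<7}}"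
  let ?p = "\<lambda>\<omega> i. cprob \<Omega> (\<lambda>\<omega>. \<omega> (e i)) (pin T) \<omega>"
  have "(\<Sum>\<omega>\<in>\<Omega>. of_bool (e 6 \<in> E \<and> (\<forall>i<6. rich_edge \<eta> T \<omega> (e i))) * \<eta>^6) \<le> (\<Sum>\<omega>\<in>\<Omega>. \<Sum>x\<in>A. \<Prod>i<7. ?p \<omega> i (x i))"
  proof (rule sum_mono)
    fix \<omega> assume w: "\<omega> \<in> \<Omega>"
    show "of_bool (e 6 \<in> E \<and> (\<forall>i<6. rich_edge \<eta> T \<omega> (e i))) * \<eta>^6 \<le> (\<Sum>x\<in>A. \<Prod>i<7. ?p \<omega> i (x i))"
    proof (cases "\<forall>i<6. rich_edge \<eta> T \<omega> (e i)")
      case True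
      have l7: "{..<7} = insert 6 {..<6::nat}" by auto
      have one: "(\<Sum>c\<in>{1..r}. ?p \<omega> 6 c) = 1"
        by (rule cprob_sum_eq1[OF w]) (use color eE in auto)
      have "\<eta> ^ card {..<6::nat} \<le> (\<Sum>x\<in>{x\<in>PiE (insert 6 {..<6}) (\<lambda>_. {1..r}). inj_on x (insert 6 {..<6::nat})}. \<Prod>i\<in>insert 6 {..<6}. ?p \<omega> i (x i))"
      proof (rule prob_injective_ge[where m = 6])
        show "(\<Sum>c\<in>{1..r}. ?p \<omega> 6 c) = 1" by (rule one)
        show "\<eta> \<le> (\<Sum>c\<in>{1..r} - K. ?p \<omega> i c)" if "i \<in> {..<6}" "finite K" "card K \<le> 6" for i K
          using True that unfolding rich_def by blast
      qed (use \<eta> cprob_nonneg in auto)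
      then have "\<eta>^6 \<le> (\<Sum>x\<in>A. \<Prod>i<7. ?p \<omega> i (x i))" unfolding A_def l7 by simp
      moreover have "of_bool (e 6 \<in> E \<and> (\<forall>i<6. rich_edge \<eta> T \<omega> (e i))) * \<eta>^6 \<le> \<eta>^6" using \<eta> by (simp add: of_bool_def)
      ultimately show ?thesis by linarith
    next
      case False
      have "0 \<le> (\<Sum>x\<in>A. \<Prod>i<7. ?p \<omega> i (x i))" by (intro sum_nonneg prod_nonneg) (simp add: cprob_nonneg)
      moreover have "of_bool (e 6 \<in> E \<and> (\<forall>i<6. rich_edge \<eta> T \<omega> (e i))) = (0::real)" using False by auto
      ultimately show ?thesis by (simp only: mult_zero_left)
    qed
  qed
  then have "(\<Sum>\<omega>\<in>\<Omega>. of_bool (e 6 \<in> E \<and> (\<forall>i<6. rich_edge \<eta> T \<omega> (e i)))) * \<eta>^6 / card \<Omega> \<le> (\<Sum>\<omega>\<in>\<Omega>. \<Sum>x\<in>A. \<Prod>i<7. ?p \<omega> i (x i)) / card \<Omega>"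
    by (intro divide_right_mono) (simp_all only: sum_distrib_right of_nat_0_le_iff)
  also have "\<dots> \<le> (\<Sum>i<7. En (\<lambda>\<omega>. \<omega> (e i)) (pin T) - En (\<lambda>\<omega>. \<omega> (e i)) (\<lambda>\<omega>. (restrict (\<lambda>j. \<omega> (e j)) {..<i}, pin T \<omega>)))"
  proof (rule total_correlation_ge[where C = "{1..r}"])
    show "(\<lambda>\<omega>. \<omega> (e i)) ` \<Omega> \<subseteq> {1..r}" if "i < 7" for i using color eE[OF that] by auto
    show "restrict (\<lambda>i. \<omega> (e i)) {..<7} \<notin> A" if "\<omega> \<in> \<Omega>" for \<omega>
    proof
      assume "restrict (\<lambda>i. \<omega> (e i)) {..<7} \<in> A"
      then have "inj_on (\<lambda>i. \<omega> (e i)) {..<7}" unfolding A_def by (simp add: inj_on_restrict_eq)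
      then show False using nr[OF eE that] by simp
    qed
    show "A \<subseteq> PiE {..<7} (\<lambda>_. {1..r})" by (auto simp: A_def)
  qed simp
  finally show ?thesis by (simp add: drop_def)
qed

end

section \<open>Rainbow-free colourings\<close>

text \<open>The order matters: each line must keep a position outside the prescribed ones and
  outside any later line. With 0, 1, 2 prescribed, \<open>{0,1,2}\<close> has no free position, so
  it comes last; index 6 is also the line that is only an edge.\<close>

definition line :: "nat \<Rightarrow> nat set" where
  "line i = [{0,3,4},{0,5,6},{1,3,5},{1,4,6},{2,3,6},{2,4,5},{0,1,2}] ! i"

lemma line_simps [simp]:
  "line 0 = {0,3,4}" "line 1 = {0,5,6}" "line (Suc 0) = {0,5,6}" "line 2 = {1,3,5}" "line 3 = {1,4,6}" "line 4 = {2,3,6}"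
  "line 5 = {2,4,5}" "line 6 = {0,1,2}"
  by (simp_all add: line_def)

lemma less_7: "{..<7} = {0,1,2,3,4,5,6::nat}" by auto

lemma all_less_7: "(\<forall>i<7. P i) \<longleftrightarrow> P 0 \<and> P 1 \<and> P 2 \<and> P 3 \<and> P 4 \<and> P 5 \<and> P (6::nat)"
proof -
  have "(\<forall>i<7. P i) \<longleftrightarrow> (\<forall>i\<in>{..<7}. P i)" by auto
  then show ?thesis unfolding less_7 by simp
qed

lemma all_less_6: "(\<forall>i<6. P i) \<longleftrightarrow> P 0 \<and> P 1 \<and> P 2 \<and> P 3 \<and> P 4 \<and> P (5::nat)"
proof -
  have "{..<6} = {0,1,2,3,4,5::nat}" by auto
  moreover have "(\<forall>i<6. P i) \<longleftrightarrow> (\<forall>i\<in>{..<6}. P i)" by auto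
  ultimately show ?thesis by simp
qed

locale three_graph =
  fixes V :: "'a set" and E :: "'a set set" and r :: nat
  assumes finV: "finite V"
    and edge: "\<And>e. e \<in> E \<Longrightarrow> e \<subseteq> V \<and> card e = 3"
    and r1: "r \<ge> 1"
begin

definition \<Omega> :: "('a set \<Rightarrow> nat) set" where
  "\<Omega> = {f \<in> colorings r (V, E). \<not> has_rainbow_copy f fano (V, E)}"

lemma finE: "finite E"
proof -
  have "E \<subseteq> Pow V" using edge by blast
  then show ?thesis using finV finite_subset by blast
qed

lemma fin_\<Omega>: "finite \<Omega>"
  unfolding \<Omega>_def colorings_def by (rule finite_subset[OF _ finite_PiE[OF finE, of "\<lambda>_. {1..r}"]]) auto

lemma card_iso_edges:
  assumes "copy_of_in C fano (V, E)" shows "card (edges C) = 7"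
proof -
  obtain \<phi> where b: "bij_betw \<phi> (verts fano) (verts C)" and e: "edges C = (\<lambda>e. \<phi> ` e) ` edges fano"
    using assms by (auto simp: copy_of_in_def isomorphic_def)
  have "inj_on (\<lambda>e. \<phi> ` e) (Pow (verts fano))" using b by (simp add: bij_betw_def inj_on_image_Pow)
  moreover have "edges fano \<subseteq> Pow (verts fano)" using fano_properties(1) by (auto simp: uniform_hypergraph_def)
  ultimately show ?thesis unfolding e using fano_properties(4) by (metis card_image inj_on_subset)
qed

lemma \<Omega>_ne: "\<Omega> \<noteq> {}"
proof -
  have "(\<lambda>e\<in>E. 1) \<in> \<Omega>"
  proof -
    have "(\<lambda>e\<in>E. 1) \<in> colorings r (V, E)" using r1 by (auto simp: colorings_def)
    moreover have "\<not> has_rainbow_copy (\<lambda>e\<in>E. 1::nat) fano (V, E)"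
    proof
      assume "has_rainbow_copy (\<lambda>e\<in>E. 1::nat) fano (V, E)"
      then obtain C where C: "copy_of_in C fano (V, E)" "inj_on (\<lambda>e\<in>E. 1::nat) (edges C)" by (auto simp: has_rainbow_copy_def)
      have "edges C \<subseteq> E" using C(1) by (simp add: copy_of_in_def)
      then have "(\<lambda>e\<in>E. 1::nat) ` edges C \<subseteq> {1}" by auto
      then have "card (edges C) \<le> card {1::nat}" using C(2) by (metis card_image card_mono finite.emptyI finite.insertI)
      then show False using card_iso_edges[OF C(1)] by simp
    qed
    ultimately show ?thesis by (simp add: \<Omega>_def)
  qed
  then show ?thesis by blast
qed

sublocale coloring_space \<Omega> E r
proof
  show "finite \<Omega>" by (rule fin_\<Omega>)
  show "\<Omega> \<noteq> {}" by (rule \<Omega>_ne)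
  show "r \<ge> 1" by (rule r1)
  show "\<omega> e \<in> {1..r}" if "\<omega> \<in> \<Omega>" "e \<in> E" for \<omega> e
    using that by (auto simp: \<Omega>_def colorings_def PiE_iff)
  show "\<omega> e = undefined" if "\<omega> \<in> \<Omega>" "e \<notin> E" for \<omega> e
    using that by (auto simp: \<Omega>_def colorings_def PiE_iff extensional_def)
qed

lemma rainbow_free:
  assumes lines: "\<And>i. i < 7 \<Longrightarrow> \<phi> ` line i \<in> E" and w: "\<omega> \<in> \<Omega>"
  shows "\<not> inj_on (\<lambda>i. \<omega> (\<phi> ` line i)) {..<7}"
proof
  assume inj: "inj_on (\<lambda>i. \<omega> (\<phi> ` line i)) {..<7}"
  define C where "C = (\<phi> ` {..<7}, (\<lambda>i. \<phi> ` line i) ` {..<7})"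
  have sub: "\<phi> ` line i \<subseteq> V" "card (\<phi> ` line i) = 3" if "i < 7" for i using edge[OF lines[OF that]] by auto
  have ne: "\<phi> a \<noteq> \<phi> b \<and> \<phi> b \<noteq> \<phi> c \<and> \<phi> a \<noteq> \<phi> c" if "i < 7" "line i = {a,b,c}" for i a b c
    using sub(2)[OF that(1)] unfolding that(2) by (auto simp: card_insert_if split: if_splits)
  note D = ne[of 0 0 3 4] ne[of 1 0 5 6] ne[of 2 1 3 5] ne[of 3 1 4 6] ne[of 4 2 3 6] ne[of 5 2 4 5] ne[of 6 0 1 2]
  have inj\<phi>: "inj_on \<phi> {..<7}" unfolding less_7 using D by (simp add: inj_on_insert)
  \<comment> \<open>A relabelling that carries the cyclic lines of \<open>fano\<close> to the lines
    of \<open>line\<close>.\<close>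
  define \<pi> where "\<pi> = (\<lambda>i. [0,1,3,2,5,6,4::nat] ! i)"
  have \<pi>: "bij_betw \<pi> {..<7} {..<7}" unfolding \<pi>_def by (rule bij_betw_nth) (auto simp: less_7)
  have "bij_betw (\<phi> \<circ> \<pi>) {..<7} (\<phi> ` {..<7})"
    by (rule bij_betw_trans[OF \<pi>]) (simp add: bij_betw_def inj\<phi>)
  moreover have "(\<lambda>i. \<phi> ` line i) ` {..<7} = (\<lambda>e. (\<phi> \<circ> \<pi>) ` e) ` edges fano"
  proof -
    have "(\<lambda>e. \<pi> ` e) ` edges fano = line ` {..<7}"
      proof -
      have p: "\<pi> 0 = 0" "\<pi> 1 = 1" "\<pi> 2 = 3" "\<pi> 3 = 2" "\<pi> 4 = 5" "\<pi> 5 = 6" "\<pi> 6 = 4"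
        by (simp_all add: \<pi>_def numeral_eq_Suc)
      have "(\<lambda>e. \<pi> ` e) ` edges fano = {{0,1,2},{1,3,5},{3,2,6},{2,5,4},{5,6,0},{6,4,1},{4,0,3}}"
        unfolding fano_edges image_insert image_empty p by (rule refl)
      also have "\<dots> = line ` {..<7}"
        unfolding less_7 image_insert image_empty line_simps by (simp only: insert_commute)
      finally show ?thesis .
    qed
    then have "(\<lambda>e. \<phi> ` e) ` ((\<lambda>e. \<pi> ` e) ` edges fano) = (\<lambda>e. \<phi> ` e) ` (line ` {..<7})" by simp
    then show ?thesis by (simp add: image_image image_comp o_def)
  qed
  ultimately have "isomorphic fano C"
    unfolding isomorphic_def C_def by (intro exI[of _ "\<phi> \<circ> \<pi>"]) (simp add: fano_def)
  moreover have "\<phi> ` {..<7} \<subseteq> V"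
  proof -
    have "{..<7} \<subseteq> (\<Union>i\<in>{..<7}. line i)" unfolding less_7 by simp
    then have "\<phi> ` {..<7} \<subseteq> (\<Union>i\<in>{..<7}. \<phi> ` line i)" by blast
    then show ?thesis using sub(1) by blast
  qed
  ultimately have "copy_of_in C fano (V, E)" using lines by (auto simp: copy_of_in_def C_def)
  moreover have "inj_on \<omega> (edges C)" unfolding C_def snd_conv by (rule inj_on_imageI) (use inj in \<open>simp add: o_def\<close>)
  ultimately have "has_rainbow_copy \<omega> fano (V, E)" unfolding has_rainbow_copy_def by blast
  then show False using w by (simp add: \<Omega>_def)
qed

definition H :: "'a \<Rightarrow> 'a \<Rightarrow> 'a \<Rightarrow> bool" where "H x y z \<longleftrightarrow> {x,y,z} \<in> E"

lemma H_sym: "H x y z \<Longrightarrow> H y x z" "H x y z \<Longrightarrow> H x z y"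
  by (simp_all add: H_def insert_commute)

lemma H_distinct: assumes "H x y z" shows "x \<noteq> y" "y \<noteq> z" "x \<noteq> z"
  using edge[of "{x,y,z}"] assms by (auto simp: H_def card_insert_if split: if_splits)

section \<open>Edges and ordered triples; edges meeting a given set\<close>

definition link :: "'a \<Rightarrow> 'a set set" where "link x = {e\<in>E. x \<in> e}"

lemma fin_link: "finite (link x)" using finE by (simp add: link_def)

lemma sum_pairs:
  fixes g :: "'a set \<Rightarrow> real"
  assumes g0: "\<And>e. e \<notin> E \<Longrightarrow> g e = 0"
  shows "(\<Sum>u\<in>V. \<Sum>v\<in>V. g {x,u,v}) = 2 * (\<Sum>e\<in>link x. g e)"
proof -
  let ?S = "{p\<in>V\<times>V. {x, fst p, snd p} \<in> E}"
  have "(\<Sum>u\<in>V. \<Sum>v\<in>V. g {x,u,v}) = (\<Sum>p\<in>V\<times>V. g {x, fst p, snd p})"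
    by (simp add: sum.cartesian_product split_def)
  also have "\<dots> = (\<Sum>p\<in>?S. g {x, fst p, snd p})"
    by (rule sum.mono_neutral_right) (use finV g0 in auto)
  also have "\<dots> = (\<Sum>e\<in>link x. \<Sum>p\<in>{p\<in>?S. {x, fst p, snd p} = e}. g {x, fst p, snd p})"
    by (rule sum.group[symmetric]) (use finV fin_link in \<open>auto simp: link_def\<close>)
  also have "\<dots> = (\<Sum>e\<in>link x. 2 * g e)"
  proof (rule sum.cong[OF refl])
    fix e assume e: "e \<in> link x"
    have "card (e - {x}) = 2" using e edge[of e] by (auto simp: link_def card_Diff_singleton)
    then obtain a b where ab: "e - {x} = {a,b}" "a \<noteq> b" by (auto simp: card_2_iff)
    then have e3: "e = {x,a,b}" "x \<noteq> a" "x \<noteq> b" "a \<in> V" "b \<in> V" using e edge[of e] by (auto simp: link_def)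
    have "{p\<in>?S. {x, fst p, snd p} = e} = {(a,b),(b,a)}"
    proof
      show "{p\<in>?S. {x, fst p, snd p} = e} \<subseteq> {(a,b),(b,a)}"
      proof
        fix p assume "p \<in> {p\<in>?S. {x, fst p, snd p} = e}"
        then have p: "{x, fst p, snd p} = {x,a,b}" using e3 by simp
        have "a \<in> {x, fst p, snd p}" "b \<in> {x, fst p, snd p}" unfolding p by simp_all
        then have "(fst p = a \<and> snd p = b) \<or> (fst p = b \<and> snd p = a)" using e3(2,3) ab(2) by blast
        then show "p \<in> {(a,b),(b,a)}" by (cases p) auto
      qed
      show "{(a,b),(b,a)} \<subseteq> {p\<in>?S. {x, fst p, snd p} = e}" using e3(1,4,5) e insert_commute[of b a "{}"] by (simp add: link_def)
    qed
    moreover have "{x,b,a} = {x,a,b}" by blast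
    ultimately show "(\<Sum>p\<in>{p\<in>?S. {x, fst p, snd p} = e}. g {x, fst p, snd p}) = 2 * g e"
    proof -
      assume a: "{p\<in>?S. {x, fst p, snd p} = e} = {(a,b),(b,a)}" and b: "{x,b,a} = {x,a,b}"
      show ?thesis unfolding a using ab(2) by (simp add: b e3(1))
    qed
  qed
  finally show ?thesis by (simp add: sum_distrib_left)
qed

lemma sum_triples:
  fixes g :: "'a set \<Rightarrow> real"
  assumes g0: "\<And>e. e \<notin> E \<Longrightarrow> g e = 0"
  shows "(\<Sum>x\<in>V. \<Sum>u\<in>V. \<Sum>v\<in>V. g {x,u,v}) = 6 * (\<Sum>e\<in>E. g e)"
proof -
  have "(\<Sum>x\<in>V. \<Sum>u\<in>V. \<Sum>v\<in>V. g {x,u,v}) = (\<Sum>x\<in>V. 2 * (\<Sum>e\<in>E. of_bool (x \<in> e) * g e))"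
  proof (rule sum.cong[OF refl])
    fix x
    have "(\<Sum>e\<in>link x. g e) = (\<Sum>e\<in>E. of_bool (x \<in> e) * g e)"
      unfolding link_def sum.inter_filter[OF finE] by (intro sum.cong refl) simp
    then show "(\<Sum>u\<in>V. \<Sum>v\<in>V. g {x,u,v}) = 2 * (\<Sum>e\<in>E. of_bool (x \<in> e) * g e)" using sum_pairs[of g x] g0 by simp
  qed
  also have "\<dots> = 2 * (\<Sum>e\<in>E. \<Sum>x\<in>V. of_bool (x \<in> e) * g e)"
    by (simp only: sum_distrib_left[symmetric]) (subst sum.swap, rule refl)
  also have "(\<Sum>e\<in>E. \<Sum>x\<in>V. of_bool (x \<in> e) * g e) = (\<Sum>e\<in>E. 3 * g e)"
  proof (rule sum.cong[OF refl])
    fix e assume e: "e \<in> E"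
    have "(\<Sum>x\<in>V. of_bool (x \<in> e) * g e) = real (card {x\<in>V. x \<in> e}) * g e"
      by (simp only: sum_distrib_right[symmetric] card_filter_sum[OF finV])
    also have "{x\<in>V. x \<in> e} = e" using edge[OF e] by blast
    finally show "(\<Sum>x\<in>V. of_bool (x \<in> e) * g e) = 3 * g e" using edge[OF e] by simp
  qed
  finally show ?thesis by (simp add: sum_distrib_left)
qed

lemma card_link_le: "2 * real (card (link x)) \<le> (real (card V))\<^sup>2"
proof -
  have "2 * real (card (link x)) = 2 * (\<Sum>e\<in>link x. of_bool (e \<in> E))" by (simp add: link_def)
  also have "\<dots> = (\<Sum>u\<in>V. \<Sum>v\<in>V. of_bool ({x,u,v} \<in> E))" by (rule sum_pairs[symmetric]) simp
  also have "\<dots> \<le> (\<Sum>u\<in>V. \<Sum>v\<in>V. 1)" by (intro sum_mono) simp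
  finally show ?thesis by (simp add: power2_eq_square)
qed

lemma card_E_le: "6 * real (card E) \<le> (real (card V))^3"
proof -
  have "6 * real (card E) = 6 * (\<Sum>e\<in>E. of_bool (e \<in> E))" by simp
  also have "\<dots> = (\<Sum>x\<in>V. \<Sum>u\<in>V. \<Sum>v\<in>V. of_bool ({x,u,v} \<in> E))" by (rule sum_triples[symmetric]) simp
  also have "\<dots> \<le> (\<Sum>x\<in>V. \<Sum>u\<in>V. \<Sum>v\<in>V. 1)" by (intro sum_mono) simp
  finally show ?thesis by (simp add: power3_eq_cube)
qed

lemma card_touch_le:
  assumes "finite T"
  shows "real (card {e\<in>E. e \<inter> T \<noteq> {}}) \<le> card T * (real (card V))\<^sup>2"
proof -
  have "{e\<in>E. e \<inter> T \<noteq> {}} = (\<Union>t\<in>T. link t)" by (auto simp: link_def)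
  then have "card {e\<in>E. e \<inter> T \<noteq> {}} \<le> (\<Sum>t\<in>T. card (link t))" using card_UN_le[OF assms] by metis
  then have "real (card {e\<in>E. e \<inter> T \<noteq> {}}) \<le> (\<Sum>t\<in>T. real (card (link t)))"
    unfolding of_nat_sum[symmetric] by linarith
  also have "\<dots> \<le> (\<Sum>t\<in>T. (real (card V))\<^sup>2)"
    by (intro sum_mono) (use card_link_le in \<open>smt (verit) of_nat_0_le_iff\<close>)
  finally show ?thesis by simp
qed

lemma card_link_touch_le:
  assumes "finite T" "x \<notin> T"
  shows "card {e\<in>link x. e \<inter> T \<noteq> {}} \<le> card T * card V"
proof -
  have "{e\<in>link x. e \<inter> T \<noteq> {}} \<subseteq> (\<lambda>(t,u). {x,t,u}) ` (T \<times> V)"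
  proof
    fix e assume "e \<in> {e\<in>link x. e \<inter> T \<noteq> {}}"
    then obtain t where e: "e \<in> E" "x \<in> e" "t \<in> e" "t \<in> T" by (auto simp: link_def)
    have "x \<noteq> t" using e assms by auto
    have "card (e - {x,t}) = 1" using edge[OF e(1)] e \<open>x \<noteq> t\<close> by (simp add: card_Diff_subset)
    then obtain u where u: "e - {x,t} = {u}" by (auto simp: card_1_singleton_iff)
    then have "e = {x,t,u}" using e by auto
    moreover have "u \<in> V" using u edge[OF e(1)] by auto
    ultimately show "e \<in> (\<lambda>(t,u). {x,t,u}) ` (T \<times> V)" using e(4) by (auto intro!: image_eqI[of _ _ "(t,u)"])
  qed
  then have "card {e\<in>link x. e \<inter> T \<noteq> {}} \<le> card ((\<lambda>(t,u). {x,t,u}) ` (T \<times> V))"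
    using assms finV by (intro card_mono) auto
  also have "\<dots> \<le> card (T \<times> V)" by (rule card_image_le) (use assms finV in auto)
  finally show ?thesis by (simp add: card_cartesian_product)
qed

section \<open>Entropy bounds, global and at a vertex\<close>

lemma agree: "\<omega> \<in> \<Omega> \<Longrightarrow> \<omega>' \<in> \<Omega> \<Longrightarrow> (\<And>e. e \<in> E \<Longrightarrow> \<omega>' e = \<omega> e) \<Longrightarrow> \<omega>' = \<omega>"
  using undef by (intro ext) metis

text \<open>The entropy of the whole colouring is \<open>ln (card \<Omega>)\<close>. The chain rule
  splits off the pinned colours, at most \<open>card T * n^2\<close> of them at \<open>ln r\<close>
  each, and subadditivity bounds the rest edge by edge.\<close>

lemma sum_entropy_ge:
  assumes T: "finite T"
  shows "ln (card \<Omega>) - card T * (real (card V))\<^sup>2 * ln r \<le> (\<Sum>e\<in>E. En (\<lambda>\<omega>. \<omega> e) (pin T))"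
proof -
  let ?F = "{e\<in>E. e \<inter> T \<noteq> {}}"
  have "ln (card \<Omega>) = En (\<lambda>\<omega>. \<omega>) (\<lambda>_. ())" by (rule entropy_total[symmetric]) (rule inj_on_id2)
  also have "\<dots> = En (\<lambda>\<omega>. (restrict \<omega> E, pin T \<omega>)) (\<lambda>_. ())"
  proof (rule entropy_cong)
    fix \<omega> \<omega>' assume w: "\<omega> \<in> \<Omega>" "\<omega>' \<in> \<Omega>"
    show "(\<omega>' = \<omega>) = ((restrict \<omega>' E, pin T \<omega>') = (restrict \<omega> E, pin T \<omega>))"
    proof
      assume "(restrict \<omega>' E, pin T \<omega>') = (restrict \<omega> E, pin T \<omega>)"
      then have "restrict \<omega>' E = restrict \<omega> E" by simp
      then have "\<omega>' e = \<omega> e" if "e \<in> E" for e using that by (metis restrict_apply')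
      then show "\<omega>' = \<omega>" using agree[OF w] by blast
    qed simp
  qed simp
  also have "\<dots> = En (pin T) (\<lambda>_. ()) + En (\<lambda>\<omega>. restrict \<omega> E) (\<lambda>\<omega>. (pin T \<omega>, ()))" by (rule entropy_chain)
  also have "En (pin T) (\<lambda>_. ()) = En (\<lambda>\<omega>. restrict \<omega> ?F) (\<lambda>_. ())"
  proof (rule entropy_cong)
    fix \<omega> \<omega>' assume w: "\<omega> \<in> \<Omega>" "\<omega>' \<in> \<Omega>"
    show "(pin T \<omega>' = pin T \<omega>) = (restrict \<omega>' ?F = restrict \<omega> ?F)"
    proof
      assume a: "pin T \<omega>' = pin T \<omega>"
      show "restrict \<omega>' ?F = restrict \<omega> ?F"
      proof (rule restrict_ext)
        fix e assume "e \<in> ?F"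
        then have "e \<in> {e. e \<inter> T \<noteq> {}}" by simp
        then show "\<omega>' e = \<omega> e" using fun_cong[OF a, of e] by (simp only: restrict_apply')
      qed
    next
      assume a: "restrict \<omega>' ?F = restrict \<omega> ?F"
      have "\<omega>' e = \<omega> e" if "e \<inter> T \<noteq> {}" for e
      proof (cases "e \<in> E")
        case True
        then have "e \<in> ?F" using that by simp
        then show ?thesis using fun_cong[OF a, of e] by (simp only: restrict_apply')
      qed (use undef[OF w(1), of e] undef[OF w(2), of e] in simp)
      then show "pin T \<omega>' = pin T \<omega>" by (intro restrict_ext) simp
    qed
  qed simp
  also have "En (\<lambda>\<omega>. restrict \<omega> ?F) (\<lambda>_. ()) \<le> (\<Sum>e\<in>?F. En (\<lambda>\<omega>. \<omega> e) (\<lambda>_. ()))"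
    by (rule entropy_restrict_le) (use finE in simp)
  also have "\<dots> \<le> (\<Sum>e\<in>?F. ln r)" by (intro sum_mono entropy_edge_le)
  also have "\<dots> = card ?F * ln r" by simp
  also have "\<dots> \<le> (card T * (real (card V))\<^sup>2) * ln r"
    by (rule mult_right_mono[OF card_touch_le[OF T] ln_r_nonneg])
  also have "En (\<lambda>\<omega>. restrict \<omega> E) (\<lambda>\<omega>. (pin T \<omega>, ())) = En (\<lambda>\<omega>. restrict \<omega> E) (pin T)"
    by (rule entropy_cong) auto
  also have "\<dots> \<le> (\<Sum>e\<in>E. En (\<lambda>\<omega>. \<omega> e) (pin T))" by (rule entropy_restrict_le[OF finE])
  finally show ?thesis by simp
qed

text \<open>The local form: the colours away from \<open>x\<close> are worth at most the logarithm
  of the number of restrictions, and they determine every pinned edge that misses \<open>x\<close>.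
  As \<open>x \<notin> T\<close>, a pinned edge through \<open>x\<close> is fixed by a vertex of
  \<open>T\<close> and one more vertex, so the pins cost only order \<open>n\<close>.\<close>

lemma sum_link_entropy_ge:
  assumes T: "finite T" "x \<notin> T"
  shows "ln (card \<Omega>) - ln (card ((\<lambda>\<omega>. restrict \<omega> {e. x \<notin> e}) ` \<Omega>)) - card T * card V * ln r
    \<le> (\<Sum>e\<in>link x. En (\<lambda>\<omega>. \<omega> e) (pin T))"
proof -
  define Rs where "Rs = (\<lambda>\<omega> :: 'a set \<Rightarrow> nat. restrict \<omega> {e. x \<notin> e})"
  define A where "A = {e\<in>link x. e \<inter> T \<noteq> {}}"
  define B where "B = link x - A"
  have fAB: "finite A" "finite B" using fin_link by (simp_all add: A_def B_def)
  have "ln (card \<Omega>) = En (\<lambda>\<omega>. \<omega>) (\<lambda>_. ())" by (rule entropy_total[symmetric]) (rule inj_on_id2)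
  also have "\<dots> = En (\<lambda>\<omega>. ((restrict \<omega> B, restrict \<omega> A), Rs \<omega>)) (\<lambda>_. ())"
  proof (rule entropy_cong)
    fix \<omega> \<omega>' assume w: "\<omega> \<in> \<Omega>" "\<omega>' \<in> \<Omega>"
    show "(\<omega>' = \<omega>) = (((restrict \<omega>' B, restrict \<omega>' A), Rs \<omega>') = ((restrict \<omega> B, restrict \<omega> A), Rs \<omega>))"
    proof
      assume "((restrict \<omega>' B, restrict \<omega>' A), Rs \<omega>') = ((restrict \<omega> B, restrict \<omega> A), Rs \<omega>)"
      then have a: "restrict \<omega>' B = restrict \<omega> B" "restrict \<omega>' A = restrict \<omega> A" "Rs \<omega>' = Rs \<omega>" by simp_all
      have "\<omega>' e = \<omega> e" if "e \<in> E" for e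
      proof -
        have "e \<in> A \<or> e \<in> B \<or> e \<in> {e. x \<notin> e}" using that by (auto simp: A_def B_def link_def)
        then show ?thesis using fun_cong[OF a(1), of e] fun_cong[OF a(2), of e] fun_cong[OF a(3), of e]
          unfolding Rs_def by (metis restrict_apply')
      qed
      then show "\<omega>' = \<omega>" using agree[OF w] by blast
    qed simp
  qed simp
  also have "\<dots> = En Rs (\<lambda>_. ()) + En (\<lambda>\<omega>. (restrict \<omega> B, restrict \<omega> A)) (\<lambda>\<omega>. (Rs \<omega>, ()))" by (rule entropy_chain)
  also have "En Rs (\<lambda>_. ()) \<le> ln (card (Rs ` \<Omega>))" by (rule entropy_le_card) (use fin in auto)
  also have "En (\<lambda>\<omega>. (restrict \<omega> B, restrict \<omega> A)) (\<lambda>\<omega>. (Rs \<omega>, ())) =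
      En (\<lambda>\<omega>. restrict \<omega> A) (\<lambda>\<omega>. (Rs \<omega>, ())) + En (\<lambda>\<omega>. restrict \<omega> B) (\<lambda>\<omega>. (restrict \<omega> A, (Rs \<omega>, ())))"
    by (rule entropy_chain)
  also have "En (\<lambda>\<omega>. restrict \<omega> A) (\<lambda>\<omega>. (Rs \<omega>, ())) \<le> (\<Sum>e\<in>A. En (\<lambda>\<omega>. \<omega> e) (\<lambda>\<omega>. (Rs \<omega>, ())))"
    by (rule entropy_restrict_le[OF fAB(1)])
  also have "\<dots> \<le> (\<Sum>e\<in>A. ln r)" by (intro sum_mono entropy_edge_le)
  also have "\<dots> = card A * ln r" by simp
  also have "\<dots> \<le> real (card T * card V) * ln r"
    by (rule mult_right_mono[OF of_nat_mono ln_r_nonneg]) (unfold A_def, rule card_link_touch_le[OF T])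
  also have "En (\<lambda>\<omega>. restrict \<omega> B) (\<lambda>\<omega>. (restrict \<omega> A, (Rs \<omega>, ()))) \<le> (\<Sum>e\<in>B. En (\<lambda>\<omega>. \<omega> e) (\<lambda>\<omega>. (restrict \<omega> A, (Rs \<omega>, ()))))"
    by (rule entropy_restrict_le[OF fAB(2)])
  also have "\<dots> \<le> (\<Sum>e\<in>B. En (\<lambda>\<omega>. \<omega> e) (pin T))"
  proof (intro sum_mono entropy_mono)
    fix \<omega> \<omega>' assume w: "\<omega> \<in> \<Omega>" "\<omega>' \<in> \<Omega>" and "(restrict \<omega>' A, (Rs \<omega>', ())) = (restrict \<omega> A, (Rs \<omega>, ()))"
    then have a: "restrict \<omega>' A = restrict \<omega> A" "Rs \<omega>' = Rs \<omega>" by simp_all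
    have "\<omega>' e = \<omega> e" if "e \<inter> T \<noteq> {}" for e
    proof (cases "e \<in> E")
      case True
      then have "e \<in> A \<or> e \<in> {e. x \<notin> e}" using that by (auto simp: A_def link_def)
      then show ?thesis using fun_cong[OF a(1), of e] fun_cong[OF a(2), of e] unfolding Rs_def by (metis restrict_apply')
    qed (use undef[OF w(1), of e] undef[OF w(2), of e] in simp)
    then show "pin T \<omega>' = pin T \<omega>" by (intro restrict_ext) simp
  qed
  also have "\<dots> \<le> (\<Sum>e\<in>link x. En (\<lambda>\<omega>. \<omega> e) (pin T))"
    by (rule sum_mono2) (use fin_link entropy_nonneg in \<open>auto simp: B_def\<close>)
  finally show ?thesis unfolding Rs_def[symmetric] by linarith
qed

text \<open>Chosen so that the last term of \<open>entropy_le_rich\<close> is exactly one nat; a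
  poor edge then costs a constant, while \<eta> still depends on \<open>r\<close> alone.\<close>

definition \<eta> :: real where "\<eta> = 1 / ln (2 * real r)"

lemma \<eta>_pos: "\<eta> > 0" using r1 by (simp add: \<eta>_def)

lemma entropy_edge_rich:
  assumes "e \<in> E"
  shows "En (\<lambda>\<omega>. \<omega> e) (pin T) \<le> ln r * (real (card {\<omega>\<in>\<Omega>. rich_edge \<eta> T \<omega> e}) / card \<Omega>) + 12"
proof -
  have X: "(\<lambda>\<omega>. \<omega> e) ` \<Omega> \<subseteq> {1..r}" using color assms by blast
  have "ln (12::real) \<le> 12 - 1" by (rule ln_le_minus_one) simp
  moreover have "ln (2 * real r) > 0" using r1 by simp
  then have "\<eta> * ln (2 * real r) = 1" by (simp add: \<eta>_def)
  ultimately show ?thesis using entropy_le_rich[OF r1 X \<eta>_pos, of "pin T"] by simp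
qed

definition R :: "'a set \<Rightarrow> ('a set \<Rightarrow> nat) \<Rightarrow> 'a \<Rightarrow> 'a \<Rightarrow> 'a \<Rightarrow> bool" where
  "R T \<omega> x y z \<longleftrightarrow> rich_edge \<eta> T \<omega> {x,y,z}"

lemma R_sym: "R T \<omega> x y z \<Longrightarrow> R T \<omega> y x z" "R T \<omega> x y z \<Longrightarrow> R T \<omega> x z y"
  by (simp_all add: R_def insert_commute)

lemma R_H: "\<omega> \<in> \<Omega> \<Longrightarrow> R T \<omega> x y z \<Longrightarrow> H x y z"
  unfolding R_def H_def using rich_edge_in[OF \<eta>_pos] by blast

lemma rich_sum_swap:
  "finite F \<Longrightarrow> (\<Sum>e\<in>F. real (card {\<omega>\<in>\<Omega>. rich_edge \<eta> T \<omega> e})) = (\<Sum>\<omega>\<in>\<Omega>. \<Sum>e\<in>F. of_bool (rich_edge \<eta> T \<omega> e))"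
  unfolding card_filter_sum[OF fin] by (rule sum.swap)

lemma rich_total_ge:
  assumes T: "finite T" and lr: "ln r > 0"
  shows "6 * card \<Omega> * ((ln (card \<Omega>) - 12 * card E) / ln r - card T * (real (card V))\<^sup>2) \<le> (\<Sum>\<omega>\<in>\<Omega>. real (count3 V (R T \<omega>)))"
proof -
  have "ln (card \<Omega>) - card T * (real (card V))\<^sup>2 * ln r \<le> (\<Sum>e\<in>E. ln r * (real (card {\<omega>\<in>\<Omega>. rich_edge \<eta> T \<omega> e}) / card \<Omega>) + 12)"
    by (rule order_trans[OF sum_entropy_ge[OF T] sum_mono[OF entropy_edge_rich]])
  also have "\<dots> = ln r / card \<Omega> * (\<Sum>e\<in>E. real (card {\<omega>\<in>\<Omega>. rich_edge \<eta> T \<omega> e})) + 12 * card E"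
    by (simp add: sum.distrib sum_distrib_left)
  finally have "ln (card \<Omega>) - 12 * card E - card T * (real (card V))\<^sup>2 * ln r \<le> ln r / card \<Omega> * (\<Sum>e\<in>E. real (card {\<omega>\<in>\<Omega>. rich_edge \<eta> T \<omega> e}))"
    by simp
  then have "card \<Omega> * ((ln (card \<Omega>) - 12 * card E) / ln r - card T * (real (card V))\<^sup>2) \<le> (\<Sum>e\<in>E. real (card {\<omega>\<in>\<Omega>. rich_edge \<eta> T \<omega> e}))"
    using lr card_pos by (simp add: field_simps)
  also have "\<dots> = (\<Sum>\<omega>\<in>\<Omega>. \<Sum>e\<in>E. of_bool (rich_edge \<eta> T \<omega> e))" by (rule rich_sum_swap[OF finE])
  finally have "6 * (card \<Omega> * ((ln (card \<Omega>) - 12 * card E) / ln r - card T * (real (card V))\<^sup>2)) \<le> (\<Sum>\<omega>\<in>\<Omega>. 6 * (\<Sum>e\<in>E. of_bool (rich_edge \<eta> T \<omega> e)))"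
    by (simp only: sum_distrib_left[symmetric] mult_left_mono)
  also have "\<dots> = (\<Sum>\<omega>\<in>\<Omega>. real (count3 V (R T \<omega>)))"
  proof (rule sum.cong[OF refl])
    fix \<omega> assume w: "\<omega> \<in> \<Omega>"
    have "(\<Sum>x\<in>V. \<Sum>u\<in>V. \<Sum>v\<in>V. (of_bool (rich_edge \<eta> T \<omega> {x,u,v}) :: real)) = 6 * (\<Sum>e\<in>E. of_bool (rich_edge \<eta> T \<omega> e))"
      by (rule sum_triples) (use rich_edge_in[OF \<eta>_pos w] in auto)
    then show "6 * (\<Sum>e\<in>E. of_bool (rich_edge \<eta> T \<omega> e)) = real (count3 V (R T \<omega>))" by (simp add: R_def)
  qed
  finally show ?thesis by simp
qed

lemma rich_link_ge:
  assumes T: "finite T" "x \<notin> T" and lr: "ln r > 0"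
  shows "2 * card \<Omega> * ((ln (card \<Omega>) - ln (card ((\<lambda>\<omega>. restrict \<omega> {e. x \<notin> e}) ` \<Omega>)) - 12 * card (link x)) / ln r - card T * card V)
    \<le> (\<Sum>\<omega>\<in>\<Omega>. real (count2 V (R T \<omega> x)))"
proof -
  let ?c = "ln (card \<Omega>) - ln (card ((\<lambda>\<omega>. restrict \<omega> {e. x \<notin> e}) ` \<Omega>))"
  have "?c - card T * card V * ln r \<le> (\<Sum>e\<in>link x. ln r * (real (card {\<omega>\<in>\<Omega>. rich_edge \<eta> T \<omega> e}) / card \<Omega>) + 12)"
    by (rule order_trans[OF sum_link_entropy_ge[OF T] sum_mono[OF entropy_edge_rich]]) (simp add: link_def)
  also have "\<dots> = ln r / card \<Omega> * (\<Sum>e\<in>link x. real (card {\<omega>\<in>\<Omega>. rich_edge \<eta> T \<omega> e})) + 12 * card (link x)"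
    by (simp add: sum.distrib sum_distrib_left)
  finally have "?c - 12 * card (link x) - card T * card V * ln r \<le> ln r / card \<Omega> * (\<Sum>e\<in>link x. real (card {\<omega>\<in>\<Omega>. rich_edge \<eta> T \<omega> e}))"
    by simp
  then have "card \<Omega> * ((?c - 12 * card (link x)) / ln r - card T * card V) \<le> (\<Sum>e\<in>link x. real (card {\<omega>\<in>\<Omega>. rich_edge \<eta> T \<omega> e}))"
    using lr card_pos by (simp add: field_simps)
  also have "\<dots> = (\<Sum>\<omega>\<in>\<Omega>. \<Sum>e\<in>link x. of_bool (rich_edge \<eta> T \<omega> e))" by (rule rich_sum_swap[OF fin_link])
  finally have "2 * (card \<Omega> * ((?c - 12 * card (link x)) / ln r - card T * card V)) \<le> (\<Sum>\<omega>\<in>\<Omega>. 2 * (\<Sum>e\<in>link x. of_bool (rich_edge \<eta> T \<omega> e)))"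
    by (simp only: sum_distrib_left[symmetric] mult_left_mono)
  also have "\<dots> = (\<Sum>\<omega>\<in>\<Omega>. real (count2 V (R T \<omega> x)))"
  proof (rule sum.cong[OF refl])
    fix \<omega> assume w: "\<omega> \<in> \<Omega>"
    have "(\<Sum>u\<in>V. \<Sum>v\<in>V. (of_bool (rich_edge \<eta> T \<omega> {x,u,v}) :: real)) = 2 * (\<Sum>e\<in>link x. of_bool (rich_edge \<eta> T \<omega> e))"
      by (rule sum_pairs) (use rich_edge_in[OF \<eta>_pos w] in auto)
    then show "2 * (\<Sum>e\<in>link x. of_bool (rich_edge \<eta> T \<omega> e)) = real (count2 V (R T \<omega> x))" by (simp add: R_def)
  qed
  finally show ?thesis by simp
qed

text \<open>The positions in \<open>S\<close> hold prescribed vertices, which are never pinned; the last line is the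
  one that need not be rich.\<close>

lemma exists_pin_fano:
  fixes s :: "nat \<Rightarrow> 'a" and P :: "'a set"
  assumes S: "S = {} \<or> S = {0} \<or> S = {0,1,2}" and P: "P \<subseteq> V" "P \<noteq> {}" and L: "L > 0"
  defines "J \<equiv> {..<7} - S" and "ext \<equiv> (\<lambda>\<phi> p. if p \<in> S then s p else \<phi> p)"
  shows "\<exists>T\<subseteq>P. card T \<le> 7 * L \<and>
    (\<Sum>\<omega>\<in>\<Omega>. \<Sum>\<phi>\<in>PiE J (\<lambda>_. P). of_bool (fano6 H (R T \<omega>) (ext \<phi>))) \<le> card \<Omega> * real (card P) ^ card J * (7 * ln r / (L * \<eta>^6))"
proof -
  define e where "e = (\<lambda>i \<phi>. ext \<phi> ` line i)"
  define dep where "dep = (\<lambda>i. line i - S)"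
  have finP: "finite P" using P finV finite_subset by blast
  have lsub: "line i \<subseteq> {..<7}" if "i < 7" for i
  proof -
    have "\<forall>i<7. line i \<subseteq> {..<7}" unfolding all_less_7 by simp
    then show ?thesis using that by blast
  qed
  \<comment> \<open>The condition \<open>meet\<close> of \<open>exists_pin\<close>: a free vertex of
    the earlier line lies off the later one. It is checked for all three prescribed sets; the last
    line never has to supply such a vertex.\<close>
  have "\<forall>i<7. \<forall>j<7. j < i \<longrightarrow> line j - S - (line i - S) \<noteq> {}"
    using S unfolding all_less_7 by (elim disjE; simp)
  then have mt: "dep j - dep i \<noteq> {}" if "j < i" "i < 7" for i j
    using that unfolding dep_def by (meson less_trans)
  have "\<exists>T\<subseteq>P. card T \<le> card J * L \<and>
    (\<Sum>\<phi>\<in>PiE J (\<lambda>_. P). drop T 7 (\<lambda>i. e i \<phi>)) \<le> real (card P) ^ card J * (7::nat) * ln r / L"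
  proof (rule exists_pin[OF finP P(2) _ _ _ _ L])
    show "finite J" by (simp add: J_def)
    show "dep i \<subseteq> J" if "i < 7" for i using lsub[OF that] by (auto simp: dep_def J_def)
    show "e i \<phi> = e i \<psi>" if "i < 7" "\<And>p. p \<in> dep i \<Longrightarrow> \<phi> p = \<psi> p" for i \<phi> \<psi>
      unfolding e_def by (rule image_cong[OF refl]) (use that(2) in \<open>auto simp: ext_def dep_def\<close>)
    show "\<exists>p\<in>dep j - dep i. \<forall>\<phi>. \<phi> p \<in> e j \<phi>" if ji: "j < i" "i < 7" for i j
    proof -
      obtain p where p: "p \<in> dep j - dep i" using mt[OF ji] by blast
      then have "\<phi> p \<in> e j \<phi>" for \<phi> unfolding e_def ext_def dep_def by (auto intro!: image_eqI[of _ _ p])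
      then show ?thesis using p by blast
    qed
  qed
  then obtain T where T: "T \<subseteq> P" "card T \<le> card J * L"
    and dr: "(\<Sum>\<phi>\<in>PiE J (\<lambda>_. P). drop T 7 (\<lambda>i. e i \<phi>)) \<le> real (card P) ^ card J * (7::nat) * ln r / L" by blast
  have "card J \<le> card {..<7::nat}" unfolding J_def by (rule card_mono) auto
  then have "card J * L \<le> 7 * L" by (intro mult_le_mono1) simp
  with T(2) have cT: "card T \<le> 7 * L" by (rule le_trans)
  have fe: "fano6 H (R T \<omega>) (ext \<phi>) \<longleftrightarrow> e 6 \<phi> \<in> E \<and> (\<forall>i<6. rich_edge \<eta> T \<omega> (e i \<phi>))" for \<omega> \<phi>
    unfolding all_less_6 fano6_def H_def R_def e_def by auto
  have "(\<Sum>\<omega>\<in>\<Omega>. \<Sum>\<phi>\<in>PiE J (\<lambda>_. P). of_bool (fano6 H (R T \<omega>) (ext \<phi>))) * (\<eta>^6 / card \<Omega>)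
     = (\<Sum>\<phi>\<in>PiE J (\<lambda>_. P). (\<Sum>\<omega>\<in>\<Omega>. of_bool (e 6 \<phi> \<in> E \<and> (\<forall>i<6. rich_edge \<eta> T \<omega> (e i \<phi>)))) * \<eta>^6 / card \<Omega>)"
    unfolding fe by (subst sum.swap) (simp only: sum_distrib_right sum_divide_distrib times_divide_eq_right)
  also have "\<dots> \<le> (\<Sum>\<phi>\<in>PiE J (\<lambda>_. P). drop T 7 (\<lambda>i. e i \<phi>))"
  proof (rule sum_mono)
    fix \<phi>
    show "(\<Sum>\<omega>\<in>\<Omega>. of_bool (e 6 \<phi> \<in> E \<and> (\<forall>i<6. rich_edge \<eta> T \<omega> (e i \<phi>)))) * \<eta>^6 / card \<Omega> \<le> drop T 7 (\<lambda>i. e i \<phi>)"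
      by (rule few_rich_copies[OF \<eta>_pos]) (unfold e_def, rule rainbow_free)
  qed
  finally have "(\<Sum>\<omega>\<in>\<Omega>. \<Sum>\<phi>\<in>PiE J (\<lambda>_. P). of_bool (fano6 H (R T \<omega>) (ext \<phi>))) * (\<eta>^6 / card \<Omega>)
     \<le> real (card P) ^ card J * 7 * ln r / L" using dr by simp
  then have "(\<Sum>\<omega>\<in>\<Omega>. \<Sum>\<phi>\<in>PiE J (\<lambda>_. P). of_bool (fano6 H (R T \<omega>) (ext \<phi>))) \<le> card \<Omega> * real (card P) ^ card J * (7 * ln r / (L * \<eta>^6))"
    using card_pos \<eta>_pos L by (simp add: field_simps)
  then show ?thesis using T(1) cT by blast
qed

end

section \<open>Numerical constants, averaging and the counting hypotheses\<close>

lemma inverse_product: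
  fixes x y z :: real
  shows "x > 0 \<Longrightarrow> y > 0 \<Longrightarrow> z \<ge> 1 \<Longrightarrow> 1 / ((x * y) * z) \<le> 1 / x * (1 / y)" "x > 0 \<Longrightarrow> x * (1 / (x * y)) = 1 / y"
proof -
  assume p: "x > 0" "y > 0"
  { assume "z \<ge> 1"
    then have "x * y * 1 \<le> x * y * z" using p by (intro mult_left_mono) auto
    then have "1 / (x * y * z) \<le> 1 / (x * y)" using p by (intro frac_le) auto
    then show "1 / ((x * y) * z) \<le> 1 / x * (1 / y)" by simp }
qed simp

lemma combine_losses:
  fixes a :: real
  shows "a - b - c \<le> X \<Longrightarrow> t \<le> d \<Longrightarrow> b \<le> b' \<Longrightarrow> a - b' - c - d \<ge> p \<Longrightarrow> p \<le> X - t"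
  by linarith

text \<open>A sample of \<open>10^90\<close> vertices has \<open>10^630\<close> placements of seven
  points, and \<open>10^750 = 10^630 * 10^120\<close>. The exponents are split by hand so that no
  power of this size is evaluated.\<close>

lemma small_constants:
  "1/10^900 \<le> 1/10^100 * (1/10^750 :: real)"
  "real (10^90)^7 * (1/10^750) \<le> (1/10^24)^3 / 8 / 10^16"
proof -
  have "(10::real)^900 = (10^100 * 10^750) * 10^50" unfolding power_add[symmetric] by (rule arg_cong[of _ _ "power 10"]) simp
  then show "1/10^900 \<le> 1/10^100 * (1/10^750 :: real)"
    using inverse_product(1)[of "10^100" "10^750" "10^50"] by (simp only: zero_less_power zero_less_numeral one_le_power one_le_numeral simp_thms)
  have "real (10^90)^7 = 10^(90 * 7)" unfolding of_nat_power of_nat_numeral by (rule power_mult[symmetric])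
  also have "(10::real)^(90 * 7) = 10^630" by (rule arg_cong[of _ _ "power 10"]) simp
  finally have M: "real (10^90)^7 = 10^630" .
  have "(10::real)^750 = 10^630 * 10^120" unfolding power_add[symmetric] by (rule arg_cong[of _ _ "power 10"]) simp
  then have "real (10^90)^7 * (1/10^750) = 1/10^120"
    unfolding M using inverse_product(2)[of "10^630" "10^120"] by (simp only: zero_less_power zero_less_numeral simp_thms)
  also have "\<dots> \<le> 1/10^88/8" by simp
  also have "\<dots> = (1/10^24)^3 / 8 / 10^16" by (simp add: power_divide)
  finally show "real (10^90)^7 * (1/10^750) \<le> (1/10^24)^3 / 8 / 10^16" .
qed

text \<open>Average \<open>s - f / c\<close>: where \<open>f > c\<close> this is negative because
  \<open>s \<le> 1\<close>, so a point reaching the mean \<open>a - b \<ge> 0\<close> satisfies both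
  conditions.\<close>

lemma exists_good_weighted:
  fixes s f :: "'w \<Rightarrow> real" and a b c :: real
  assumes fin: "finite \<Omega>" "\<Omega> \<noteq> {}" and s: "card \<Omega> * a \<le> (\<Sum>\<omega>\<in>\<Omega>. s \<omega>)" and s1: "\<And>\<omega>. \<omega> \<in> \<Omega> \<Longrightarrow> s \<omega> \<le> 1"
    and f0: "\<And>\<omega>. \<omega> \<in> \<Omega> \<Longrightarrow> f \<omega> \<ge> 0" and f: "(\<Sum>\<omega>\<in>\<Omega>. f \<omega>) \<le> card \<Omega> * (b * c)" and c: "c > 0" and ab: "a - b \<ge> 0"
  shows "\<exists>\<omega>\<in>\<Omega>. a - b \<le> s \<omega> \<and> f \<omega> \<le> c"
proof (rule ccontr)
  assume no: "\<not> ?thesis"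
  have "s \<omega> - f \<omega> / c < a - b" if w: "\<omega> \<in> \<Omega>" for \<omega>
  proof (cases "f \<omega> \<le> c")
    case True
    then have "s \<omega> < a - b" using no w by force
    moreover have "f \<omega> / c \<ge> 0" using f0[OF w] c by simp
    ultimately show ?thesis by linarith
  next
    case False
    then have "f \<omega> / c > 1" using c by simp
    then show ?thesis using s1[OF w] ab by linarith
  qed
  then have "(\<Sum>\<omega>\<in>\<Omega>. s \<omega> - f \<omega> / c) < (\<Sum>\<omega>\<in>\<Omega>. a - b)" using fin by (intro sum_strict_mono) auto
  then have "(\<Sum>\<omega>\<in>\<Omega>. s \<omega>) - (\<Sum>\<omega>\<in>\<Omega>. f \<omega>) / c < card \<Omega> * (a - b)"
    by (simp add: sum_subtractf sum_divide_distrib)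
  moreover have "(\<Sum>\<omega>\<in>\<Omega>. f \<omega>) / c \<le> card \<Omega> * b" using f c by (simp add: field_simps)
  ultimately show False using s by (simp add: algebra_simps)
qed

lemma count3_cross:
  assumes "finite V" "A \<subseteq> V"
  shows "real (count3 V (cross A)) = 3 * real (card A) * real (card (V - A)) * card V"
proof -
  let ?B = "V - A"
  have "count3 V (\<lambda>u v w. True) = count3 V (cross A) + (count3 V (\<lambda>u v w. u \<in> A \<and> v \<in> A \<and> w \<in> A) + count3 V (\<lambda>u v w. u \<in> ?B \<and> v \<in> ?B \<and> w \<in> ?B))"
    unfolding sum.distrib[symmetric] by (intro sum.cong refl) (auto simp: cross_def)
  moreover have "count3 V (\<lambda>u v w. True) = card V ^ 3" by (simp add: power3_eq_cube)
  ultimately have "card V ^ 3 = count3 V (cross A) + (card A ^ 3 + card ?B ^ 3)"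
    using count3_inside[OF assms] count3_inside[OF assms(1), of ?B] by simp
  then have "real (card V) ^ 3 = real (count3 V (cross A)) + (real (card A) ^ 3 + real (card ?B) ^ 3)"
    by (metis of_nat_add of_nat_power)
  moreover have "real (card V) = real (card A) + real (card ?B)"
    using assms card_Diff_subset[of A V] card_mono[OF assms] finite_subset[OF assms(2,1)] by simp
  ultimately show ?thesis by (simp del: of_nat_sum add: power3_eq_cube algebra_simps)
qed

text \<open>The case in which deletion does not help: there are about as many colourings as for the
  complete balanced 3-graph, and every vertex accounts for nearly its full degree
  \<open>3/8 * n^2\<close> in powers of \<open>r\<close>. \<open>L\<close> is the number of pinning
  rounds; \<open>eps\<close> makes the remaining correlation tiny and \<open>big\<close> makes the
  at most \<open>7 * L\<close> pinned vertices negligible.\<close>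

locale dense_coloring = three_graph V E r for V :: "'a set" and E r +
  fixes L :: nat
  assumes L: "L > 0"
    and lr: "10^95 \<le> ln (real r)"
    and eps: "7 * ln r / (L * \<eta>^6) \<le> 1/10^900"
    and big: "10^100 * real L \<le> card V"
    and many: "((real (card V))^3 / 8 - (real (card V))\<^sup>2) * ln r \<le> ln (card \<Omega>)"
    and drop_vertex: "\<And>x. x \<in> V \<Longrightarrow> (3/8 * (real (card V))\<^sup>2 - 2 * card V) * ln r \<le> ln (card \<Omega>) - ln (card ((\<lambda>\<omega>. restrict \<omega> {e. x \<notin> e}) ` \<Omega>))"
begin

abbreviation n :: real where "n \<equiv> real (card V)"

lemma lr_pos: "ln r > 0"
  by (rule less_le_trans[OF _ lr]) simp

lemma n_ge: "10^100 \<le> n"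
proof -
  have "(10::real)^100 * 1 \<le> 10^100 * real L" using L by (intro mult_left_mono) auto
  then show ?thesis using big by linarith
qed

lemma n_pos: "n > 0" by (rule less_le_trans[OF _ n_ge]) simp

lemma V_ne: "V \<noteq> {}" using n_pos by auto

lemma L_le: "real L \<le> n / 10^100" using big by (simp add: field_simps)

lemma loss:
  assumes "0 \<le> q" shows "q / ln r \<le> q / 10^95"
proof (rule divide_left_mono[OF lr assms])
  show "0 < ln r * 10^95" by (intro mult_pos_pos lr_pos zero_less_power zero_less_numeral)
qed

text \<open>Relative to \<open>n^3 / 8\<close> three things are lost: 12 nats per edge, at most
  \<open>2 * n^3 / ln r\<close>; the pins, at most \<open>7 * n^3 / 10^100\<close>; and the
  lower-order term. The first of these is where \<open>r\<close> has to be large.\<close>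

lemma rich_total:
  assumes T: "finite T" "card T \<le> 7 * L"
  shows "card \<Omega> * ((3/4 - 1/10^90) * n^3) \<le> (\<Sum>\<omega>\<in>\<Omega>. real (count3 V (R T \<omega>)))"
proof -
  have "(n^3 / 8 - n\<^sup>2) - 2 * n^3 / 10^95 \<le> (ln (card \<Omega>) - 12 * card E) / ln r"
  proof -
    have "n^3 / 8 - n\<^sup>2 \<le> ln (card \<Omega>) / ln r" using many lr_pos by (simp add: field_simps)
    moreover have "12 * card E / ln r \<le> 2 * n^3 / ln r"
      by (rule divide_right_mono) (use card_E_le lr_pos in auto)
    moreover have "2 * n^3 / ln r \<le> 2 * n^3 / 10^95" by (rule loss) simp
    ultimately show ?thesis by (simp add: diff_divide_distrib)
  qed
  moreover have "card T * n\<^sup>2 \<le> 7 * n^3 / 10^100"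
  proof -
    have "real (card T) \<le> 7 * (n / 10^100)" using T(2) L_le by linarith
    then have "card T * n\<^sup>2 \<le> (7 * (n / 10^100)) * n\<^sup>2" by (rule mult_right_mono) simp
    also have "\<dots> = 7 * n^3 / 10^100" by (simp add: power2_eq_square power3_eq_cube)
    finally show ?thesis .
  qed
  moreover have "n\<^sup>2 \<le> n^3 / 10^100"
  proof -
    have "10^100 * n\<^sup>2 \<le> n * n\<^sup>2" by (rule mult_right_mono[OF n_ge]) simp
    then show ?thesis by (simp add: field_simps power2_eq_square power3_eq_cube)
  qed
  moreover have "n^3/8 - n^3/10^100 - 2 * n^3 / 10^95 - 7 * n^3 / 10^100 \<ge> (1/8 - 1/10^91) * n^3"
  proof -
    have "(1/8 - 1/10^91) * n^3 \<le> (1/8 - 1/10^100 - 2/10^95 - 7/10^100) * n^3"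
      by (rule mult_right_mono) simp_all
    then show ?thesis by (simp only: left_diff_distrib times_divide_eq_left mult_1_left mult.assoc)
  qed
  ultimately have "(1/8 - 1/10^91) * n^3 \<le> (ln (card \<Omega>) - 12 * card E) / ln r - card T * n\<^sup>2" by (rule combine_losses)
  then have "6 * card \<Omega> * ((1/8 - 1/10^91) * n^3) \<le> 6 * card \<Omega> * ((ln (card \<Omega>) - 12 * card E) / ln r - card T * n\<^sup>2)"
    by (rule mult_left_mono) simp
  also have "\<dots> \<le> (\<Sum>\<omega>\<in>\<Omega>. real (count3 V (R T \<omega>)))" by (rule rich_total_ge[OF T(1) lr_pos])
  finally have F: "6 * card \<Omega> * ((1/8 - 1/10^91) * n^3) \<le> (\<Sum>\<omega>\<in>\<Omega>. real (count3 V (R T \<omega>)))" .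
  have M: "card \<Omega> * ((3/4 - 1/10^90) * n^3) \<le> card \<Omega> * (6 * (1/8 - 1/10^91) * n^3)"
    by (intro mult_left_mono mult_right_mono) simp_all
  have Q: "card \<Omega> * (6 * (1/8 - 1/10^91) * n^3) = 6 * card \<Omega> * ((1/8 - 1/10^91) * n^3)" by simp
  show ?thesis using M unfolding Q by (rule order_trans[OF _ F])
qed

lemma rich_link:
  assumes T: "finite T" "card T \<le> 7 * L" "x \<notin> T" and x: "x \<in> V"
  shows "card \<Omega> * ((3/4 - 1/10^90) * n\<^sup>2) \<le> (\<Sum>\<omega>\<in>\<Omega>. real (count2 V (R T \<omega> x)))"
proof -
  let ?c = "ln (card \<Omega>) - ln (card ((\<lambda>\<omega>. restrict \<omega> {e. x \<notin> e}) ` \<Omega>))"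
  have "(3/8 * n\<^sup>2 - 2 * n) - 6 * n\<^sup>2 / 10^95 \<le> (?c - 12 * card (link x)) / ln r"
  proof -
    have "3/8 * n\<^sup>2 - 2 * n \<le> ?c / ln r" using drop_vertex[OF x] lr_pos by (simp add: pos_le_divide_eq)
    moreover have "12 * card (link x) / ln r \<le> 6 * n\<^sup>2 / ln r"
      by (rule divide_right_mono) (use card_link_le[of x] lr_pos in auto)
    moreover have "6 * n\<^sup>2 / ln r \<le> 6 * n\<^sup>2 / 10^95" by (rule loss) simp
    ultimately show ?thesis unfolding diff_divide_distrib[of ?c] by linarith
  qed
  moreover have "card T * n \<le> 7 * n\<^sup>2 / 10^100"
  proof -
    have "real (card T) \<le> 7 * (n / 10^100)" using T(2) L_le by linarith
    then have "card T * n \<le> (7 * (n / 10^100)) * n" by (rule mult_right_mono) simp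
    also have "\<dots> = 7 * n\<^sup>2 / 10^100" by (simp add: power2_eq_square)
    finally show ?thesis .
  qed
  moreover have "2 * n \<le> 2 * (n\<^sup>2 / 10^100)"
  proof -
    have "10^100 * n \<le> n * n" by (rule mult_right_mono[OF n_ge]) simp
    then show ?thesis by (simp add: field_simps power2_eq_square)
  qed
  moreover have "3/8 * n\<^sup>2 - 2 * (n\<^sup>2 / 10^100) - 6 * n\<^sup>2 / 10^95 - 7 * n\<^sup>2 / 10^100 \<ge> (3/8 - 1/10^91) * n\<^sup>2"
  proof -
    have "(3/8 - 1/10^91) * n\<^sup>2 \<le> (3/8 - 2 * (1/10^100) - 6/10^95 - 7/10^100) * n\<^sup>2"
      by (rule mult_right_mono) simp_all
    then show ?thesis by (simp only: left_diff_distrib times_divide_eq_left mult_1_left mult.assoc)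
  qed
  ultimately have "(3/8 - 1/10^91) * n\<^sup>2 \<le> (?c - 12 * card (link x)) / ln r - card T * n" by (rule combine_losses)
  then have "2 * card \<Omega> * ((3/8 - 1/10^91) * n\<^sup>2) \<le> 2 * card \<Omega> * ((?c - 12 * card (link x)) / ln r - card T * n)"
    by (rule mult_left_mono) simp
  also have "\<dots> = 2 * card \<Omega> * ((?c - 12 * card (link x)) / ln r - card T * card V)" by simp
  also have "\<dots> \<le> (\<Sum>\<omega>\<in>\<Omega>. real (count2 V (R T \<omega> x)))" by (rule rich_link_ge[OF T(1,3) lr_pos])
  finally have F: "2 * card \<Omega> * ((3/8 - 1/10^91) * n\<^sup>2) \<le> (\<Sum>\<omega>\<in>\<Omega>. real (count2 V (R T \<omega> x)))" .
  have M: "card \<Omega> * ((3/4 - 1/10^90) * n\<^sup>2) \<le> card \<Omega> * (2 * (3/8 - 1/10^91) * n\<^sup>2)"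
    by (intro mult_left_mono mult_right_mono) simp_all
  have Q: "card \<Omega> * (2 * (3/8 - 1/10^91) * n\<^sup>2) = 2 * card \<Omega> * ((3/8 - 1/10^91) * n\<^sup>2)" by simp
  show ?thesis using M unfolding Q by (rule order_trans[OF _ F])
qed

lemma pin_fano:
  fixes s :: "nat \<Rightarrow> 'a" and P :: "'a set"
  assumes S: "S = {} \<or> S = {0} \<or> S = {0,1,2}" and P: "P \<subseteq> V" "P \<noteq> {}"
  shows "\<exists>T\<subseteq>P. finite T \<and> card T \<le> 7 * L \<and>
    (\<Sum>\<omega>\<in>\<Omega>. \<Sum>\<phi>\<in>PiE ({..<7} - S) (\<lambda>_. P). of_bool (fano6 H (R T \<omega>) (\<lambda>p. if p \<in> S then s p else \<phi> p)))
      \<le> card \<Omega> * (n ^ card ({..<7} - S) * (1/10^900))"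
proof -
  obtain T where T: "T \<subseteq> P" "card T \<le> 7 * L" and
    f: "(\<Sum>\<omega>\<in>\<Omega>. \<Sum>\<phi>\<in>PiE ({..<7} - S) (\<lambda>_. P). of_bool (fano6 H (R T \<omega>) (\<lambda>p. if p \<in> S then s p else \<phi> p)))
      \<le> card \<Omega> * real (card P) ^ card ({..<7} - S) * (7 * ln r / (L * \<eta>^6))"
    using exists_pin_fano[OF S P L, of s] by blast
  have "card P \<le> card V" using P finV by (simp add: card_mono)
  then have "real (card P) ^ card ({..<7} - S) \<le> n ^ card ({..<7} - S)" by (intro power_mono) auto
  then have "card \<Omega> * (real (card P) ^ card ({..<7} - S) * (7 * ln r / (L * \<eta>^6))) \<le> card \<Omega> * (n ^ card ({..<7} - S) * (1/10^900))"
    by (intro mult_left_mono mult_mono eps) (use \<eta>_pos lr_pos in auto)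
  with f have "(\<Sum>\<omega>\<in>\<Omega>. \<Sum>\<phi>\<in>PiE ({..<7} - S) (\<lambda>_. P). of_bool (fano6 H (R T \<omega>) (\<lambda>p. if p \<in> S then s p else \<phi> p)))
      \<le> card \<Omega> * (n ^ card ({..<7} - S) * (1/10^900))"
    unfolding mult.assoc by (rule order_trans)
  moreover have "finite T" using T P finV by (meson finite_subset)
  ultimately show ?thesis using T by blast
qed

text \<open>\<open>exists_good_weighted\<close> picks one colouring that is dense in rich edges and
  has few planes; the error \<open>10^-900\<close> covers the product of the loss
  \<open>10^-100\<close> in density and the plane density \<open>10^-750\<close>.\<close>

lemma near_complete_bipartite: "\<exists>A\<subseteq>V. real (count3 V (\<lambda>u v w. H u v w \<noteq> cross A u v w)) \<le> n^3 / 10^8"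
proof -
  obtain T where T: "T \<subseteq> V" "finite T" "card T \<le> 7 * L" and
    f: "(\<Sum>\<omega>\<in>\<Omega>. \<Sum>\<phi>\<in>tuples 7 V. of_bool (fano6 H (R T \<omega>) \<phi>)) \<le> card \<Omega> * (n ^ 7 * (1/10^900))"
    using pin_fano[of "{}" V "\<lambda>_. undefined"] V_ne unfolding Diff_empty empty_iff if_False card_lessThan by blast
  define \<beta> :: real where "\<beta> = 1/10^24"
  define d :: real where "d = 1/10^100"
  define e :: real where "e = 1/10^750"
  let ?s = "\<lambda>\<omega>. real (count3 V (R T \<omega>)) / n^3"
  let ?f = "\<lambda>\<omega>. \<Sum>\<phi>\<in>tuples 7 V. (of_bool (fano6 H (R T \<omega>) \<phi>) :: real)"
  have "\<exists>\<omega>\<in>\<Omega>. (3/4 - 1/10^90) - d \<le> ?s \<omega> \<and> ?f \<omega> \<le> e * n^7"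
  proof (rule exists_good_weighted[OF fin ne])
    show "card \<Omega> * (3/4 - 1/10^90) \<le> (\<Sum>\<omega>\<in>\<Omega>. ?s \<omega>)"
      unfolding sum_divide_distrib[symmetric]
      by (rule mult_imp_le_div_pos) (use n_pos rich_total[OF T(2,3)] in \<open>simp_all only: mult.assoc zero_less_power\<close>)
    show "?s \<omega> \<le> 1" for \<omega>
    proof -
      have "count3 V (R T \<omega>) \<le> count3 V (\<lambda>_ _ _. True)" by (rule count3_mono) simp
      also have "\<dots> = card V ^ 3" by (simp add: power3_eq_cube)
      finally have "count3 V (R T \<omega>) \<le> card V ^ 3" .
      then have "real (count3 V (R T \<omega>)) \<le> n^3" by (metis of_nat_le_iff of_nat_power)
      then show ?thesis using n_pos by (simp only: divide_le_eq_1_pos zero_less_power)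
    qed
    show "?f \<omega> \<ge> 0" for \<omega> by (simp add: sum_nonneg)
    have "n^7 * (1/10^900) \<le> n^7 * (d * e)" unfolding d_def e_def by (rule mult_left_mono[OF small_constants(1)]) simp
    then have "card \<Omega> * (n^7 * (1/10^900)) \<le> card \<Omega> * (d * (e * n^7))"
      by (intro mult_left_mono) (simp_all only: mult_ac of_nat_0_le_iff)
    then show "(\<Sum>\<omega>\<in>\<Omega>. ?f \<omega>) \<le> card \<Omega> * (d * (e * n^7))" using f by linarith
    show "e * n^7 > 0" using n_pos unfolding e_def by (intro mult_pos_pos zero_less_power divide_pos_pos) simp_all
    show "(3/4 - 1/10^90) - d \<ge> 0" by (simp add: d_def)
  qed
  then obtain \<omega> where w: "\<omega> \<in> \<Omega>" and s: "3/4 - 1/10^90 - d \<le> ?s \<omega>" and fw: "?f \<omega> \<le> e * n^7" by blast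
  have "\<exists>A\<subseteq>V. real (count3 V (\<lambda>u v w. H u v w \<noteq> cross A u v w)) \<le> (card V)^3 / 10^8"
  proof (rule near_bipartite_of_few_fano[where H = H and \<beta> = \<beta> and R = "R T \<omega>" and \<delta>' = "1/10^90 + d" and \<epsilon> = e and M = "10^90"])
    show "(3/4 - (1/10^90 + d)) * (card V)^3 \<le> count3 V (R T \<omega>)"
    proof -
      have "(3/4 - (1/10^90 + d)) * n^3 \<le> ?s \<omega> * n^3" by (rule mult_right_mono) (use s n_pos in auto)
      also have "\<dots> = real (count3 V (R T \<omega>))" using n_pos by (simp only: nonzero_eq_divide_eq[symmetric] power_not_zero less_imp_neq[symmetric] simp_thms)
      finally show ?thesis by simp
    qed
    show "?f \<omega> \<le> e * (card V)^7" using fw by simp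
    show "16 / \<beta>\<^sup>2 \<le> real (10^90)" by (simp add: \<beta>_def power_divide)
    show "3 / real (10^90) \<le> \<beta>^3 / 8 / 10^16" by (simp add: \<beta>_def power_divide)
    show "1/10^90 + d \<le> \<beta>^3 / 8 / 10^16" by (simp add: \<beta>_def d_def power_divide)
    show "real (10^90)^7 * e \<le> \<beta>^3 / 8 / 10^16" unfolding \<beta>_def e_def by (rule small_constants(2))
    show "\<beta> = 1/10^24" by (simp add: \<beta>_def)
    show "R T \<omega> y x z" "R T \<omega> x z y" if "R T \<omega> x y z" for x y z using R_sym that by blast+
    show "H y x z" "H x z y" if "H x y z" for x y z using H_sym that by blast+
    show "H x y z" if "R T \<omega> x y z" for x y z by (rule R_H[OF w that])
    show "x \<noteq> y" if "H x y z" for x y z by (rule H_distinct(1)[OF that])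
  qed (rule finV V_ne)+
  then show ?thesis by (simp only: of_nat_power)
qed

end

definition pairs :: "('a \<Rightarrow> 'a \<Rightarrow> bool) \<Rightarrow> 'a set \<Rightarrow> 'a set \<Rightarrow> real" where
  "pairs Q S S' = (\<Sum>u\<in>S. \<Sum>v\<in>S'. of_bool (Q u v))"

section \<open>Counting pairs, and planes as products of pair counts\<close>

lemma pairs_nonneg: "pairs Q S S' \<ge> 0" unfolding pairs_def by (intro sum_nonneg) simp

lemma pairs_le_card: "pairs Q S S' \<le> real (card S) * real (card S')"
proof -
  have "pairs Q S S' \<le> (\<Sum>u\<in>S. \<Sum>v\<in>S'. 1)" unfolding pairs_def by (intro sum_mono) simp
  then show ?thesis by simp
qed

lemma pairs_mono: "(\<And>u v. Q u v \<Longrightarrow> Q' u v) \<Longrightarrow> pairs Q S S' \<le> pairs Q' S S'"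
  unfolding pairs_def by (intro sum_mono) (auto simp: of_bool_def)

lemma pairs_subset: "finite S \<Longrightarrow> U \<subseteq> S \<Longrightarrow> pairs Q U U \<le> pairs Q S S"
proof -
  assume f: "finite S" "U \<subseteq> S"
  have "pairs Q U U \<le> (\<Sum>u\<in>U. \<Sum>v\<in>S. of_bool (Q u v))"
    unfolding pairs_def by (rule sum_mono, rule sum_mono2) (use f in auto)
  also have "\<dots> \<le> pairs Q S S"
    unfolding pairs_def by (rule sum_mono2) (use f in \<open>auto intro: sum_nonneg\<close>)
  finally show ?thesis .
qed

lemma pairs_remove:
  assumes "finite S" "finite S'" "\<And>u v. Q u v \<Longrightarrow> u \<noteq> x \<and> v \<noteq> x"
  shows "pairs Q (S - {x}) (S' - {x}) = pairs Q S S'"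
proof -
  have "pairs Q (S - {x}) (S' - {x}) = (\<Sum>u\<in>S - {x}. \<Sum>v\<in>S'. of_bool (Q u v))"
    unfolding pairs_def by (intro sum.cong refl sum.mono_neutral_left) (use assms in auto)
  also have "\<dots> = pairs Q S S'"
    unfolding pairs_def by (intro sum.mono_neutral_left) (use assms in \<open>auto intro!: sum.neutral\<close>)
  finally show ?thesis .
qed

lemma pairs_compl:
  assumes "finite S" shows "pairs (\<lambda>u v. \<not> Q u v) S S = (real (card S))\<^sup>2 - pairs Q S S"
proof -
  have "pairs (\<lambda>u v. \<not> Q u v) S S + pairs Q S S = (\<Sum>u\<in>S. \<Sum>v\<in>S. 1)"
    unfolding pairs_def sum.distrib[symmetric] by (intro sum.cong refl) simp
  then show ?thesis by (simp add: power2_eq_square)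
qed

lemma count2_split:
  assumes "finite V" "A \<subseteq> V" and sym: "\<And>u v. Q u v \<Longrightarrow> Q v u"
  shows "real (count2 V Q) = pairs Q A A + pairs Q (V - A) (V - A) + 2 * pairs Q A (V - A)"
proof -
  have f: "finite A" "finite (V - A)" using assms finite_subset by auto
  have V: "(\<Sum>u\<in>V. g u) = (\<Sum>u\<in>A. g u) + (\<Sum>u\<in>V - A. g u)" for g :: "_ \<Rightarrow> real"
    using sum.subset_diff[OF assms(2,1), of g] by simp
  have "real (count2 V Q) = (\<Sum>u\<in>V. \<Sum>v\<in>V. of_bool (Q u v))" unfolding of_nat_sum of_nat_of_bool ..
  also have "\<dots> = pairs Q A A + pairs Q A (V - A) + (pairs Q (V - A) A + pairs Q (V - A) (V - A))"
    unfolding V sum.distrib pairs_def by (simp only: add_ac)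
  also have "pairs Q (V - A) A = pairs Q A (V - A)"
  proof -
    have "Q u v = Q v u" for u v using sym by blast
    then show ?thesis unfolding pairs_def by (subst sum.swap) simp
  qed
  finally show ?thesis by simp
qed

lemma sum_PiE_4:
  fixes g :: "'a \<Rightarrow> 'a \<Rightarrow> 'a \<Rightarrow> 'a \<Rightarrow> real"
  shows "(\<Sum>\<phi>\<in>PiE {3,4,5,6::nat} V. g (\<phi> 3) (\<phi> 4) (\<phi> 5) (\<phi> 6)) =
    (\<Sum>c\<in>V 3. \<Sum>d\<in>V 4. \<Sum>e\<in>V 5. \<Sum>f\<in>V 6. g c d e f)"
  by (simp add: sum_PiE_insert)

lemma sum_PiE_6:
  fixes g :: "'a \<Rightarrow> 'a \<Rightarrow> 'a \<Rightarrow> 'a \<Rightarrow> 'a \<Rightarrow> 'a \<Rightarrow> real"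
  shows "(\<Sum>\<phi>\<in>PiE {1,2,3,4,5,6::nat} V. g (\<phi> 1) (\<phi> 2) (\<phi> 3) (\<phi> 4) (\<phi> 5) (\<phi> 6)) =
    (\<Sum>a\<in>V 1. \<Sum>b\<in>V 2. \<Sum>c\<in>V 3. \<Sum>d\<in>V 4. \<Sum>e\<in>V 5. \<Sum>f\<in>V 6. g a b c d e f)"
  by (simp add: sum_PiE_insert)

lemma triple_in_6:
  fixes m :: "'a \<Rightarrow> 'a \<Rightarrow> 'a \<Rightarrow> real" and P :: "'a set"
  defines "M \<equiv> real (card P)^3 * (\<Sum>u\<in>P. \<Sum>v\<in>P. \<Sum>w\<in>P. m u v w)"
  shows "(\<Sum>a\<in>P. \<Sum>b\<in>P. \<Sum>c\<in>P. \<Sum>d\<in>P. \<Sum>e\<in>P. \<Sum>f\<in>P. m a c e) = M"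
    "(\<Sum>a\<in>P. \<Sum>b\<in>P. \<Sum>c\<in>P. \<Sum>d\<in>P. \<Sum>e\<in>P. \<Sum>f\<in>P. m a d f) = M"
    "(\<Sum>a\<in>P. \<Sum>b\<in>P. \<Sum>c\<in>P. \<Sum>d\<in>P. \<Sum>e\<in>P. \<Sum>f\<in>P. m b c f) = M"
    "(\<Sum>a\<in>P. \<Sum>b\<in>P. \<Sum>c\<in>P. \<Sum>d\<in>P. \<Sum>e\<in>P. \<Sum>f\<in>P. m b d e) = M"
  unfolding M_def sum_constant sum_distrib_left[symmetric] power3_eq_cube by (simp_all only: mult.assoc)

lemma pair_in_4:
  fixes m :: "'a \<Rightarrow> 'a \<Rightarrow> real" and P :: "'a set"
  defines "M \<equiv> (real (card P))\<^sup>2 * (\<Sum>u\<in>P. \<Sum>v\<in>P. m u v)"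
  shows "(\<Sum>c\<in>P. \<Sum>d\<in>P. \<Sum>e\<in>P. \<Sum>f\<in>P. m c d) = M" "(\<Sum>c\<in>P. \<Sum>d\<in>P. \<Sum>e\<in>P. \<Sum>f\<in>P. m e f) = M"
    "(\<Sum>c\<in>P. \<Sum>d\<in>P. \<Sum>e\<in>P. \<Sum>f\<in>P. m c e) = M" "(\<Sum>c\<in>P. \<Sum>d\<in>P. \<Sum>e\<in>P. \<Sum>f\<in>P. m d f) = M"
    "(\<Sum>c\<in>P. \<Sum>d\<in>P. \<Sum>e\<in>P. \<Sum>f\<in>P. m c f) = M" "(\<Sum>c\<in>P. \<Sum>d\<in>P. \<Sum>e\<in>P. \<Sum>f\<in>P. m d e) = M"
  unfolding M_def sum_constant sum_distrib_left[symmetric] power2_eq_square by (simp_all only: mult.assoc)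

text \<open>A plane through one fixed vertex consists of three pairs in its link, on positions 12,
  34, 56, and four further lines. Choosing the pairs independently gives the product; each choice is
  a plane counted by \<open>F\<close> unless one of the four lines is bad, and a bad triple extends
  in \<open>card P ^ 3\<close> ways.\<close>

lemma rectangle_product:
  fixes Q1 Q2 Q3 :: "'a \<Rightarrow> 'a \<Rightarrow> bool"
  assumes P: "finite P" and S: "\<And>i. i \<in> {1,2,3,4,5,6::nat} \<Longrightarrow> S i \<subseteq> P"
    and F0: "\<And>\<phi>. F \<phi> \<ge> (0::real)"
    and F: "\<And>\<phi>. \<phi> \<in> PiE {1,2,3,4,5,6} S \<Longrightarrow> Q1 (\<phi> 1) (\<phi> 2) \<Longrightarrow> Q2 (\<phi> 3) (\<phi> 4) \<Longrightarrow> Q3 (\<phi> 5) (\<phi> 6) \<Longrightarrow>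
      \<not> m (\<phi> 1) (\<phi> 3) (\<phi> 5) \<Longrightarrow> \<not> m (\<phi> 1) (\<phi> 4) (\<phi> 6) \<Longrightarrow> \<not> m (\<phi> 2) (\<phi> 3) (\<phi> 6) \<Longrightarrow> \<not> m (\<phi> 2) (\<phi> 4) (\<phi> 5) \<Longrightarrow> F \<phi> \<ge> 1"
  shows "pairs Q1 (S 1) (S 2) * (pairs Q2 (S 3) (S 4) * pairs Q3 (S 5) (S 6))
    \<le> (\<Sum>\<phi>\<in>PiE {1,2,3,4,5,6} (\<lambda>_. P). F \<phi>) + 4 * (real (card P)^3 * (\<Sum>u\<in>P. \<Sum>v\<in>P. \<Sum>w\<in>P. of_bool (m u v w)))"
proof -
  let ?I = "{1,2,3,4,5,6::nat}"
  define K where "K = (\<lambda>\<phi>. F \<phi> + (of_bool (m (\<phi> 1) (\<phi> 3) (\<phi> 5)) + (of_bool (m (\<phi> 1) (\<phi> 4) (\<phi> 6)) + (of_bool (m (\<phi> 2) (\<phi> 3) (\<phi> 6)) + of_bool (m (\<phi> 2) (\<phi> 4) (\<phi> 5))))))"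
  have "pairs Q2 (S 3) (S 4) * pairs Q3 (S 5) (S 6) =
     (\<Sum>c\<in>S 3. \<Sum>d\<in>S 4. \<Sum>e\<in>S 5. \<Sum>f\<in>S 6. of_bool (Q2 c d) * of_bool (Q3 e f))"
    unfolding pairs_def sum_distrib_right unfolding sum_distrib_left ..
  then have "pairs Q1 (S 1) (S 2) * (pairs Q2 (S 3) (S 4) * pairs Q3 (S 5) (S 6)) =
     (\<Sum>a\<in>S 1. \<Sum>b\<in>S 2. \<Sum>c\<in>S 3. \<Sum>d\<in>S 4. \<Sum>e\<in>S 5. \<Sum>f\<in>S 6. of_bool (Q1 a b) * (of_bool (Q2 c d) * of_bool (Q3 e f)))"
    unfolding pairs_def[of Q1] sum_distrib_right by (simp only: sum_distrib_left)
  also have "\<dots> = (\<Sum>\<phi>\<in>PiE ?I S. of_bool (Q1 (\<phi> 1) (\<phi> 2)) * (of_bool (Q2 (\<phi> 3) (\<phi> 4)) * of_bool (Q3 (\<phi> 5) (\<phi> 6))))"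
    by (rule sum_PiE_6[symmetric])
  also have "\<dots> \<le> (\<Sum>\<phi>\<in>PiE ?I S. K \<phi>)"
  proof (rule sum_mono)
    fix \<phi> assume p: "\<phi> \<in> PiE ?I S"
    show "of_bool (Q1 (\<phi> 1) (\<phi> 2)) * (of_bool (Q2 (\<phi> 3) (\<phi> 4)) * of_bool (Q3 (\<phi> 5) (\<phi> 6))) \<le> K \<phi>"
      using F[OF p] F0[of \<phi>] unfolding K_def by (auto simp: of_bool_def)
  qed
  also have "\<dots> \<le> (\<Sum>\<phi>\<in>PiE ?I (\<lambda>_. P). K \<phi>)"
  proof (rule sum_mono2)
    show "finite (PiE ?I (\<lambda>_. P))" by (rule finite_PiE) (use P in auto)
    show "PiE ?I S \<subseteq> PiE ?I (\<lambda>_. P)" by (rule PiE_mono) (rule S)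
    show "0 \<le> K \<phi>" for \<phi> using F0[of \<phi>] by (simp add: K_def)
  qed
  also have "\<dots> = (\<Sum>\<phi>\<in>PiE ?I (\<lambda>_. P). F \<phi>) + 4 * (real (card P)^3 * (\<Sum>u\<in>P. \<Sum>v\<in>P. \<Sum>w\<in>P. of_bool (m u v w)))"
    unfolding K_def sum.distrib
      sum_PiE_6[of "\<lambda>a b c d e f. of_bool (m a c e)"] sum_PiE_6[of "\<lambda>a b c d e f. of_bool (m a d f)"]
      sum_PiE_6[of "\<lambda>a b c d e f. of_bool (m b c f)"] sum_PiE_6[of "\<lambda>a b c d e f. of_bool (m b d e)"]
    unfolding triple_in_6[of "\<lambda>u v w. of_bool (m u v w)"] by simp
  finally show ?thesis .
qed

lemma diff_sets: "{..<7} - {0} = {1,2,3,4,5,6::nat}" "{..<7} - {0,1,2} = {3,4,5,6::nat}" by auto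

section \<open>From almost bipartite to bipartite\<close>

context dense_coloring
begin

lemma N_pos: "real (card \<Omega>) > 0" using card_pos by simp

lemma rich_link_749:
  assumes "finite T" "card T \<le> 7 * L" "x \<notin> T" "x \<in> V"
  shows "card \<Omega> * (749/1000 * n\<^sup>2) \<le> (\<Sum>\<omega>\<in>\<Omega>. real (count2 V (R T \<omega> x)))"
proof -
  have "card \<Omega> * (749/1000 * n\<^sup>2) \<le> card \<Omega> * ((3/4 - 1/10^90) * n\<^sup>2)"
    by (intro mult_left_mono mult_right_mono) simp_all
  also note rich_link[OF assms]
  finally show ?thesis .
qed

lemma R_pair_sym: "R T \<omega> x u v \<Longrightarrow> R T \<omega> x v u" by (rule R_sym(2))

lemma rich_link_split:
  assumes "W \<subseteq> V"
  shows "real (count2 V (R T \<omega> x)) = pairs (R T \<omega> x) W W + pairs (R T \<omega> x) (V - W) (V - W) + 2 * pairs (R T \<omega> x) W (V - W)"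
  by (rule count2_split[OF finV assms]) (rule R_pair_sym)

lemma power_900: "n ^ k * (1/10^900) \<le> n ^ k * (1/10^8)"
proof (rule mult_left_mono)
  have "(10::real)^8 \<le> 10^900" by (rule power_increasing) simp_all
  moreover have "(0::real) < 10^8" "(0::real) \<le> 1" "(1::real) \<le> 1" by simp_all
  ultimately show "(1/10^900 :: real) \<le> 1/10^8" by (intro frac_le)
qed simp

lemma pin_fano_8:
  fixes s :: "nat \<Rightarrow> 'a" and P :: "'a set"
  assumes S: "S = {} \<or> S = {0} \<or> S = {0,1,2}" and P: "P \<subseteq> V" "P \<noteq> {}"
  shows "\<exists>T\<subseteq>P. finite T \<and> card T \<le> 7 * L \<and>
    (\<Sum>\<omega>\<in>\<Omega>. \<Sum>\<phi>\<in>PiE ({..<7} - S) (\<lambda>_. P). of_bool (fano6 H (R T \<omega>) (\<lambda>p. if p \<in> S then s p else \<phi> p)))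
      \<le> card \<Omega> * (n ^ card ({..<7} - S) * (1/10^8))"
proof -
  obtain T where T: "T \<subseteq> P" "finite T" "card T \<le> 7 * L" and
    f: "(\<Sum>\<omega>\<in>\<Omega>. \<Sum>\<phi>\<in>PiE ({..<7} - S) (\<lambda>_. P). of_bool (fano6 H (R T \<omega>) (\<lambda>p. if p \<in> S then s p else \<phi> p)))
      \<le> card \<Omega> * (n ^ card ({..<7} - S) * (1/10^900))"
    using pin_fano[OF S P, of s] by blast
  have "card \<Omega> * (n ^ card ({..<7} - S) * (1/10^900)) \<le> card \<Omega> * (n ^ card ({..<7} - S) * (1/10^8))"
    by (rule mult_left_mono[OF power_900]) simp
  from order_trans[OF f this] show ?thesis by (intro exI[of _ T] conjI T)
qed

text \<open>If the links of \<open>x\<close>, \<open>y\<close> and \<open>z\<close> are nearly complete inside the class \<open>V - W\<close>, then this class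
  contains many Fano planes through the edge \<open>{x, y, z}\<close>, whose other six lines are rich.\<close>

lemma no_edge_inside:
  assumes W: "W \<subseteq> V" "4998/10000 * n \<le> card W" "4998/10000 * n \<le> card (V - W)"
    and xyz: "\<And>v. v \<in> {x,y,z} \<Longrightarrow> v \<in> V \<and> pairs (H v) W W < n\<^sup>2 / 100"
  shows "\<not> H x y z"
proof
  assume Hxyz: "H x y z"
  define S :: "nat set" where "S = {0,1,2}"
  define s where "s = (\<lambda>p::nat. if p = 0 then x else if p = 1 then y else z)"
  \<comment> \<open>The pins are drawn outside \<open>x, y, z\<close>, because
    \<open>rich_link\<close> concerns vertices that are not pinned.\<close>
  define P where "P = V - {x,y,z}"
  define B where "B = V - W - {x,y,z}"
  have n10: "n \<ge> 100000"
  proof -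
    have "(100000::real) \<le> 10^100" by simp
    then show ?thesis using n_ge by (rule order_trans)
  qed
  have fin: "finite W" "finite (V - W)" "finite B" "finite P" using finV finite_subset[OF W(1) finV] by (simp_all add: B_def P_def)
  have cW: "real (card W) + real (card (V - W)) = n"
    using card_Diff_subset[OF fin(1) W(1)] card_mono[OF finV W(1)] by simp
  have cB: "real (card B) \<ge> 4997/10000 * n"
  proof -
    have "card (V - W) \<le> card (B \<union> {x,y,z})" by (rule card_mono) (auto simp: B_def fin)
    also have "\<dots> \<le> card B + card {x,y,z}" by (rule card_Un_le)
    also have "card {x,y,z} \<le> 3" by (simp add: card_insert_if)
    finally have "real (card (V - W)) \<le> real (card B) + 3" by linarith
    then show ?thesis using W(3) n10 by linarith
  qed
  have cB': "real (card B) \<le> n" using card_mono[OF finV, of B] by (simp add: B_def subset_iff)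
  have "B \<noteq> {}" using cB n10 by (intro notI) simp
  then have P0: "P \<subseteq> V" "P \<noteq> {}" by (auto simp: P_def B_def)
  obtain T where T: "T \<subseteq> P" "finite T" "card T \<le> 7 * L" and
    f: "(\<Sum>\<omega>\<in>\<Omega>. \<Sum>\<phi>\<in>PiE ({..<7} - S) (\<lambda>_. P). of_bool (fano6 H (R T \<omega>) (\<lambda>p. if p \<in> S then s p else \<phi> p)))
      \<le> card \<Omega> * (n ^ card ({..<7} - S) * (1/10^8))"
    using pin_fano_8[of S P s] P0 S_def by blast
  define F where "F = (\<lambda>\<omega>. \<Sum>\<phi>\<in>PiE {3,4,5,6} (\<lambda>_. P). (of_bool (fano6 H (R T \<omega>) (\<lambda>p. if p \<in> S then s p else \<phi> p)) :: real))"
  have Fsum: "(\<Sum>\<omega>\<in>\<Omega>. F \<omega>) \<le> card \<Omega> * (n^4 * (1/10^8))"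
  proof -
    have "{..<7} - S = {3,4,5,6::nat}" "card {3,4,5,6::nat} = 4" unfolding S_def by (rule diff_sets, simp)
    then show ?thesis using f unfolding F_def by (simp only:)
  qed
  define M where "M = (\<lambda>v \<omega>. pairs (\<lambda>u w. \<not> R T \<omega> v u w) B B)"
  \<comment> \<open>The rich link of \<open>v\<close> has \<open>0.749 * n^2\<close> ordered pairs
    on average, at most \<open>n^2 / 100\<close> of them inside \<open>W\<close>, so inside
    \<open>V - W\<close> it is nearly complete. The constant is
    \<open>0.7602 = 1 - 0.2498 + 0.01\<close>, with \<open>0.2498 * n^2\<close> a lower bound for
    the square of \<open>card W\<close>.\<close>
  have Msum: "(\<Sum>\<omega>\<in>\<Omega>. M v \<omega>) \<le> card \<Omega> * (112/10000 * n\<^sup>2)" if v: "v \<in> {x,y,z}" for v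
  proof -
    have vV: "v \<in> V" "v \<notin> T" using v xyz T(1) by (auto simp: P_def)
    have "M v \<omega> \<le> 7602/10000 * n\<^sup>2 - real (count2 V (R T \<omega> v))" if w: "\<omega> \<in> \<Omega>" for \<omega>
    proof -
      have "M v \<omega> \<le> pairs (\<lambda>u w. \<not> R T \<omega> v u w) (V - W) (V - W)"
        unfolding M_def by (rule pairs_subset[OF fin(2)]) (auto simp: B_def)
      also have "\<dots> = (real (card (V - W)))\<^sup>2 - pairs (R T \<omega> v) (V - W) (V - W)" by (rule pairs_compl[OF fin(2)])
      finally have 1: "M v \<omega> \<le> (real (card (V - W)))\<^sup>2 - pairs (R T \<omega> v) (V - W) (V - W)" .
      have 2: "pairs (R T \<omega> v) W W \<le> n\<^sup>2 / 100"
        using pairs_mono[of "R T \<omega> v" "H v" W W] R_H[OF w] xyz[OF v] by force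
      have 3: "pairs (R T \<omega> v) W (V - W) \<le> real (card W) * real (card (V - W))" by (rule pairs_le_card)
      have "(4998/10000 * n)\<^sup>2 \<le> (real (card W))\<^sup>2" by (rule power_mono[OF W(2)]) simp
      then have 4: "2498/10000 * n\<^sup>2 \<le> (real (card W))\<^sup>2"
        by (simp add: power_mult_distrib power_divide) (use zero_le_power2[of n] in linarith)
      have 5: "n\<^sup>2 = (real (card W))\<^sup>2 + (2 * (real (card W) * real (card (V - W))) + (real (card (V - W)))\<^sup>2)"
        unfolding cW[symmetric] by (simp add: power2_sum)
      show ?thesis unfolding rich_link_split[OF W(1), of T \<omega> v] using 1 2 3 4 5 by linarith
    qed
    then have "(\<Sum>\<omega>\<in>\<Omega>. M v \<omega>) \<le> (\<Sum>\<omega>\<in>\<Omega>. 7602/10000 * n\<^sup>2 - real (count2 V (R T \<omega> v)))" by (rule sum_mono)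
    also have "\<dots> = card \<Omega> * (7602/10000 * n\<^sup>2) - (\<Sum>\<omega>\<in>\<Omega>. real (count2 V (R T \<omega> v)))"
      unfolding sum_subtractf sum_constant ..
    also have "\<dots> \<le> card \<Omega> * (7602/10000 * n\<^sup>2) - card \<Omega> * (749/1000 * n\<^sup>2)"
      using rich_link_749[OF T(2,3) vV(2,1)] by (rule diff_left_mono)
    also have "\<dots> = card \<Omega> * (112/10000 * n\<^sup>2)" by (simp add: algebra_simps)
    finally show ?thesis .
  qed
  let ?b = "real (card B)"
  \<comment> \<open>A union bound: four points of \<open>B\<close> complete the edge
    \<open>xyz\<close> to a plane unless one of six pairs is missing from the rich links, two pairs
    for each of \<open>x\<close>, \<open>y\<close>, \<open>z\<close>.\<close>
  have F_ge: "?b^4 - 2 * ?b\<^sup>2 * (M x \<omega> + M y \<omega> + M z \<omega>) \<le> F \<omega>" for \<omega>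
  proof -
    let ?Q = "\<lambda>v u w. \<not> R T \<omega> v u w"
    let ?I = "{3,4,5,6::nat}"
    have "?b^4 \<le> (\<Sum>\<phi>\<in>PiE ?I (\<lambda>_. B). of_bool (fano6 H (R T \<omega>) (\<lambda>p. if p \<in> S then s p else \<phi> p)) +
      (of_bool (?Q x (\<phi> 3) (\<phi> 4)) + (of_bool (?Q x (\<phi> 5) (\<phi> 6)) + (of_bool (?Q y (\<phi> 3) (\<phi> 5)) +
       (of_bool (?Q y (\<phi> 4) (\<phi> 6)) + (of_bool (?Q z (\<phi> 3) (\<phi> 6)) + of_bool (?Q z (\<phi> 4) (\<phi> 5))))))))"
    proof -
      have "?b^4 = (\<Sum>\<phi>\<in>PiE ?I (\<lambda>_. B). 1)" by (simp add: card_PiE power4_eq_xxxx)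
      also have "\<dots> \<le> (\<Sum>\<phi>\<in>PiE ?I (\<lambda>_. B). of_bool (fano6 H (R T \<omega>) (\<lambda>p. if p \<in> S then s p else \<phi> p)) +
      (of_bool (?Q x (\<phi> 3) (\<phi> 4)) + (of_bool (?Q x (\<phi> 5) (\<phi> 6)) + (of_bool (?Q y (\<phi> 3) (\<phi> 5)) +
       (of_bool (?Q y (\<phi> 4) (\<phi> 6)) + (of_bool (?Q z (\<phi> 3) (\<phi> 6)) + of_bool (?Q z (\<phi> 4) (\<phi> 5))))))))"
      proof (rule sum_mono)
        fix \<phi>
        have "fano6 H (R T \<omega>) (\<lambda>p. if p \<in> S then s p else \<phi> p) \<longleftrightarrow>
          R T \<omega> x (\<phi> 3) (\<phi> 4) \<and> R T \<omega> x (\<phi> 5) (\<phi> 6) \<and> R T \<omega> y (\<phi> 3) (\<phi> 5) \<and> R T \<omega> y (\<phi> 4) (\<phi> 6) \<and> R T \<omega> z (\<phi> 3) (\<phi> 6) \<and> R T \<omega> z (\<phi> 4) (\<phi> 5)"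
          unfolding fano6_def S_def s_def using Hxyz by simp
        then show "1 \<le> of_bool (fano6 H (R T \<omega>) (\<lambda>p. if p \<in> S then s p else \<phi> p)) +
      (of_bool (?Q x (\<phi> 3) (\<phi> 4)) + (of_bool (?Q x (\<phi> 5) (\<phi> 6)) + (of_bool (?Q y (\<phi> 3) (\<phi> 5)) +
       (of_bool (?Q y (\<phi> 4) (\<phi> 6)) + (of_bool (?Q z (\<phi> 3) (\<phi> 6)) + (of_bool (?Q z (\<phi> 4) (\<phi> 5)) :: real))))))"
          by (auto simp: of_bool_def)
      qed
      finally show ?thesis .
    qed
    also have "\<dots> = (\<Sum>\<phi>\<in>PiE ?I (\<lambda>_. B). of_bool (fano6 H (R T \<omega>) (\<lambda>p. if p \<in> S then s p else \<phi> p))) +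
       2 * ?b\<^sup>2 * (M x \<omega> + M y \<omega> + M z \<omega>)"
      unfolding sum.distrib sum_PiE_4[of "\<lambda>c d e f. of_bool (?Q _ c d)"] sum_PiE_4[of "\<lambda>c d e f. of_bool (?Q _ e f)"]
        sum_PiE_4[of "\<lambda>c d e f. of_bool (?Q _ c e)"] sum_PiE_4[of "\<lambda>c d e f. of_bool (?Q _ d f)"]
        sum_PiE_4[of "\<lambda>c d e f. of_bool (?Q _ c f)"] sum_PiE_4[of "\<lambda>c d e f. of_bool (?Q _ d e)"]
      unfolding pair_in_4 M_def pairs_def by (simp only: distrib_left mult_2 distrib_right add_ac)
    also have "(\<Sum>\<phi>\<in>PiE ?I (\<lambda>_. B). of_bool (fano6 H (R T \<omega>) (\<lambda>p. if p \<in> S then s p else \<phi> p))) \<le> F \<omega>"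
      unfolding F_def
    proof (rule sum_mono2)
      show "finite (PiE ?I (\<lambda>_. P))" by (rule finite_PiE) (use fin in auto)
      show "PiE ?I (\<lambda>_. B) \<subseteq> PiE ?I (\<lambda>_. P)" by (rule PiE_mono) (auto simp: B_def P_def)
    qed simp
    finally show ?thesis by linarith
  qed
  have "(\<Sum>\<omega>\<in>\<Omega>. ?b^4 - 2 * ?b\<^sup>2 * (M x \<omega> + M y \<omega> + M z \<omega>)) \<le> (\<Sum>\<omega>\<in>\<Omega>. F \<omega>)"
    by (rule sum_mono) (rule F_ge)
  then have 1: "card \<Omega> * ?b^4 - 2 * ?b\<^sup>2 * ((\<Sum>\<omega>\<in>\<Omega>. M x \<omega>) + (\<Sum>\<omega>\<in>\<Omega>. M y \<omega>) + (\<Sum>\<omega>\<in>\<Omega>. M z \<omega>)) \<le> card \<Omega> * (n^4 * (1/10^8))"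
    using Fsum by (simp only: sum_subtractf sum_distrib_left[symmetric] sum.distrib sum_constant order_trans)
  have "(\<Sum>\<omega>\<in>\<Omega>. M x \<omega>) + (\<Sum>\<omega>\<in>\<Omega>. M y \<omega>) + (\<Sum>\<omega>\<in>\<Omega>. M z \<omega>) \<le> card \<Omega> * (336/10000 * n\<^sup>2)"
    using Msum[of x] Msum[of y] Msum[of z] by simp
  then have "2 * ?b\<^sup>2 * ((\<Sum>\<omega>\<in>\<Omega>. M x \<omega>) + (\<Sum>\<omega>\<in>\<Omega>. M y \<omega>) + (\<Sum>\<omega>\<in>\<Omega>. M z \<omega>)) \<le> 2 * ?b\<^sup>2 * (card \<Omega> * (336/10000 * n\<^sup>2))"
    by (rule mult_left_mono) simp
  then have "card \<Omega> * ?b^4 - 2 * ?b\<^sup>2 * (card \<Omega> * (336/10000 * n\<^sup>2)) \<le> card \<Omega> * (n^4 * (1/10^8))" using 1 by linarith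
  then have "card \<Omega> * (?b\<^sup>2 * (?b\<^sup>2 - 672/10000 * n\<^sup>2)) \<le> card \<Omega> * (n^4 * (1/10^8))"
    by (simp add: algebra_simps power4_eq_xxxx power2_eq_square)
  then have 2: "?b\<^sup>2 * (?b\<^sup>2 - 672/10000 * n\<^sup>2) \<le> n^4 * (1/10^8)" using N_pos by (simp only: mult_le_cancel_left_pos)
  have "(4997/10000 * n)\<^sup>2 \<le> ?b\<^sup>2" by (rule power_mono[OF cB]) simp
  then have b2: "2/10 * n\<^sup>2 \<le> ?b\<^sup>2" by (simp add: power_mult_distrib power_divide) (use zero_le_power2[of n] in linarith)
  have "(2/10 * n\<^sup>2) * (1/10 * n\<^sup>2) \<le> ?b\<^sup>2 * (?b\<^sup>2 - 672/10000 * n\<^sup>2)"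
    by (rule mult_mono[OF b2]) (use b2 zero_le_power2[of n] in linarith)+
  then have "2/100 * n^4 \<le> n^4 * (1/10^8)" using 2 by (simp add: power4_eq_xxxx power2_eq_square)
  moreover have "n^4 > 0" using n_pos by simp
  ultimately show False by simp
qed

end

lemma sum_le_shift: "a + b \<le> c + d \<Longrightarrow> d \<le> e \<Longrightarrow> a \<le> c + e - b" for a :: real
  by linarith

text \<open>To be used with \<open>m = n^2\<close>, with \<open>g\<close> and \<open>s\<close> the
  rich pairs at a vertex across and inside the classes, and \<open>t = s + 2 * g\<close>. The lower
  bound is linear in \<open>t\<close>, so it survives averaging over colourings, although the
  product itself would not.\<close>

lemma product_bound:
  fixes m g s t :: real
  assumes "m \<ge> 0" "g \<ge> 0" "s \<ge> 0" "s \<ge> t - 1/2 * m" "2 * g \<ge> t - 501/1000 * m"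
  shows "75/100000 * m\<^sup>2 * (t - 65/100 * m) \<le> m / 100 * (g * s)"
proof (cases "t \<le> 65/100 * m")
  case True
  then have "75/100000 * m\<^sup>2 * (t - 65/100 * m) \<le> 0" by (intro mult_nonneg_nonpos) auto
  moreover have "0 \<le> m / 100 * (g * s)" using assms by simp
  ultimately show ?thesis by linarith
next
  case False
  have "(t - 65/100 * m) / 2 \<le> g" "15/100 * m \<le> s" "0 \<le> 15/100 * m" using assms False by simp_all
  then have "(t - 65/100 * m) / 2 * (15/100 * m) \<le> g * s" using assms(2) by (intro mult_mono)
  then have "m / 100 * ((t - 65/100 * m) / 2 * (15/100 * m)) \<le> m / 100 * (g * s)" using assms(1) by (intro mult_left_mono) auto
  moreover have "m / 100 * ((t - 65/100 * m) / 2 * (15/100 * m)) = 75/100000 * m\<^sup>2 * (t - 65/100 * m)" by (simp add: power2_eq_square)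
  ultimately show ?thesis by linarith
qed

locale split_coloring = dense_coloring V E r L for V :: "'a set" and E r L +
  fixes A :: "'a set"
  assumes A_sub: "A \<subseteq> V"
    and err: "real (count3 V (\<lambda>u v w. H u v w \<noteq> cross A u v w)) \<le> n^3 / 10^8"
begin

abbreviation B :: "'a set" where "B \<equiv> V - A"
abbreviation missing :: "'a set \<Rightarrow> ('a set \<Rightarrow> nat) \<Rightarrow> nat" where
  "missing T \<omega> \<equiv> count3 V (\<lambda>u v w. cross A u v w \<and> \<not> R T \<omega> u v w)"

section \<open>Rich edges against a fixed bipartition\<close>

lemma finAB: "finite A" "finite B" using finV A_sub finite_subset by auto

lemma n_split: "n = real (card A) + real (card B)"
  using card_Diff_subset[OF finAB(1) A_sub] card_mono[OF finV A_sub] by simp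

lemma rich_total_cross:
  assumes "finite T" "card T \<le> 7 * L"
  shows "(\<Sum>\<omega>\<in>\<Omega>. real (missing T \<omega>)) \<le> card \<Omega> * (3 * real (card A) * real (card B) * n - 3/4 * n^3 + 2 * n^3/10^8)"
proof -
  have "real (missing T \<omega>) \<le> real (count3 V (cross A)) + n^3 / 10^8 - real (count3 V (R T \<omega>))" if w: "\<omega> \<in> \<Omega>" for \<omega>
  proof -
    have "missing T \<omega> + count3 V (R T \<omega>) \<le> count3 V (cross A) + count3 V (\<lambda>u v w. H u v w \<noteq> cross A u v w)"
      unfolding sum.distrib[symmetric] by (intro sum_mono) (use R_H[OF w] in \<open>auto simp: of_bool_def\<close>)
    then have "real (missing T \<omega>) + real (count3 V (R T \<omega>)) \<le> real (count3 V (cross A)) + real (count3 V (\<lambda>u v w. H u v w \<noteq> cross A u v w))"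
      by (simp only: of_nat_add[symmetric] of_nat_le_iff)
    then show ?thesis by (rule sum_le_shift[OF _ err])
  qed
  then have "(\<Sum>\<omega>\<in>\<Omega>. real (missing T \<omega>)) \<le> (\<Sum>\<omega>\<in>\<Omega>. real (count3 V (cross A)) + n^3 / 10^8 - real (count3 V (R T \<omega>)))"
    by (rule sum_mono)
  also have "\<dots> = card \<Omega> * (real (count3 V (cross A)) + n^3 / 10^8) - (\<Sum>\<omega>\<in>\<Omega>. real (count3 V (R T \<omega>)))"
    unfolding sum_subtractf sum_constant ..
  also have "\<dots> \<le> card \<Omega> * (real (count3 V (cross A)) + n^3 / 10^8) - card \<Omega> * ((3/4 - 1/10^90) * n^3)"
    by (rule diff_left_mono[OF rich_total[OF assms]])
  also have "\<dots> \<le> card \<Omega> * (real (count3 V (cross A)) + n^3 / 10^8) - card \<Omega> * ((3/4 - 1/10^8) * n^3)"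
    by (intro diff_left_mono mult_left_mono mult_right_mono) simp_all
  also have "\<dots> = card \<Omega> * (3 * real (card A) * real (card B) * n - 3/4 * n^3 + 2 * n^3/10^8)"
    unfolding count3_cross[OF finV A_sub] by (simp add: algebra_simps)
  finally show ?thesis .
qed

text \<open>A nonnegative number of missing triples, taken without any pins, forces
  \<open>3 * a * b * n\<close> up to nearly \<open>3/4 * n^3\<close>; and
  \<open>(a - b)^2 = n^2 - 4 * a * b\<close>.\<close>

lemma parts_balanced: "(real (card A) - real (card B))\<^sup>2 \<le> n\<^sup>2 / 10^7"
proof -
  have "0 \<le> (\<Sum>\<omega>\<in>\<Omega>. real (missing {} \<omega>))" by (intro sum_nonneg of_nat_0_le_iff)
  also have "\<dots> \<le> card \<Omega> * (3 * real (card A) * real (card B) * n - 3/4 * n^3 + 2 * n^3/10^8)"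
    by (rule rich_total_cross) simp_all
  also have "\<dots> = (card \<Omega> * n) * (3 * real (card A) * real (card B) - 3/4 * n\<^sup>2 + 2 * n\<^sup>2/10^8)"
    by (simp add: algebra_simps power2_eq_square power3_eq_cube)
  finally have "0 \<le> (card \<Omega> * n) * (3 * real (card A) * real (card B) - 3/4 * n\<^sup>2 + 2 * n\<^sup>2/10^8)" .
  then have "0 \<le> 3 * real (card A) * real (card B) - 3/4 * n\<^sup>2 + 2 * n\<^sup>2/10^8"
    using mult_pos_pos[OF N_pos n_pos] by (simp only: zero_le_mult_iff) linarith
  moreover have "(real (card A) - real (card B))\<^sup>2 = n\<^sup>2 - 4 * (real (card A) * real (card B))"
    unfolding n_split by (simp add: power2_eq_square algebra_simps)
  ultimately show ?thesis by simp (use zero_le_power2[of n] in linarith)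
qed

lemma part_ge: "4998/10000 * n \<le> card A" "4998/10000 * n \<le> card B"
proof -
  have "n\<^sup>2 / 10^7 \<le> (4/10000 * n)\<^sup>2" by (simp add: power_mult_distrib power_divide)
  then have "(real (card A) - real (card B))\<^sup>2 \<le> (4/10000 * n)\<^sup>2" using parts_balanced by linarith
  then have "\<bar>real (card A) - real (card B)\<bar> \<le> 4/10000 * n" using n_pos by (simp only: abs_le_square_iff[symmetric])
  then show "4998/10000 * n \<le> card A" "4998/10000 * n \<le> card B" using n_split by linarith+
qed

lemma missing_le:
  assumes "finite T" "card T \<le> 7 * L"
  shows "(\<Sum>\<omega>\<in>\<Omega>. real (missing T \<omega>)) \<le> card \<Omega> * (2 * n^3/10^8)"
proof -
  have "4 * (real (card A) * real (card B)) \<le> n\<^sup>2"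
    unfolding n_split using zero_le_power2[of "real (card A) - real (card B)"] by (simp add: power2_eq_square algebra_simps)
  then have "4 * (real (card A) * real (card B)) * n \<le> n\<^sup>2 * n" by (rule mult_right_mono) simp
  then have "3 * real (card A) * real (card B) * n - 3/4 * n^3 + 2 * n^3/10^8 \<le> 2 * n^3/10^8"
    by (simp add: power2_eq_square power3_eq_cube algebra_simps)
  then have "card \<Omega> * (3 * real (card A) * real (card B) * n - 3/4 * n^3 + 2 * n^3/10^8) \<le> card \<Omega> * (2 * n^3/10^8)"
    by (rule mult_left_mono) simp
  with rich_total_cross[OF assms] show ?thesis by (rule order_trans)
qed

text \<open>An \<open>x\<close> with many link pairs inside both classes would have an edge
  \<open>{x,u,v}\<close> available on either side. Its rich link has nearly \<open>3/4 * n^2\<close>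
  ordered pairs, so it contains many cross pairs and many pairs inside some class; with an edge
  inside the other class these span many planes, as nearly all cross triples are rich.\<close>

lemma inside_small:
  assumes x: "x \<in> V"
  shows "pairs (H x) A A < n\<^sup>2 / 100 \<or> pairs (H x) B B < n\<^sup>2 / 100"
proof (rule ccontr)
  assume "\<not> ?thesis"
  then have h: "n\<^sup>2 / 100 \<le> pairs (H x) A A" "n\<^sup>2 / 100 \<le> pairs (H x) B B" by auto
  define P where "P = V - {x}"
  have n1: "1 < n" using less_le_trans[OF _ n_ge, of 1] by simp
  have "V \<noteq> {x}" using n1 by auto
  then have P: "P \<subseteq> V" "P \<noteq> {}" "finite P" using x finV by (auto simp: P_def)
  have cP: "real (card P) \<le> n" using card_mono[OF finV P(1)] by simp
  obtain T where T: "T \<subseteq> P" "finite T" "card T \<le> 7 * L" and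
    f: "(\<Sum>\<omega>\<in>\<Omega>. \<Sum>\<phi>\<in>PiE ({..<7} - {0}) (\<lambda>_. P). of_bool (fano6 H (R T \<omega>) (\<lambda>p. if p \<in> {0} then x else \<phi> p)))
      \<le> card \<Omega> * (n ^ card ({..<7} - {0::nat}) * (1/10^8))"
    using pin_fano_8[of "{0}" P "\<lambda>_. x"] P by blast
  define F where "F = (\<lambda>\<omega>. \<Sum>\<phi>\<in>PiE {1,2,3,4,5,6} (\<lambda>_. P). (of_bool (fano6 H (R T \<omega>) (\<lambda>p. if p \<in> {0} then x else \<phi> p)) :: real))"
  have Fsum: "(\<Sum>\<omega>\<in>\<Omega>. F \<omega>) \<le> card \<Omega> * (n^6 * (1/10^8))"
  proof -
    have "card {1,2,3,4,5,6::nat} = 6" by simp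
    then show ?thesis using f unfolding F_def diff_sets by (simp only:)
  qed
  have xT: "x \<notin> T" using T(1) by (auto simp: P_def)
  \<comment> \<open>Positions 1, 2 go to one class, 3, 4 to the other, 5 to \<open>A\<close> and 6
    to \<open>B\<close>. Each line off position 0 then meets both classes, and the line
    \<open>{0,1,2}\<close> has to be only an edge, hence \<open>H\<close>.\<close>
  have rectangle: "pairs (H x) S1 S1 * (pairs (R T \<omega> x) S2 S2 * pairs (R T \<omega> x) A B) \<le> F \<omega> + 4 * (n^3 * real (missing T \<omega>))"
    if w: "\<omega> \<in> \<Omega>" and S: "S1 = A \<and> S2 = B \<or> S1 = B \<and> S2 = A" for \<omega> S1 S2
  proof -
    define S where "S = (\<lambda>i::nat. (if i \<le> 2 then S1 else if i \<le> 4 then S2 else if i = 5 then A else B) - {x})"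
    let ?m = "\<lambda>u v w. cross A u v w \<and> \<not> R T \<omega> u v w"
    have S_eq: "S 1 = S1 - {x}" "S 2 = S1 - {x}" "S 3 = S2 - {x}" "S 4 = S2 - {x}" "S 5 = A - {x}" "S 6 = B - {x}"
      by (simp_all add: S_def)
    have fS: "finite S1" "finite S2" using S finAB by auto
    have Hx: "u \<noteq> x \<and> v \<noteq> x" if "H x u v" for u v using H_distinct[OF that] by auto
    have Rx: "u \<noteq> x \<and> v \<noteq> x" if "R T \<omega> x u v" for u v using Hx[OF R_H[OF w that]] .
    have "pairs (H x) (S 1) (S 2) * (pairs (R T \<omega> x) (S 3) (S 4) * pairs (R T \<omega> x) (S 5) (S 6))
      \<le> F \<omega> + 4 * (real (card P)^3 * (\<Sum>u\<in>P. \<Sum>v\<in>P. \<Sum>w\<in>P. of_bool (?m u v w)))"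
      unfolding F_def
    proof (rule rectangle_product[OF P(3)])
      show "S i \<subseteq> P" for i using S A_sub by (auto simp: S_def P_def)
      fix \<phi> assume p: "\<phi> \<in> PiE {1,2,3,4,5,6} S" and q: "H x (\<phi> 1) (\<phi> 2)" "R T \<omega> x (\<phi> 3) (\<phi> 4)" "R T \<omega> x (\<phi> 5) (\<phi> 6)"
        "\<not> ?m (\<phi> 1) (\<phi> 3) (\<phi> 5)" "\<not> ?m (\<phi> 1) (\<phi> 4) (\<phi> 6)" "\<not> ?m (\<phi> 2) (\<phi> 3) (\<phi> 6)" "\<not> ?m (\<phi> 2) (\<phi> 4) (\<phi> 5)"
      have "\<phi> i \<in> S i" if "i \<in> {1,2,3,4,5,6}" for i using p that by (rule PiE_mem)
      from this[of 1] this[of 2] this[of 3] this[of 4] this[of 5] this[of 6]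
      have "\<phi> 1 \<in> S1" "\<phi> 2 \<in> S1" "\<phi> 3 \<in> S2" "\<phi> 4 \<in> S2" "\<phi> 5 \<in> A" "\<phi> 6 \<in> B" unfolding S_eq by simp_all
      then have "cross A (\<phi> 1) (\<phi> 3) (\<phi> 5)" "cross A (\<phi> 1) (\<phi> 4) (\<phi> 6)" "cross A (\<phi> 2) (\<phi> 3) (\<phi> 6)" "cross A (\<phi> 2) (\<phi> 4) (\<phi> 5)"
        using S by (auto simp: cross_def)
      then have "fano6 H (R T \<omega>) (\<lambda>p. if p \<in> {0} then x else \<phi> p)" unfolding fano6_def using q by simp
      then show "1 \<le> (of_bool (fano6 H (R T \<omega>) (\<lambda>p. if p \<in> {0} then x else \<phi> p)) :: real)" by simp
    qed simp
    also have "pairs (H x) (S 1) (S 2) = pairs (H x) S1 S1" unfolding S_eq by (rule pairs_remove[OF fS(1) fS(1) Hx])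
    also have "pairs (R T \<omega> x) (S 3) (S 4) = pairs (R T \<omega> x) S2 S2" unfolding S_eq by (rule pairs_remove[OF fS(2) fS(2) Rx])
    also have "pairs (R T \<omega> x) (S 5) (S 6) = pairs (R T \<omega> x) A B" unfolding S_eq by (rule pairs_remove[OF finAB Rx])
    also have "real (card P)^3 * (\<Sum>u\<in>P. \<Sum>v\<in>P. \<Sum>w\<in>P. of_bool (?m u v w)) \<le> n^3 * real (missing T \<omega>)"
    proof (rule mult_mono)
      show "real (card P)^3 \<le> n^3" by (rule power_mono[OF cP]) simp
      have "(\<Sum>u\<in>P. \<Sum>v\<in>P. \<Sum>w\<in>P. (of_bool (?m u v w) :: real)) \<le> (\<Sum>u\<in>P. \<Sum>v\<in>P. \<Sum>w\<in>V. of_bool (?m u v w))"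
        by (intro sum_mono sum_mono2[OF finV P(1)]) simp
      also have "\<dots> \<le> (\<Sum>u\<in>P. \<Sum>v\<in>V. \<Sum>w\<in>V. of_bool (?m u v w))"
        by (intro sum_mono sum_mono2[OF finV P(1)] sum_nonneg) simp
      also have "\<dots> \<le> (\<Sum>u\<in>V. \<Sum>v\<in>V. \<Sum>w\<in>V. of_bool (?m u v w))"
        by (intro sum_mono2[OF finV P(1)] sum_nonneg) simp
      also have "\<dots> = real (missing T \<omega>)" unfolding of_nat_sum of_nat_of_bool ..
      finally show "(\<Sum>u\<in>P. \<Sum>v\<in>P. \<Sum>w\<in>P. (of_bool (?m u v w) :: real)) \<le> real (missing T \<omega>)" .
    qed (simp_all add: sum_nonneg)
    finally show ?thesis by linarith
  qed
  define t where "t = (\<lambda>\<omega>. real (count2 V (R T \<omega> x)))"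
  \<comment> \<open>The two rectangles are added so that only \<open>\<alpha> + \<beta>\<close>
    enters: it is large even when the rich link of \<open>x\<close> is concentrated in a single
    class.\<close>
  have pointwise: "75/100000 * (n\<^sup>2)\<^sup>2 * (t \<omega> - 65/100 * n\<^sup>2) \<le> 2 * F \<omega> + 8 * n^3 * real (missing T \<omega>)" if w: "\<omega> \<in> \<Omega>" for \<omega>
  proof -
    define \<alpha> \<beta> \<gamma> where "\<alpha> = pairs (R T \<omega> x) A A" and "\<beta> = pairs (R T \<omega> x) B B" and "\<gamma> = pairs (R T \<omega> x) A B"
    have nn: "\<alpha> \<ge> 0" "\<beta> \<ge> 0" "\<gamma> \<ge> 0" by (simp_all add: \<alpha>_def \<beta>_def \<gamma>_def pairs_nonneg)
    have t: "t \<omega> = \<alpha> + \<beta> + 2 * \<gamma>" unfolding t_def \<alpha>_def \<beta>_def \<gamma>_def by (rule rich_link_split[OF A_sub])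
    have up: "\<alpha> \<le> real (card A) * real (card A)" "\<beta> \<le> real (card B) * real (card B)" "\<gamma> \<le> real (card A) * real (card B)"
      unfolding \<alpha>_def \<beta>_def \<gamma>_def by (rule pairs_le_card)+
    have sq: "(real (card A) - real (card B))\<^sup>2 = n\<^sup>2 - 4 * (real (card A) * real (card B))"
      "real (card A) * real (card A) + real (card B) * real (card B) = n\<^sup>2 - 2 * (real (card A) * real (card B))"
      unfolding n_split by (simp_all add: power2_eq_square algebra_simps)
    have "4 * (real (card A) * real (card B)) \<le> n\<^sup>2" using sq(1) zero_le_power2[of "real (card A) - real (card B)"] by linarith
    then have g1: "\<alpha> + \<beta> \<ge> t \<omega> - 1/2 * n\<^sup>2" using up(3) t by linarith
    have "n\<^sup>2 - 4 * (real (card A) * real (card B)) \<le> n\<^sup>2 / 10^7" using parts_balanced sq(1) by linarith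
    moreover have "n\<^sup>2 / 10^7 \<le> n\<^sup>2 / 1000" by (rule divide_left_mono) simp_all
    ultimately have g2: "2 * \<gamma> \<ge> t \<omega> - 501/1000 * n\<^sup>2" using up(1,2) t sq(2) zero_le_power2[of n] by linarith
    have "n\<^sup>2 / 100 * (\<gamma> * (\<alpha> + \<beta>)) = n\<^sup>2 / 100 * (\<beta> * \<gamma>) + n\<^sup>2 / 100 * (\<alpha> * \<gamma>)" by (simp add: algebra_simps)
    also have "n\<^sup>2 / 100 * (\<beta> * \<gamma>) \<le> pairs (H x) A A * (\<beta> * \<gamma>)" by (rule mult_right_mono[OF h(1)]) (use nn in simp)
    also have "n\<^sup>2 / 100 * (\<alpha> * \<gamma>) \<le> pairs (H x) B B * (\<alpha> * \<gamma>)" by (rule mult_right_mono[OF h(2)]) (use nn in simp)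
    finally have "n\<^sup>2 / 100 * (\<gamma> * (\<alpha> + \<beta>)) \<le> pairs (H x) A A * (\<beta> * \<gamma>) + pairs (H x) B B * (\<alpha> * \<gamma>)" by linarith
    also have "\<dots> \<le> 2 * F \<omega> + 8 * n^3 * real (missing T \<omega>)"
      using rectangle[OF w, of A B] rectangle[OF w, of B A] unfolding \<alpha>_def \<beta>_def \<gamma>_def by (simp del: of_nat_sum)
    finally have "n\<^sup>2 / 100 * (\<gamma> * (\<alpha> + \<beta>)) \<le> 2 * F \<omega> + 8 * n^3 * real (missing T \<omega>)" .
    moreover have "75/100000 * (n\<^sup>2)\<^sup>2 * (t \<omega> - 65/100 * n\<^sup>2) \<le> n\<^sup>2 / 100 * (\<gamma> * (\<alpha> + \<beta>))"
      by (rule product_bound) (use nn g1 g2 in auto)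
    ultimately show ?thesis by linarith
  qed
  have "(\<Sum>\<omega>\<in>\<Omega>. 75/100000 * (n\<^sup>2)\<^sup>2 * (t \<omega> - 65/100 * n\<^sup>2)) \<le> (\<Sum>\<omega>\<in>\<Omega>. 2 * F \<omega> + 8 * n^3 * real (missing T \<omega>))"
    by (rule sum_mono) (rule pointwise)
  also have "\<dots> = 2 * (\<Sum>\<omega>\<in>\<Omega>. F \<omega>) + 8 * n^3 * (\<Sum>\<omega>\<in>\<Omega>. real (missing T \<omega>))"
    unfolding sum.distrib sum_distrib_left ..
  also have "\<dots> \<le> 2 * (card \<Omega> * (n^6 * (1/10^8))) + 8 * n^3 * (card \<Omega> * (2 * n^3/10^8))"
    by (intro add_mono mult_left_mono Fsum missing_le T) simp_all
  also have "\<dots> = card \<Omega> * n^6 * (18 / 10^8)"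
  proof -
    have "n^6 = n^3 * n^3" unfolding power_add[symmetric] by simp
    then show ?thesis by simp
  qed
  finally have up: "(\<Sum>\<omega>\<in>\<Omega>. 75/100000 * (n\<^sup>2)\<^sup>2 * (t \<omega> - 65/100 * n\<^sup>2)) \<le> card \<Omega> * n^6 * (18 / 10^8)" .
  have "card \<Omega> * n^6 * (7/100000) \<le> 75/100000 * (n\<^sup>2)\<^sup>2 * (card \<Omega> * (99/1000 * n\<^sup>2))"
  proof -
    have 6: "n^6 = (n\<^sup>2)\<^sup>2 * n\<^sup>2" unfolding power_mult[symmetric] power_add[symmetric] by simp
    have "75/100000 * q\<^sup>2 * (c * (99/1000 * q)) = c * (q\<^sup>2 * q) * (7425/100000000)" for q c :: real by simp
    then show ?thesis unfolding 6 by (simp only:) (rule mult_left_mono, simp_all)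
  qed
  also have "\<dots> \<le> 75/100000 * (n\<^sup>2)\<^sup>2 * ((\<Sum>\<omega>\<in>\<Omega>. t \<omega>) - card \<Omega> * (65/100 * n\<^sup>2))"
  proof (rule mult_left_mono)
    show "card \<Omega> * (99/1000 * n\<^sup>2) \<le> (\<Sum>\<omega>\<in>\<Omega>. t \<omega>) - card \<Omega> * (65/100 * n\<^sup>2)"
      using rich_link_749[OF T(2,3) xT x] unfolding t_def[symmetric] by (simp add: algebra_simps)
  qed simp
  also have "\<dots> = (\<Sum>\<omega>\<in>\<Omega>. 75/100000 * (n\<^sup>2)\<^sup>2 * (t \<omega> - 65/100 * n\<^sup>2))"
    by (subst sum_distrib_left[symmetric]) (simp only: sum_subtractf sum_constant)
  also note up
  finally have "card \<Omega> * n^6 * (7/100000) \<le> card \<Omega> * n^6 * (18 / 10^8)" .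
  moreover have "card \<Omega> * n^6 > 0" by (intro mult_pos_pos N_pos zero_less_power n_pos)
  ultimately show False by (simp only: mult_le_cancel_left_pos) simp
qed

text \<open>The classes are corrected vertex by vertex: \<open>W\<close> takes the vertices with few
  link pairs inside \<open>A\<close>, and by \<open>inside_small\<close> all others have few inside
  \<open>B\<close>. \<open>no_edge_inside\<close>, applied with \<open>A\<close> and with
  \<open>B\<close>, then excludes edges within \<open>W\<close> and within
  \<open>V - W\<close>.\<close>

lemma cross_bipartition: "\<exists>W\<subseteq>V. \<forall>e\<in>E. e \<inter> W \<noteq> {} \<and> e \<inter> (V - W) \<noteq> {}"
proof -
  define W where "W = {x\<in>V. pairs (H x) A A < n\<^sup>2 / 100}"
  have WB: "pairs (H x) B B < n\<^sup>2 / 100" if "x \<in> V - W" for x using inside_small[of x] that by (auto simp: W_def)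
  have VB: "V - B = A" using A_sub by blast
  have "e \<inter> W \<noteq> {} \<and> e \<inter> (V - W) \<noteq> {}" if e: "e \<in> E" for e
  proof -
    obtain x y z where xyz: "e = {x,y,z}" using edge[OF e] by (auto simp: card_3_iff)
    have sub: "e \<subseteq> V" using edge[OF e] by blast
    have Hxyz: "H x y z" using e xyz by (simp add: H_def)
    have "\<not> e \<subseteq> W"
    proof
      assume "e \<subseteq> W"
      then have "v \<in> V \<and> pairs (H v) A A < n\<^sup>2 / 100" if "v \<in> {x,y,z}" for v using that xyz by (auto simp: W_def)
      from no_edge_inside[OF A_sub part_ge this] Hxyz show False by blast
    qed
    moreover have "\<not> e \<subseteq> V - W"
    proof
      assume "e \<subseteq> V - W"
      then have "v \<in> V \<and> pairs (H v) B B < n\<^sup>2 / 100" if "v \<in> {x,y,z}" for v using that xyz WB[of v] by auto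
      from no_edge_inside[of B x y z, OF _ part_ge(2) _ this] VB part_ge(1) Hxyz show False by auto
    qed
    ultimately show ?thesis using sub by blast
  qed
  then show ?thesis by (intro exI[of _ W]) (auto simp: W_def)
qed

end

lemma (in dense_coloring) cross_bipartition: "\<exists>W\<subseteq>V. \<forall>e\<in>E. e \<inter> W \<noteq> {} \<and> e \<inter> (V - W) \<noteq> {}"
proof -
  obtain A where "A \<subseteq> V" "real (count3 V (\<lambda>u v w. H u v w \<noteq> cross A u v w)) \<le> n^3 / 10^8"
    using near_complete_bipartite by blast
  then interpret split_coloring V E r L A by unfold_locales
  show ?thesis by (rule cross_bipartition)
qed

section \<open>Complete bipartite 3-graphs\<close>

definition cross_edges :: "'a set \<Rightarrow> 'a set \<Rightarrow> 'a set set" where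
  "cross_edges A B = edges (complete_bipartite3 A B)"

definition bal :: "nat \<Rightarrow> nat" where
  "bal n = card (edges (balanced_bipartite3 n))"

section \<open>Sizes of complete bipartite 3-graphs\<close>

lemma six_choose_three: "6 * real (n choose 3) = real n * (real n - 1) * (real n - 2)"
proof (induction n)
  case (Suc n)
  have "Suc n choose 3 = (n choose 2) + (n choose 3)" by (simp add: numeral_3_eq_3 numeral_2_eq_2)
  moreover have "2 * real (n choose 2) = real n * (real n - 1)"
  proof -
    have "2 * (n choose 2) = n * (n - 1)" by (cases n) (simp_all add: choose_two)
    then have "real (2 * (n choose 2)) = real (n * (n - 1))" by simp
    then show ?thesis by (cases n) (simp_all add: algebra_simps)
  qed
  ultimately show ?case using Suc by (simp add: algebra_simps)
qed simp

lemma card_cross_edges: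
  assumes f: "finite A" "finite B" "A \<inter> B = {}"
  shows "2 * real (card (cross_edges A B)) = real (card A) * real (card B) * (real (card A) + real (card B) - 2)"
proof -
  let ?S = "\<lambda>X. {e. e \<subseteq> X \<and> card e = 3}"
  have fS: "finite (?S X)" if "finite X" for X by (rule finite_subset[of _ "Pow X"]) (use that in auto)
  have ne: "e \<noteq> {}" if "card e = 3" for e :: "'a set" using that by auto
  have "?S (A \<union> B) = cross_edges A B \<union> (?S A \<union> ?S B)"
    unfolding cross_edges_def complete_bipartite3_def using f(3) by auto
  moreover have "cross_edges A B \<inter> (?S A \<union> ?S B) = {}"
    unfolding cross_edges_def complete_bipartite3_def using f(3) by auto
  moreover have AB: "?S A \<inter> ?S B = {}"
  proof -
    have "e = {}" if "e \<subseteq> A" "e \<subseteq> B" for e using f(3) that by blast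
    then show ?thesis using ne by blast
  qed
  moreover have fin: "finite (cross_edges A B)"
    by (rule finite_subset[OF _ fS[of "A \<union> B"]]) (use f in \<open>auto simp: cross_edges_def complete_bipartite3_def\<close>)
  ultimately have "card (?S (A \<union> B)) = card (cross_edges A B) + (card (?S A) + card (?S B))"
    using fS f(1,2) by (simp add: card_Un_disjoint)
  then have "card (A \<union> B) choose 3 = card (cross_edges A B) + ((card A choose 3) + (card B choose 3))"
    using f by (simp add: n_subsets)
  then have "real ((card A + card B) choose 3) = real (card (cross_edges A B)) + (real (card A choose 3) + real (card B choose 3))"
    using f by (simp add: card_Un_disjoint)
  then have "6 * real ((card A + card B) choose 3) = 6 * real (card (cross_edges A B)) + (6 * real (card A choose 3) + 6 * real (card B choose 3))" by simp
  then show ?thesis unfolding six_choose_three by (simp add: algebra_simps)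
qed

lemma finite_cross_edges: "finite A \<Longrightarrow> finite B \<Longrightarrow> finite (cross_edges A B)"
  unfolding cross_edges_def complete_bipartite3_def by (rule finite_subset[of _ "Pow (A \<union> B)"]) auto

lemma bal_eq: "2 * real (bal n) = real (n div 2) * real (n - n div 2) * (real n - 2)"
proof -
  have "bal n = card (cross_edges {..<n div 2} {n div 2..<n})"
    by (simp add: bal_def balanced_bipartite3_def cross_edges_def)
  moreover have "real (n div 2) + real (n - n div 2) = real n" by (simp add: of_nat_diff)
  moreover have "{..<n div 2} \<inter> {n div 2..<n} = {}" by auto
  ultimately show ?thesis using card_cross_edges[of "{..<n div 2}" "{n div 2..<n}"] by simp
qed

text \<open>With \<open>q - p = 2 * j + k\<close>, the balanced product exceeds \<open>p * q\<close>
  by \<open>j * (j + k)\<close>, which vanishes only for \<open>j = 0\<close>.\<close>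

lemma balanced_product:
  fixes p q n :: nat
  assumes "p + q = n" "p \<le> q"
  shows "p * q \<le> n div 2 * (n - n div 2)" "p * q = n div 2 * (n - n div 2) \<Longrightarrow> p = n div 2"
proof -
  define j where "j = n div 2 - p"
  define k where "k = q - p - 2 * j"
  have j: "n div 2 = p + j" "q = p + 2 * j + k" "n - n div 2 = p + j + k" using assms unfolding j_def k_def by linarith+
  have e: "n div 2 * (n - n div 2) = p * q + j * j + j * k" unfolding j(3) unfolding j(1,2) by (simp add: algebra_simps)
  then show "p * q \<le> n div 2 * (n - n div 2)" by simp
  show "p = n div 2" if "p * q = n div 2 * (n - n div 2)" using that e j(1) by simp
qed

lemma bal_ge: "real n ^ 3 / 8 - (real n)\<^sup>2 \<le> real (bal n)"
proof (cases "n \<ge> 2")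
  case True
  define k where "k = n div 2"
  have "n = 2 * k \<or> n = 2 * k + 1" by (auto simp: k_def)
  then have "(real n)\<^sup>2 - 1 \<le> 4 * (real k * real (n - k))" by (auto simp: power2_eq_square algebra_simps)
  then have "((real n)\<^sup>2 - 1) * (real n - 2) \<le> 4 * (real k * real (n - k)) * (real n - 2)"
    using True by (intro mult_right_mono) auto
  also have "\<dots> = 8 * real (bal n)" using bal_eq[of n] unfolding k_def by simp
  finally have "real n ^ 3 - 2 * (real n)\<^sup>2 - real n + 2 \<le> 8 * real (bal n)" by (simp add: algebra_simps power2_eq_square power3_eq_cube)
  moreover have "real n \<le> (real n)\<^sup>2" using True by (simp add: power2_eq_square)
  moreover have "0 \<le> (real n)\<^sup>2" by simp
  ultimately show ?thesis by linarith
next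
  case False
  then have "n = 0 \<or> n = 1" by auto
  then show ?thesis by auto
qed

text \<open>The exact differences are \<open>k * (3 * k - 3) / 2\<close> for
  \<open>n = 2 * k\<close> and \<open>k * (3 * k - 1) / 2\<close> for \<open>n = 2 * k + 1\<close>.
  The extra 1 that is subtracted is the factor \<open>r\<close> gained by each cheap
  deletion.\<close>

lemma bal_step:
  assumes "n \<ge> 6"
  shows "bal (n - 1) < bal n" "3/8 * (real n)\<^sup>2 - 2 * real n \<le> real (bal n - bal (n - 1) - 1)"
proof -
  define k where "k = n div 2"
  have k: "k \<ge> 3" using assms by (auto simp: k_def)
  have "3/8 * (real n)\<^sup>2 - 2 * real n + 1 \<le> real (bal n) - real (bal (n - 1))"
  proof (cases "even n")
    case True
    then have n: "n = 2 * k" "(n - 1) div 2 = k - 1" "n - 1 - (k - 1) = k" using k by (auto simp: k_def)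
    have "2 * real (bal n) = real k * real k * (2 * real k - 2)" using bal_eq[of n] n(1) by simp
    moreover have "2 * real (bal (n - 1)) = (real k - 1) * real k * (2 * real k - 3)"
      using bal_eq[of "n - 1"] n k by (simp add: of_nat_diff)
    moreover have "real k \<ge> 3" using k by simp
    ultimately show ?thesis unfolding n(1) by (simp add: algebra_simps power2_eq_square)
  next
    case False
    then have n: "n = 2 * k + 1" "(n - 1) div 2 = k" "n - 1 - k = k" by (auto simp: k_def elim: oddE)
    have "2 * real (bal n) = real k * (real k + 1) * (2 * real k - 1)" using bal_eq[of n] n(1) by simp
    moreover have "2 * real (bal (n - 1)) = real k * real k * (2 * real k - 2)"
      using bal_eq[of "n - 1"] n by simp
    moreover have "real k \<ge> 3" using k by simp
    ultimately show ?thesis unfolding n(1) by (simp add: algebra_simps power2_eq_square)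
  qed
  moreover have "3/8 * (real n)\<^sup>2 - 2 * real n \<ge> 0"
  proof -
    have "6 * real n \<le> (real n)\<^sup>2" using assms by (simp add: power2_eq_square)
    then show ?thesis by simp
  qed
  ultimately show l: "bal (n - 1) < bal n" and "3/8 * (real n)\<^sup>2 - 2 * real n \<le> real (bal n - bal (n - 1) - 1)"
    by linarith+
qed

lemma isomorphic_cross:
  assumes f: "finite A" "finite B" "A \<inter> B = {}" and f': "finite A'" "finite B'" "A' \<inter> B' = {}"
    and c: "card A = card A'" "card B = card B'"
  shows "isomorphic (complete_bipartite3 A B) (complete_bipartite3 A' B')"
proof -
  obtain g h where g: "bij_betw g A A'" and h: "bij_betw h B B'"
    using finite_same_card_bij[OF f(1) f'(1) c(1)] finite_same_card_bij[OF f(2) f'(2) c(2)] by blast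
  define \<phi> where "\<phi> = (\<lambda>x. if x \<in> A then g x else h x)"
  have a: "bij_betw \<phi> A A'" using g by (rule bij_betw_cong[THEN iffD1, rotated]) (simp add: \<phi>_def)
  have b: "bij_betw \<phi> B B'" using h by (rule bij_betw_cong[THEN iffD1, rotated]) (use f(3) in \<open>auto simp: \<phi>_def\<close>)
  have bij: "bij_betw \<phi> (A \<union> B) (A' \<union> B')" by (rule bij_betw_combine[OF a b f'(3)])
  have im: "\<phi> ` A = A'" "\<phi> ` B = B'" using a b by (simp_all add: bij_betw_def)
  have inj: "inj_on \<phi> (A \<union> B)" using bij by (simp add: bij_betw_def)
  have sub: "(\<lambda>e. \<phi> ` e) ` cross_edges A B \<subseteq> cross_edges A' B'"
  proof
    fix e' assume "e' \<in> (\<lambda>e. \<phi> ` e) ` cross_edges A B"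
    then obtain e where e: "e \<subseteq> A \<union> B" "card e = 3" "e \<inter> A \<noteq> {}" "e \<inter> B \<noteq> {}" and e': "e' = \<phi> ` e"
      by (auto simp: cross_edges_def complete_bipartite3_def)
    have "card e' = 3" unfolding e' using e(2) inj_on_subset[OF inj e(1)] by (simp add: card_image)
    moreover have "e' \<subseteq> A' \<union> B'" "e' \<inter> A' \<noteq> {}" "e' \<inter> B' \<noteq> {}" unfolding e' im[symmetric] using e by blast+
    ultimately show "e' \<in> cross_edges A' B'" by (simp add: cross_edges_def complete_bipartite3_def)
  qed
  have "inj_on (\<lambda>e. \<phi> ` e) (Pow (A \<union> B))" using inj by (rule inj_on_image_Pow)
  moreover have "cross_edges A B \<subseteq> Pow (A \<union> B)" by (auto simp: cross_edges_def complete_bipartite3_def)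
  ultimately have "card ((\<lambda>e. \<phi> ` e) ` cross_edges A B) = card (cross_edges A B)" by (metis card_image inj_on_subset)
  also have "\<dots> = card (cross_edges A' B')"
  proof -
    have "2 * real (card (cross_edges A B)) = 2 * real (card (cross_edges A' B'))"
      unfolding card_cross_edges[OF f] card_cross_edges[OF f'] c ..
    then show ?thesis by simp
  qed
  finally have "(\<lambda>e. \<phi> ` e) ` cross_edges A B = cross_edges A' B'"
    by (rule card_subset_eq[OF finite_cross_edges[OF f'(1,2)] sub])
  then have "edges (complete_bipartite3 A' B') = (\<lambda>e. \<phi> ` e) ` edges (complete_bipartite3 A B)"
    unfolding cross_edges_def by (rule sym)
  moreover have "bij_betw \<phi> (verts (complete_bipartite3 A B)) (verts (complete_bipartite3 A' B'))"
    using bij by (simp only: complete_bipartite3_def fst_conv)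
  ultimately show ?thesis unfolding isomorphic_def by blast
qed

definition bipartite_on :: "'a set \<Rightarrow> 'a set set \<Rightarrow> bool" where
  "bipartite_on V E \<longleftrightarrow> (\<exists>W\<subseteq>V. \<forall>e\<in>E. e \<inter> W \<noteq> {} \<and> e \<inter> (V - W) \<noteq> {})"

text \<open>The Fano plane has no 2-colouring of its points without a monochromatic line; fixing the
  classes of the points 0, 1, 2, 3 decides the rest.\<close>

lemma no_fano_if_bipartite:
  assumes b: "bipartite_on V E" and c: "copy_of_in C fano (V, E)"
  shows False
proof -
  obtain W where W: "W \<subseteq> V" "\<And>e. e \<in> E \<Longrightarrow> e \<inter> W \<noteq> {} \<and> e \<inter> (V - W) \<noteq> {}" using b by (auto simp: bipartite_on_def)
  obtain \<phi> where e: "edges C = (\<lambda>e. \<phi> ` e) ` edges fano"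
    using c by (auto simp: copy_of_in_def isomorphic_def)
  define \<chi> where "\<chi> i \<longleftrightarrow> \<phi> i \<in> W" for i :: nat
  have line: "\<not> (\<chi> i \<and> \<chi> j \<and> \<chi> k) \<and> (\<chi> i \<or> \<chi> j \<or> \<chi> k)" if "{i,j,k} \<in> edges fano" for i j k
  proof -
    have "\<phi> ` {i,j,k} \<in> E" using that e c by (auto simp: copy_of_in_def)
    from W(2)[OF this] show ?thesis by (auto simp: \<chi>_def)
  qed
  have "{0,1,3} \<in> edges fano" "{1,2,4} \<in> edges fano" "{2,3,5} \<in> edges fano" "{3,4,6} \<in> edges fano"
    "{4,5,0} \<in> edges fano" "{5,6,1} \<in> edges fano" "{6,0,2} \<in> edges fano" unfolding fano_edges by (simp_all only: insert_iff simp_thms)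
  from this[THEN line] show False
    by (cases "\<chi> 0"; cases "\<chi> 1"; cases "\<chi> 2"; cases "\<chi> 3"; auto)
qed

lemma bipartite_iso:
  assumes "isomorphic H (complete_bipartite3 A B)" "A \<inter> B = {}" "uniform_hypergraph 3 H"
  shows "bipartite_on (verts H) (edges H)" "card (verts H) = card (A \<union> B)" "card (edges H) = card (cross_edges A B)"
proof -
  obtain \<phi> where b: "bij_betw \<phi> (verts H) (A \<union> B)" and e: "cross_edges A B = (\<lambda>e. \<phi> ` e) ` edges H"
    using assms(1) by (auto simp: isomorphic_def cross_edges_def complete_bipartite3_def)
  have sub: "edges H \<subseteq> Pow (verts H)" using assms(3) by (auto simp: uniform_hypergraph_def)
  show "card (verts H) = card (A \<union> B)" by (rule bij_betw_same_card[OF b])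
  have "inj_on (\<lambda>e. \<phi> ` e) (Pow (verts H))" using b by (intro inj_on_image_Pow) (simp add: bij_betw_def)
  then show "card (edges H) = card (cross_edges A B)" unfolding e using sub by (metis card_image inj_on_subset)
  show "bipartite_on (verts H) (edges H)" unfolding bipartite_on_def
  proof (intro exI[of _ "{v\<in>verts H. \<phi> v \<in> A}"] conjI ballI)
    fix f assume f: "f \<in> edges H"
    then have "\<phi> ` f \<in> cross_edges A B" unfolding e by blast
    then have "\<phi> ` f \<inter> A \<noteq> {}" "\<phi> ` f \<inter> B \<noteq> {}" by (auto simp: cross_edges_def complete_bipartite3_def)
    then obtain u v where "u \<in> f" "\<phi> u \<in> A" "v \<in> f" "\<phi> v \<in> B" by blast
    then show "f \<inter> {v\<in>verts H. \<phi> v \<in> A} \<noteq> {}" "f \<inter> (verts H - {v\<in>verts H. \<phi> v \<in> A}) \<noteq> {}"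
      using sub f assms(2) by blast+
  qed auto
qed

lemma bipartite_card_le:
  assumes V: "finite V" and E: "\<And>e. e \<in> E \<Longrightarrow> e \<subseteq> V \<and> card e = 3" and b: "bipartite_on V E"
  shows "card E \<le> bal (card V)" "card E = bal (card V) \<Longrightarrow> card V \<ge> 3 \<Longrightarrow> isomorphic (V, E) (balanced_bipartite3 (card V))"
proof -
  obtain W0 where W0: "W0 \<subseteq> V" "\<And>e. e \<in> E \<Longrightarrow> e \<inter> W0 \<noteq> {} \<and> e \<inter> (V - W0) \<noteq> {}"
    using b unfolding bipartite_on_def by blast
  obtain W where W: "W \<subseteq> V" "\<And>e. e \<in> E \<Longrightarrow> e \<inter> W \<noteq> {} \<and> e \<inter> (V - W) \<noteq> {}" and le: "card W \<le> card (V - W)"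
  proof (cases "card W0 \<le> card (V - W0)")
    case False
    have "V - (V - W0) = W0" using W0(1) by blast
    then show ?thesis using that[of "V - W0"] W0 False by auto
  qed (use that W0 in blast)
  let ?n = "card V" and ?k = "card V div 2"
  have fin: "finite W" "finite (V - W)" using V W(1) finite_subset by auto
  have pq: "card W + card (V - W) = ?n" using card_Diff_subset[OF fin(1) W(1)] card_mono[OF V W(1)] by simp
  have sub: "E \<subseteq> cross_edges W (V - W)" using E W by (auto simp: cross_edges_def complete_bipartite3_def)
  have fc: "finite (cross_edges W (V - W))" by (rule finite_cross_edges[OF fin])
  have c2: "2 * real (card (cross_edges W (V - W))) = real (card W * card (V - W)) * (real ?n - 2)"
    unfolding card_cross_edges[OF fin Diff_disjoint] pq[symmetric] by simp
  note prod = balanced_product[OF pq le]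
  have b2: "2 * real (bal ?n) = real (?k * (?n - ?k)) * (real ?n - 2)" using bal_eq[of ?n] by simp
  have small: "cross_edges W (V - W) = {}" if "?n < 3"
  proof -
    have "card e \<noteq> 3" if "e \<subseteq> V" for e using card_mono[OF V that] \<open>?n < 3\<close> by simp
    then show ?thesis using W(1) by (auto simp: cross_edges_def complete_bipartite3_def)
  qed
  have cl: "card (cross_edges W (V - W)) \<le> bal ?n"
  proof (cases "?n < 3")
    case False
    then have "real (card W * card (V - W)) * (real ?n - 2) \<le> real (?k * (?n - ?k)) * (real ?n - 2)"
      by (intro mult_right_mono of_nat_mono prod(1)) simp
    then show ?thesis using c2 b2 by simp
  qed (simp add: small)
  have ce: "card E \<le> card (cross_edges W (V - W))" by (rule card_mono[OF fc sub])
  show "card E \<le> bal ?n" using ce cl by simp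
  show "isomorphic (V, E) (balanced_bipartite3 ?n)" if eq: "card E = bal ?n" and n3: "?n \<ge> 3"
  proof -
    have eq2: "card E = card (cross_edges W (V - W))" using eq ce cl by simp
    have Eq: "E = cross_edges W (V - W)" by (rule card_subset_eq[OF fc sub eq2])
    have "real (card W * card (V - W)) * (real ?n - 2) = real (?k * (?n - ?k)) * (real ?n - 2)"
      unfolding c2[symmetric] b2[symmetric] using eq eq2 by simp
    moreover have "real ?n - 2 \<noteq> 0" using n3 by linarith
    ultimately have "real (card W * card (V - W)) = real (?k * (?n - ?k))" by (simp only: mult_cancel_right simp_thms)
    then have "card W * card (V - W) = ?k * (?n - ?k)" by (simp only: of_nat_eq_iff)
    then have cW: "card W = ?k" by (rule prod(2))
    have "(V, E) = complete_bipartite3 W (V - W)"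
      unfolding Eq cross_edges_def complete_bipartite3_def using W(1) by auto
    then show ?thesis unfolding balanced_bipartite3_def
      by (simp only:) (rule isomorphic_cross, use fin cW pq in auto)
  qed
qed

section \<open>Vertex deletion\<close>

abbreviation num :: "nat \<Rightarrow> 'a set \<Rightarrow> 'a set set \<Rightarrow> nat" where
  "num r V E \<equiv> num_rainbow_free_colorings r fano (V, E)"

lemma finite_colorings_filter:
  assumes "finite E" shows "finite {f \<in> colorings r (V, E). Q f}"
proof (rule finite_subset)
  show "finite (E \<rightarrow>\<^sub>E {1..r})" by (rule finite_PiE) (use assms in auto)
qed (auto simp: colorings_def)

lemma num_le_power:
  assumes "finite E" shows "num r V E \<le> r ^ card E"
proof -
  have "card {f \<in> colorings r (V, E). \<not> has_rainbow_copy f fano (V, E)} \<le> card (colorings r (V, E))"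
    by (rule card_mono) (use finite_colorings_filter[OF assms, of r V "\<lambda>_. True"] in auto)
  also have "\<dots> = r ^ card E" using assms by (simp add: colorings_def card_PiE)
  finally show ?thesis by (simp add: num_rainbow_free_colorings_def)
qed

lemma num_fano_free:
  assumes "finite E" "\<not> (\<exists>C. copy_of_in C fano (V, E))" shows "num r V E = r ^ card E"
proof -
  have "{f \<in> colorings r (V, E). \<not> has_rainbow_copy f fano (V, E)} = colorings r (V, E)"
    using assms(2) by (auto simp: has_rainbow_copy_def)
  moreover have "card (colorings r (V, E)) = r ^ card E" using assms by (simp add: colorings_def card_PiE)
  ultimately show ?thesis by (simp add: num_rainbow_free_colorings_def)
qed

context three_graph
begin

lemma num_eq: "num r V E = card \<Omega>"
  by (simp add: num_rainbow_free_colorings_def \<Omega>_def)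

lemma bipartite_card:
  assumes "bipartite_on V E"
  shows "card E \<le> bal (card V)" "card E = bal (card V) \<Longrightarrow> card V \<ge> 3 \<Longrightarrow> isomorphic (V, E) (balanced_bipartite3 (card V))"
  by (rule bipartite_card_le[OF finV _ assms]; use edge in blast)+

lemma card_restrict_le:
  "card ((\<lambda>\<omega>. restrict \<omega> {e. x \<notin> e}) ` \<Omega>) \<le> num r (V - {x}) {e\<in>E. x \<notin> e}"
proof -
  let ?E = "{e\<in>E. x \<notin> e}"
  have "(\<lambda>\<omega>. restrict \<omega> {e. x \<notin> e}) ` \<Omega> \<subseteq> {f \<in> colorings r (V - {x}, ?E). \<not> has_rainbow_copy f fano (V - {x}, ?E)}"
  proof
    fix f assume "f \<in> (\<lambda>\<omega>. restrict \<omega> {e. x \<notin> e}) ` \<Omega>"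
    then obtain \<omega> where w: "\<omega> \<in> \<Omega>" and f: "f = restrict \<omega> {e. x \<notin> e}" by blast
    have "f \<in> colorings r (V - {x}, ?E)"
      unfolding colorings_def f using color[OF w] undef[OF w] by (auto simp: PiE_iff extensional_def)
    moreover have "\<not> has_rainbow_copy f fano (V - {x}, ?E)"
    proof
      assume "has_rainbow_copy f fano (V - {x}, ?E)"
      then obtain C where C: "copy_of_in C fano (V - {x}, ?E)" "inj_on f (edges C)" by (auto simp: has_rainbow_copy_def)
      have "copy_of_in C fano (V, E)" using C(1) by (auto simp: copy_of_in_def)
      moreover have "inj_on \<omega> (edges C)"
      proof -
        have "f e = \<omega> e" if "e \<in> edges C" for e using that C(1) by (auto simp: copy_of_in_def f)
        then show ?thesis using C(2) by (simp add: inj_on_def)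
      qed
      ultimately have "has_rainbow_copy \<omega> fano (V, E)" unfolding has_rainbow_copy_def by blast
      then show False using w by (simp add: \<Omega>_def)
    qed
    ultimately show "f \<in> {f \<in> colorings r (V - {x}, ?E). \<not> has_rainbow_copy f fano (V - {x}, ?E)}" by blast
  qed
  moreover have "finite {f \<in> colorings r (V - {x}, ?E). \<not> has_rainbow_copy f fano (V - {x}, ?E)}"
    by (rule finite_colorings_filter) (use finE in simp)
  ultimately show ?thesis unfolding num_rainbow_free_colorings_def by (rule card_mono[rotated])
qed

text \<open>If every deletion is expensive, \<open>dense_coloring\<close> applies. A cheap deletion
  loses less than \<open>(3/8 * n^2 - 2 * n) * ln r\<close>, which \<open>bal_step\<close> places at
  or below one less than the difference of consecutive values of \<open>bal\<close>.\<close>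

lemma bipartite_or_heavy_vertex:
  assumes L: "L > 0" and lr: "10^95 \<le> ln (real r)" and eps: "7 * ln r / (L * \<eta>^6) \<le> 1/10^900"
    and big: "10^100 * real L \<le> card V" and many: "r ^ bal (card V) \<le> num r V E"
  shows "bipartite_on V E \<or> (\<exists>x\<in>V. num r V E \<le> num r (V - {x}) {e\<in>E. x \<notin> e} * r ^ (bal (card V) - bal (card V - 1) - 1))"
proof -
  let ?n = "real (card V)"
  have n6: "card V \<ge> 6"
  proof -
    have "(6::real) \<le> 10^100" by simp
    also have "\<dots> = 10^100 * 1" by simp
    also have "\<dots> \<le> 10^100 * real L" using L by (intro mult_left_mono) auto
    also note big
    finally show ?thesis by simp
  qed
  have lr0: "0 \<le> ln (real r)" by (rule ln_r_nonneg)
  have rp: "real r > 0" using r1 by simp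
  let ?res = "\<lambda>x. card ((\<lambda>\<omega>. restrict \<omega> {e. x \<notin> e}) ` \<Omega>)"
  have res: "?res x > 0" for x using fin ne by (simp add: card_gt_0_iff)
  show ?thesis
  proof (cases "\<forall>x\<in>V. (3/8 * ?n\<^sup>2 - 2 * ?n) * ln r \<le> ln (card \<Omega>) - ln (?res x)")
    case True
    have "(?n^3 / 8 - ?n\<^sup>2) * ln r \<le> real (bal (card V)) * ln r"
      by (rule mult_right_mono[OF bal_ge lr0])
    also have "\<dots> = ln (real r ^ bal (card V))" by (simp add: ln_realpow rp)
    also have "\<dots> \<le> ln (real (card \<Omega>))"
    proof -
      have "real r ^ bal (card V) \<le> real (card \<Omega>)" using many unfolding num_eq by (metis of_nat_le_iff of_nat_power)
      then show ?thesis using rp by (intro ln_mono) auto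
    qed
    finally have many': "(?n^3 / 8 - ?n\<^sup>2) * ln r \<le> ln (real (card \<Omega>))" .
    have drop:  "(3/8 * ?n\<^sup>2 - real (2 * card V)) * ln r \<le> ln (card \<Omega>) - ln (?res x)" if "x \<in> V" for x
      using True that by (simp only: of_nat_mult of_nat_numeral)
    have "dense_coloring V E r L"
      by (intro dense_coloring.intro dense_coloring_axioms.intro three_graph_axioms L lr eps big many' drop)
    from dense_coloring.cross_bipartition[OF this] show ?thesis unfolding bipartite_on_def by blast
  next
    case False
    then obtain x where x: "x \<in> V" and "\<not> (3/8 * ?n\<^sup>2 - 2 * ?n) * ln r \<le> ln (card \<Omega>) - ln (?res x)" by blast
    then have d: "ln (card \<Omega>) - ln (?res x) < (3/8 * ?n\<^sup>2 - 2 * ?n) * ln r" by (simp only: not_le)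
    let ?d = "bal (card V) - bal (card V - 1) - 1"
    have "(3/8 * ?n\<^sup>2 - 2 * ?n) * ln r \<le> real ?d * ln r" by (rule mult_right_mono[OF bal_step(2)[OF n6] lr0])
    then have "ln (card \<Omega>) < ln (?res x) + real ?d * ln r" using d by linarith
    also have "\<dots> = ln (real (?res x) * real r ^ ?d)"
      using res[of x] rp by (subst ln_mult) (auto simp: ln_realpow)
    finally have "real (card \<Omega>) < real (?res x) * real r ^ ?d" using card_pos res[of x] rp by simp
    then have "card \<Omega> \<le> ?res x * r ^ ?d" by (metis less_imp_le of_nat_le_iff of_nat_mult of_nat_power)
    also have "\<dots> \<le> num r (V - {x}) {e\<in>E. x \<notin> e} * r ^ ?d" by (rule mult_right_mono[OF card_restrict_le]) simp
    finally show ?thesis using x unfolding num_eq[symmetric] by blast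
  qed
qed

end

section \<open>Iterated deletion and the extremal statement\<close>

lemma three_graph_remove:
  assumes "three_graph V E r" shows "three_graph (V - {x}) {e\<in>E. x \<notin> e} r"
  using assms unfolding three_graph_def by auto

text \<open>The number \<open>m\<close> is the surplus in the exponent over \<open>bal\<close>; a
  cheap deletion raises it by one.\<close>

lemma remove_step:
  assumes n: "card V \<ge> 6" and fin: "finite V" and r: "r \<ge> 2" and x: "x \<in> V"
    and many: "r ^ (bal (card V) + m) \<le> num r V E"
    and le: "num r V E \<le> num r (V - {x}) E' * r ^ (bal (card V) - bal (card V - 1) - 1)"
  shows "r ^ (bal (card (V - {x})) + (m + 1)) \<le> num r (V - {x}) E'"
proof -
  let ?d = "bal (card V) - bal (card V - 1) - 1"
  have "bal (card V) + m = (bal (card (V - {x})) + (m + 1)) + ?d"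
    using bal_step(1)[OF n] x fin by (simp add: card_Diff_singleton)
  then have "r ^ (bal (card (V - {x})) + (m + 1)) * r ^ ?d \<le> num r (V - {x}) E' * r ^ ?d"
    using order_trans[OF many le] by (simp only: power_add)
  then show ?thesis using r by (simp only: mult_le_cancel2) simp
qed

lemma power_le_exp: "(2::nat) \<le> r \<Longrightarrow> r ^ a \<le> r ^ b \<longleftrightarrow> a \<le> b"
  by (rule power_increasing_iff) simp

text \<open>The surplus grows by one per deletion, and a positive surplus rules out the bipartite
  alternative, so deletions continue down to \<open>n1\<close> vertices. There the surplus is at
  most the number of edges, hence at most \<open>n1^3\<close>.\<close>

lemma descent:
  assumes r: "r \<ge> 2" and n1: "n1 \<ge> 6"
    and step: "\<And>V E. three_graph V E r \<Longrightarrow> n1 \<le> card (V :: 'a set) \<Longrightarrow> r ^ bal (card V) \<le> num r V E \<Longrightarrow>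
      bipartite_on V E \<or> (\<exists>x\<in>V. num r V E \<le> num r (V - {x}) {e\<in>E. x \<notin> e} * r ^ (bal (card V) - bal (card V - 1) - 1))"
  shows "three_graph V E r \<Longrightarrow> card (V :: 'a set) = n1 + j \<Longrightarrow> m \<ge> 1 \<Longrightarrow> r ^ (bal (card V) + m) \<le> num r V E \<Longrightarrow> m + j \<le> n1^3"
proof (induction j arbitrary: V E m)
  case 0
  interpret three_graph V E r by fact
  have "r ^ (bal (card V) + m) \<le> r ^ card E" using 0(4) num_le_power[OF finE] by (rule order_trans)
  then have "m \<le> card E" unfolding power_le_exp[OF r] by simp
  moreover have "card E \<le> n1^3"
  proof -
    have "real (card E) \<le> real (card V)^3" using card_E_le by linarith
    then show ?thesis using 0(2) by (metis add.right_neutral of_nat_le_iff of_nat_power)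
  qed
  ultimately show ?case by simp
next
  case (Suc j)
  interpret three_graph V E r by fact
  have "r ^ bal (card V) \<le> r ^ (bal (card V) + m)" unfolding power_le_exp[OF r] by simp
  then have many: "r ^ bal (card V) \<le> num r V E" using Suc.prems(4) by (rule order_trans)
  have nb: "\<not> bipartite_on V E"
  proof
    assume "bipartite_on V E"
    then have "card E \<le> bal (card V)" by (rule bipartite_card(1))
    moreover have "r ^ (bal (card V) + m) \<le> r ^ card E" using Suc.prems(4) num_le_power[OF finE] by (rule order_trans)
    ultimately show False unfolding power_le_exp[OF r] using Suc.prems(3) by simp
  qed
  then obtain x where x: "x \<in> V" and le: "num r V E \<le> num r (V - {x}) {e\<in>E. x \<notin> e} * r ^ (bal (card V) - bal (card V - 1) - 1)"
    using step[OF Suc.prems(1) _ many] Suc.prems(2) by auto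
  have "r ^ (bal (card (V - {x})) + (m + 1)) \<le> num r (V - {x}) {e\<in>E. x \<notin> e}"
    by (rule remove_step[OF _ finV r x Suc.prems(4) le]) (use Suc.prems(2) n1 in simp)
  then have "(m + 1) + j \<le> n1^3"
    by (rule Suc.IH[OF three_graph_remove[OF Suc.prems(1)], rotated 2]) (use Suc.prems(2) x finV in auto)
  then show ?case by simp
qed

text \<open>Above \<open>n1 + n1^3\<close> vertices even the surplus 1 left by a first cheap
  deletion would violate \<open>descent\<close>, so reaching the bound forces bipartiteness. Then
  all \<open>r ^ card E\<close> colourings count, and comparing exponents settles equality.\<close>

lemma extremal:
  assumes r: "r \<ge> 2" and n1: "n1 \<ge> 6"
    and step: "\<And>V E. three_graph V E r \<Longrightarrow> n1 \<le> card (V :: 'a set) \<Longrightarrow> r ^ bal (card V) \<le> num r V E \<Longrightarrow>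
      bipartite_on V E \<or> (\<exists>x\<in>V. num r V E \<le> num r (V - {x}) {e\<in>E. x \<notin> e} * r ^ (bal (card V) - bal (card V - 1) - 1))"
    and H: "uniform_hypergraph 3 (V, E)" and n: "card (V :: 'a set) \<ge> n1 + n1^3 + 1"
  shows "num r V E \<le> r ^ bal (card V)"
    "num r V E = r ^ bal (card V) \<longleftrightarrow> isomorphic (V, E) (balanced_bipartite3 (card V))"
proof -
  have tg: "three_graph V E r" using H r by (auto simp: three_graph_def uniform_hypergraph_def)
  interpret three_graph V E r by (rule tg)
  have bip: "bipartite_on V E" if many: "r ^ bal (card V) \<le> num r V E"
  proof (rule ccontr)
    assume "\<not> bipartite_on V E"
    then obtain x where x: "x \<in> V" and le: "num r V E \<le> num r (V - {x}) {e\<in>E. x \<notin> e} * r ^ (bal (card V) - bal (card V - 1) - 1)"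
      using step[OF tg _ many] n by auto
    have "r ^ (bal (card (V - {x})) + (0 + 1)) \<le> num r (V - {x}) {e\<in>E. x \<notin> e}"
      by (rule remove_step[OF _ finV r x _ le]) (use n n1 many in simp_all)
    then have m: "r ^ (bal (card (V - {x})) + 1) \<le> num r (V - {x}) {e\<in>E. x \<notin> e}" by simp
    have "1 + (card (V - {x}) - n1) \<le> n1^3"
      by (rule descent[OF r n1 step three_graph_remove[OF tg] _ _ m]) (use n x finV in \<open>simp_all add: card_Diff_singleton\<close>)
    then show False using n x finV by (simp add: card_Diff_singleton)
  qed
  show le: "num r V E \<le> r ^ bal (card V)"
  proof (cases "r ^ bal (card V) \<le> num r V E")
    case True
    have "num r V E \<le> r ^ card E" by (rule num_le_power[OF finE])
    also have "\<dots> \<le> r ^ bal (card V)"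
      unfolding power_le_exp[OF r] by (rule bipartite_card(1)[OF bip[OF True]])
    finally show ?thesis .
  qed simp
  show "num r V E = r ^ bal (card V) \<longleftrightarrow> isomorphic (V, E) (balanced_bipartite3 (card V))"
  proof
    assume eq: "num r V E = r ^ bal (card V)"
    then have b: "bipartite_on V E" by (intro bip) simp
    have "r ^ bal (card V) \<le> r ^ card E" using num_le_power[OF finE, of r V] eq by simp
    then have "bal (card V) \<le> card E" unfolding power_le_exp[OF r] .
    then have "card E = bal (card V)" using bipartite_card(1)[OF b] by simp
    then show "isomorphic (V, E) (balanced_bipartite3 (card V))"
      by (rule bipartite_card(2)[OF b]) (use n n1 in simp)
  next
    let ?n = "card V"
    assume iso: "isomorphic (V, E) (balanced_bipartite3 ?n)"
    have dis: "{..<?n div 2} \<inter> {?n div 2..<?n} = {}" by auto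
    note bi = bipartite_iso[OF iso[unfolded balanced_bipartite3_def] dis H]
    have "card E = bal ?n" using bi(3) by (simp add: bal_def balanced_bipartite3_def cross_edges_def)
    moreover have "\<not> (\<exists>C. copy_of_in C fano (V, E))" using no_fano_if_bipartite[of V E] bi(1) by auto
    ultimately show "num r V E = r ^ bal ?n" using num_fano_free[OF finE] by simp
  qed
qed

text \<open>For a Fano-free 3-graph every colouring is rainbow-free, so the colouring bound reads
  \<open>r ^ card E \<le> r ^ bal n\<close>; the complete balanced 3-graph attains it.\<close>

lemma turan_eq:
  assumes r: "r \<ge> 2" and le: "\<And>E. uniform_hypergraph 3 ({..<n::nat}, E) \<Longrightarrow> num r {..<n} E \<le> r ^ bal n"
  shows "turan_ex n fano = bal n"
  unfolding turan_ex_def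
proof (rule Max_eqI)
  let ?S = "{card (edges H) | H :: nat hypergraph. uniform_hypergraph 3 H \<and> verts H = {..<n} \<and> \<not> (\<exists>C. copy_of_in C fano H)}"
  show ub: "y \<le> bal n" if yS: "y \<in> ?S" for y
  proof -
    obtain E where u: "uniform_hypergraph 3 ({..<n}, E)" and y: "y = card E" and ff: "\<not> (\<exists>C. copy_of_in C fano ({..<n}, E))"
    proof -
      from yS obtain G :: "nat hypergraph" where G: "y = card (edges G)" "uniform_hypergraph 3 G" "verts G = {..<n}" "\<not> (\<exists>C. copy_of_in C fano G)"
        by blast
      then have "G = ({..<n}, edges G)" by (simp add: prod_eq_iff)
      then show thesis using that[of "edges G"] G by metis
    qed
    have "E \<subseteq> Pow {..<n}" using u by (auto simp: uniform_hypergraph_def)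
    then have "finite E" by (rule finite_subset) simp
    from num_fano_free[OF this ff] le[OF u] show ?thesis unfolding y using power_le_exp[OF r] by metis
  qed
  show "finite ?S" by (rule finite_subset[of _ "{..bal n}"]) (use ub in blast)+
  let ?A = "{..<n div 2}" and ?B = "{n div 2..<n}"
  have un: "?A \<union> ?B = {..<n}" by auto
  have B: "balanced_bipartite3 n = ({..<n}, cross_edges ?A ?B)"
    by (simp add: balanced_bipartite3_def cross_edges_def complete_bipartite3_def un)
  have "bipartite_on {..<n} (cross_edges ?A ?B)" unfolding bipartite_on_def
  proof (intro exI[of _ ?A] conjI ballI)
    fix e assume "e \<in> cross_edges ?A ?B"
    then have "e \<inter> ?A \<noteq> {}" "e \<inter> ?B \<noteq> {}" by (auto simp: cross_edges_def complete_bipartite3_def)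
    then show "e \<inter> ?A \<noteq> {}" "e \<inter> ({..<n} - ?A) \<noteq> {}" by (auto simp: not_less)
  qed auto
  then have "\<not> (\<exists>C. copy_of_in C fano (balanced_bipartite3 n))" unfolding B using no_fano_if_bipartite by blast
  moreover have "uniform_hypergraph 3 (balanced_bipartite3 n)"
    by (auto simp: B uniform_hypergraph_def cross_edges_def complete_bipartite3_def un)
  ultimately show "bal n \<in> ?S" unfolding bal_def by (intro CollectI exI[of _ "balanced_bipartite3 n"]) (simp add: B)
qed

text \<open>Far from sharp: \<open>492 \<ge> 10^2\<close> makes the factor \<open>492^64\<close>
  alone at least \<open>10^128\<close>, and \<open>ln 6 \<ge> 1\<close>.\<close>

lemma ln_r0: assumes "r \<ge> r0" shows "10^95 \<le> ln (real r)"
proof -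
  define a :: nat where "a = 492 ^ 64"
  define b :: nat where "b = (37 * 16 ^ 3 * 1406 ^ 9) ^ 63"
  have r0: "r0 = 6 ^ (a * b)" unfolding r0_def a_def b_def ..
  have "1 \<le> b" unfolding b_def by (rule one_le_power) simp
  have "(10::nat)^95 \<le> 10^128" by (rule power_increasing) simp_all
  also have "\<dots> = (10^2)^64" unfolding power_mult[symmetric] by simp
  also have "\<dots> \<le> a" unfolding a_def by (rule power_mono) simp_all
  also have "\<dots> \<le> a * b" using \<open>1 \<le> b\<close> by simp
  finally have ab: "(10::nat)^95 \<le> a * b" .
  have "(10::real)^95 \<le> real (a * b)"
    using ab by (metis of_nat_le_iff of_nat_numeral of_nat_power)
  also have "\<dots> = real (a * b) * 1" by simp
  also have "\<dots> \<le> real (a * b) * ln 6"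
  proof (rule mult_left_mono)
    have "exp 1 \<le> (6::real)" using exp_le by simp
    then show "1 \<le> ln (6::real)" by (subst ln_ge_iff) simp_all
  qed simp
  also have "\<dots> = ln (6 ^ (a * b))" by (simp add: ln_realpow)
  also have "\<dots> \<le> ln (real r)"
  proof (rule ln_mono)
    have "real (6 ^ (a * b)) \<le> real r" using assms unfolding r0 by (simp only: of_nat_le_iff)
    then show "(6::real) ^ (a * b) \<le> real r" by (simp only: of_nat_power of_nat_numeral)
  qed simp_all
  finally show ?thesis .
qed

text \<open>The number \<open>L\<close> of pinning rounds after which the correlation per copy,
  divided by \<eta>^6, is at most \<open>10^-900\<close>.\<close>

definition pin_bound :: "nat \<Rightarrow> nat" where
  "pin_bound r = nat \<lceil>7 * ln (real r) * 10^900 / (1 / ln (2 * real r))^6\<rceil> + 1"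

text \<open>The product makes the pinned vertices negligible as required by \<open>big\<close>; the
  6 is the lower limit of \<open>bal_step\<close>.\<close>

definition threshold :: "nat \<Rightarrow> nat" where
  "threshold r = 10^100 * pin_bound r + 6"

lemma pin_bound:
  assumes "r \<ge> 2"
  shows "pin_bound r > 0" "7 * ln (real r) / (real (pin_bound r) * (1 / ln (2 * real r))^6) \<le> 1/10^900"
proof -
  define K :: real where "K = 10^900"
  define h where "h = 1 / ln (2 * real r)"
  have K: "K > 0" unfolding K_def by (intro zero_less_power zero_less_numeral)
  have h: "h > 0" using assms by (simp add: h_def)
  show L0: "pin_bound r > 0" by (simp only: pin_bound_def)
  have "7 * ln (real r) * K / h^6 \<le> real (pin_bound r)"
    unfolding pin_bound_def K_def[symmetric] h_def[symmetric] by linarith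
  then have "7 * ln (real r) / (real (pin_bound r) * h^6) \<le> 1/K" using L0 K h by (simp add: field_simps)
  then show "7 * ln (real r) / (real (pin_bound r) * (1 / ln (2 * real r))^6) \<le> 1/10^900" unfolding K_def h_def .
qed

lemma r0_ge_2: assumes "r \<ge> r0" shows "r \<ge> 2"
proof (rule ccontr)
  assume "\<not> r \<ge> 2"
  then have "r = 0 \<or> r = 1" by auto
  moreover have "(0::real) < 10^95" by simp
  then have "ln (real r) > 0" using ln_r0[OF assms] by (rule less_le_trans)
  ultimately show False by auto
qed

lemma bipartite_or_heavy_vertex_above_threshold:
  assumes r: "r \<ge> r0" and tg: "three_graph V E r" and n: "threshold r \<le> card V" and many: "r ^ bal (card V) \<le> num r V E"
  shows "bipartite_on V E \<or> (\<exists>x\<in>V. num r V E \<le> num r (V - {x}) {e\<in>E. x \<notin> e} * r ^ (bal (card V) - bal (card V - 1) - 1))"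
proof -
  interpret three_graph V E r by (rule tg)
  have "10^100 * pin_bound r \<le> card V" using n unfolding threshold_def by linarith
  then have "real (10^100 * pin_bound r) \<le> real (card V)" by (simp only: of_nat_le_iff)
  then have big: "10^100 * real (pin_bound r) \<le> real (card V)" by (simp only: of_nat_mult of_nat_power of_nat_numeral)
  have eps: "7 * ln (real r) / (real (pin_bound r) * \<eta>^6) \<le> 1/10^900"
    unfolding \<eta>_def by (rule pin_bound(2)[OF r0_ge_2[OF r]])
  show ?thesis
    by (rule bipartite_or_heavy_vertex[OF pin_bound(1)[OF r0_ge_2[OF r]] ln_r0[OF r] eps big many])
qed

theorem theorem1p1:
  shows "\<forall>r::nat. r \<ge> r0 \<longrightarrow> (\<exists>n0::nat. \<forall>n\<ge>n0. \<forall>H :: 'a hypergraph.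
    uniform_hypergraph 3 H \<and> card (verts H) = n \<longrightarrow>
      num_rainbow_free_colorings r fano H \<le> r ^ turan_ex n fano \<and>
      (num_rainbow_free_colorings r fano H = r ^ turan_ex n fano \<longleftrightarrow> isomorphic H (balanced_bipartite3 n)))"
proof (intro allI impI)
  fix r :: nat assume r: "r \<ge> r0"
  note r2 = r0_ge_2[OF r] and step = bipartite_or_heavy_vertex_above_threshold[OF r]
  define n1 where "n1 = threshold r"
  have n1: "n1 \<ge> 6" unfolding n1_def threshold_def by (rule le_add2)
  show "\<exists>n0::nat. \<forall>n\<ge>n0. \<forall>H :: 'a hypergraph.
    uniform_hypergraph 3 H \<and> card (verts H) = n \<longrightarrow>
      num_rainbow_free_colorings r fano H \<le> r ^ turan_ex n fano \<and>
      (num_rainbow_free_colorings r fano H = r ^ turan_ex n fano \<longleftrightarrow> isomorphic H (balanced_bipartite3 n))"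
  \<comment> \<open>With \<open>n1\<close> the size down to which deletion can be iterated,
    \<open>n1^3\<close> bounds the number of possible deletions, and one more vertex makes the
    contradiction strict.\<close>
  proof (intro exI[of _ "n1 + n1^3 + 1"] allI impI)
    fix n :: nat and H :: "'a hypergraph"
    assume n: "n1 + n1^3 + 1 \<le> n" and H: "uniform_hypergraph 3 H \<and> card (verts H) = n"
    obtain V E where VE: "H = (V, E)" by (cases H)
    have u: "uniform_hypergraph 3 (V, E)" and c: "card V = n" using H VE by auto
    have nV: "n1 + n1^3 + 1 \<le> card V" using n c by simp
    have "turan_ex n fano = bal n"
    proof (rule turan_eq[OF r2])
      fix F assume F: "uniform_hypergraph 3 ({..<n}, F)"
      have "num r {..<n} F \<le> r ^ bal (card {..<n})"
        by (rule extremal(1)[OF r2 n1 step[folded n1_def] F]) (use n in simp_all)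
      then show "num r {..<n} F \<le> r ^ bal n" by simp
    qed
    then show "num_rainbow_free_colorings r fano H \<le> r ^ turan_ex n fano \<and>
      (num_rainbow_free_colorings r fano H = r ^ turan_ex n fano \<longleftrightarrow> isomorphic H (balanced_bipartite3 n))"
      using extremal[OF r2 n1 step[folded n1_def] u nV] unfolding VE c by simp
  qed
qed

end
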